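(* Let $0<\rho_1<\rho_2<\infty$, $\Omega=\{x\in\mathbb{R}^2:\rho_1<|x|<\rho_2\}$, and let $u_0(x)=\hat u_0(|x|)$ be radially symmetric boundary data with $m_i:=\hat u_0(\rho_i)\in\mathbb{R}$, $i=1,2$. Let $\mu\in(1,\infty)$ and let $g:[0,\infty)\to[0,\infty)$ be of class $C^2([0,\infty))$ such that: (1) there are constants $a,A>0$ and $b,B\in\mathbb{R}$ with $at-b\le g(t)\le At+B$ for all $t\ge 0$; (2) $g(0)=g'(0)=0$; (3) there are constants $\nu_1,\nu_2>0$ and an exponent $\overline{\mu}\in[1,\mu]$ with $$\nu_1(1+t)^{-\mu}\le g''(t)\le \nu_2(1+t)^{-\overline{\mu}}\quad\text{for all } t\ge 0;$$ (4) $\mu-\overline{\mu}<2$. Then the relaxed problem $$K[w]\to\min\quad\text{in } \mathrm{BV}(\Omega)$$ admits a solution $$u\in W^{1,1}(\Omega)\cap C^0(\overline{\Omega})\cap C^1(\Omega)\cap W^{2,2}_{\mathrm{loc}}(\Omega)$$ which in addition is of the form $u(x)=\hat u(|x|)$. Moreover, the solution is unique up to additive constants, i.e. any two minimizers of $K$ in $\mathrm{BV}(\Omega)$ differ by a constant.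
   Context: For $w\in\mathrm{BV}(\Omega)$, $\nabla^a w$ and $\nabla^s w$ denote the absolutely continuous and the singular part of the measure $\nabla w$ with respect to Lebesgue measure. Under the linear growth condition and convexity of $g$ the limit $g'_\infty:=\lim_{t\to\infty}g'(t)=\lim_{t\to\infty}g(t)/t$ exists in $(0,\infty)$. The relaxed functional is $$K[w]:=\int_\Omega g(|\nabla^a w|)\,dx+g'_\infty|\nabla^s w|(\Omega)+g'_\infty\int_{\partial\Omega}|u_0-w|\,d\mathcal{H}^1,\qquad w\in\mathrm{BV}(\Omega),$$ where in the boundary integral $w$ is understood in the sense of traces, $u_0=m_i$ on $\{|x|=\rho_i\}$, and $\mathcal{H}^1$ is one-dimensional Hausdorff measure. It is the relaxation of $J[w]=\int_\Omega g(|\nabla w|)\,dx$ on $u_0+W^{1,1}_0(\Omega)$. *)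

theory Defs
  imports "HOL-Analysis.Analysis"
begin

section \<open>Functions of class C1 and Sobolev spaces\<close>

definition partial_deriv :: "'n::finite \<Rightarrow> (real ^ 'n \<Rightarrow> real) \<Rightarrow> real ^ 'n \<Rightarrow> real" where
  "partial_deriv i f x = frechet_derivative f (at x) (axis i 1)"

text \<open>Meant for open \<open>S\<close>.\<close>

definition C1_on :: "(real ^ 'n::finite) set \<Rightarrow> (real ^ 'n \<Rightarrow> real) \<Rightarrow> bool" where
  "C1_on S f \<longleftrightarrow>
     (\<forall>x\<in>S. f differentiable (at x)) \<and> (\<forall>i. continuous_on S (partial_deriv i f))"

definition test_functions :: "(real ^ 'n::finite) set \<Rightarrow> (real ^ 'n \<Rightarrow> real) set" where
  "test_functions \<Omega> = {\<phi>. C1_on UNIV \<phi> \<and>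
     compact (closure {x. \<phi> x \<noteq> 0}) \<and> closure {x. \<phi> x \<noteq> 0} \<subseteq> \<Omega>}"

definition Lp_space :: "real \<Rightarrow> (real ^ 'n::finite) set \<Rightarrow> (real ^ 'n \<Rightarrow> real) set" where
  "Lp_space p \<Omega> = {w. set_borel_measurable lebesgue \<Omega> w \<and>
     set_integrable lebesgue \<Omega> (\<lambda>x. \<bar>w x\<bar> powr p)}"

definition weak_partial ::
    "(real ^ 'n::finite) set \<Rightarrow> 'n \<Rightarrow> (real ^ 'n \<Rightarrow> real) \<Rightarrow> (real ^ 'n \<Rightarrow> real) \<Rightarrow> bool" where
  "weak_partial \<Omega> i w f \<longleftrightarrow> (\<forall>\<phi>\<in>test_functions \<Omega>.
     (LINT x:\<Omega>|lebesgue. w x * partial_deriv i \<phi> x) = - (LINT x:\<Omega>|lebesgue. f x * \<phi> x))"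

primrec sobolev :: "nat \<Rightarrow> real \<Rightarrow> (real ^ 'n::finite) set \<Rightarrow> (real ^ 'n \<Rightarrow> real) set" where
  "sobolev 0 p \<Omega> = Lp_space p \<Omega>"
| "sobolev (Suc k) p \<Omega> =
     {w \<in> Lp_space p \<Omega>. \<forall>i. \<exists>f\<in>sobolev k p \<Omega>. weak_partial \<Omega> i w f}"

definition sobolev_loc :: "nat \<Rightarrow> real \<Rightarrow> (real ^ 'n::finite) set \<Rightarrow> (real ^ 'n \<Rightarrow> real) set" where
  "sobolev_loc k p \<Omega> = {w. \<forall>V. open V \<and> compact (closure V) \<and> closure V \<subseteq> \<Omega> \<longrightarrow> w \<in> sobolev k p V}"


section \<open>Finite signed and vector measures\<close>

text \<open>A finite vector measure on a Borel set \<open>\<Omega>\<close> is a set function that is countably additive on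
  the Borel subsets of \<open>\<Omega>\<close>; its values on other sets are irrelevant.\<close>

abbreviation borel_on :: "'a::topological_space set \<Rightarrow> 'a set set" where
  "borel_on \<Omega> \<equiv> sets (restrict_space borel \<Omega>)"

definition vector_measure_on ::
    "'a::topological_space set \<Rightarrow> ('a set \<Rightarrow> 'b::real_normed_vector) \<Rightarrow> bool" where
  "vector_measure_on \<Omega> \<mu> \<longleftrightarrow> (\<forall>A :: nat \<Rightarrow> 'a set. range A \<subseteq> borel_on \<Omega> \<and> disjoint_family A
     \<longrightarrow> (\<lambda>n. \<mu> (A n)) sums \<mu> (\<Union>n. A n))"

definition total_variation ::
    "('a::topological_space set \<Rightarrow> 'b::real_normed_vector) \<Rightarrow> 'a set \<Rightarrow> ennreal" where
  "total_variation \<mu> E =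
     (SUP A \<in> {A :: nat \<Rightarrow> 'a set. range A \<subseteq> sets borel \<and> disjoint_family A \<and> (\<Union>n. A n) = E}.
        \<Sum>n. ennreal (norm (\<mu> (A n))))"

text \<open>Positive part of the Jordan decomposition: \<open>\<nu>\<^sup>+(E) = sup {\<nu>(B) | B \<subseteq> E Borel}\<close>, where
  \<open>ennreal\<close> sends negative numbers to 0, which is harmless because \<open>B = {}\<close> is admissible.\<close>

definition positive_part :: "'a::topological_space set \<Rightarrow> ('a set \<Rightarrow> real) \<Rightarrow> 'a measure" where
  "positive_part \<Omega> \<nu> = measure_of \<Omega> (borel_on \<Omega>)
     (\<lambda>E. SUP B \<in> {B \<in> sets borel. B \<subseteq> E}. ennreal (\<nu> B))"

definition signed_integral ::
    "'a::topological_space set \<Rightarrow> ('a set \<Rightarrow> real) \<Rightarrow> ('a \<Rightarrow> real) \<Rightarrow> real" where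
  "signed_integral \<Omega> \<nu> \<phi> =
     integral\<^sup>L (positive_part \<Omega> \<nu>) \<phi> - integral\<^sup>L (positive_part \<Omega> (\<lambda>E. - \<nu> E)) \<phi>"

text \<open>Lebesgue decomposition \<open>\<mu> = f dx + \<sigma>\<close> with \<open>\<sigma>\<close> concentrated on a Lebesgue null set.\<close>

definition lebesgue_decomposition ::
    "'a::euclidean_space set \<Rightarrow> ('a set \<Rightarrow> 'b::euclidean_space) \<Rightarrow> ('a \<Rightarrow> 'b) \<Rightarrow> ('a set \<Rightarrow> 'b) \<Rightarrow> bool"
  where
  "lebesgue_decomposition \<Omega> \<mu> f \<sigma> \<longleftrightarrow>
     set_integrable lebesgue \<Omega> f \<and> vector_measure_on \<Omega> \<sigma> \<and>
     (\<exists>Z\<in>borel_on \<Omega>. emeasure lborel Z = 0 \<and> (\<forall>E\<in>borel_on \<Omega>. \<sigma> E = \<sigma> (E \<inter> Z))) \<and>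
     (\<forall>E\<in>borel_on \<Omega>. \<mu> E = (LINT x:E|lebesgue. f x) + \<sigma> E)"


section \<open>Functions of bounded variation\<close>

text \<open>As usual, functions are identified when they agree almost everywhere in \<open>\<Omega>\<close>; the values
  outside \<open>\<Omega>\<close> play no role.\<close>

definition is_gradient_measure ::
    "(real ^ 'n::finite) set \<Rightarrow> (real ^ 'n \<Rightarrow> real) \<Rightarrow> ((real ^ 'n) set \<Rightarrow> real ^ 'n) \<Rightarrow> bool" where
  "is_gradient_measure \<Omega> w \<mu> \<longleftrightarrow> vector_measure_on \<Omega> \<mu> \<and>
     (\<forall>\<phi>\<in>test_functions \<Omega>. \<forall>i. (LINT x:\<Omega>|lebesgue. w x * partial_deriv i \<phi> x)
        = - signed_integral \<Omega> (\<lambda>E. \<mu> E $ i) \<phi>)"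

definition BV :: "(real ^ 'n::finite) set \<Rightarrow> (real ^ 'n \<Rightarrow> real) set" where
  "BV \<Omega> = {w. set_integrable lebesgue \<Omega> w \<and> (\<exists>\<mu>. is_gradient_measure \<Omega> w \<mu>)}"

text \<open>The objects selected by \<open>SOME\<close> below are unique: \<open>gradient_measure\<close> and \<open>grad_sing\<close> on the
  Borel subsets of \<open>\<Omega>\<close>, the density \<open>grad_ac\<close> almost everywhere in \<open>\<Omega>\<close>, and the trace
  \<open>\<H>\<close>1-almost everywhere on the boundary.\<close>

definition gradient_measure ::
    "(real ^ 'n::finite) set \<Rightarrow> (real ^ 'n \<Rightarrow> real) \<Rightarrow> (real ^ 'n) set \<Rightarrow> real ^ 'n" where
  "gradient_measure \<Omega> w = (SOME \<mu>. is_gradient_measure \<Omega> w \<mu>)"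

definition grad_ac ::
    "(real ^ 'n::finite) set \<Rightarrow> (real ^ 'n \<Rightarrow> real) \<Rightarrow> real ^ 'n \<Rightarrow> real ^ 'n" where
  "grad_ac \<Omega> w = (SOME f. \<exists>\<sigma>. lebesgue_decomposition \<Omega> (gradient_measure \<Omega> w) f \<sigma>)"

definition grad_sing ::
    "(real ^ 'n::finite) set \<Rightarrow> (real ^ 'n \<Rightarrow> real) \<Rightarrow> (real ^ 'n) set \<Rightarrow> real ^ 'n" where
  "grad_sing \<Omega> w = (SOME \<sigma>. \<exists>f. lebesgue_decomposition \<Omega> (gradient_measure \<Omega> w) f \<sigma>)"


section \<open>One-dimensional Hausdorff measure and traces\<close>

text \<open>The library's \<open>diameter\<close> is a real number, hence the explicit boundedness of the covering
  sets. In dimension one the normalizing factor is 1.\<close>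

definition hausdorff1_pre :: "real \<Rightarrow> 'a::metric_space set \<Rightarrow> ennreal" where
  "hausdorff1_pre \<delta> E =
     (INF C \<in> {C :: nat \<Rightarrow> 'a set. E \<subseteq> (\<Union>n. C n) \<and> (\<forall>n. bounded (C n) \<and> diameter (C n) \<le> \<delta>)}.
        \<Sum>n. ennreal (diameter (C n)))"

definition hausdorff1 :: "'a::metric_space measure" where
  "hausdorff1 = measure_of UNIV (sets borel) (\<lambda>E. SUP \<delta>\<in>{0<..}. hausdorff1_pre \<delta> E)"

text \<open>\<open>T\<close> is a trace of \<open>w \<in> BV \<Omega>\<close> on the boundary of a planar Lipschitz domain with outward unit
  normal \<open>n\<close>: the Gauss--Green formula
  \<open>\<integral>\<^bsub>\<Omega>\<^esub> w div \<Phi> dx = - \<integral>\<^bsub>\<Omega>\<^esub> \<Phi> \<cdot> d\<nabla>w + \<integral>\<^bsub>\<partial>\<Omega>\<^esub> (\<Phi> \<cdot> n) T d\<H>\<close>1 holds for all C1 fields \<open>\<Phi>\<close> on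
  the plane. It is written for \<open>\<Phi> = \<phi> e\<^sub>i\<close>, which is the same by linearity.\<close>

definition is_trace ::
    "(real ^ 2) set \<Rightarrow> (real ^ 2 \<Rightarrow> real ^ 2) \<Rightarrow> (real ^ 2 \<Rightarrow> real) \<Rightarrow> (real ^ 2 \<Rightarrow> real) \<Rightarrow> bool" where
  "is_trace \<Omega> n w T \<longleftrightarrow> set_integrable hausdorff1 (frontier \<Omega>) T \<and>
     (\<forall>\<phi> i. C1_on UNIV \<phi> \<longrightarrow>
        (LINT x:\<Omega>|lebesgue. w x * partial_deriv i \<phi> x)
          = - signed_integral \<Omega> (\<lambda>E. gradient_measure \<Omega> w E $ i) \<phi>
            + (LINT x:frontier \<Omega>|hausdorff1. \<phi> x * n x $ i * T x))"

definition bv_trace ::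
    "(real ^ 2) set \<Rightarrow> (real ^ 2 \<Rightarrow> real ^ 2) \<Rightarrow> (real ^ 2 \<Rightarrow> real) \<Rightarrow> real ^ 2 \<Rightarrow> real" where
  "bv_trace \<Omega> n w = (SOME T. is_trace \<Omega> n w T)"


section \<open>The relaxed functional on an annulus\<close>

definition annulus :: "real \<Rightarrow> real \<Rightarrow> (real ^ 2) set" where
  "annulus \<rho>\<^sub>1 \<rho>\<^sub>2 = {x. \<rho>\<^sub>1 < norm x \<and> norm x < \<rho>\<^sub>2}"

definition annulus_normal :: "real \<Rightarrow> real \<Rightarrow> real ^ 2 \<Rightarrow> real ^ 2" where
  "annulus_normal \<rho>\<^sub>1 \<rho>\<^sub>2 x = (if norm x = \<rho>\<^sub>2 then x /\<^sub>R \<rho>\<^sub>2 else - (x /\<^sub>R \<rho>\<^sub>1))"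

definition recession_slope :: "(real \<Rightarrow> real) \<Rightarrow> real" where
  "recession_slope g = Lim at_top (\<lambda>t. g t / t)"

text \<open>All three terms are nonnegative, so the functional is a sum in \<open>[0,\<infinity>]\<close>.\<close>

definition relaxed_functional ::
    "real \<Rightarrow> real \<Rightarrow> (real \<Rightarrow> real) \<Rightarrow> (real ^ 2 \<Rightarrow> real) \<Rightarrow> (real ^ 2 \<Rightarrow> real) \<Rightarrow> ennreal" where
  "relaxed_functional \<rho>\<^sub>1 \<rho>\<^sub>2 g u\<^sub>0 w = (let \<Omega> = annulus \<rho>\<^sub>1 \<rho>\<^sub>2 in
     (\<integral>\<^sup>+x\<in>\<Omega>. ennreal (g (norm (grad_ac \<Omega> w x))) \<partial>lebesgue)
     + ennreal (recession_slope g) * total_variation (grad_sing \<Omega> w) \<Omega>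
     + ennreal (recession_slope g) *
         (\<integral>\<^sup>+x\<in>frontier \<Omega>. ennreal \<bar>u\<^sub>0 x - bv_trace \<Omega> (annulus_normal \<rho>\<^sub>1 \<rho>\<^sub>2) w x\<bar> \<partial>hausdorff1))"

text \<open>\<open>K[w] \<rightarrow> min\<close> in \<open>BV(\<Omega>)\<close>.\<close>

definition relaxed_minimizer ::
    "real \<Rightarrow> real \<Rightarrow> (real \<Rightarrow> real) \<Rightarrow> (real ^ 2 \<Rightarrow> real) \<Rightarrow> (real ^ 2 \<Rightarrow> real) \<Rightarrow> bool" where
  "relaxed_minimizer \<rho>\<^sub>1 \<rho>\<^sub>2 g u\<^sub>0 u \<longleftrightarrow>
     is_arg_min (relaxed_functional \<rho>\<^sub>1 \<rho>\<^sub>2 g u\<^sub>0) (\<lambda>w. w \<in> BV (annulus \<rho>\<^sub>1 \<rho>\<^sub>2)) u"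

end

theory Submission
  imports Defs
begin

text \<open>
 The solution is found by a calibration. By convexity, the derivative \<open>\<gamma>\<close> of the integrand (the odd
 extension of \<open>g'\<close>) increases strictly from \<open>-S\<close> to \<open>S\<close>, where \<open>S\<close> is the recession slope of \<open>g\<close>;
 let \<open>G\<close> be its inverse. The Euler equation for a radial function \<open>u(x) = U(|x|)\<close> says that the
 field \<open>\<gamma>(U'(r)) x/r\<close> is divergence free, that is \<open>\<gamma>(U'(r)) = c/r\<close> for a constant \<open>c\<close>, hence
 \<open>U'(r) = G(c/r)\<close>. This makes sense on the open annulus as soon as \<open>|c| \<le> r1 S\<close>. The boundary
 value at the outer circle is prescribed; the constant is chosen by shooting so that the inner
 boundary value is attained, and if no \<open>|c| < r1 S\<close> achieves this, then the limiting value
 \<open>c = \<plusminus>r1 S\<close> is taken, for which \<open>U\<close> stays integrable by monotone convergence and jumps at the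
 inner circle in the direction of the flux (\<open>shooting\<close>, \<open>calibrated_exists\<close>).

 The divergence free field \<open>\<sigma>(x) = c x/|x|\<^sup>2\<close> then has length less than \<open>S\<close> in the annulus, at most
 \<open>S\<close> on its boundary, and it is the derivative of \<open>\<xi> \<mapsto> g(|\<xi>|)\<close> at \<open>\<nabla>u\<close>. For any \<open>w\<close> of bounded
 variation with trace \<open>T\<close>, the Gauss--Green formula gives
 \<open>\<integral>\<sigma> \<cdot> \<nabla>\<^sup>aw dx + \<integral>\<sigma> \<cdot> d\<nabla>\<^sup>sw = \<integral>(\<sigma> \<cdot> n) T d\<H>\<close>, and the same for \<open>u\<close>. Subtracting, \<open>K[w] - K[u]\<close>
 is a sum of three integrals of nonnegative functions: the convexity gap of \<open>g\<close> at \<open>\<nabla>u\<close>, the gap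
 between \<open>S |\<nabla>\<^sup>sw|\<close> and \<open>\<sigma> \<cdot> \<nabla>\<^sup>sw\<close>, and the boundary gap (\<open>energy_excess\<close>). So \<open>u\<close> is a minimizer.
 If \<open>K[w] = K[u]\<close>, strict convexity forces \<open>\<nabla>\<^sup>aw = \<nabla>u\<close>, and \<open>|\<sigma>| < S\<close> forces \<open>\<nabla>\<^sup>sw = 0\<close>, so that
 \<open>w - u\<close> has zero gradient and is constant because the annulus is connected.

 Most of the text provides the measure theory behind this argument. A finite vector measure is
 represented by a density with respect to a finite positive measure
 (\<open>vector_measure_density\<close>), which yields the Lebesgue decomposition, integration against the
 gradient measure, and a lower bound for the total variation. The trace of a function of bounded
 variation on the annulus is constructed in polar coordinates: for a cut-off \<open>H\<close> equal to 1 near one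
 of the circles, the measure \<open>B \<mapsto> \<plusminus>\<integral> (H w)\<^sub>r\<close>, taken over the part of the annulus in direction \<open>B\<close>
 and divided by \<open>|x|\<close>, has a density with respect to the arc length on the unit circle, and this
 density is the trace (\<open>trace_density_exists\<close>, \<open>trace_formula\<close>). One-dimensional Hausdorff measure on a
 circle is identified with arc length in \<open>hausdorff1_sphere\<close>.
\<close>


section \<open>Functions of class C1 through their gradients\<close>

definition C1_gradient :: "(real ^ 'n::finite) set => (real ^ 'n => real) => (real ^ 'n => real ^ 'n) => bool"
 where "C1_gradient S f D \<longleftrightarrow>
  (\<forall>x\<in>S. (f has_derivative (%v. D x \<bullet> v)) (at x)) & continuous_on S D"

lemma C1_gradient_partial:
 assumes "C1_gradient S f D" "x : S"
 shows "partial_deriv i f x = D x $ i"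
proof -
 have "(f has_derivative (%v. D x \<bullet> v)) (at x)" using assms by (auto simp: C1_gradient_def)
 then have "frechet_derivative f (at x) = (%v. D x \<bullet> v)" by (simp add: frechet_derivative_at[symmetric])
 then show ?thesis by (simp add: partial_deriv_def inner_axis)
qed

lemma C1_gradient_C1_on:
 assumes "C1_gradient S f D"
 shows "C1_on S f"
proof -
 have "continuous_on S (partial_deriv i f)" for i
 proof -
  have "continuous_on S (%x. D x $ i)"
   using assms by (auto simp: C1_gradient_def intro!: continuous_intros)
  then show ?thesis
   by (rule continuous_on_eq) (simp add: C1_gradient_partial[OF assms])
 qed
 then show ?thesis
  using assms by (auto simp: C1_on_def C1_gradient_def intro: differentiableI)
qed

lemma C1_on_gradient:
 assumes "C1_on S f"
 shows "C1_gradient S f (%x. \<chi> i. partial_deriv i f x)"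
proof -
 have "(f has_derivative (%v. (\<chi> i. partial_deriv i f x) \<bullet> v)) (at x)" if "x : S" for x
 proof -
  define F where "F = frechet_derivative f (at x)"
  have F: "(f has_derivative F) (at x)"
   using assms that by (auto simp: C1_on_def F_def frechet_derivative_works)
  then interpret bounded_linear F by (rule has_derivative_bounded_linear)
  have "F v = (\<chi> i. partial_deriv i f x) \<bullet> v" for v
  proof -
   have "F v = F (\<Sum>i\<in>UNIV. v $ i *\<^sub>R axis i 1)"
    by (metis basis_expansion vector_scalar_mult_def scalar_mult_eq_scaleR)
   also have "... = (\<Sum>i\<in>UNIV. v $ i * F (axis i 1))"
    by (simp add: sum scaleR)
   also have "... = (\<chi> i. partial_deriv i f x) \<bullet> v"
    by (simp add: inner_vec_def partial_deriv_def F_def mult.commute)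
   finally show ?thesis .
  qed
  then have "F = (%v. (\<chi> i. partial_deriv i f x) \<bullet> v)" by (rule ext)
  with F show ?thesis by metis
 qed
 moreover have "continuous_on S (%x. \<chi> i. partial_deriv i f x)"
  using assms by (auto simp: C1_on_def intro!: continuous_intros)
 ultimately show ?thesis by (simp add: C1_gradient_def)
qed

lemma C1_gradient_subset: "C1_gradient S f D ==> T \<subseteq> S ==> C1_gradient T f D"
 by (auto simp: C1_gradient_def intro: continuous_on_subset)

lemma C1_gradient_continuous_on: "C1_gradient S f D ==> continuous_on S f"
 by (auto simp: C1_gradient_def intro!: has_derivative_continuous continuous_at_imp_continuous_on)

lemma C1_gradient_const: "C1_gradient S (%x. c) (%x. 0)"
 by (auto simp: C1_gradient_def)

lemma C1_gradient_coord: "C1_gradient S (%x. x $ i) (%x. axis i 1)"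
proof -
 have "((%x. x $ i) has_derivative (%v. v $ i)) (at x)" for x :: "real ^ 'a"
  by (rule bounded_linear_imp_has_derivative) (rule bounded_linear_vec_nth)
 then show ?thesis by (auto simp: C1_gradient_def inner_axis')
qed

lemma C1_gradient_mult:
 assumes "C1_gradient S f D" "C1_gradient S g E"
 shows "C1_gradient S (%x. f x * g x) (%x. f x *\<^sub>R E x + g x *\<^sub>R D x)"
proof -
 have "((%x. f x * g x) has_derivative (%v. (f x *\<^sub>R E x + g x *\<^sub>R D x) \<bullet> v)) (at x)" if "x : S" for x
 proof -
  have "(f has_derivative (%v. D x \<bullet> v)) (at x)" "(g has_derivative (%v. E x \<bullet> v)) (at x)"
   using assms that by (auto simp: C1_gradient_def)
  from has_derivative_mult[OF this] show ?thesis by (simp add: inner_add_left algebra_simps)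
 qed
 then show ?thesis
  using assms C1_gradient_continuous_on[OF assms(1)] C1_gradient_continuous_on[OF assms(2)]
  by (auto simp: C1_gradient_def intro!: continuous_intros)
qed

lemma C1_gradient_compose:
 assumes "C1_gradient S f D" "!!x. x : S ==> (h has_real_derivative h' (f x)) (at (f x))"
  and "continuous_on (f ` S) h'"
 shows "C1_gradient S (%x. h (f x)) (%x. h' (f x) *\<^sub>R D x)"
proof -
 have "((%x. h (f x)) has_derivative (%v. (h' (f x) *\<^sub>R D x) \<bullet> v)) (at x)" if "x : S" for x
 proof -
  have 1: "(f has_derivative (%v. D x \<bullet> v)) (at x)"
   using assms(1) that by (auto simp: C1_gradient_def)
  have "(h has_derivative (*) (h' (f x))) (at (f x))"
   using assms(2)[OF that] by (simp add: has_field_derivative_def)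
  from has_derivative_compose[OF 1 this] show ?thesis by simp
 qed
 moreover have "continuous_on S (%x. h' (f x))"
  using continuous_on_compose[OF C1_gradient_continuous_on[OF assms(1)] assms(3)] by (simp add: o_def)
 ultimately show ?thesis
  using assms(1) by (auto simp: C1_gradient_def intro!: continuous_intros)
qed

lemma C1_gradient_norm: "0 \<notin> S ==> C1_gradient S norm (sgn :: real ^ 'n::finite => real ^ 'n)"
proof -
 assume S: "0 \<notin> S"
 have "(norm has_derivative (%v. sgn x \<bullet> v)) (at x)" if "x : S" for x :: "real ^ 'n"
  using has_derivative_norm[of x] S that by (auto simp: inner_commute)
 moreover have "continuous_on S (sgn :: real ^ 'n => real ^ 'n)"
  unfolding sgn_div_norm using S by (auto intro!: continuous_intros)
 ultimately show ?thesis by (auto simp: C1_gradient_def)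
qed

text \<open>Gluing: a function that is C1 on two open sets is C1 on their union.\<close>

lemma C1_on_Un:
 assumes "C1_on S f" "C1_on T f" "open S" "open T"
 shows "C1_on (S \<union> T) f"
 using assms by (auto simp: C1_on_def intro: continuous_on_open_Un)

lemma C1_on_cong_open:
 assumes "C1_on S g" "open S" "!!x. x : S ==> f x = g x"
 shows "C1_on S f"
proof -
 have "C1_gradient S g (%x. \<chi> i. partial_deriv i g x)" using assms(1) by (rule C1_on_gradient)
 then have "C1_gradient S f (%x. \<chi> i. partial_deriv i g x)"
  using assms(2,3) by (auto simp: C1_gradient_def intro: has_derivative_transform_within_open)
 then show ?thesis by (rule C1_gradient_C1_on)
qed

lemma test_functionsI:
 assumes "C1_on UNIV \<phi>" "compact K" "K \<subseteq> \<U>" "!!x. x \<notin> K ==> \<phi> x = 0"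
 shows "\<phi> : test_functions \<U>"
proof -
 have "closure {x. \<phi> x ~= 0} \<subseteq> K"
  using assms by (intro closure_minimal) (auto intro: compact_imp_closed)
 moreover from this have "compact (closure {x. \<phi> x ~= 0})"
  using assms(2) closed_closure compact_closure bounded_subset compact_imp_bounded closure_subset
  by (metis subset_trans)
 ultimately show ?thesis using assms by (auto simp: test_functions_def)
qed

section \<open>Cut-off functions\<close>

definition C1_real :: "(real => real) => (real => real) => bool" where
 "C1_real h h' \<longleftrightarrow> (\<forall>t. (h has_real_derivative h' t) (at t)) & continuous_on UNIV h'"

lemma C1_real_continuous: "C1_real h h' ==> continuous_on UNIV h"
 by (auto simp: C1_real_def intro!: continuous_at_imp_continuous_on DERIV_isCont)

lemma C1_real_mult:
 assumes "C1_real f f'" "C1_real g g'"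
 shows "C1_real (%t. f t * g t) (%t. f' t * g t + f t * g' t)"
 using assms C1_real_continuous[OF assms(1)] C1_real_continuous[OF assms(2)]
 by (auto simp: C1_real_def intro!: continuous_intros derivative_eq_intros)

lemma C1_real_affine:
 assumes "C1_real f f'"
 shows "C1_real (%t. f (c * t + d)) (%t. c * f' (c * t + d))"
proof -
 have "continuous_on UNIV (%t. f' (c * t + d))"
  by (rule continuous_on_compose2[where f = "%t. c * t + d" and t = UNIV])
    (use assms in "auto simp: C1_real_def intro!: continuous_intros")
 moreover have "((%t. f (c * t + d)) has_real_derivative c * f' (c * t + d)) (at t)" for t
  by (rule DERIV_chain2[where f = f and g = "%t. c * t + d", THEN DERIV_cong, where Db1 = c])
    (use assms in "auto simp: C1_real_def intro!: derivative_eq_intros")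
 ultimately show ?thesis by (auto simp: C1_real_def intro!: continuous_intros)
qed

lemma C1_gradient_C1_real:
 assumes "C1_real h h'" "C1_gradient S f D"
 shows "C1_gradient S (%x. h (f x)) (%x. h' (f x) *\<^sub>R D x)"
 using assms by (intro C1_gradient_compose) (auto simp: C1_real_def intro: continuous_on_subset)

definition ramp2 :: "real => real" where "ramp2 t = t * max 0 t"

lemma C1_real_ramp2: "C1_real ramp2 (%t. 2 * max 0 t)"
proof -
 have "(ramp2 has_real_derivative 2 * max 0 t) (at t)" for t :: real
 proof -
  consider "t < 0" | "t = 0" | "t > 0" by linarith
  then show ?thesis
  proof cases
   case 1
   have "((%t. 0) has_real_derivative 0) (at t)" by simp
   then have "(ramp2 has_real_derivative 0) (at t)"
    by (rule has_field_derivative_transform_within_open[where S = "{..<0}"])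
    (use 1 in "auto simp: ramp2_def")
   then show ?thesis using 1 by simp
  next
   case 2
   have "((%y. max 0 y) \<longlongrightarrow> max 0 (0::real)) (at 0)"
    by (intro tendsto_intros)
   moreover have "\<forall>\<^sub>F y in at (0::real). max 0 y = ramp2 y / y"
    by (auto simp: eventually_at_filter ramp2_def)
   ultimately have "((%y. ramp2 y / y) \<longlongrightarrow> 0) (at 0)"
    by (simp add: filterlim_cong)
   then show ?thesis using 2 by (simp add: has_field_derivative_iff ramp2_def)
  next
   case 3
   have "((%t. t * t) has_real_derivative 2 * t) (at t)" by (auto intro!: derivative_eq_intros)
   then have "(ramp2 has_real_derivative 2 * t) (at t)"
    by (rule has_field_derivative_transform_within_open[where S = "{0<..}"])
    (use 3 in "auto simp: ramp2_def")
   then show ?thesis using 3 by simp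
  qed
 qed
 then show ?thesis by (auto simp: C1_real_def intro!: continuous_intros)
qed

definition smoothstep :: "real => real" where
 "smoothstep t = ramp2 t / (ramp2 t + ramp2 (1 - t))"

definition smoothstep' :: "real => real" where
 "smoothstep' t = (2 * max 0 t * ramp2 (1 - t) + ramp2 t * (2 * max 0 (1 - t))) / (ramp2 t + ramp2 (1 - t))\<^sup>2"

lemma ramp2_nonneg: "0 <= ramp2 t" by (auto simp: ramp2_def max_def)

lemma ramp2_sum_pos: "0 < ramp2 t + ramp2 (1 - t)"
proof (cases "0 < t")
 case True
 then have "0 < ramp2 t" by (simp add: ramp2_def)
 then show ?thesis using ramp2_nonneg[of "1 - t"] by linarith
next
 case False
 then have "0 < ramp2 (1 - t)" by (simp add: ramp2_def)
 then show ?thesis using ramp2_nonneg[of t] by linarith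
qed

lemma C1_real_smoothstep: "C1_real smoothstep smoothstep'"
proof -
 have d: "(ramp2 has_real_derivative 2 * max 0 t) (at t)" for t
  using C1_real_ramp2 by (simp add: C1_real_def)
 have d2: "((%t. ramp2 (1 - t)) has_real_derivative - (2 * max 0 (1 - t))) (at t)" for t
  using C1_real_affine[OF C1_real_ramp2, of "-1" 1] by (simp add: C1_real_def)
 have ne: "ramp2 t + ramp2 (1 - t) ~= 0" for t using ramp2_sum_pos[of t] by simp
 have "(smoothstep has_real_derivative smoothstep' t) (at t)" for t
 proof -
  have "((%t. ramp2 t / (ramp2 t + ramp2 (1 - t))) has_real_derivative
   (2 * max 0 t * (ramp2 t + ramp2 (1 - t)) - ramp2 t * (2 * max 0 t + - (2 * max 0 (1 - t))))
    / ((ramp2 t + ramp2 (1 - t)) * (ramp2 t + ramp2 (1 - t)))) (at t)"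
   by (intro DERIV_divide DERIV_add d d2 ne)
  then show ?thesis
   by (simp add: smoothstep_def[abs_def] smoothstep'_def power2_eq_square algebra_simps)
 qed
 moreover have c: "continuous_on UNIV ramp2" using C1_real_continuous[OF C1_real_ramp2] .
 have "continuous_on UNIV (%t. ramp2 (1 - t))"
  by (rule continuous_on_compose2[OF c]) (auto intro!: continuous_intros)
 then have "continuous_on UNIV smoothstep'"
  unfolding smoothstep'_def[abs_def] using c ne by (auto intro!: continuous_intros)
 ultimately show ?thesis by (auto simp: C1_real_def)
qed

lemma smoothstep_0: "t <= 0 ==> smoothstep t = 0"
 and smoothstep'_0: "t <= 0 ==> smoothstep' t = 0"
 and smoothstep_1: "t \<ge> 1 ==> smoothstep t = 1"
 and smoothstep'_1: "t \<ge> 1 ==> smoothstep' t = 0"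
 by (auto simp: smoothstep_def smoothstep'_def ramp2_def)

lemma smoothstep_bounds: "0 <= smoothstep t" "smoothstep t <= 1"
 using ramp2_nonneg[of t] ramp2_nonneg[of "1 - t"] ramp2_sum_pos[of t]
 by (auto simp: smoothstep_def divide_le_eq)

lemma smoothstep'_bounded: "\<exists>C\<ge>0. \<forall>t. \<bar>smoothstep' t\<bar> <= C"
proof -
 have "continuous_on {0..1} smoothstep'"
  using C1_real_smoothstep by (auto simp: C1_real_def intro: continuous_on_subset)
 then have "bounded (smoothstep' ` {0..1})"
  by (intro compact_imp_bounded compact_continuous_image) auto
 then obtain C where C: "\<forall>t\<in>{0..1}. \<bar>smoothstep' t\<bar> <= C" by (auto simp: bounded_iff)
 have "0 <= C" using C[rule_format, of 0] by auto
 moreover have "\<bar>smoothstep' t\<bar> <= C" for t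
  using C smoothstep'_0[of t] smoothstep'_1[of t] \<open>0 <= C\<close>
  by (cases "t : {0..1}") auto
 ultimately show ?thesis by auto
qed

definition bump :: "real => real => nat => real => real" where
 "bump a b n t = smoothstep (real (Suc n) * (t - a) - 1) * smoothstep (real (Suc n) * (b - t) - 1)"

definition bump' :: "real => real => nat => real => real" where
 "bump' a b n t = real (Suc n) *
   (smoothstep' (real (Suc n) * (t - a) - 1) * smoothstep (real (Suc n) * (b - t) - 1)
   - smoothstep (real (Suc n) * (t - a) - 1) * smoothstep' (real (Suc n) * (b - t) - 1))"

lemma C1_real_bump: "C1_real (bump a b n) (bump' a b n)"
proof -
 let ?m = "real (Suc n)"
 have "C1_real (%t. smoothstep (?m * t + (- ?m * a - 1)) * smoothstep (- ?m * t + (?m * b - 1)))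
   (%t. ?m * smoothstep' (?m * t + (- ?m * a - 1)) * smoothstep (- ?m * t + (?m * b - 1))
    + smoothstep (?m * t + (- ?m * a - 1)) * (- ?m * smoothstep' (- ?m * t + (?m * b - 1))))"
  by (intro C1_real_mult C1_real_affine C1_real_smoothstep)
 then show ?thesis
  by (simp add: bump_def[abs_def] bump'_def[abs_def] algebra_simps)
qed

lemma bump_bounds: "0 <= bump a b n t" "bump a b n t <= 1"
 using smoothstep_bounds by (auto simp: bump_def intro: mult_le_one)

lemma bump_outside: "t \<notin> {a + 1 / real (Suc n)..b - 1 / real (Suc n)} ==> bump a b n t = 0"
proof -
 assume t: "t \<notin> {a + 1 / real (Suc n)..b - 1 / real (Suc n)}"
 have m: "real (Suc n) > 0" by simp
 from t consider "t - a < 1 / real (Suc n)" | "b - t < 1 / real (Suc n)" by force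
 then have "real (Suc n) * (t - a) - 1 <= 0 \<or> real (Suc n) * (b - t) - 1 <= 0"
  using m by cases (simp_all only: pos_less_divide_eq mult.commute; linarith)+
 then show ?thesis by (auto simp: bump_def smoothstep_0)
qed

lemma bump_zero: "t \<notin> {a<..<b} ==> bump a b n t = 0"
proof (rule bump_outside)
 assume "t \<notin> {a<..<b}"
 moreover have "0 < 1 / real (Suc n)" by simp
 ultimately show "t \<notin> {a + 1 / real (Suc n)..b - 1 / real (Suc n)}"
  unfolding atLeastAtMost_iff greaterThanLessThan_iff by linarith
qed

text \<open>For fixed \<open>t\<close> strictly between \<open>a\<close> and \<open>b\<close>, the arguments of both steps grow without bound.\<close>

lemma bump_eventually:
 assumes "a < t" "t < b"
 shows "\<forall>\<^sub>F n in sequentially. bump a b n t = 1 & bump' a b n t = 0"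
proof -
 have *: "\<forall>\<^sub>F n in sequentially. 1 <= real (Suc n) * d - 1" if "d > 0" for d :: real
 proof -
  obtain N where N: "2 / d < real N" using reals_Archimedean2 by blast
  have "1 <= real (Suc n) * d - 1" if "n \<ge> N" for n
  proof -
   have "2 / d <= real (Suc n)" using N that by linarith
   then show ?thesis using \<open>d > 0\<close> by (simp add: divide_le_eq)
  qed
  then show ?thesis by (auto simp: eventually_sequentially)
 qed
 have "\<forall>\<^sub>F n in sequentially. 1 <= real (Suc n) * (t - a) - 1"
  "\<forall>\<^sub>F n in sequentially. 1 <= real (Suc n) * (b - t) - 1"
  using *[of "t - a"] *[of "b - t"] assms by simp_all
 then show ?thesis
  by eventually_elim (simp add: bump_def bump'_def smoothstep_1 smoothstep'_1)
qed

lemma bump_tendsto: "(%n. bump a b n t) \<longlonglongrightarrow> indicator {a<..<b} t"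
proof (cases "t : {a<..<b}")
 case True
 then have "\<forall>\<^sub>F n in sequentially. bump a b n t = 1"
  using bump_eventually[of a t b] by (auto elim: eventually_mono)
 with True show ?thesis by (simp add: tendsto_eventually)
qed (simp add: bump_zero)

definition box_bump :: "real ^ 2 => real ^ 2 => nat => real ^ 2 => real" where
 "box_bump a b n x = bump (a $ 1) (b $ 1) n (x $ 1) * bump (a $ 2) (b $ 2) n (x $ 2)"

lemma test_functions_product:
 fixes \<alpha> \<beta> :: "real => real"
 assumes "C1_real \<alpha> \<alpha>'" "C1_real \<beta> \<beta>'" and "box a b \<subseteq> \<U>"
  and "a $ 1 < la" "ua < b $ 1" "!!t. t \<notin> {la..ua} ==> \<alpha> t = 0"
  and "a $ 2 < lb" "ub < b $ 2" "!!t. t \<notin> {lb..ub} ==> \<beta> t = 0"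
 shows "(%x::real^2. \<alpha> (x $ 1) * \<beta> (x $ 2)) : test_functions \<U>"
  and "partial_deriv 1 (%x::real^2. \<alpha> (x $ 1) * \<beta> (x $ 2)) x = \<alpha>' (x $ 1) * \<beta> (x $ 2)"
  and "partial_deriv 2 (%x::real^2. \<alpha> (x $ 1) * \<beta> (x $ 2)) x = \<alpha> (x $ 1) * \<beta>' (x $ 2)"
proof -
 have G: "C1_gradient UNIV (%x::real^2. \<alpha> (x $ 1) * \<beta> (x $ 2))
   (%x. \<alpha> (x $ 1) *\<^sub>R (\<beta>' (x $ 2) *\<^sub>R axis 2 1) + \<beta> (x $ 2) *\<^sub>R (\<alpha>' (x $ 1) *\<^sub>R axis 1 1))"
  by (intro C1_gradient_mult C1_gradient_C1_real[OF assms(1)] C1_gradient_C1_real[OF assms(2)]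
    C1_gradient_coord)
 show "(%x::real^2. \<alpha> (x $ 1) * \<beta> (x $ 2)) : test_functions \<U>"
 proof (rule test_functionsI[OF C1_gradient_C1_on[OF G], where K = "cbox (vector [la, lb]) (vector [ua, ub])"])
  have "cbox (vector [la, lb]) (vector [ua, ub]) \<subseteq> box a b"
   using assms by (auto simp: mem_box_cart forall_2)
  then show "cbox (vector [la, lb]) (vector [ua, ub]) \<subseteq> \<U>" using assms by auto
 next
  fix x :: "real^2" assume "x \<notin> cbox (vector [la, lb]) (vector [ua, ub])"
  then show "\<alpha> (x $ 1) * \<beta> (x $ 2) = 0"
   using assms(6)[of "x $ 1"] assms(9)[of "x $ 2"] by (auto simp: mem_box_cart forall_2)
 qed auto
 show "partial_deriv 1 (%x::real^2. \<alpha> (x $ 1) * \<beta> (x $ 2)) x = \<alpha>' (x $ 1) * \<beta> (x $ 2)"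
  and "partial_deriv 2 (%x::real^2. \<alpha> (x $ 1) * \<beta> (x $ 2)) x = \<alpha> (x $ 1) * \<beta>' (x $ 2)"
  by (simp_all add: C1_gradient_partial[OF G] axis_def)
qed

lemma box_bump_test:
 assumes "box a b \<subseteq> \<U>"
 shows "box_bump a b n : test_functions \<U>"
 unfolding box_bump_def[abs_def]
 by (rule test_functions_product[OF C1_real_bump C1_real_bump assms,
    where la = "a $ 1 + 1 / real (Suc n)" and ua = "b $ 1 - 1 / real (Suc n)" and
    lb = "a $ 2 + 1 / real (Suc n)" and ub = "b $ 2 - 1 / real (Suc n)"])
   (auto intro: bump_outside)

lemma box_bump_tendsto: "(%n. box_bump a b n x) \<longlonglongrightarrow> indicator (box a b) x"
proof -
 have "(%n. box_bump a b n x) \<longlonglongrightarrow> indicator {a $ 1<..<b $ 1} (x $ 1) * indicator {a $ 2<..<b $ 2} (x $ 2)"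
  unfolding box_bump_def by (intro tendsto_mult bump_tendsto)
 also have "indicator {a $ 1<..<b $ 1} (x $ 1) * indicator {a $ 2<..<b $ 2} (x $ 2) = (indicator (box a b) x :: real)"
  by (auto simp: indicator_def mem_box_cart forall_2)
 finally show ?thesis .
qed

lemma box_bump_bounds: "0 <= box_bump a b n x" "box_bump a b n x <= 1"
 using bump_bounds by (auto simp: box_bump_def intro: mult_le_one)

lemma test_function_C1: "\<phi> : test_functions \<U> ==> C1_on UNIV \<phi>"
 by (simp add: test_functions_def)

lemma C1_on_continuous_on: "C1_on S \<phi> ==> continuous_on S \<phi>"
 by (rule C1_gradient_continuous_on[OF C1_on_gradient])

lemma C1_on_borel: "C1_on UNIV \<phi> ==> \<phi> : borel_measurable borel"
 by (intro borel_measurable_continuous_onI C1_on_continuous_on)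

lemma partial_deriv_borel: "C1_on UNIV \<phi> ==> partial_deriv i \<phi> : borel_measurable borel"
 by (intro borel_measurable_continuous_onI) (simp add: C1_on_def)

section \<open>Test functions determine densities\<close>

lemma sigma_sets_boxes:
 fixes \<U> :: "(real ^ 2) set"
 assumes "open \<U>"
 shows "borel_on \<U> = sigma_sets \<U> {box a b | a b. box a b \<subseteq> \<U>}" (is "_ = sigma_sets \<U> ?B")
proof
 have sub: "?B \<subseteq> Pow \<U>" by auto
 interpret S: sigma_algebra \<U> "sigma_sets \<U> ?B" by (rule sigma_algebra_sigma_sets[OF sub])
 have op: "U : sigma_sets \<U> ?B" if U: "open U" "U \<subseteq> \<U>" for U
 proof -
  obtain D where D: "countable D" "D \<subseteq> Pow U" "!!X. X : D ==> \<exists>a b. X = box a b" "\<Union>D = U"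
   by (rule open_countable_Union_open_box[OF U(1)]) metis
  have "X : sigma_sets \<U> ?B" if "X : D" for X
  proof -
   have "X : ?B" using D(2,3) that U(2) by blast
   then show ?thesis by (rule sigma_sets.Basic)
  qed
  then show ?thesis using S.countable_Union[OF D(1)] D(4) by auto
 qed
 have "borel_on \<U> = (Int) \<U> ` sigma_sets UNIV {S. open S}"
  by (simp add: sets_restrict_space borel_def)
 also have "... = sigma_sets \<U> ((Int) \<U> ` {S. open S})"
 proof -
  have "\<U> : sigma_sets UNIV {S. open S}" using assms by (auto intro: sigma_sets.Basic)
  from sigma_sets_Int[OF this] show ?thesis by simp
 qed
 also have "... \<subseteq> sigma_sets \<U> ?B"
 proof (rule sigma_sets_mono, safe)
  fix U :: "(real^2) set" assume "open U"
  then show "\<U> Int U : sigma_sets \<U> ?B" using assms by (intro op) auto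
 qed
 finally show "borel_on \<U> \<subseteq> sigma_sets \<U> ?B" .
 interpret R: sigma_algebra \<U> "borel_on \<U>"
  using sets.sigma_algebra_axioms[of "restrict_space borel \<U>"] by (simp add: space_restrict_space)
 show "sigma_sets \<U> ?B \<subseteq> borel_on \<U>"
  by (rule R.sigma_sets_subset) (use assms in "auto simp: sets_restrict_space_iff borel_open")
qed

text \<open>Boxes generate the Borel sets and are stable under intersection, and the indicator of a box is the
 bounded pointwise limit of test functions.\<close>

lemma test_functions_determine:
 fixes p :: "'a => real ^ 2" and F :: "'a => real"
 assumes \<U>: "open \<U>" and p[measurable]: "p : borel_measurable M" and p\<U>: "!!x. x : space M ==> p x : \<U>"
  and F: "integrable M F"
  and zero: "!!a b n. box a b \<subseteq> \<U> ==> (\<integral>x. box_bump a b n (p x) * F x \<partial>M) = 0"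
  and B: "B : sets borel"
 shows "(\<integral>x. indicator B (p x) * F x \<partial>M) = 0"
proof -
 note [measurable] = borel_measurable_integrable[OF F]
 have F': "integrable M (%x. max 0 (F x))" "integrable M (%x. max 0 (- F x))"
  using F by (auto intro: integrable_max)
 have pr: "p : M \<rightarrow>\<^sub>M restrict_space borel \<U>"
  by (rule measurable_restrict_space2) (use p\<U> p in auto)
 define P where "P = distr (density M (%x. ennreal (F x))) (restrict_space borel \<U>) p"
 define N where "N = distr (density M (%x. ennreal (- F x))) (restrict_space borel \<U>) p"
 have int_ind: "integrable M (%x. indicator X (p x) * G x)" if "X : sets borel" "integrable M G" for X and G :: "'a => real"
 proof (rule Bochner_Integration.integrable_bound[OF that(2)])
  show "(%x. indicator X (p x) * G x) : borel_measurable M" using that by measurable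
 qed (auto simp: indicator_def)
 have eP: "emeasure P X = ennreal (\<integral>x. indicator X (p x) * max 0 (F x) \<partial>M)"
  and eN: "emeasure N X = ennreal (\<integral>x. indicator X (p x) * max 0 (- F x) \<partial>M)"
  if X: "X : borel_on \<U>" for X
 proof -
  have [measurable]: "X : sets borel" and "X \<subseteq> \<U>"
   using X \<U> by (auto simp: sets_restrict_space_iff borel_open)
  have m: "p -` X Int space M : sets M" by measurable
  have "emeasure P X = (\<integral>\<^sup>+x. ennreal (F x) * indicator (p -` X Int space M) x \<partial>M)"
   unfolding P_def using pr X m by (subst emeasure_distr) (auto simp: emeasure_density)
  also have "... = (\<integral>\<^sup>+x. ennreal (indicator X (p x) * max 0 (F x)) \<partial>M)"
   by (intro nn_integral_cong) (auto simp: indicator_def max_def ennreal_neg)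
  also have "... = ennreal (\<integral>x. indicator X (p x) * max 0 (F x) \<partial>M)"
   by (rule nn_integral_eq_integral[OF int_ind]) (use F' in "auto simp: max_def")
  finally show "emeasure P X = ennreal (\<integral>x. indicator X (p x) * max 0 (F x) \<partial>M)" .
  have "emeasure N X = (\<integral>\<^sup>+x. ennreal (- F x) * indicator (p -` X Int space M) x \<partial>M)"
   unfolding N_def using pr X m by (subst emeasure_distr) (auto simp: emeasure_density)
  also have "... = (\<integral>\<^sup>+x. ennreal (indicator X (p x) * max 0 (- F x)) \<partial>M)"
   by (intro nn_integral_cong) (auto simp: indicator_def max_def ennreal_neg)
  also have "... = ennreal (\<integral>x. indicator X (p x) * max 0 (- F x) \<partial>M)"
   by (rule nn_integral_eq_integral[OF int_ind]) (use F' in "auto simp: max_def")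
  finally show "emeasure N X = ennreal (\<integral>x. indicator X (p x) * max 0 (- F x) \<partial>M)" .
 qed
 have diff: "(\<integral>x. indicator X (p x) * F x \<partial>M)
   = (\<integral>x. indicator X (p x) * max 0 (F x) \<partial>M) - (\<integral>x. indicator X (p x) * max 0 (- F x) \<partial>M)"
  if "X : sets borel" for X
 proof -
  have "(\<integral>x. indicator X (p x) * F x \<partial>M)
   = (\<integral>x. indicator X (p x) * max 0 (F x) - indicator X (p x) * max 0 (- F x) \<partial>M)"
   by (intro Bochner_Integration.integral_cong) (auto simp: indicator_def)
  also have "... = (\<integral>x. indicator X (p x) * max 0 (F x) \<partial>M) - (\<integral>x. indicator X (p x) * max 0 (- F x) \<partial>M)"
   by (intro Bochner_Integration.integral_diff int_ind that F')
  finally show ?thesis .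
 qed
 have box0: "(\<integral>x. indicator (box a b) (p x) * F x \<partial>M) = 0" if "box a b \<subseteq> \<U>" for a b
 proof -
  have "(%n. \<integral>x. box_bump a b n (p x) * F x \<partial>M) \<longlonglongrightarrow> (\<integral>x. indicator (box a b) (p x) * F x \<partial>M)"
  proof (rule integral_dominated_convergence[where w = "%x. \<bar>F x\<bar>"])
   have [measurable]: "box_bump a b n : borel_measurable borel" for n
    using box_bump_test[of a b UNIV n] by (auto intro!: C1_on_borel test_function_C1)
   show "(%x. box_bump a b n (p x) * F x) : borel_measurable M" for n by measurable
   show "AE x in M. (%n. box_bump a b n (p x) * F x) \<longlonglongrightarrow> indicator (box a b) (p x) * F x"
    by (auto intro!: tendsto_mult box_bump_tendsto)
   show "AE x in M. norm (box_bump a b n (p x) * F x) <= \<bar>F x\<bar>" for n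
    using box_bump_bounds by (auto simp: abs_mult intro!: mult_left_le_one_le)
  qed (use F in "auto simp: borel_open")
  then show ?thesis using zero[OF that] by (simp add: LIMSEQ_const_iff)
 qed
 have "P = N"
 proof -
  let ?B = "{box a b | a b. box a b \<subseteq> \<U>}"
  obtain D where D: "countable D" "D \<subseteq> Pow \<U>" "!!X. X : D ==> \<exists>a b. X = box a b" "\<Union>D = \<U>"
   by (rule open_countable_Union_open_box[OF \<U>]) metis
  have mem: "X : borel_on \<U>" if "X : ?B" for X
   using that \<U> by (auto simp: sets_restrict_space_iff borel_open)
  show ?thesis
  proof (rule measure_eqI_generator_eq_countable[where E = ?B and \<Omega> = \<U> and A = D])
   show "Int_stable ?B"
   proof (rule Int_stableI)
    fix X Y assume "X : ?B" "Y : ?B"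
    then obtain a b c d where "X = box a b" "Y = box c d" "box a b \<subseteq> \<U>" by blast
    moreover from this obtain e f where "X Int Y = box e f" by (simp add: box_Int_box)
    ultimately show "X Int Y : ?B" by blast
   qed
   show "emeasure P X = emeasure N X" if "X : ?B" for X
   proof -
    from that obtain a b where X: "X = box a b" "box a b \<subseteq> \<U>" by blast
    have "(\<integral>x. indicator X (p x) * max 0 (F x) \<partial>M) = (\<integral>x. indicator X (p x) * max 0 (- F x) \<partial>M)"
    using diff[of X] box0[OF X(2)] X(1) by (simp add: borel_open)
    then show ?thesis using eP[OF mem[OF that]] eN[OF mem[OF that]] by simp
   qed
   show "sets P = sigma_sets \<U> ?B" "sets N = sigma_sets \<U> ?B"
    unfolding P_def N_def using sigma_sets_boxes[OF \<U>] by auto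
   show "D \<subseteq> ?B" using D by blast
   then show "emeasure P X ~= \<infinity>" if "X : D" for X
    using eP[OF mem[OF subsetD[OF _ that]]] by simp
  qed (use D in auto)
 qed
 have BO: "B Int \<U> : borel_on \<U>" using B \<U> by (auto simp: sets_restrict_space_iff borel_open)
 have "(\<integral>x. indicator (B Int \<U>) (p x) * max 0 (F x) \<partial>M) = (\<integral>x. indicator (B Int \<U>) (p x) * max 0 (- F x) \<partial>M)"
 proof -
  have "ennreal (\<integral>x. indicator (B Int \<U>) (p x) * max 0 (F x) \<partial>M) = ennreal (\<integral>x. indicator (B Int \<U>) (p x) * max 0 (- F x) \<partial>M)"
   using eP[OF BO] eN[OF BO] \<open>P = N\<close> by simp
  then show ?thesis
   by (subst (asm) ennreal_inj) (auto intro!: integral_nonneg_AE)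
 qed
 then have "(\<integral>x. indicator (B Int \<U>) (p x) * F x \<partial>M) = 0"
  using diff[of "B Int \<U>"] B \<U> by (simp add: borel_open)
 also have "(\<integral>x. indicator (B Int \<U>) (p x) * F x \<partial>M) = (\<integral>x. indicator B (p x) * F x \<partial>M)"
  by (intro Bochner_Integration.integral_cong) (auto simp: indicator_def p\<U>)
 finally show ?thesis .
qed

section \<open>Signed measures\<close>

lemma borel_on_iff: "\<U> : sets borel ==> E : borel_on \<U> \<longleftrightarrow> E : sets borel & E \<subseteq> \<U>"
 by (auto simp: sets_restrict_space_iff)

lemma vector_measure_empty:
 assumes "vector_measure_on \<U> \<mu>"
 shows "\<mu> {} = 0"
proof -
 have "(%n::nat. \<mu> {}) sums \<mu> (\<Union>n::nat. {})"
  using assms[unfolded vector_measure_on_def, rule_format, of "%_. {}"]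
  by (auto simp: disjoint_family_on_def)
 then have "(%n::nat. \<mu> {}) \<longlonglongrightarrow> 0" by (intro summable_LIMSEQ_zero sums_summable)
 then show ?thesis by (simp add: LIMSEQ_const_iff)
qed

lemma vector_measure_Un:
 assumes "vector_measure_on \<U> \<mu>" "E : borel_on \<U>" "F : borel_on \<U>" "E Int F = {}"
 shows "\<mu> (E \<union> F) = \<mu> E + \<mu> F"
proof -
 have "(%n. \<mu> (binaryset E F n)) sums \<mu> (\<Union>n. binaryset E F n)"
  using assms by (intro assms(1)[unfolded vector_measure_on_def, rule_format])
   (auto simp: range_binaryset_eq disjoint_family_on_def binaryset_def)
 then have "(%n. \<mu> (binaryset E F n)) sums \<mu> (E \<union> F)" by (simp add: UN_binaryset_eq)
 moreover have "(%n. \<mu> (binaryset E F n)) sums (\<Sum>n\<in>{0,1}. \<mu> (binaryset E F n))"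
  by (rule sums_finite) (auto simp: binaryset_def vector_measure_empty[OF assms(1)])
 ultimately show ?thesis by (auto simp: binaryset_def dest: sums_unique2)
qed

lemma vector_measure_Diff:
 assumes "vector_measure_on \<U> \<mu>" "E : borel_on \<U>" "F : borel_on \<U>" "F \<subseteq> E"
 shows "\<mu> (E - F) = \<mu> E - \<mu> F"
proof -
 have "\<mu> ((E - F) \<union> F) = \<mu> (E - F) + \<mu> F"
  using assms by (intro vector_measure_Un) auto
 moreover have "(E - F) \<union> F = E" using assms(4) by auto
 ultimately show ?thesis by simp
qed

lemma vector_measure_minus: "vector_measure_on \<U> \<mu> ==> vector_measure_on \<U> (%E. - \<mu> E)"
 by (auto simp: vector_measure_on_def intro: sums_minus)

lemma vector_measure_component:
 fixes \<mu> :: "'a::topological_space set => real ^ 'n::finite"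
 shows "vector_measure_on \<U> \<mu> ==> vector_measure_on \<U> (%E. \<mu> E $ i)"
 by (auto simp: vector_measure_on_def intro: bounded_linear.sums[OF bounded_linear_vec_nth])

text \<open>If the values on subsets of \<open>E\<close> were unbounded, one could split off from \<open>E\<close> a set of measure
 larger than 1 in modulus in such a way that the remainder is again unbounded; iterating this gives
 a disjoint sequence of sets whose measures do not form a convergent series.\<close>

lemma signed_measure_bounded_above:
 fixes \<nu> :: "'a::topological_space set => real"
 assumes vm: "vector_measure_on \<U> \<nu>" and \<U>: "\<U> : sets borel"
 shows "\<exists>K. \<forall>B\<in>borel_on \<U>. \<nu> B <= K"
proof (rule ccontr)
 define bad where "bad E \<longleftrightarrow> E : borel_on \<U> & (\<forall>K. \<exists>B\<in>borel_on \<U>. B \<subseteq> E & K < \<nu> B)" for E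
 assume "\<nexists>K. \<forall>B\<in>borel_on \<U>. \<nu> B <= K"
 then have bad0: "bad \<U>"
  using \<U> by (auto simp: bad_def borel_on_iff not_le)
 have step: "\<exists>E'. bad E' & E' \<subseteq> E & 1 < \<bar>\<nu> (E - E')\<bar>" if E: "bad E" for E
 proof -
  have EB: "E : borel_on \<U>" using E by (simp add: bad_def)
  obtain B where B: "B : borel_on \<U>" "B \<subseteq> E" "\<bar>\<nu> E\<bar> + 1 < \<nu> B"
   using E unfolding bad_def by blast
  have D: "\<nu> (E - B) = \<nu> E - \<nu> B" using vector_measure_Diff[OF vm EB B(1,2)] .
  have "bad B \<or> bad (E - B)"
  proof (rule ccontr)
   assume "\<not> ?thesis"
   then obtain K1 K2 where K: "!!C. C : borel_on \<U> ==> C \<subseteq> B ==> \<nu> C <= K1"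
    "!!C. C : borel_on \<U> ==> C \<subseteq> E - B ==> \<nu> C <= K2"
    using B(1) EB unfolding bad_def by (meson not_le sets.Diff)
   obtain C where C: "C : borel_on \<U>" "C \<subseteq> E" "K1 + K2 < \<nu> C"
    using E unfolding bad_def by blast
   have "\<nu> C = \<nu> ((C Int B) \<union> (C - B))" by (simp add: Int_Diff_Un)
   also have "... = \<nu> (C Int B) + \<nu> (C - B)"
    using C B by (intro vector_measure_Un[OF vm]) auto
   also have "... <= K1 + K2"
    using C B by (intro add_mono K) auto
   finally show False using C(3) by simp
  qed
  then show ?thesis
  proof
   assume "bad B"
   then show ?thesis using B D by (intro exI[of _ B]) auto
  next
   assume "bad (E - B)"
   moreover have "E - (E - B) = B" using B by auto
   ultimately show ?thesis using B by (intro exI[of _ "E - B"]) auto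
  qed
 qed
 obtain f where f: "!!n. bad (f n)" "!!n. f (Suc n) \<subseteq> f n & 1 < \<bar>\<nu> (f n - f (Suc n))\<bar>"
  using dependent_nat_choice[of "%_. bad" "%_ E E'. E' \<subseteq> E & 1 < \<bar>\<nu> (E - E')\<bar>"] bad0 step
  by metis
 define A where "A n = f n - f (Suc n)" for n
 have dec: "f n \<subseteq> f m" if "m <= n" for m n
  by (rule lift_Suc_antimono_le[of f]) (use that f(2) in auto)
 have "disjoint_family A"
 proof -
  have "A m Int A n = {}" if "m < n" for m n
   using dec[of "Suc m" n] that by (auto simp: A_def)
  then show ?thesis
   unfolding disjoint_family_on_def by (metis inf_commute linorder_neqE_nat)
 qed
 moreover have "range A \<subseteq> borel_on \<U>"
  using f(1) by (auto simp: A_def bad_def)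
 ultimately have "(%n. \<nu> (A n)) sums \<nu> (\<Union>n. A n)"
  using vm by (simp add: vector_measure_on_def)
 then have "(%n. \<nu> (A n)) \<longlonglongrightarrow> 0"
  by (intro summable_LIMSEQ_zero sums_summable)
 then have "\<forall>\<^sub>F n in sequentially. \<bar>\<nu> (A n)\<bar> < 1"
  using tendsto_rabs_zero order_tendstoD(2) zero_less_one by blast
 then obtain n where "\<bar>\<nu> (A n)\<bar> < 1" by (auto simp: eventually_sequentially)
 then show False using f(2)[of n] by (simp add: A_def)
qed

lemma ennreal_le_suminf:
 assumes "f sums s"
 shows "ennreal s <= (\<Sum>i. ennreal (f i))"
proof -
 have "(%n. ennreal (\<Sum>i<n. f i)) \<longlonglongrightarrow> ennreal s"
  using assms by (intro tendsto_ennrealI) (simp add: sums_def)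
 moreover have "ennreal (\<Sum>i<n. f i) <= (\<Sum>i. ennreal (f i))" for n
 proof -
  have "ennreal (\<Sum>i<n. f i) <= ennreal (\<Sum>i<n. max 0 (f i))"
   by (intro ennreal_leI sum_mono) auto
  also have "... = (\<Sum>i<n. ennreal (max 0 (f i)))" by (simp add: sum_ennreal)
  also have "... = (\<Sum>i<n. ennreal (f i))" by (intro sum.cong) (auto simp: max_def ennreal_neg)
  also have "... <= (\<Sum>i. ennreal (f i))" by (intro sum_le_suminf) auto
  finally show ?thesis .
 qed
 ultimately show ?thesis by (intro LIMSEQ_le_const2) auto
qed

lemma space_positive_part [simp]: "space (positive_part \<U> \<nu>) = \<U>"
 by (simp add: positive_part_def space_measure_of_conv)

lemma sets_positive_part [simp]: "sets (positive_part \<U> \<nu>) = borel_on \<U>"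
proof -
 have "sigma_sets \<U> (borel_on \<U>) = borel_on \<U>"
  using sets.sigma_sets_eq[of "restrict_space borel \<U>"] by (simp add: space_restrict_space)
 moreover have "borel_on \<U> \<subseteq> Pow \<U>"
  using sets.space_closed[of "restrict_space borel \<U>"] by (simp add: space_restrict_space)
 ultimately show ?thesis by (simp add: positive_part_def sets_measure_of_conv)
qed

lemma emeasure_positive_part:
 fixes \<nu> :: "'a::topological_space set => real"
 assumes vm: "vector_measure_on \<U> \<nu>" and \<U>: "\<U> : sets borel" and E: "E : borel_on \<U>"
 shows "emeasure (positive_part \<U> \<nu>) E = (SUP B \<in> {B : sets borel. B \<subseteq> E}. ennreal (\<nu> B))"
proof -
 define pp where "pp E = (SUP B \<in> {B : sets borel. B \<subseteq> E}. ennreal (\<nu> B))" for E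
 have pp_upper: "ennreal (\<nu> B) <= pp E" if "B : sets borel" "B \<subseteq> E" for B E
  unfolding pp_def using that by (intro SUP_upper) auto
 have super: "pp E + pp F <= pp (E \<union> F)" if EF: "E : borel_on \<U>" "F : borel_on \<U>" "E Int F = {}" for E F
 proof -
  have "ennreal (\<nu> B) + ennreal (\<nu> C) <= pp (E \<union> F)"
   if B: "B : sets borel" "B \<subseteq> E" and C: "C : sets borel" "C \<subseteq> F" for B C
  proof (cases "\<nu> B < 0 \<or> \<nu> C < 0")
   case True
   then show ?thesis
    using pp_upper[of B "E \<union> F"] pp_upper[of C "E \<union> F"] le_supI1[OF B(2)] le_supI2[OF C(2)] B C
    by (auto simp: ennreal_neg)
  next
   case False
   have "\<nu> (B \<union> C) = \<nu> B + \<nu> C"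
    using B C EF \<U> by (intro vector_measure_Un[OF vm]) (auto simp: borel_on_iff)
   then have "ennreal (\<nu> B) + ennreal (\<nu> C) = ennreal (\<nu> (B \<union> C))" using False by (simp add: ennreal_plus)
   then show ?thesis using pp_upper[of "B \<union> C" "E \<union> F"] B C by auto
  qed
  then have "ennreal (\<nu> B) + pp F <= pp (E \<union> F)" if "B : sets borel" "B \<subseteq> E" for B
   unfolding pp_def[of F] using that
   by (subst ennreal_SUP_add_right) (auto intro!: SUP_least)
  then show ?thesis
   unfolding pp_def[of E]
   by (subst ennreal_SUP_add_left[symmetric]) (auto intro!: SUP_least)
 qed
 have empty: "pp {} = 0"
 proof -
  have "{B :: 'a set. B : sets borel & B \<subseteq> {}} = {{}}" by auto
  then show ?thesis by (simp add: pp_def vector_measure_empty[OF vm])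
 qed
 have "countably_additive (borel_on \<U>) pp"
  unfolding countably_additive_def
 proof safe
  fix A :: "nat => 'a set"
  assume A: "range A \<subseteq> borel_on \<U>" "disjoint_family A"
  have "(\<Sum>i<n. pp (A i)) <= pp (\<Union>i<n. A i)" for n
  proof (induction n)
   case (Suc n)
   have "(\<Sum>i<Suc n. pp (A i)) <= pp (\<Union>i<n. A i) + pp (A n)"
    using Suc by (simp add: add_mono)
   also have "... <= pp ((\<Union>i<n. A i) \<union> A n)"
   proof (rule super)
    show "(\<Union>i<n. A i) Int A n = {}"
    proof -
    have "A i Int A n = {}" if "i < n" for i
    using disjoint_family_onD[OF A(2), of i n] that by simp
    then show ?thesis by blast
    qed
    have "A i : borel_on \<U>" for i using A(1) by blast
    then show "(\<Union>i<n. A i) : borel_on \<U>" "A n : borel_on \<U>" by (simp_all add: sets.finite_UN)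
   qed
   finally show ?case by (simp add: lessThan_Suc Un_commute)
  qed (simp add: empty)
  moreover have "pp (\<Union>i<n. A i) <= pp (\<Union>i. A i)" for n
   unfolding pp_def by (intro SUP_subset_mono) auto
  ultimately have "(\<Sum>i. pp (A i)) <= pp (\<Union>i. A i)"
   by (intro suminf_le_const) (auto intro: order_trans)
  moreover have "pp (\<Union>i. A i) <= (\<Sum>i. pp (A i))"
   unfolding pp_def[of "\<Union>i. A i"]
  proof (intro SUP_least, safe)
   fix B assume B: "B : sets borel" "B \<subseteq> (\<Union>i. A i)"
   have "(%i. \<nu> (B Int A i)) sums \<nu> (\<Union>i. B Int A i)"
   proof (rule vm[unfolded vector_measure_on_def, rule_format], intro conjI)
    have A': "A i : sets borel" "A i \<subseteq> \<U>" for i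
    using A(1) unfolding borel_on_iff[OF \<U>, symmetric] image_subset_iff by (auto simp: borel_on_iff[OF \<U>])
    have "B Int A i : borel_on \<U>" for i using A'[of i] B(1) by (auto simp: borel_on_iff[OF \<U>])
    then show "range (%i. B Int A i) \<subseteq> borel_on \<U>" by blast
    show "disjoint_family (%i. B Int A i)"
    using A(2) by (auto intro: disjoint_family_subset)
   qed
   moreover have "(\<Union>i. B Int A i) = B" using B by auto
   ultimately have "ennreal (\<nu> B) <= (\<Sum>i. ennreal (\<nu> (B Int A i)))" using ennreal_le_suminf by metis
   also have "... <= (\<Sum>i. pp (A i))"
   proof (intro suminf_le pp_upper)
    fix i
    have "A i : borel_on \<U>" using A(1) by blast
    then show "B Int A i : sets borel" using B(1) by (auto simp: borel_on_iff[OF \<U>])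
   qed auto
   finally show "ennreal (\<nu> B) <= (\<Sum>i. pp (A i))" .
  qed
  ultimately show "(\<Sum>i. pp (A i)) = pp (\<Union>i. A i)" by (rule antisym)
 qed
 moreover have "positive (borel_on \<U>) pp" by (simp add: positive_def empty)
 moreover have "sigma_algebra \<U> (borel_on \<U>)"
  using sets.sigma_algebra_axioms[of "restrict_space borel \<U>"] by (simp add: space_restrict_space)
 ultimately show ?thesis
  unfolding positive_part_def pp_def[abs_def] using E by (intro emeasure_measure_of_sigma) auto
qed

lemma finite_positive_part:
 fixes \<nu> :: "'a::topological_space set => real"
 assumes vm: "vector_measure_on \<U> \<nu>" and \<U>: "\<U> : sets borel"
 shows "finite_measure (positive_part \<U> \<nu>)"
proof
 obtain K where K: "\<forall>B\<in>borel_on \<U>. \<nu> B <= K" using signed_measure_bounded_above[OF assms] by blast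
 have "emeasure (positive_part \<U> \<nu>) \<U> <= ennreal K"
  using \<U> K by (subst emeasure_positive_part[OF assms]) (auto simp: borel_on_iff intro!: SUP_least ennreal_leI)
 then show "emeasure (positive_part \<U> \<nu>) (space (positive_part \<U> \<nu>)) ~= \<infinity>"
  by (auto simp: top_unique)
qed

lemma positive_part_le:
 fixes \<nu> :: "'a::topological_space set => real"
 assumes vm: "vector_measure_on \<U> \<nu>" and \<U>: "\<U> : sets borel" and E: "E : borel_on \<U>"
  and "0 <= c" "!!B. B : borel_on \<U> ==> B \<subseteq> E ==> \<nu> B <= c"
 shows "measure (positive_part \<U> \<nu>) E <= c"
proof -
 have "emeasure (positive_part \<U> \<nu>) E <= ennreal c"
  using assms by (subst emeasure_positive_part[OF vm \<U> E]) (auto simp: borel_on_iff intro!: SUP_least ennreal_leI)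
 then show ?thesis using assms(4) by (simp add: measure_def enn2real_leI)
qed

lemma positive_part_ge:
 fixes \<nu> :: "'a::topological_space set => real"
 assumes vm: "vector_measure_on \<U> \<nu>" and \<U>: "\<U> : sets borel" and E: "E : borel_on \<U>"
  and B: "B : borel_on \<U>" "B \<subseteq> E"
 shows "\<nu> B <= measure (positive_part \<U> \<nu>) E"
proof -
 interpret finite_measure "positive_part \<U> \<nu>" by (rule finite_positive_part[OF vm \<U>])
 have "ennreal (\<nu> B) <= emeasure (positive_part \<U> \<nu>) E"
  using B \<U> by (subst emeasure_positive_part[OF vm \<U> E]) (auto simp: borel_on_iff intro!: SUP_upper)
 then show ?thesis by (simp add: emeasure_eq_measure)
qed

lemma Jordan_decomposition:
 fixes \<nu> :: "'a::topological_space set => real"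
 assumes vm: "vector_measure_on \<U> \<nu>" and \<U>: "\<U> : sets borel" and E: "E : borel_on \<U>"
 shows "\<nu> E = measure (positive_part \<U> \<nu>) E - measure (positive_part \<U> (%E. - \<nu> E)) E"
proof -
 have half: "measure (positive_part \<U> \<nu>) E <= \<nu> E + measure (positive_part \<U> (%E. - \<nu> E)) E"
  if vm: "vector_measure_on \<U> \<nu>" for \<nu> :: "'a set => real"
 proof -
  have *: "\<nu> B <= \<nu> E + measure (positive_part \<U> (%E. - \<nu> E)) E" if B: "B : borel_on \<U>" "B \<subseteq> E" for B
  proof -
   have "- \<nu> (E - B) <= measure (positive_part \<U> (%E. - \<nu> E)) E"
    by (rule positive_part_ge[OF vector_measure_minus[OF vm] \<U> E]) (use B E in auto)
   then show ?thesis using vector_measure_Diff[OF vm E B] by simp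
  qed
  have "0 <= \<nu> E + measure (positive_part \<U> (%E. - \<nu> E)) E"
   using *[of "{}"] vector_measure_empty[OF vm] by simp
  then show ?thesis by (rule positive_part_le[OF vm \<U> E]) (use * in auto)
 qed
 show ?thesis using half[OF vm] half[OF vector_measure_minus[OF vm]] by simp
qed

lemma vector_measure_diff_measures:
 assumes "finite_measure A" "finite_measure B" "sets A = borel_on \<U>" "sets B = borel_on \<U>"
  and "!!E. E : borel_on \<U> ==> \<nu> E = measure A E - measure B E"
 shows "vector_measure_on \<U> \<nu>"
 unfolding vector_measure_on_def
proof safe
 fix S :: "nat => 'a set" assume S: "range S \<subseteq> borel_on \<U>" "disjoint_family S"
 have "(%n. measure A (S n) - measure B (S n)) sums (measure A (\<Union>n. S n) - measure B (\<Union>n. S n))"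
  using S assms by (intro sums_diff finite_measure.finite_measure_UNION) auto
 moreover have "\<nu> (S n) = measure A (S n) - measure B (S n)" for n using S assms(5) by blast
 moreover have "\<nu> (\<Union>n. S n) = measure A (\<Union>n. S n) - measure B (\<Union>n. S n)" using S by (intro assms(5)) auto
 ultimately show "(%n. \<nu> (S n)) sums \<nu> (\<Union>n. S n)" by simp
qed

lemma nn_integral_four_measures:
 assumes sets: "sets B = sets A" "sets C = sets A" "sets D = sets A"
  and eq: "!!E. E : sets A ==> emeasure A E + emeasure B E = emeasure C E + emeasure D E"
  and f: "f : borel_measurable A"
 shows "(\<integral>\<^sup>+x. f x \<partial>A) + (\<integral>\<^sup>+x. f x \<partial>B) = (\<integral>\<^sup>+x. f x \<partial>C) + (\<integral>\<^sup>+x. f x \<partial>D)"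
 using f
proof (induction rule: borel_measurable_induct)
 have sp: "space B = space A" "space C = space A" "space D = space A" using sets by (auto dest: sets_eq_imp_space_eq)
 note ms = measurable_cong_sets[OF sets(1) refl] measurable_cong_sets[OF sets(2) refl] measurable_cong_sets[OF sets(3) refl]
 {
  case (cong f g)
  then have "(\<integral>\<^sup>+x. f x \<partial>X) = (\<integral>\<^sup>+x. g x \<partial>X)" if "space X = space A" for X
   using that by (intro nn_integral_cong) auto
  then show ?case using cong sp by simp
 next
  case (set E)
  then show ?case using eq sets by simp
 next
  case (mult u c)
  then show ?case by (simp add: nn_integral_cmult ms distrib_left[symmetric])
 next
  case (add u v)
  have *: "(\<integral>\<^sup>+x. v x + u x \<partial>X) = (\<integral>\<^sup>+x. v x \<partial>X) + (\<integral>\<^sup>+x. u x \<partial>X)" if "sets X = sets A" for X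
   using add(1-5) by (intro nn_integral_add) (simp_all add: measurable_cong_sets[OF that refl])
  have re: "(a + b) + (c + d) = (a + c) + (b + d)" for a b c d :: ennreal by (simp add: ac_simps)
  show ?case
   unfolding *[OF refl] *[OF sets(1)] *[OF sets(2)] *[OF sets(3)]
   by (subst (1 2) re) (simp add: add.IH)
 next
  case (seq U)
  have "incseq U" using seq by blast
  have inc: "incseq (%i. \<integral>\<^sup>+x. U i x \<partial>X)" for X
   using \<open>incseq U\<close> by (auto simp: incseq_def le_fun_def intro!: nn_integral_mono)
  have SU: "Sup (range U) = (%x. SUP i. U i x)" by (rule ext) (simp add: image_image)
  have "U i : borel_measurable A" for i using seq by blast
  then have S: "integral\<^sup>N X (Sup (range U)) = (SUP i. integral\<^sup>N X (U i))" if "sets X = sets A" for X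
   using nn_integral_monotone_convergence_SUP[OF \<open>incseq U\<close>, of X]
   unfolding SU by (simp add: measurable_cong_sets[OF that refl])
  have "(SUP i. integral\<^sup>N A (U i)) + (SUP i. integral\<^sup>N B (U i))
    = (SUP i. integral\<^sup>N C (U i)) + (SUP i. integral\<^sup>N D (U i))"
   unfolding ennreal_SUP_add[OF inc inc, symmetric] using seq.IH by simp
  then show ?case
   using S[OF refl] S[OF sets(1)] S[OF sets(2)] S[OF sets(3)] by metis
 }
qed

lemma integral_diff_unique:
 fixes \<phi> :: "'a => real"
 assumes fin: "finite_measure A" "finite_measure B" "finite_measure C" "finite_measure D"
  and sets: "sets B = sets A" "sets C = sets A" "sets D = sets A"
  and eq: "!!E. E : sets A ==> measure A E - measure B E = measure C E - measure D E"
  and \<phi>: "\<phi> : borel_measurable A" "!!x. x : space A ==> \<bar>\<phi> x\<bar> <= K"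
 shows "(\<integral>x. \<phi> x \<partial>A) - (\<integral>x. \<phi> x \<partial>B) = (\<integral>x. \<phi> x \<partial>C) - (\<integral>x. \<phi> x \<partial>D)"
proof -
 have sp: "space B = space A" "space C = space A" "space D = space A" using sets by (auto dest: sets_eq_imp_space_eq)
 have eq2: "emeasure A E + emeasure D E = emeasure C E + emeasure B E" if "E : sets A" for E
  using eq[OF that] fin
  by (simp add: finite_measure.emeasure_eq_measure ennreal_plus[symmetric] del: ennreal_plus)
 have intg: "integrable X f" if "finite_measure X" "sets X = sets A" "space X = space A"
  "f : borel_measurable A" "!!x. x : space A ==> \<bar>f x\<bar> <= C" for X C and f :: "'a => real"
  by (rule finite_measure.integrable_const_bound[OF that(1), of _ C])
    (use that in "auto simp: measurable_cong_sets[OF that(2) refl] intro!: AE_I2")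
 have pos: "(\<integral>x. f x \<partial>A) + (\<integral>x. f x \<partial>D) = (\<integral>x. f x \<partial>C) + (\<integral>x. f x \<partial>B)"
  if f: "f : borel_measurable A" "!!x. 0 <= f x" "!!x. x : space A ==> \<bar>f x\<bar> <= C'" for f :: "'a => real" and C'
 proof -
  have "ennreal (\<integral>x. f x \<partial>X) = (\<integral>\<^sup>+x. ennreal (f x) \<partial>X)" "0 <= (\<integral>x. f x \<partial>X)"
   if "finite_measure X" "sets X = sets A" "space X = space A" for X
   using f by (auto intro!: nn_integral_eq_integral[symmetric] intg[OF that] integral_nonneg_AE)
  moreover have "(\<integral>\<^sup>+x. ennreal (f x) \<partial>A) + (\<integral>\<^sup>+x. ennreal (f x) \<partial>D) = (\<integral>\<^sup>+x. ennreal (f x) \<partial>C) + (\<integral>\<^sup>+x. ennreal (f x) \<partial>B)"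
   using f(1) by (intro nn_integral_four_measures) (auto simp: sets eq2)
  ultimately have "ennreal (\<integral>x. f x \<partial>A) + ennreal (\<integral>x. f x \<partial>D) = ennreal (\<integral>x. f x \<partial>C) + ennreal (\<integral>x. f x \<partial>B)"
   and "0 <= (\<integral>x. f x \<partial>A)" "0 <= (\<integral>x. f x \<partial>B)" "0 <= (\<integral>x. f x \<partial>C)" "0 <= (\<integral>x. f x \<partial>D)"
   using fin sets sp by auto
  then show ?thesis by (simp add: ennreal_plus[symmetric] del: ennreal_plus)
 qed
 have b: "\<bar>max 0 (\<phi> x)\<bar> <= K" "\<bar>max 0 (- \<phi> x)\<bar> <= K" if "x : space A" for x
  using \<phi>(2)[OF that] by auto
 have m: "(%x. max 0 (\<phi> x)) : borel_measurable A" "(%x. max 0 (- \<phi> x)) : borel_measurable A"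
  using \<phi>(1) by measurable
 have split: "(\<integral>x. \<phi> x \<partial>X) = (\<integral>x. max 0 (\<phi> x) \<partial>X) - (\<integral>x. max 0 (- \<phi> x) \<partial>X)"
  if "finite_measure X" "sets X = sets A" "space X = space A" for X
  by (subst Bochner_Integration.integral_diff[symmetric])
    (auto intro!: intg[OF that m(1) b(1)] intg[OF that m(2) b(2)] Bochner_Integration.integral_cong)
 show ?thesis
  using pos[OF m(1) _ b(1)] pos[OF m(2) _ b(2)] split fin sets sp by simp
qed

text \<open>Integration against a signed measure that is the image of a measure with integrable density.\<close>

lemma signed_image_parts:
 fixes F :: "'b => real" and p :: "'b => 'a::topological_space"
 assumes p: "p : M \<rightarrow>\<^sub>M restrict_space borel \<U>" and F: "integrable M F"
 obtains A B where "finite_measure A" "finite_measure B" "sets A = borel_on \<U>" "sets B = borel_on \<U>"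
  "!!E. E : borel_on \<U> ==> (\<integral>x. indicator E (p x) * F x \<partial>M) = measure A E - measure B E"
  "!!\<phi> K. \<phi> : borel_measurable (restrict_space borel \<U>) ==> (!!x. x : \<U> ==> \<bar>\<phi> x\<bar> <= K) ==>
    (\<integral>x. \<phi> (p x) * F x \<partial>M) = (\<integral>x. \<phi> x \<partial>A) - (\<integral>x. \<phi> x \<partial>(B :: 'a measure))"
proof
 define G where "G s x = max 0 (s * F x)" for s x
 define A where "A s = distr (density M (%x. ennreal (G s x))) (restrict_space borel \<U>) p" for s
 note [measurable] = borel_measurable_integrable[OF F] p
 have G: "integrable M (G s)" for s
  unfolding G_def using F by (auto intro: integrable_max)
 have G0: "0 <= G s x" for s x by (simp add: G_def)
 note [measurable] = borel_measurable_integrable[OF G]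
 have p\<U>: "p x : \<U>" if "x : space M" for x
  using measurable_space[OF p that] by (simp add: space_restrict_space)
 have int\<phi>: "integrable M (%x. \<phi> (p x) * G s x)"
  if [measurable]: "\<phi> : borel_measurable (restrict_space borel \<U>)" and b: "!!x. x : \<U> ==> \<bar>\<phi> x\<bar> <= K" for \<phi> K s
  by (rule Bochner_Integration.integrable_bound[of _ "%x. K * G s x"])
    (use b G G0 p\<U> in "auto simp: abs_mult intro!: AE_I2 mult_mono intro: order_trans[OF _ abs_ge_self]")
 have intA: "(\<integral>x. \<phi> x \<partial>A s) = (\<integral>x. \<phi> (p x) * G s x \<partial>M)"
  if [measurable]: "\<phi> : borel_measurable (restrict_space borel \<U>)" for \<phi> s
  unfolding A_def using G0
  by (subst integral_distr) (auto simp: integral_density mult.commute)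
 show fin: "finite_measure (A 1)" "finite_measure (A (-1))"
 proof -
  have "finite_measure (A s)" for s
  proof
   have "\<U> : borel_on \<U>" using sets.top[of "restrict_space borel \<U>"] by (simp add: space_restrict_space)
   moreover have "p -` \<U> Int space M = space M" using p\<U> by auto
   ultimately have "emeasure (A s) (space (A s)) = emeasure (density M (%x. ennreal (G s x))) (space M)"
    unfolding A_def by (subst emeasure_distr) (auto simp: space_restrict_space)
   also have "... = (\<integral>\<^sup>+x. ennreal (G s x) \<partial>M)"
    by (subst emeasure_density) (auto intro!: nn_integral_cong)
   also have "... = ennreal (\<integral>x. G s x \<partial>M)" by (rule nn_integral_eq_integral[OF G]) (simp add: G0)
   finally show "emeasure (A s) (space (A s)) ~= \<infinity>" by simp
  qed
  then show "finite_measure (A 1)" "finite_measure (A (-1))" by auto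
 qed
 show "sets (A 1) = borel_on \<U>" "sets (A (-1)) = borel_on \<U>" by (auto simp: A_def)
 show main: "(\<integral>x. \<phi> (p x) * F x \<partial>M) = (\<integral>x. \<phi> x \<partial>A 1) - (\<integral>x. \<phi> x \<partial>A (-1))"
  if \<phi>: "\<phi> : borel_measurable (restrict_space borel \<U>)" "!!x. x : \<U> ==> \<bar>\<phi> x\<bar> <= K" for \<phi> K
 proof -
  have "(\<integral>x. \<phi> (p x) * F x \<partial>M) = (\<integral>x. \<phi> (p x) * G 1 x - \<phi> (p x) * G (-1) x \<partial>M)"
   by (intro Bochner_Integration.integral_cong) (auto simp: G_def max_def)
  also have "... = (\<integral>x. \<phi> (p x) * G 1 x \<partial>M) - (\<integral>x. \<phi> (p x) * G (-1) x \<partial>M)"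
   by (intro Bochner_Integration.integral_diff int\<phi>[OF \<phi>]) auto
  finally show ?thesis by (simp add: intA[OF \<phi>(1)])
 qed
 show "(\<integral>x. indicator E (p x) * F x \<partial>M) = measure (A 1) E - measure (A (-1)) E" if E: "E : borel_on \<U>" for E
 proof -
  have "indicator E : borel_measurable (restrict_space borel \<U>)" using E by (rule borel_measurable_indicator)
  then have "(\<integral>x. indicator E (p x) * F x \<partial>M) = (\<integral>x. indicator E x \<partial>A 1) - (\<integral>x. indicator E x \<partial>A (-1))"
   by (rule main[where K = 1]) (auto simp: indicator_def)
  moreover have "(\<integral>x. indicator E x \<partial>A s) = measure (A s) E" for s
   using E sets.sets_into_space[OF E] by (simp add: A_def space_restrict_space Int_absorb2)
  ultimately show ?thesis by simp
 qed
qed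

lemma signed_integral_image:
 fixes F :: "'b => real" and p :: "'b => 'a::topological_space"
 assumes p: "p : M \<rightarrow>\<^sub>M restrict_space borel \<U>" and F: "integrable M F" and \<U>: "\<U> : sets borel"
  and \<nu>: "!!E. E : borel_on \<U> ==> \<nu> E = (\<integral>x. indicator E (p x) * F x \<partial>M)"
 shows "vector_measure_on \<U> \<nu>"
  and "\<phi> : borel_measurable (restrict_space borel \<U>) ==> (!!x. x : \<U> ==> \<bar>\<phi> x\<bar> <= K) ==>
    signed_integral \<U> \<nu> \<phi> = (\<integral>x. \<phi> (p x) * F x \<partial>M)"
proof -
 obtain A B where AB: "finite_measure A" "finite_measure B" "sets A = borel_on \<U>" "sets B = borel_on \<U>"
  "!!E. E : borel_on \<U> ==> (\<integral>x. indicator E (p x) * F x \<partial>M) = measure A E - measure B E"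
  "!!\<phi> K. \<phi> : borel_measurable (restrict_space borel \<U>) ==> (!!x. x : \<U> ==> \<bar>\<phi> x\<bar> <= K) ==>
    (\<integral>x. \<phi> (p x) * F x \<partial>M) = (\<integral>x. \<phi> x \<partial>A) - (\<integral>x. \<phi> x \<partial>B)"
  using signed_image_parts[OF p F] by blast
 show vm: "vector_measure_on \<U> \<nu>"
  by (rule vector_measure_diff_measures[OF AB(1-4)]) (simp add: \<nu> AB(5))
 assume \<phi>: "\<phi> : borel_measurable (restrict_space borel \<U>)" "!!x. x : \<U> ==> \<bar>\<phi> x\<bar> <= K"
 have "signed_integral \<U> \<nu> \<phi> = (\<integral>x. \<phi> x \<partial>A) - (\<integral>x. \<phi> x \<partial>B)"
  unfolding signed_integral_def
 proof (rule integral_diff_unique)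
  show "finite_measure (positive_part \<U> \<nu>)" "finite_measure (positive_part \<U> (%E. - \<nu> E))"
   using finite_positive_part[OF vm \<U>] finite_positive_part[OF vector_measure_minus[OF vm] \<U>] by auto
  show "measure (positive_part \<U> \<nu>) E - measure (positive_part \<U> (%E. - \<nu> E)) E = measure A E - measure B E"
   if "E : sets (positive_part \<U> \<nu>)" for E
   using that Jordan_decomposition[OF vm \<U>] \<nu> AB(5) by simp
  show "\<phi> : borel_measurable (positive_part \<U> \<nu>)"
   using \<phi>(1) measurable_cong_sets[OF sets_positive_part refl] by blast
 qed (use AB \<phi> in auto)
 then show "signed_integral \<U> \<nu> \<phi> = (\<integral>x. \<phi> (p x) * F x \<partial>M)"
  using AB(6)[OF \<phi>] by simp
qed

section \<open>Radon-Nikodym theorem and Lebesgue decomposition for vector measures\<close>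

lemma Radon_Nikodym_finite:
 assumes fin: "finite_measure N" "finite_measure P" and sets: "sets P = sets N"
  and ac: "!!E. E : sets N ==> emeasure N E = 0 ==> emeasure P E = 0"
 obtains f :: "'a => real" where "integrable N f" "!!x. 0 <= f x" "density N (%x. ennreal (f x)) = P"
  "!!E. E : sets N ==> measure P E = (\<integral>x. indicator E x * f x \<partial>N)"
proof -
 interpret N: finite_measure N by fact
 interpret P: finite_measure P by fact
 have "absolutely_continuous N P"
  using ac by (auto simp: absolutely_continuous_def null_sets_def sets)
 from N.Radon_Nikodym[OF this sets] obtain p where p[measurable]: "p : borel_measurable N" and dp: "density N p = P"
  by auto
 have "(\<integral>\<^sup>+x. p x \<partial>N) = emeasure P (space P)"
  unfolding dp[symmetric] by (subst emeasure_density) (auto intro!: nn_integral_cong)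
 then have "(\<integral>\<^sup>+x. p x \<partial>N) ~= \<infinity>" by simp
 then have AE: "AE x in N. p x ~= \<infinity>" by (intro nn_integral_PInf_AE) auto
 define f where "f x = enn2real (p x)" for x
 have [measurable]: "f : borel_measurable N" unfolding f_def by measurable
 have AEf: "AE x in N. ennreal (f x) = p x" using AE by eventually_elim (simp add: f_def top.not_eq_extremum)
 have df: "density N (%x. ennreal (f x)) = P"
  unfolding dp[symmetric] by (rule density_cong) (use AEf in auto)
 have "integrable N f"
 proof (rule integrableI_nonneg)
  have "(\<integral>\<^sup>+x. ennreal (f x) \<partial>N) = (\<integral>\<^sup>+x. p x \<partial>N)" by (rule nn_integral_cong_AE[OF AEf])
  then show "(\<integral>\<^sup>+x. ennreal (f x) \<partial>N) < \<infinity>" using \<open>(\<integral>\<^sup>+x. p x \<partial>N) ~= \<infinity>\<close> by (simp add: top.not_eq_extremum)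
 qed (auto simp: f_def)
 moreover have "measure P E = (\<integral>x. indicator E x * f x \<partial>N)" if E: "E : sets N" for E
 proof -
  have "measure P E = (\<integral>x. indicator E x \<partial>P)" using E sets sets.sets_into_space[OF E]
   by (simp add: Int_absorb2 sets_eq_imp_space_eq[OF sets])
  also have "... = (\<integral>x. f x * indicator E x \<partial>N)"
   unfolding df[symmetric] using E by (subst integral_density) (auto simp: f_def)
  finally show ?thesis by (simp add: mult.commute)
 qed
 ultimately show ?thesis using that[of f] df by (auto simp: f_def)
qed

lemma signed_Radon_Nikodym:
 fixes \<nu> :: "'a::topological_space set => real"
 assumes vm: "vector_measure_on \<U> \<nu>" and \<U>: "\<U> : sets borel"
  and N: "finite_measure N" "sets N = borel_on \<U>"
  and ac: "!!E. E : borel_on \<U> ==> emeasure N E = 0 ==> \<nu> E = 0"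
 obtains f where "integrable N f" "!!E. E : borel_on \<U> ==> \<nu> E = (\<integral>x. indicator E x * f x \<partial>N)"
proof -
 have ac': "emeasure (positive_part \<U> \<nu>) E = 0"
  if E: "E : sets N" "emeasure N E = 0" and vm: "vector_measure_on \<U> \<nu>"
   and ac: "!!E. E : borel_on \<U> ==> emeasure N E = 0 ==> \<nu> E = 0" for E \<nu>
 proof -
  have "\<nu> B = 0" if "B : sets borel" "B \<subseteq> E" for B
  proof (rule ac)
   show "B : borel_on \<U>" using that E N \<U> by (auto simp: borel_on_iff)
   then show "emeasure N B = 0" using E that N by (metis emeasure_eq_0)
  qed
  then show ?thesis using E N by (subst emeasure_positive_part[OF vm \<U>]) (auto simp: SUP_constant image_constant_conv bot_ennreal)
 qed
 have vm': "vector_measure_on \<U> (%E. - \<nu> E)" using vm by (rule vector_measure_minus)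
 obtain f1 where f1: "integrable N f1" "!!E. E : sets N ==> measure (positive_part \<U> \<nu>) E = (\<integral>x. indicator E x * f1 x \<partial>N)"
  by (rule Radon_Nikodym_finite[OF N(1) finite_positive_part[OF vm \<U>]]) (use N ac' vm ac in auto)
 obtain f2 where f2: "integrable N f2" "!!E. E : sets N ==> measure (positive_part \<U> (%E. - \<nu> E)) E = (\<integral>x. indicator E x * f2 x \<partial>N)"
  by (rule Radon_Nikodym_finite[OF N(1) finite_positive_part[OF vm' \<U>]]) (use N ac'[OF _ _ vm'] ac in auto)
 show ?thesis
 proof (rule that[of "%x. f1 x - f2 x"])
  show "integrable N (%x. f1 x - f2 x)" using f1 f2 by auto
  fix E assume E: "E : borel_on \<U>"
  have i: "integrable N (%x. indicator E x * f x)" if "integrable N f" for f :: "'a => real"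
   using integrable_real_mult_indicator[of E N f] E N that by (simp add: mult.commute)
  show "\<nu> E = (\<integral>x. indicator E x * (f1 x - f2 x) \<partial>N)"
   using E N by (simp add: right_diff_distrib i f1 f2 Jordan_decomposition[OF vm \<U> E])
 qed
qed

definition plus_measure :: "'a measure => 'a measure => 'a measure" where
 "plus_measure A B = measure_of (space A) (sets A) (%E. emeasure A E + emeasure B E)"

lemma plus_measure:
 assumes "sets B = sets A"
 shows "sets (plus_measure A B) = sets A"
  and "E : sets A ==> emeasure (plus_measure A B) E = emeasure A E + emeasure B E"
proof -
 show "sets (plus_measure A B) = sets A" by (simp add: plus_measure_def)
 assume "E : sets A"
 then show "emeasure (plus_measure A B) E = emeasure A E + emeasure B E"
  unfolding plus_measure_def
 proof (intro emeasure_measure_of_sigma)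
  show "countably_additive (sets A) (%E. emeasure A E + emeasure B E)"
   unfolding countably_additive_def
  proof safe
   fix S :: "nat => 'a set" assume S: "range S \<subseteq> sets A" "disjoint_family S"
   then show "(\<Sum>i. emeasure A (S i) + emeasure B (S i)) = emeasure A (\<Union>i. S i) + emeasure B (\<Union>i. S i)"
    using assms by (subst suminf_add[symmetric]) (auto simp: suminf_emeasure)
  qed
 qed (auto simp: positive_def sets.sigma_algebra_axioms)
qed

lemma finite_plus_measure:
 assumes "finite_measure A" "finite_measure B" "sets B = sets A"
 shows "finite_measure (plus_measure A B)"
proof
 have "space (plus_measure A B) = space A" by (simp add: plus_measure_def space_measure_of_conv)
 moreover have "space B = space A" using assms(3) by (rule sets_eq_imp_space_eq)
 ultimately show "emeasure (plus_measure A B) (space (plus_measure A B)) ~= \<infinity>"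
  using assms finite_measure.emeasure_finite[OF assms(1)] finite_measure.emeasure_finite[OF assms(2)]
  by (simp add: plus_measure(2)[OF assms(3)])
qed

lemma borel_measurable_vec_nth [measurable (raw)]:
 fixes f :: "'a => real ^ 'n::finite"
 assumes "f : borel_measurable M"
 shows "(%x. f x $ i) : borel_measurable M"
 using assms by (rule borel_measurable_continuous_on[rotated])
  (intro linear_continuous_on bounded_linear_vec_nth)

text \<open>All the measures that occur have densities with respect to a single finite measure \<open>M\<close>: the
 sum of Lebesgue measure on \<open>\<U>\<close> and of the positive and negative parts of the components.\<close>

lemma vector_measure_density:
 fixes \<mu> :: "(real ^ 2) set => real ^ 2"
 assumes vm: "vector_measure_on \<U> \<mu>" and \<U>: "\<U> : sets borel" "emeasure lborel \<U> < \<infinity>"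
 obtains M d l where "finite_measure M" "sets M = borel_on \<U>" "integrable M d"
  "!!E i. E : borel_on \<U> ==> \<mu> E $ i = (\<integral>x. indicator E x * (d x :: real ^ 2) $ i \<partial>M)"
  "integrable M l" "!!x. 0 <= (l x :: real)" "density M (%x. ennreal (l x)) = restrict_space lborel \<U>"
proof -
 define L where "L = restrict_space lborel \<U>"
 have sL: "sets L = borel_on \<U>" unfolding L_def by (rule sets_restrict_space_cong) simp
 have fL: "finite_measure L"
  using \<U> by (intro finite_measureI) (simp add: L_def emeasure_restrict_space space_restrict_space)
 let ?P = "%i. positive_part \<U> (%E. \<mu> E $ i)" and ?N = "%i. positive_part \<U> (%E. - \<mu> E $ i)"
 have v: "vector_measure_on \<U> (%E. \<mu> E $ i)" "vector_measure_on \<U> (%E. - \<mu> E $ i)" for i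
  using vector_measure_component[OF vm] vector_measure_minus by auto
 define M where "M = plus_measure L (plus_measure (plus_measure (?P 1) (?N 1)) (plus_measure (?P 2) (?N 2)))"
 note f = finite_positive_part[OF v(1) \<U>(1)] finite_positive_part[OF v(2) \<U>(1)]
 have sM: "sets M = borel_on \<U>" by (simp add: M_def plus_measure sL)
 have fM: "finite_measure M"
  unfolding M_def by (intro finite_plus_measure fL f) (simp_all add: plus_measure sL)
 have eM: "emeasure M E = emeasure L E + (emeasure (?P 1) E + emeasure (?N 1) E + (emeasure (?P 2) E + emeasure (?N 2) E))"
  if "E : borel_on \<U>" for E
  unfolding M_def using that by (simp add: plus_measure sL)
 have z: "emeasure L E = 0 & emeasure (?P i) E = 0 & emeasure (?N i) E = 0"
  if "E : borel_on \<U>" "emeasure M E = 0" for E and i :: 2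
 proof -
  have "i = 1 \<or> i = 2" by (rule exhaust_2)
  then show ?thesis using eM[OF that(1)] that(2) by auto
 qed
 have "\<exists>f. integrable M f & (\<forall>E\<in>borel_on \<U>. \<mu> E $ i = (\<integral>x. indicator E x * f x \<partial>M))" for i
 proof -
  have "\<mu> E $ i = 0" if "E : borel_on \<U>" "emeasure M E = 0" for E
   using Jordan_decomposition[OF v(1) \<U>(1) that(1), of i] z[OF that, of i] by (simp add: measure_def)
  from signed_Radon_Nikodym[OF v(1) \<U>(1) fM sM this] show ?thesis by metis
 qed
 then obtain f where f: "!!i. integrable M (f i)" "!!i E. E : borel_on \<U> ==> \<mu> E $ i = (\<integral>x. indicator E x * f i x \<partial>M)"
  by metis
 define d where "d x = f 1 x *\<^sub>R axis 1 1 + f 2 x *\<^sub>R (axis 2 1 :: real ^ 2)" for x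
 have d: "d x $ i = f i x" for x i
  using exhaust_2[of i] by (auto simp: d_def axis_def)
 have "integrable M d" unfolding d_def using f(1) by auto
 obtain l where l: "integrable M l" "!!x. 0 <= l x" "density M (%x. ennreal (l x)) = L"
  by (rule Radon_Nikodym_finite[OF fM fL]) (use sM sL z in auto)
 show ?thesis
  by (rule that[OF fM sM \<open>integrable M d\<close> _ l[unfolded L_def]]) (simp add: d f(2))
qed

lemma integral_restrict_density:
 fixes f :: "real ^ 2 => real"
 assumes \<U>: "\<U> : sets borel" and M: "sets M = borel_on \<U>" and l: "l : borel_measurable M" "!!x. 0 <= l x"
  and dens: "density M (%x. ennreal (l x)) = restrict_space lborel \<U>"
  and f: "f : borel_measurable (restrict_space borel \<U>)"
 shows "(\<integral>x. f x * l x \<partial>M) = (LINT x:\<U>|lborel. f x)"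
  and "integrable M (%x. f x * l x) \<longleftrightarrow> set_integrable lborel \<U> f"
proof -
 have fM: "f : borel_measurable M" using f measurable_cong_sets[OF M refl] by blast
 have "(\<integral>x. f x * l x \<partial>M) = (\<integral>x. f x \<partial>density M (%x. ennreal (l x)))"
  using l fM by (subst integral_density) (auto simp: mult.commute)
 also have "... = (LINT x:\<U>|lborel. f x)"
  unfolding dens using \<U> by (subst integral_restrict_space) (auto simp: set_lebesgue_integral_def)
 finally show "(\<integral>x. f x * l x \<partial>M) = (LINT x:\<U>|lborel. f x)" .
 have "integrable M (%x. f x * l x) \<longleftrightarrow> integrable (density M (%x. ennreal (l x))) f"
  using l fM by (subst integrable_density) (auto simp: mult.commute)
 also have "... \<longleftrightarrow> set_integrable lborel \<U> f"
  unfolding dens using \<U> by (subst integrable_restrict_space) (auto simp: set_integrable_def)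
 finally show "integrable M (%x. f x * l x) \<longleftrightarrow> set_integrable lborel \<U> f" .
qed

lemma AE_lebesgue_iff: "(AE x in lebesgue. P x) \<longleftrightarrow> (AE x in lborel. P x)"
 by (rule AE_completion_iff)

lemma set_integral_lebesgue_lborel:
 fixes f :: "'a::euclidean_space => 'b::{banach, second_countable_topology}"
 assumes "E : sets borel" "(%x. indicator E x *\<^sub>R f x) : borel_measurable lborel"
 shows "(LINT x:E|lebesgue. f x) = (LINT x:E|lborel. f x)"
  and "set_integrable lebesgue E f \<longleftrightarrow> set_integrable lborel E f"
 using assms by (auto simp: set_lebesgue_integral_def set_integrable_def integral_completion integrable_completion)

text \<open>The part of \<open>\<mu>\<close> on the set where the density \<open>l\<close> of Lebesgue measure is positive is absolutely
 continuous with density \<open>d / l\<close>; the remaining set is Lebesgue null and carries the singular part.\<close>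

lemma lebesgue_decomposition_exists:
 fixes \<mu> :: "(real ^ 2) set => real ^ 2"
 assumes vm: "vector_measure_on \<U> \<mu>" and \<U>: "\<U> : sets borel" "emeasure lborel \<U> < \<infinity>"
 obtains M k f \<sigma> where "lebesgue_decomposition \<U> \<mu> f \<sigma>"
  "finite_measure M" "sets M = borel_on \<U>" "integrable M k"
  "!!E i. E : borel_on \<U> ==> \<sigma> E $ i = (\<integral>x. indicator E x * (k x :: real ^ 2) $ i \<partial>M)"
  "!!\<phi> K i. \<phi> : borel_measurable borel ==> (!!x. x : \<U> ==> \<bar>\<phi> x\<bar> <= K) ==>
    signed_integral \<U> (%E. \<mu> E $ i) \<phi> = (LINT x:\<U>|lebesgue. \<phi> x * f x $ i) + (\<integral>x. \<phi> x * k x $ i \<partial>M)"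
proof -
 obtain M d l where M: "finite_measure M" "sets M = borel_on \<U>" and d: "integrable M d"
  and \<mu>: "!!E i. E : borel_on \<U> ==> \<mu> E $ i = (\<integral>x. indicator E x * (d x :: real ^ 2) $ i \<partial>M)"
  and l: "integrable M l" "!!x. 0 <= (l x :: real)" "density M (%x. ennreal (l x)) = restrict_space lborel \<U>"
  by (rule vector_measure_density[OF vm \<U>], rule that)
 interpret M: finite_measure M by fact
 have spM: "space M = \<U>" using sets_eq_imp_space_eq[OF M(2)] by (simp add: space_restrict_space)
 note [measurable] = borel_measurable_integrable[OF d] borel_measurable_integrable[OF l(1)] \<U>(1)
 have di: "integrable M (%x. d x $ i)" for i
  using d by (rule integrable_bounded_linear[OF bounded_linear_vec_nth])
 note [measurable] = borel_measurable_integrable[OF di]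
 define Z where "Z = {x : \<U>. l x = 0}"
 have Z: "Z : sets M" unfolding Z_def spM[symmetric] by measurable
 have Zb: "Z : sets borel" "Z \<subseteq> \<U>" using Z M(2) \<U> by (auto simp: borel_on_iff)
 define f where "f x = (if x : \<U> then (if l x = 0 then 0 else d x /\<^sub>R l x) else 0)" for x
 define k where "k x = (if l x = 0 then d x else 0)" for x
 have fM[measurable]: "f : borel_measurable M"
 proof -
  have "(%x. if l x = 0 then 0 else d x /\<^sub>R l x) : borel_measurable M" by measurable
  then show ?thesis by (rule measurable_cong[THEN iffD1, rotated]) (simp add: f_def spM)
 qed
 have fr: "f : borel_measurable (restrict_space borel \<U>)" using fM measurable_cong_sets[OF M(2) refl] by blast
 have fb[measurable]: "f : borel_measurable borel"
 proof -
  have "(%x. indicator \<U> x *\<^sub>R f x) : borel_measurable borel"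
   using fr \<U> by (subst borel_measurable_restrict_space_iff[symmetric]) auto
  also have "(%x. indicator \<U> x *\<^sub>R f x) = f" by (auto simp: f_def indicator_def)
  finally show ?thesis .
 qed
 have k: "integrable M k"
 proof (rule Bochner_Integration.integrable_bound[OF d])
  show "k : borel_measurable M" unfolding k_def[abs_def] by measurable
 qed (auto simp: k_def)
 have split: "d x $ i = f x $ i * l x + k x $ i" if "x : \<U>" for x i
  using that by (auto simp: f_def k_def)
 have fl: "integrable M (%x. f x $ i * l x)" for i
 proof (rule Bochner_Integration.integrable_bound[OF di[of i]])
  show "AE x in M. norm (f x $ i * l x) <= norm (d x $ i)"
  proof (rule AE_I2)
   fix x
   have "f x $ i * l x = (if x : \<U> & l x ~= 0 then d x $ i else 0)" by (auto simp: f_def)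
   then show "norm (f x $ i * l x) <= norm (d x $ i)" by simp
  qed
 qed measurable
 have ki: "integrable M (%x. k x $ i)" for i
  using k by (rule integrable_bounded_linear[OF bounded_linear_vec_nth])
 have bdd: "integrable M (%x. \<phi> x * h x)" if "integrable M h" "\<phi> : borel_measurable borel" "!!x. x : \<U> ==> \<bar>\<phi> x\<bar> <= K"
  for \<phi> h :: "real ^ 2 => real" and K
 proof (rule Bochner_Integration.integrable_bound[of _ "%x. K * h x"])
  have "\<phi> : borel_measurable M"
   using that(2) measurable_restrict_space1 measurable_cong_sets[OF M(2) refl] by blast
  then show "(%x. \<phi> x * h x) : borel_measurable M" using borel_measurable_integrable[OF that(1)] by measurable
  show "AE x in M. norm (\<phi> x * h x) <= norm (K * h x)"
   using that(3) by (auto simp: abs_mult spM intro!: AE_I2 mult_right_mono intro: order_trans[OF _ abs_ge_self])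
 qed (use that in auto)
 have leb: "(\<integral>x. \<phi> x * (f x $ i * l x) \<partial>M) = (LINT x:\<U>|lebesgue. \<phi> x * f x $ i)"
  if [measurable]: "\<phi> : borel_measurable borel" for \<phi> i
 proof -
  have "(%x. \<phi> x * f x $ i) : borel_measurable borel" by measurable
  then have "(\<integral>x. \<phi> x * f x $ i * l x \<partial>M) = (LINT x:\<U>|lborel. \<phi> x * f x $ i)"
   by (intro integral_restrict_density(1)[OF \<U>(1) M(2) _ l(2,3)])
    (auto intro: borel_measurable_integrable l measurable_restrict_space1)
  also have "... = (LINT x:\<U>|lebesgue. \<phi> x * f x $ i)"
   by (rule set_integral_lebesgue_lborel(1)[symmetric]) auto
  finally show ?thesis by (simp add: mult.assoc)
 qed
 have vec_int: "set_integrable lebesgue \<U> f"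
 proof -
  have "set_integrable lborel \<U> (%x. f x $ i)" for i
   using integral_restrict_density(2)[OF \<U>(1) M(2) borel_measurable_integrable[OF l(1)] l(2,3), of "%x. f x $ i"] fl[of i]
   by (simp add: measurable_restrict_space1)
  then have "integrable lborel (%x. (indicator \<U> x * f x $ 1) *\<^sub>R axis 1 1 + (indicator \<U> x * f x $ 2) *\<^sub>R (axis 2 1 :: real^2))"
   by (auto simp: set_integrable_def)
  also have "(%x. (indicator \<U> x * f x $ 1) *\<^sub>R axis 1 1 + (indicator \<U> x * f x $ 2) *\<^sub>R (axis 2 1 :: real^2)) = (%x. indicator \<U> x *\<^sub>R f x)"
   by (auto simp: fun_eq_iff vec_eq_iff forall_2 axis_def)
  finally have "set_integrable lborel \<U> f" by (simp add: set_integrable_def)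
  then show ?thesis by (subst set_integral_lebesgue_lborel(2)) auto
 qed
 define \<sigma> where "\<sigma> E = (\<chi> i. \<integral>x. indicator E x * k x $ i \<partial>M)" for E
 have vm\<sigma>: "vector_measure_on \<U> \<sigma>"
 proof -
  have "vector_measure_on \<U> (%E. \<sigma> E $ i)" for i
   by (rule signed_integral_image(1)[where p = "%x. x", OF _ ki \<U>(1)])
    (auto simp: \<sigma>_def measurable_cong_sets[OF M(2) refl])
  then show ?thesis
   unfolding vector_measure_on_def sums_def by (auto intro!: vec_tendstoI)
 qed
 have int_comp: "(LINT x:E|lebesgue. f x) $ i = (\<integral>x. indicator E x * (f x $ i * l x) \<partial>M)" if "E : borel_on \<U>" for E i
 proof -
  have E[measurable]: "E : sets borel" "E \<subseteq> \<U>" using that \<U> by (auto simp: borel_on_iff)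
  have "integrable lebesgue (%x. indicator E x *\<^sub>R f x)"
   using set_integrable_subset[OF vec_int, of E] E by (simp add: set_integrable_def)
  then have "(LINT x:E|lebesgue. f x) $ i = (\<integral>x. (indicator E x *\<^sub>R f x) $ i \<partial>lebesgue)"
   unfolding set_lebesgue_integral_def by (subst integral_bounded_linear[OF bounded_linear_vec_nth]) auto
  also have "... = (LINT x:\<U>|lebesgue. indicator E x * f x $ i)"
   unfolding set_lebesgue_integral_def using E
   by (intro Bochner_Integration.integral_cong) (auto simp: indicator_def)
  finally show ?thesis by (subst leb) auto
 qed
 have dec: "lebesgue_decomposition \<U> \<mu> f \<sigma>"
  unfolding lebesgue_decomposition_def
 proof (intro conjI vec_int vm\<sigma> bexI[of _ Z] ballI)
  have "emeasure lborel Z = emeasure (restrict_space lborel \<U>) Z"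
   using Zb \<U> by (simp add: emeasure_restrict_space)
  also have "... = (\<integral>\<^sup>+x. ennreal (l x) * indicator Z x \<partial>M)"
   unfolding l(3)[symmetric] using Z by (subst emeasure_density) auto
  also have "... = (\<integral>\<^sup>+x. 0 \<partial>M)" by (intro nn_integral_cong) (auto simp: Z_def indicator_def)
  finally show "emeasure lborel Z = 0" by simp
  show "Z : borel_on \<U>" using Z M by simp
  fix E assume E: "E : borel_on \<U>"
  show "\<sigma> E = \<sigma> (E Int Z)"
   unfolding \<sigma>_def vec_eq_iff
   by (auto intro!: Bochner_Integration.integral_cong simp: k_def Z_def indicator_def spM)
  have iE: "indicator E : borel_measurable borel" using E \<U> by (auto simp: borel_on_iff)
  show "\<mu> E = (LINT x:E|lebesgue. f x) + \<sigma> E"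
   unfolding vec_eq_iff
  proof
   fix i
   have "\<mu> E $ i = (\<integral>x. indicator E x * (f x $ i * l x) + indicator E x * k x $ i \<partial>M)"
    unfolding \<mu>[OF E] by (intro Bochner_Integration.integral_cong) (auto simp: split spM algebra_simps)
   also have "... = (\<integral>x. indicator E x * (f x $ i * l x) \<partial>M) + (\<integral>x. indicator E x * k x $ i \<partial>M)"
    by (intro Bochner_Integration.integral_add bdd[where K = 1] fl ki iE) (auto simp: indicator_def)
   finally show "\<mu> E $ i = ((LINT x:E|lebesgue. f x) + \<sigma> E) $ i"
    by (simp add: int_comp[OF E] \<sigma>_def)
  qed
 qed
 show ?thesis
 proof (rule that[OF dec M k])
  show "\<sigma> E $ i = (\<integral>x. indicator E x * k x $ i \<partial>M)" for E i by (simp add: \<sigma>_def)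
  fix \<phi> :: "real ^ 2 => real" and K i
  assume \<phi>: "\<phi> : borel_measurable borel" "!!x. x : \<U> ==> \<bar>\<phi> x\<bar> <= K"
  have "signed_integral \<U> (%E. \<mu> E $ i) \<phi> = (\<integral>x. \<phi> x * d x $ i \<partial>M)"
   by (rule signed_integral_image(2)[where p = "%x. x", OF _ di \<U>(1)])
    (use \<phi> in "auto simp: \<mu> measurable_cong_sets[OF M(2) refl] measurable_restrict_space1")
  also have "... = (\<integral>x. \<phi> x * (f x $ i * l x) + \<phi> x * k x $ i \<partial>M)"
   by (intro Bochner_Integration.integral_cong) (auto simp: split spM algebra_simps)
  also have "... = (\<integral>x. \<phi> x * (f x $ i * l x) \<partial>M) + (\<integral>x. \<phi> x * k x $ i \<partial>M)"
   by (rule Bochner_Integration.integral_add[OF bdd[OF fl \<phi>] bdd[OF ki \<phi>]])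
  finally show "signed_integral \<U> (%E. \<mu> E $ i) \<phi> = (LINT x:\<U>|lebesgue. \<phi> x * f x $ i) + (\<integral>x. \<phi> x * k x $ i \<partial>M)"
   by (simp add: leb[OF \<phi>(1)])
 qed
qed

text \<open>Off the union of the two null sets only the absolutely continuous parts are seen, and on it only
 the singular parts.\<close>

lemma lebesgue_decomposition_unique:
 fixes f f' :: "real ^ 2 => real ^ 2"
 assumes D: "lebesgue_decomposition \<U> \<mu> f \<sigma>" "lebesgue_decomposition \<U> \<mu>' f' \<sigma>'" and \<U>: "\<U> : sets borel"
  and eq: "!!E. E : borel_on \<U> ==> \<mu> E = \<mu>' E"
 shows "AE x in lebesgue. x : \<U> --> f x = f' x" and "E : borel_on \<U> ==> \<sigma> E = \<sigma>' E"
proof -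
 obtain Z where "Z : borel_on \<U>" "emeasure lborel Z = 0" "!!E. E : borel_on \<U> ==> \<sigma> E = \<sigma> (E Int Z)"
  using D(1) unfolding lebesgue_decomposition_def by blast
 moreover obtain Z' where "Z' : borel_on \<U>" "emeasure lborel Z' = 0" "!!E. E : borel_on \<U> ==> \<sigma>' E = \<sigma>' (E Int Z')"
  using D(2) unfolding lebesgue_decomposition_def by blast
 ultimately have Z: "Z : borel_on \<U>" "emeasure lborel Z = 0" "!!E. E : borel_on \<U> ==> \<sigma> E = \<sigma> (E Int Z)"
  "Z' : borel_on \<U>" "emeasure lborel Z' = 0" "!!E. E : borel_on \<U> ==> \<sigma>' E = \<sigma>' (E Int Z')"
  by blast+
 have f: "set_integrable lebesgue \<U> f" "set_integrable lebesgue \<U> f'"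
  using D unfolding lebesgue_decomposition_def by blast+
 have \<sigma>0: "\<sigma> {} = 0" "\<sigma>' {} = 0"
  using D vector_measure_empty unfolding lebesgue_decomposition_def by blast+
 have val: "\<mu> E = (LINT x:E|lebesgue. f x) + \<sigma> E" "\<mu>' E = (LINT x:E|lebesgue. f' x) + \<sigma>' E" if "E : borel_on \<U>" for E
  using D that unfolding lebesgue_decomposition_def by blast+
 have null: "AE x in lborel. x \<notin> Z \<union> Z'"
  using Z \<U> by (intro AE_not_in null_sets.Un) (auto simp: null_sets_def borel_on_iff)
 have AEi: "AE x in lebesgue. indicator \<U> x * f x $ i = indicator \<U> x * f' x $ i" for i
 proof (rule density_unique_real)
  have fi: "integrable lebesgue (%x. indicator \<U> x * f x $ i)" "integrable lebesgue (%x. indicator \<U> x * f' x $ i)"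
   using integrable_bounded_linear[OF bounded_linear_vec_nth f(1)[unfolded set_integrable_def], of i]
    integrable_bounded_linear[OF bounded_linear_vec_nth f(2)[unfolded set_integrable_def], of i] by auto
  then show "integrable lebesgue (%x. indicator \<U> x * f x $ i)" "integrable lebesgue (%x. indicator \<U> x * f' x $ i)"
   by auto
  fix A :: "(real^2) set" assume A: "A : sets lebesgue"
  then obtain S N N' where S: "A = S \<union> N" "N \<subseteq> N'" "N' : null_sets lborel" "S : sets lborel"
   by (elim sets_completionE)
  define E where "E = S Int \<U> - (Z \<union> Z')"
  have E: "E : borel_on \<U>" using S Z \<U> by (auto simp: borel_on_iff E_def)
  have AE: "AE x in lebesgue. x \<notin> N' & x \<notin> Z \<union> Z'"
   unfolding AE_lebesgue_iff using null AE_not_in[OF S(3)] by eventually_elim auto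
  have red: "(LINT x:A|lebesgue. indicator \<U> x * h x $ i) = (LINT x:E|lebesgue. h x) $ i"
   if h: "set_integrable lebesgue \<U> h" for h :: "real ^ 2 => real ^ 2"
  proof -
   have hi: "integrable lebesgue (%x. indicator \<U> x * h x $ i)"
    using integrable_bounded_linear[OF bounded_linear_vec_nth h[unfolded set_integrable_def], of i] by auto
   have E': "E : sets lebesgue" "E \<subseteq> \<U>" using E \<U> by (auto simp: borel_on_iff)
   have hE: "integrable lebesgue (%x. indicator E x *\<^sub>R h x)"
    using set_integrable_subset[OF h E'] by (simp add: set_integrable_def)
   have "(LINT x:A|lebesgue. indicator \<U> x * h x $ i) = (\<integral>x. (indicator E x *\<^sub>R h x) $ i \<partial>lebesgue)"
    unfolding set_lebesgue_integral_def
   proof (rule integral_cong_AE)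
    show "(%x. indicator A x *\<^sub>R (indicator \<U> x * h x $ i)) : borel_measurable lebesgue"
    using A borel_measurable_integrable[OF hi] by measurable
    show "(%x. (indicator E x *\<^sub>R h x) $ i) : borel_measurable lebesgue"
    using borel_measurable_integrable[OF hE] by measurable
    show "AE x in lebesgue. indicator A x *\<^sub>R (indicator \<U> x * h x $ i) = (indicator E x *\<^sub>R h x) $ i"
    using AE by eventually_elim (use S(1,2) in "auto simp: E_def indicator_def")
   qed
   also have "... = (LINT x:E|lebesgue. h x) $ i"
    unfolding set_lebesgue_integral_def by (rule integral_bounded_linear[OF bounded_linear_vec_nth hE])
   finally show ?thesis .
  qed
  have "E Int Z = {}" "E Int Z' = {}" by (auto simp: E_def)
  then have "\<mu> E = (LINT x:E|lebesgue. f x)" "\<mu>' E = (LINT x:E|lebesgue. f' x)"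
   using val[OF E] Z(3)[OF E] Z(6)[OF E] \<sigma>0 by simp_all
  then show "(LINT x:A|lebesgue. indicator \<U> x * f x $ i) = (LINT x:A|lebesgue. indicator \<U> x * f' x $ i)"
   using red[OF f(1)] red[OF f(2)] eq[OF E] by simp
 qed
 have "AE x in lebesgue. \<forall>i\<in>(UNIV :: 2 set). indicator \<U> x * f x $ i = indicator \<U> x * f' x $ i"
  by (rule AE_finite_allI) (use AEi in auto)
 then show AE: "AE x in lebesgue. x : \<U> --> f x = f' x"
  by eventually_elim (auto simp: vec_eq_iff)
 assume E: "E : borel_on \<U>"
 have E': "E : sets lebesgue" "E \<subseteq> \<U>" using E \<U> by (auto simp: borel_on_iff)
 have "(LINT x:E|lebesgue. f x) = (LINT x:E|lebesgue. f' x)"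
  unfolding set_lebesgue_integral_def
 proof (rule integral_cong_AE)
  show "(%x. indicator E x *\<^sub>R f x) : borel_measurable lebesgue" "(%x. indicator E x *\<^sub>R f' x) : borel_measurable lebesgue"
   using set_integrable_subset[OF f(1) E'] set_integrable_subset[OF f(2) E'] by (auto simp: set_integrable_def)
  show "AE x in lebesgue. indicator E x *\<^sub>R f x = indicator E x *\<^sub>R f' x"
   using AE by eventually_elim (use E' in "auto simp: indicator_def")
 qed
 then show "\<sigma> E = \<sigma>' E"
  using val[OF E] eq[OF E] by simp
qed

section \<open>Total variation\<close>

text \<open>On a set where the density oscillates little, the norm of the vector measure is nearly the
 integral of the norm of the density; countably many level sets of a fine grid exhaust \<open>\<U>\<close>.\<close>

lemma total_variation_ge:
 fixes \<sigma> :: "(real ^ 2) set => real ^ 2"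
 assumes \<U>: "\<U> : sets borel" and M: "finite_measure M" "sets M = borel_on \<U>" and k: "integrable M k"
  and \<sigma>: "!!E i. E : borel_on \<U> ==> \<sigma> E $ i = (\<integral>x. indicator E x * (k x :: real ^ 2) $ i \<partial>M)"
 shows "ennreal (\<integral>x. norm (k x) \<partial>M) <= total_variation \<sigma> \<U>"
proof (rule ennreal_le_epsilon)
 fix e :: real assume "0 < e"
 interpret M: finite_measure M by fact
 have spM: "space M = \<U>" using sets_eq_imp_space_eq[OF M(2)] by (simp add: space_restrict_space)
 define \<epsilon> where "\<epsilon> = e / (4 * (measure M \<U> + 1))"
 have pos: "0 < measure M \<U> + 1" by (simp add: add_nonneg_pos)
 have \<epsilon>: "0 < \<epsilon>" "4 * \<epsilon> * measure M \<U> <= e"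
  using \<open>0 < e\<close> pos by (auto simp: \<epsilon>_def field_simps)
 note [measurable] = borel_measurable_integrable[OF k]
 define c where "c x = (\<lfloor>k x $ 1 / \<epsilon>\<rfloor>, \<lfloor>k x $ 2 / \<epsilon>\<rfloor>)" for x
 define A where "A n = {x : space M. c x = from_nat n & to_nat (from_nat n :: int \<times> int) = n}" for n
 have A: "A n : sets M" for n
 proof -
  define i where "i = fst (from_nat n :: int \<times> int)"
  define j where "j = snd (from_nat n :: int \<times> int)"
  have "A n = (if to_nat (from_nat n :: int \<times> int) = n
    then {x : space M. \<lfloor>k x $ 1 / \<epsilon>\<rfloor> = i & \<lfloor>k x $ 2 / \<epsilon>\<rfloor> = j} else {})"
   by (auto simp: A_def c_def prod_eq_iff i_def j_def)
  moreover have "{x : space M. \<lfloor>k x $ 1 / \<epsilon>\<rfloor> = i & \<lfloor>k x $ 2 / \<epsilon>\<rfloor> = j} : sets M"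
  proof -
   have q: "(%x. \<lfloor>k x $ q / \<epsilon>\<rfloor>) -` {v} Int space M : sets M" for q v
   proof -
    have "(%x. \<lfloor>k x $ q / \<epsilon>\<rfloor>) \<in> M \<rightarrow>\<^sub>M count_space UNIV" by measurable
    then show ?thesis by (rule measurable_sets) simp
   qed
   from sets.Int[OF q[of 1 i] q[of 2 j]]
   show ?thesis by (rule back_subst[where P = "%S. S : sets M"]) auto
  qed
  ultimately show ?thesis by simp
 qed
 have disj: "disjoint_family A"
  by (auto simp: disjoint_family_on_def A_def)
 have UN: "(\<Union>n. A n) = \<U>"
  by (auto simp: A_def spM) (metis from_nat_to_nat)
 have est: "(\<integral>x. indicator (A n) x * norm (k x) \<partial>M) <= norm (\<sigma> (A n)) + 4 * \<epsilon> * measure M (A n)" for n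
 proof (cases "A n = {}")
  case False
  then obtain x0 where x0: "x0 : A n" by blast
  have close: "norm (k x - k x0) <= 2 * \<epsilon>" if "x : A n" for x
  proof -
   have "c x = c x0" using that x0 by (simp add: A_def)
   then have fl: "\<lfloor>k x $ 1 / \<epsilon>\<rfloor> = \<lfloor>k x0 $ 1 / \<epsilon>\<rfloor>" "\<lfloor>k x $ 2 / \<epsilon>\<rfloor> = \<lfloor>k x0 $ 2 / \<epsilon>\<rfloor>" by (auto simp: c_def)
   have "\<bar>s - t\<bar> <= \<epsilon>" if "\<lfloor>s / \<epsilon>\<rfloor> = \<lfloor>t / \<epsilon>\<rfloor>" for s t
   proof -
    have "\<bar>s / \<epsilon> - t / \<epsilon>\<bar> <= 1" using that by linarith
    then show ?thesis using \<epsilon>(1) by (simp add: diff_divide_distrib[symmetric] divide_le_eq)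
   qed
   from this[OF fl(1)] this[OF fl(2)] have "\<bar>(k x - k x0) $ 1\<bar> + \<bar>(k x - k x0) $ 2\<bar> <= 2 * \<epsilon>" by simp
   then show ?thesis using norm_le_l1_cart[of "k x - k x0"] by (simp add: sum_2)
  qed
  have intA: "integrable M (%x. indicator (A n) x *\<^sub>R h x)" if "integrable M h" for h :: "_ => real ^ 2"
   using integrable_mult_indicator[OF A that] by simp
  have \<sigma>A: "\<sigma> (A n) = (\<integral>x. indicator (A n) x *\<^sub>R k x \<partial>M)"
   unfolding vec_eq_iff
  proof
   fix i
   show "\<sigma> (A n) $ i = (\<integral>x. indicator (A n) x *\<^sub>R k x \<partial>M) $ i"
    using A M(2) by (subst integral_bounded_linear[OF bounded_linear_vec_nth intA[OF k], symmetric]) (simp add: \<sigma>)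
  qed
  have cst: "(\<integral>x. indicator (A n) x *\<^sub>R k x0 \<partial>M) = measure M (A n) *\<^sub>R k x0" "integrable M (%x. indicator (A n) x *\<^sub>R k x0)"
   using A by (auto simp: less_top[symmetric] Int_absorb2 sets.sets_into_space)
  have ind: "(\<integral>x. indicator (A n) x * r \<partial>M) = measure M (A n) * r" "integrable M (%x. indicator (A n) x * r)" for r :: real
   using A by (auto simp: less_top[symmetric] Int_absorb2 sets.sets_into_space)
  have "norm (measure M (A n) *\<^sub>R k x0 - \<sigma> (A n)) = norm (\<integral>x. indicator (A n) x *\<^sub>R k x0 - indicator (A n) x *\<^sub>R k x \<partial>M)"
   unfolding \<sigma>A using cst intA[OF k] by (subst Bochner_Integration.integral_diff) auto
  also have "... <= (\<integral>x. norm (indicator (A n) x *\<^sub>R k x0 - indicator (A n) x *\<^sub>R k x) \<partial>M)"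
   by (rule integral_norm_bound)
  also have "... <= (\<integral>x. indicator (A n) x * (2 * \<epsilon>) \<partial>M)"
  proof (rule integral_mono)
   show "integrable M (%x. norm (indicator (A n) x *\<^sub>R k x0 - indicator (A n) x *\<^sub>R k x))"
    using cst(2) intA[OF k] by auto
   show "norm (indicator (A n) x *\<^sub>R k x0 - indicator (A n) x *\<^sub>R k x) <= indicator (A n) x * (2 * \<epsilon>)" for x
    using close[of x] by (auto simp: indicator_def norm_minus_commute)
  qed (rule ind)
  finally have 1: "norm (measure M (A n) *\<^sub>R k x0 - \<sigma> (A n)) <= 2 * \<epsilon> * measure M (A n)"
   unfolding ind(1) by (simp only: mult.commute)
  have "(\<integral>x. indicator (A n) x * norm (k x) \<partial>M) <= (\<integral>x. indicator (A n) x * (norm (k x0) + 2 * \<epsilon>) \<partial>M)"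
  proof (rule integral_mono)
   show "integrable M (%x. indicator (A n) x * norm (k x))"
    using integrable_norm[OF intA[OF k]] by simp
   show "indicator (A n) x * norm (k x) <= indicator (A n) x * (norm (k x0) + 2 * \<epsilon>)" for x
    using close[of x] norm_triangle_sub[of "k x" "k x0"] by (auto simp: indicator_def)
  qed (rule ind)
  also have "... = norm (measure M (A n) *\<^sub>R k x0) + 2 * \<epsilon> * measure M (A n)"
   unfolding ind(1) by (simp add: algebra_simps)
  also have "... <= norm (\<sigma> (A n)) + 4 * \<epsilon> * measure M (A n)"
   using 1 norm_triangle_sub[of "measure M (A n) *\<^sub>R k x0" "\<sigma> (A n)"] by linarith
  finally show ?thesis .
 qed simp
 have "ennreal (\<integral>x. norm (k x) \<partial>M) = (\<integral>\<^sup>+x. ennreal (norm (k x)) \<partial>M)"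
  by (rule nn_integral_eq_integral[symmetric]) (use k in auto)
 also have "... = emeasure (density M (%x. ennreal (norm (k x)))) \<U>"
  unfolding spM[symmetric] by (subst emeasure_density) (auto intro!: nn_integral_cong)
 also have "... = (\<Sum>n. emeasure (density M (%x. ennreal (norm (k x)))) (A n))"
  unfolding UN[symmetric] by (rule suminf_emeasure[symmetric]) (use A disj in auto)
 also have "... <= (\<Sum>n. ennreal (norm (\<sigma> (A n))) + ennreal (4 * \<epsilon>) * emeasure M (A n))"
 proof (rule suminf_le)
  fix n
  have i: "integrable M (%x. indicator (A n) x * norm (k x))"
   using integrable_mult_indicator[OF A integrable_norm[OF k]] by simp
  have "emeasure (density M (%x. ennreal (norm (k x)))) (A n) = (\<integral>\<^sup>+x. ennreal (indicator (A n) x * norm (k x)) \<partial>M)"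
   using A by (subst emeasure_density) (auto intro!: nn_integral_cong simp: indicator_def)
  also have "... = ennreal (\<integral>x. indicator (A n) x * norm (k x) \<partial>M)"
   by (rule nn_integral_eq_integral[OF i]) auto
  also have "... <= ennreal (norm (\<sigma> (A n)) + 4 * \<epsilon> * measure M (A n))" by (rule ennreal_leI[OF est])
  also have "... = ennreal (norm (\<sigma> (A n))) + ennreal (4 * \<epsilon>) * emeasure M (A n)"
   using \<epsilon>(1) by (simp add: M.emeasure_eq_measure ennreal_mult ennreal_plus)
  finally show "emeasure (density M (%x. ennreal (norm (k x)))) (A n) <= ..." .
 qed auto
 also have "... = (\<Sum>n. ennreal (norm (\<sigma> (A n)))) + ennreal (4 * \<epsilon>) * emeasure M \<U>"
 proof -
  have "(\<Sum>n. emeasure M (A n)) = emeasure M \<U>"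
   unfolding UN[symmetric] by (rule suminf_emeasure) (use A disj in auto)
  then show ?thesis by (subst suminf_add[symmetric]) (simp_all add: ennreal_suminf_cmult)
 qed
 also have "... <= total_variation \<sigma> \<U> + ennreal e"
 proof (rule add_mono)
  show "(\<Sum>n. ennreal (norm (\<sigma> (A n)))) <= total_variation \<sigma> \<U>"
   unfolding total_variation_def
   using A M(2) \<U> disj UN by (intro SUP_upper) (auto simp: borel_on_iff)
  have "ennreal (4 * \<epsilon>) * emeasure M \<U> = ennreal (4 * \<epsilon> * measure M \<U>)"
   using \<epsilon>(1) by (simp add: M.emeasure_eq_measure ennreal_mult)
  then show "ennreal (4 * \<epsilon>) * emeasure M \<U> <= ennreal e" using \<epsilon>(2) by (simp add: ennreal_leI)
 qed
 finally show "ennreal (\<integral>x. norm (k x) \<partial>M) <= total_variation \<sigma> \<U> + ennreal e" .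
qed

lemma total_variation_zero:
 fixes \<U> :: "'a::topological_space set" and \<sigma> :: "'a set => 'b::real_normed_vector"
 assumes "!!E. E : borel_on \<U> ==> \<sigma> E = 0" "\<U> : sets borel"
 shows "total_variation \<sigma> \<U> = 0"
proof -
 have *: "(\<Sum>n. ennreal (norm (\<sigma> (A n)))) = 0"
  if "range A \<subseteq> sets borel" "(\<Union>n. A n) = \<U>" for A :: "nat => 'a set"
 proof -
  have "\<sigma> (A n) = 0" for n
  proof (rule assms(1))
   show "A n : borel_on \<U>" unfolding borel_on_iff[OF assms(2)] using that by blast
  qed
  then show ?thesis by simp
 qed
 have "total_variation \<sigma> \<U> <= 0"
  unfolding total_variation_def
 proof (rule SUP_least)
  fix A :: "nat => 'a set" assume A: "A : {A. range A \<subseteq> sets borel & disjoint_family A & \<Union> (range A) = \<U>}"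
  then have "range A \<subseteq> sets borel" "\<Union> (range A) = \<U>" by blast+
  from *[OF this] show "(\<Sum>n. ennreal (norm (\<sigma> (A n)))) <= 0" by simp
 qed
 then show ?thesis by simp
qed

section \<open>Weak derivatives\<close>

lemma C1_gradient_cong_open:
 assumes "C1_gradient S g D" "open S" "!!x. x : S ==> f x = g x"
 shows "C1_gradient S f D"
proof -
 have "(f has_derivative (%v. D x \<bullet> v)) (at x)" if "x : S" for x
  by (rule has_derivative_transform_within_open[of g _ _ UNIV S])
    (use assms that in "auto simp: C1_gradient_def")
 then show ?thesis using assms(1) by (auto simp: C1_gradient_def)
qed

lemma vector_measure_componentwise:
 fixes \<mu> :: "'a::topological_space set => real ^ 'n::finite"
 assumes "!!i. vector_measure_on \<U> (%E. \<mu> E $ i)"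
 shows "vector_measure_on \<U> \<mu>"
 using assms unfolding vector_measure_on_def sums_def by (auto intro!: vec_tendstoI)

lemma test_function_bounded:
 assumes "\<phi> : test_functions \<U>"
 obtains K where "!!x. \<bar>\<phi> x\<bar> <= K"
proof -
 let ?S = "closure {x. \<phi> x ~= 0}"
 have c: "continuous_on UNIV \<phi>" using assms by (auto simp: test_functions_def C1_on_continuous_on)
 have "compact (\<phi> ` ?S)"
  using assms by (intro compact_continuous_image continuous_on_subset[OF c]) (auto simp: test_functions_def)
 then obtain K where "\<forall>x\<in>?S. \<bar>\<phi> x\<bar> <= K"
  by (auto dest!: compact_imp_bounded simp: bounded_iff)
 then have K: "\<bar>\<phi> x\<bar> <= K" if "x : ?S" for x using that by blast
 have "\<bar>\<phi> x\<bar> <= max K 0" for x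
  using K[of x] closure_subset[of "{x. \<phi> x ~= 0}"] by (cases "\<phi> x = 0") auto
 then show ?thesis by (rule that)
qed

text \<open>Two gradient measures are handled at once as the components of one vector measure.\<close>

lemma gradient_measure_unique:
 fixes \<mu> \<mu>' :: "(real ^ 2) set => real ^ 2"
 assumes \<U>: "open \<U>" "emeasure lborel \<U> < \<infinity>"
  and g: "is_gradient_measure \<U> w \<mu>" "is_gradient_measure \<U> w \<mu>'" and E: "E : borel_on \<U>"
 shows "\<mu> E = \<mu>' E"
proof -
 have "\<mu> E $ j = \<mu>' E $ j" for j
 proof -
  define \<kappa> where "\<kappa> E = (\<chi> i::2. if i = 1 then \<mu> E $ j else \<mu>' E $ j)" for E
  have vm: "vector_measure_on \<U> \<mu>" "vector_measure_on \<U> \<mu>'"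
   using g by (auto simp: is_gradient_measure_def)
  have v\<kappa>: "vector_measure_on \<U> \<kappa>"
  proof (rule vector_measure_componentwise)
   fix i :: 2
   show "vector_measure_on \<U> (%E. \<kappa> E $ i)"
    using vector_measure_component[OF vm(1), of j] vector_measure_component[OF vm(2), of j]
    by (cases "i = 1") (simp_all add: \<kappa>_def)
  qed
  have \<U>b: "\<U> : sets borel" using \<U> by (simp add: borel_open)
  obtain M d l where M: "finite_measure M" "sets M = borel_on \<U>" and d: "integrable M d"
   and \<kappa>d: "!!E i. E : borel_on \<U> ==> \<kappa> E $ i = (\<integral>x. indicator E x * (d x :: real ^ 2) $ i \<partial>M)"
   and "integrable M l" "!!x. 0 <= (l x :: real)" "density M (%x. ennreal (l x)) = restrict_space lborel \<U>"
   by (rule vector_measure_density[OF v\<kappa> \<U>b \<U>(2)], rule that)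
  have spM: "space M = \<U>" using sets_eq_imp_space_eq[OF M(2)] by (simp add: space_restrict_space)
  have di: "integrable M (%x. d x $ i)" for i
   using d by (rule integrable_bounded_linear[OF bounded_linear_vec_nth])
  have id: "(%x. x) : M \<rightarrow>\<^sub>M restrict_space borel \<U>" by (simp add: measurable_cong_sets[OF M(2) refl])
  have idb: "(%x. x) : borel_measurable M"
   using measurable_restrict_space1[of "%x. x" borel borel \<U>] by (simp add: measurable_cong_sets[OF M(2) refl])
  have si: "signed_integral \<U> (%E. \<mu> E $ j) \<phi> = (\<integral>x. \<phi> x * d x $ 1 \<partial>M)"
    "signed_integral \<U> (%E. \<mu>' E $ j) \<phi> = (\<integral>x. \<phi> x * d x $ 2 \<partial>M)"
    if \<phi>: "\<phi> : test_functions \<U>" for \<phi>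
  proof -
   obtain K where K: "!!x. \<bar>\<phi> x\<bar> <= K" using test_function_bounded[OF \<phi>] by blast
   have m: "\<phi> : borel_measurable (restrict_space borel \<U>)"
    using \<phi> by (intro measurable_restrict_space1 C1_on_borel test_function_C1)
   show "signed_integral \<U> (%E. \<mu> E $ j) \<phi> = (\<integral>x. \<phi> x * d x $ 1 \<partial>M)"
    by (rule signed_integral_image(2)[where p = "%x. x", OF id di \<U>b _ m K])
    (simp add: \<kappa>d[symmetric], simp add: \<kappa>_def)
   show "signed_integral \<U> (%E. \<mu>' E $ j) \<phi> = (\<integral>x. \<phi> x * d x $ 2 \<partial>M)"
    by (rule signed_integral_image(2)[where p = "%x. x", OF id di \<U>b _ m K])
    (simp add: \<kappa>d[symmetric], simp add: \<kappa>_def)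
  qed
  have "(\<integral>x. indicator E x * (d x $ 1 - d x $ 2) \<partial>M) = 0"
  proof (rule test_functions_determine[OF \<U>(1) idb])
   show "x : \<U>" if "x : space M" for x using that spM by simp
   show "integrable M (%x. d x $ 1 - d x $ 2)" using di by auto
   show "E : sets borel" using E \<U>b by (simp add: borel_on_iff)
   fix a b :: "real ^ 2" and n assume "box a b \<subseteq> \<U>"
   then have t: "box_bump a b n : test_functions \<U>" by (rule box_bump_test)
   have m: "box_bump a b n : borel_measurable M"
    using measurable_compose[OF idb C1_on_borel[OF test_function_C1[OF t]]] by simp
   have i: "integrable M (%x. box_bump a b n x * d x $ i)" for i
    by (rule Bochner_Integration.integrable_bound[OF di[of i]])
    (use m borel_measurable_integrable[OF di] box_bump_bounds in
    \<open>auto simp: abs_mult intro!: mult_left_le_one_le\<close>)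
   have "signed_integral \<U> (%E. \<mu> E $ j) (box_bump a b n) = signed_integral \<U> (%E. \<mu>' E $ j) (box_bump a b n)"
   proof -
    have "(LINT x:\<U>|lebesgue. w x * partial_deriv j (box_bump a b n) x) = - signed_integral \<U> (%E. \<mu> E $ j) (box_bump a b n)"
    using g(1) t unfolding is_gradient_measure_def by blast
    moreover have "(LINT x:\<U>|lebesgue. w x * partial_deriv j (box_bump a b n) x) = - signed_integral \<U> (%E. \<mu>' E $ j) (box_bump a b n)"
    using g(2) t unfolding is_gradient_measure_def by blast
    ultimately show ?thesis by linarith
   qed
   then show "(\<integral>x. box_bump a b n x * (d x $ 1 - d x $ 2) \<partial>M) = 0"
    using si[OF t] i by (simp add: right_diff_distrib)
  qed
  also have "(\<integral>x. indicator E x * (d x $ 1 - d x $ 2) \<partial>M) = \<mu> E $ j - \<mu>' E $ j"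
  proof -
   have "integrable M (%x. indicator E x * d x $ i)" for i
    using integrable_mult_indicator[OF _ di[of i], of E] E M by simp
   then have "(\<integral>x. indicator E x * (d x $ 1 - d x $ 2) \<partial>M) = \<kappa> E $ 1 - \<kappa> E $ 2"
    by (simp add: right_diff_distrib \<kappa>d[OF E])
   then show ?thesis by (simp add: \<kappa>_def)
  qed
  finally show ?thesis by simp
 qed
 then show ?thesis by (simp add: vec_eq_iff)
qed

lemma integrable_compact_support:
 fixes f :: "'a::euclidean_space => real"
 assumes "compact K" "continuous_on K f" "!!x. x \<notin> K ==> f x = 0"
 shows "integrable lborel f"
proof -
 have "(%x. indicator K x *\<^sub>R f x) = f" using assms(3) by (auto simp: fun_eq_iff indicator_def)
 then show ?thesis using borel_integrable_compact[OF assms(1,2)] by simp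
qed

text \<open>The difference quotients have integral zero because Lebesgue measure is invariant under
 translations; they converge to the partial derivative boundedly and with bounded support.\<close>

lemma integral_partial_deriv_zero:
 fixes \<psi> :: "real ^ 'n::finite => real"
 assumes C1: "C1_on UNIV \<psi>" and K: "compact K" "!!x. x \<notin> K ==> \<psi> x = 0"
 shows "(\<integral>x. partial_deriv i \<psi> x \<partial>lborel) = 0"
proof -
 let ?e = "axis i 1 :: real ^ 'n"
 define D where "D x = (\<chi> i. partial_deriv i \<psi> x)" for x
 have G: "C1_gradient UNIV \<psi> D" unfolding D_def using C1 by (rule C1_on_gradient)
 have c: "continuous_on UNIV \<psi>" using C1 by (rule C1_on_continuous_on)
 have pc: "continuous_on UNIV (partial_deriv i \<psi>)" using C1 by (simp add: C1_on_def)
 have dl: "((%t. \<psi> (x + t *\<^sub>R ?e)) has_real_derivative partial_deriv i \<psi> (x + t *\<^sub>R ?e)) (at t)" for x t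
 proof -
  have "(\<psi> has_derivative (%v. D (x + t *\<^sub>R ?e) \<bullet> v)) (at (x + t *\<^sub>R ?e))"
   using G by (simp add: C1_gradient_def)
  moreover have "((%t. x + t *\<^sub>R ?e) has_derivative (%s. s *\<^sub>R ?e)) (at t)"
   by (auto intro!: derivative_eq_intros)
  ultimately have "((%t. \<psi> (x + t *\<^sub>R ?e)) has_derivative (%s. D (x + t *\<^sub>R ?e) \<bullet> (s *\<^sub>R ?e))) (at t)"
   using has_derivative_compose by blast
  then show ?thesis
   by (simp add: has_field_derivative_def D_def inner_axis mult.commute[of _ "partial_deriv _ _ _"] mult_commute_abs)
 qed
 obtain R where R: "R > 0" "!!x. x : K ==> norm x <= R"
  using compact_imp_bounded[OF K(1)] by (auto simp: bounded_pos)
 have "compact (partial_deriv i \<psi> ` cball 0 (R + 2))"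
  by (intro compact_continuous_image continuous_on_subset[OF pc]) auto
 then obtain C where "\<forall>x\<in>cball 0 (R + 2). \<bar>partial_deriv i \<psi> x\<bar> <= C"
  by (auto dest!: compact_imp_bounded simp: bounded_iff)
 then have C: "\<bar>partial_deriv i \<psi> x\<bar> <= C" if "norm x <= R + 2" for x using that by simp
 define h where "h n = 1 / real (Suc n)" for n
 have h: "0 < h n" "h n <= 1" for n by (auto simp: h_def)
 have h0: "h \<longlonglongrightarrow> 0" unfolding h_def using LIMSEQ_inverse_real_of_nat by (simp add: inverse_eq_divide)
 define q where "q n x = (\<psi> (x + h n *\<^sub>R ?e) - \<psi> x) / h n" for n x
 have int\<psi>: "integrable lborel \<psi>"
  by (rule integrable_compact_support[OF K(1) continuous_on_subset[OF c]]) (use K in auto)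
 have q0: "(\<integral>x. q n x \<partial>lborel) = 0" for n
 proof -
  have "(\<integral>x. \<psi> x \<partial>lborel) = (\<integral>x. \<psi> x \<partial>distr lborel borel ((+) (h n *\<^sub>R ?e)))"
   by (simp add: lborel_distr_plus)
  also have "... = (\<integral>x. \<psi> (h n *\<^sub>R ?e + x) \<partial>lborel)"
   using C1_on_borel[OF C1] by (subst integral_distr) auto
  finally have 1: "(\<integral>x. \<psi> (x + h n *\<^sub>R ?e) \<partial>lborel) = (\<integral>x. \<psi> x \<partial>lborel)" by (simp add: add.commute)
  have "integrable (distr lborel borel ((+) (h n *\<^sub>R ?e))) \<psi>" using int\<psi> by (simp add: lborel_distr_plus)
  then have "integrable lborel (%x. \<psi> (x + h n *\<^sub>R ?e))"
   using C1_on_borel[OF C1] by (subst (asm) integrable_distr_eq) (auto simp: add.commute)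
  then show ?thesis unfolding q_def using int\<psi> 1 by simp
 qed
 have "(%n. \<integral>x. q n x \<partial>lborel) \<longlonglongrightarrow> (\<integral>x. partial_deriv i \<psi> x \<partial>lborel)"
 proof (rule integral_dominated_convergence[where w = "%x. C * indicator (cball 0 (R + 1)) x"])
  show "partial_deriv i \<psi> : borel_measurable lborel" using partial_deriv_borel[OF C1] by simp
  have [measurable]: "\<psi> : borel_measurable borel" using C1_on_borel[OF C1] .
  show "q n : borel_measurable lborel" for n unfolding q_def by measurable
  show "integrable lborel (%x :: real ^ 'n. C * indicator (cball 0 (R + 1)) x :: real)"
   by (intro integrable_mult_right integrable_real_indicator) (use emeasure_bounded_finite[of "cball (0 :: real ^ 'n) (R + 1)"] in auto)
  have "(%n. q n x) \<longlonglongrightarrow> partial_deriv i \<psi> x" for x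
  proof -
   have "((%t. (\<psi> (x + t *\<^sub>R ?e) - \<psi> x) / t) \<longlongrightarrow> partial_deriv i \<psi> x) (at 0)"
    using dl[of x 0] by (simp add: has_field_derivative_iff)
   moreover have "filterlim h (at 0) sequentially"
    using h0 h(1) by (auto simp: filterlim_at less_imp_neq[symmetric] intro!: always_eventually)
   ultimately show ?thesis unfolding q_def by (rule filterlim_compose)
  qed
  then show "AE x in lborel. (%n. q n x) \<longlonglongrightarrow> partial_deriv i \<psi> x" by simp
  have "\<bar>q n x\<bar> <= C * indicator (cball 0 (R + 1)) x" for n x
  proof (cases "norm x <= R + 1")
   case True
   have "\<exists>t>0. t < h n & \<psi> (x + h n *\<^sub>R ?e) - \<psi> (x + 0 *\<^sub>R ?e) = (h n - 0) * partial_deriv i \<psi> (x + t *\<^sub>R ?e)"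
    using dl h(1) by (intro MVT2) auto
   then obtain t where t: "0 < t" "t < h n" "q n x = partial_deriv i \<psi> (x + t *\<^sub>R ?e)"
    using h(1)[of n] by (auto simp: q_def)
   have "norm (x + t *\<^sub>R ?e) <= norm x + norm (t *\<^sub>R ?e)" by (rule norm_triangle_ineq)
   also have "... <= R + 2" using True t h(2)[of n] by (simp add: norm_axis_1)
   finally show ?thesis using t(3) C True by simp
  next
   case False
   have "norm (h n *\<^sub>R ?e) <= 1" using h[of n] by (simp add: norm_axis_1)
   then have "norm x <= norm (x + h n *\<^sub>R ?e) + 1"
    using norm_triangle_ineq4[of "x + h n *\<^sub>R ?e" "h n *\<^sub>R ?e"] by simp
   then have "x \<notin> K" "x + h n *\<^sub>R ?e \<notin> K" using False R(2)[of x] R(2)[of "x + h n *\<^sub>R ?e"] by auto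
   then show ?thesis using False by (simp add: q_def K(2))
  qed
  then show "AE x in lborel. norm (q n x) <= C * indicator (cball 0 (R + 1)) x" for n by simp
 qed
 then show ?thesis by (simp add: q0 LIMSEQ_const_iff)
qed

lemma set_integral_compact_support:
 fixes F :: "real ^ 'n::finite => real"
 assumes "compact K" "K \<subseteq> V" "continuous_on K F" "!!x. x : V - K ==> F x = 0"
 shows "set_integrable lebesgue V F"
  and "(LINT x:V|lebesgue. F x) = (\<integral>x. indicator K x * F x \<partial>lborel)"
proof -
 have eq: "(%x. indicator V x *\<^sub>R F x) = (%x. indicator K x *\<^sub>R F x)"
  using assms(2,4) by (auto simp: fun_eq_iff indicator_def)
 have i: "integrable lborel (%x. indicator K x *\<^sub>R F x)"
  using assms by (intro borel_integrable_compact)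
 then have m: "(%x. indicator K x *\<^sub>R F x) : borel_measurable lborel" by (rule borel_measurable_integrable)
 show "set_integrable lebesgue V F"
  unfolding set_integrable_def eq using i integrable_completion[OF m] by simp
 show "(LINT x:V|lebesgue. F x) = (\<integral>x. indicator K x * F x \<partial>lborel)"
  unfolding set_lebesgue_integral_def eq using integral_completion[OF m] by simp
qed

text \<open>The product of \<open>f\<close> and a test function, extended by zero, is of class C1 on the whole space.\<close>

lemma C1_weak_partial:
 fixes f :: "real ^ 'n::finite => real"
 assumes V: "open V" and f: "C1_on V f"
 shows "weak_partial V i f (partial_deriv i f)"
 unfolding weak_partial_def
proof
 fix \<phi> assume \<phi>: "\<phi> : test_functions V"
 define K where "K = closure {x. \<phi> x ~= 0}"
 have K: "compact K" "K \<subseteq> V" "!!x. x \<notin> K ==> \<phi> x = 0"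
  using \<phi> closure_subset[of "{x. \<phi> x ~= 0}"] by (auto simp: test_functions_def K_def)
 have oK: "open (- K)" using K(1) by (simp add: compact_imp_closed open_Compl)
 have \<phi>C: "C1_on UNIV \<phi>" using \<phi> by (rule test_function_C1)
 define \<psi> where "\<psi> x = (if x : V then f x * \<phi> x else 0)" for x
 have G: "C1_gradient V (%x. f x * \<phi> x) (%x. f x *\<^sub>R (\<chi> i. partial_deriv i \<phi> x) + \<phi> x *\<^sub>R (\<chi> i. partial_deriv i f x))"
  by (intro C1_gradient_mult C1_on_gradient f C1_gradient_subset[OF C1_on_gradient[OF \<phi>C]]) auto
 have \<psi>V: "C1_gradient V \<psi> (%x. f x *\<^sub>R (\<chi> i. partial_deriv i \<phi> x) + \<phi> x *\<^sub>R (\<chi> i. partial_deriv i f x))"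
  by (rule C1_gradient_cong_open[OF G V]) (simp add: \<psi>_def)
 have "C1_on (- K) \<psi>"
  by (rule C1_on_cong_open[OF C1_gradient_C1_on[OF C1_gradient_const[of _ 0]] oK])
    (auto simp: \<psi>_def K(3))
 then have "C1_on (V \<union> - K) \<psi>"
  using C1_gradient_C1_on[OF \<psi>V] V oK by (intro C1_on_Un)
 moreover have "V \<union> - K = UNIV" using K(2) by auto
 ultimately have \<psi>C: "C1_on UNIV \<psi>" by simp
 have d\<phi>: "partial_deriv i \<phi> x = 0" if "x \<notin> K" for x
 proof -
  have "C1_gradient (- K) \<phi> (%x. 0)"
   by (rule C1_gradient_cong_open[OF C1_gradient_const[of _ 0] oK]) (simp add: K(3))
  from C1_gradient_partial[OF this, of x i] that show ?thesis by simp
 qed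
 have d\<psi>: "partial_deriv i \<psi> x = indicator K x * (f x * partial_deriv i \<phi> x) + indicator K x * (partial_deriv i f x * \<phi> x)" for x
 proof (cases "x : V")
  case True
  from C1_gradient_partial[OF \<psi>V this, of i]
  have "partial_deriv i \<psi> x = f x * partial_deriv i \<phi> x + \<phi> x * partial_deriv i f x" by simp
  then show ?thesis using K(3)[of x] d\<phi>[of x] by (cases "x : K") auto
 next
  case False
  then have "x \<notin> K" using K(2) by auto
  have "C1_gradient (- K) \<psi> (%x. 0)"
   by (rule C1_gradient_cong_open[OF C1_gradient_const[of _ 0] oK]) (simp add: K(3) \<psi>_def)
  from C1_gradient_partial[OF this, of x i] \<open>x \<notin> K\<close> show ?thesis by simp
 qed
 have cK: "continuous_on K f" "continuous_on K \<phi>" "continuous_on K (partial_deriv i f)" "continuous_on K (partial_deriv i \<phi>)"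
  using C1_on_continuous_on[OF f] C1_on_continuous_on[OF \<phi>C] f \<phi>C K(2)
  by (auto simp: C1_on_def intro: continuous_on_subset)
 have c1: "continuous_on K (%x. f x * partial_deriv i \<phi> x)" and c2: "continuous_on K (%x. partial_deriv i f x * \<phi> x)"
  using cK by (auto intro!: continuous_intros)
 have "0 = (\<integral>x. partial_deriv i \<psi> x \<partial>lborel)"
  by (rule integral_partial_deriv_zero[OF \<psi>C K(1), symmetric]) (auto simp: \<psi>_def K(3))
 also have "... = (\<integral>x. indicator K x * (f x * partial_deriv i \<phi> x) \<partial>lborel) + (\<integral>x. indicator K x * (partial_deriv i f x * \<phi> x) \<partial>lborel)"
  unfolding d\<psi> using borel_integrable_compact[OF K(1) c1] borel_integrable_compact[OF K(1) c2] by simp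
 also have "(\<integral>x. indicator K x * (f x * partial_deriv i \<phi> x) \<partial>lborel) = (LINT x:V|lebesgue. f x * partial_deriv i \<phi> x)"
  by (rule set_integral_compact_support(2)[OF K(1,2) c1, symmetric]) (auto simp: d\<phi>)
 also have "(\<integral>x. indicator K x * (partial_deriv i f x * \<phi> x) \<partial>lborel) = (LINT x:V|lebesgue. partial_deriv i f x * \<phi> x)"
  by (rule set_integral_compact_support(2)[OF K(1,2) c2, symmetric]) (auto simp: K(3))
 finally show "(LINT x:V|lebesgue. f x * partial_deriv i \<phi> x) = - (LINT x:V|lebesgue. partial_deriv i f x * \<phi> x)" by simp
qed

lemma lebesgue_borel_representative:
 fixes w :: "'a::euclidean_space => real"
 assumes "set_integrable lebesgue \<U> w" "\<U> : sets borel"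
 obtains v where "v : borel_measurable borel" "set_integrable lborel \<U> v"
  "AE x in lborel. x : \<U> --> w x = v x"
  "!!\<phi>. \<phi> : borel_measurable borel ==> (LINT x:\<U>|lebesgue. w x * \<phi> x) = (LINT x:\<U>|lborel. v x * \<phi> x)"
proof -
 have i: "integrable lebesgue (%x. indicator \<U> x * w x)" using assms(1) by (simp add: set_integrable_def)
 from completion_ex_borel_measurable_real[OF borel_measurable_integrable[OF this]]
 obtain v where v: "v : borel_measurable lborel" "AE x in lborel. indicator \<U> x * w x = v x" by auto
 have AE: "AE x in lborel. x : \<U> --> w x = v x" using v(2) by eventually_elim (auto simp: indicator_def)
 have [measurable]: "v : borel_measurable borel" "\<U> : sets borel" using v assms by auto
 have eq: "AE x in lebesgue. indicator \<U> x * w x = indicator \<U> x * v x"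
  unfolding AE_lebesgue_iff using AE by eventually_elim (auto simp: indicator_def)
 have mv: "(%x. indicator \<U> x * v x) : borel_measurable lborel" by measurable
 have "integrable lebesgue (%x. indicator \<U> x * v x)"
  by (subst integrable_cong_AE[OF _ _ eq, symmetric])
    (use i borel_measurable_integrable[OF i] measurable_completion[OF mv] in auto)
 then have sv: "set_integrable lborel \<U> v"
  using integrable_completion[OF mv] by (simp add: set_integrable_def)
 show ?thesis
 proof (rule that[OF _ sv AE])
  show "v : borel_measurable borel" by measurable
  fix \<phi> :: "'a => real" assume [measurable]: "\<phi> : borel_measurable borel"
  have m: "(%x. indicator \<U> x *\<^sub>R (v x * \<phi> x)) : borel_measurable lborel" by measurable
  have "\<phi> : borel_measurable lebesgue" by (rule measurable_completion) simp
  then have "(%x. (indicator \<U> x * w x) * \<phi> x) : borel_measurable lebesgue"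
   using borel_measurable_integrable[OF i] by (rule borel_measurable_times[rotated])
  then have "(LINT x:\<U>|lebesgue. w x * \<phi> x) = (LINT x:\<U>|lebesgue. v x * \<phi> x)"
   unfolding set_lebesgue_integral_def using eq measurable_completion[OF m]
   by (intro integral_cong_AE) (auto simp: mult.assoc[symmetric] elim: eventually_mono)
  also have "... = (LINT x:\<U>|lborel. v x * \<phi> x)"
   by (rule set_integral_lebesgue_lborel(1)) (use m in auto)
  finally show "(LINT x:\<U>|lebesgue. w x * \<phi> x) = (LINT x:\<U>|lborel. v x * \<phi> x)" .
 qed
qed

text \<open>For a C1 function with integrable gradient the weak derivatives are the classical ones, and the
 gradient measure has no singular part.\<close>

lemma C1_gradient_measure:
 fixes u :: "real ^ 2 => real"
 assumes \<U>: "open \<U>" and u: "C1_gradient \<U> u D" and D: "set_integrable lebesgue \<U> D"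
 shows "is_gradient_measure \<U> u (%E. LINT x:E|lebesgue. D x)"
  and "lebesgue_decomposition \<U> (%E. LINT x:E|lebesgue. D x) D (%E. 0)"
  and "\<phi> : borel_measurable borel ==> (!!x. x : \<U> ==> \<bar>\<phi> x\<bar> <= K) ==>
   signed_integral \<U> (%E. (LINT x:E|lebesgue. D x) $ i) \<phi> = (LINT x:\<U>|lebesgue. \<phi> x * D x $ i)"
proof -
 define \<mu> where "\<mu> E = (LINT x:E|lebesgue. D x)" for E
 have \<U>b[measurable]: "\<U> : sets borel" using \<U> by (simp add: borel_open)
 have Di: "integrable lebesgue (%x. indicator \<U> x * D x $ i)" for i
  using integrable_bounded_linear[OF bounded_linear_vec_nth D[unfolded set_integrable_def], of i] by simp
 have cD: "continuous_on \<U> (%x. D x $ i)" for i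
  using u by (auto simp: C1_gradient_def intro!: continuous_intros)
 have mD[measurable]: "(%x. indicator \<U> x * D x $ i) : borel_measurable borel" for i
  using borel_measurable_continuous_on_indicator[OF \<U>b cD[of i]] by simp
 define L where "L = restrict_space lborel \<U>"
 have sL: "sets L = borel_on \<U>" unfolding L_def by (rule sets_restrict_space_cong) simp
 have DL: "integrable L (%x. D x $ i)" for i
 proof -
  have "integrable lborel (%x. indicator \<U> x *\<^sub>R D x $ i)"
   using Di[of i] integrable_completion[of "%x. indicator \<U> x * D x $ i" lborel] by simp
  then show ?thesis unfolding L_def by (subst integrable_restrict_space) auto
 qed
 have idL: "(%x. x) : L \<rightarrow>\<^sub>M restrict_space borel \<U>" by (simp add: measurable_cong_sets[OF sL refl])
 have Lint: "(\<integral>x. \<phi> x * D x $ i \<partial>L) = (LINT x:\<U>|lebesgue. \<phi> x * D x $ i)"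
  if [measurable]: "\<phi> : borel_measurable borel" for \<phi> i
 proof -
  have "(%x. \<phi> x * (indicator \<U> x * D x $ i)) : borel_measurable lborel" by measurable
  then have "(LINT x:\<U>|lborel. \<phi> x * D x $ i) = (LINT x:\<U>|lebesgue. \<phi> x * D x $ i)"
   by (intro set_integral_lebesgue_lborel(1)[symmetric]) (auto simp: algebra_simps)
  then show ?thesis unfolding L_def by (subst integral_restrict_space) (auto simp: set_lebesgue_integral_def)
 qed
 have \<mu>i: "\<mu> E $ i = (\<integral>x. indicator E x * D x $ i \<partial>L)" if "E : borel_on \<U>" for E i
 proof -
  have E: "E : sets borel" "E \<subseteq> \<U>" using that \<U>b by (auto simp: borel_on_iff)
  have hE: "integrable lebesgue (%x. indicator E x *\<^sub>R D x)"
   using set_integrable_subset[OF D _ E(2)] E by (simp add: set_integrable_def)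
  have "\<mu> E $ i = (\<integral>x. (indicator E x *\<^sub>R D x) $ i \<partial>lebesgue)"
   unfolding \<mu>_def set_lebesgue_integral_def by (rule integral_bounded_linear[OF bounded_linear_vec_nth hE, symmetric])
  also have "... = (LINT x:\<U>|lebesgue. indicator E x * D x $ i)"
   unfolding set_lebesgue_integral_def using E
   by (intro Bochner_Integration.integral_cong) (auto simp: indicator_def)
  also have "... = (\<integral>x. indicator E x * D x $ i \<partial>L)"
   by (rule Lint[symmetric]) (use E in auto)
  finally show ?thesis .
 qed
 note img = signed_integral_image[where p = "%x. x", OF idL DL \<U>b]
 have vmi: "vector_measure_on \<U> (%E. \<mu> E $ i)" for i
  by (rule img(1)[of _ i]) (simp add: \<mu>i)
 then have vm: "vector_measure_on \<U> \<mu>" by (rule vector_measure_componentwise)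
 have si: "signed_integral \<U> (%E. \<mu> E $ i) \<phi> = (LINT x:\<U>|lebesgue. \<phi> x * D x $ i)"
  if "\<phi> : borel_measurable borel" "!!x. x : \<U> ==> \<bar>\<phi> x\<bar> <= K" for \<phi> K i
 proof -
  have "signed_integral \<U> (%E. \<mu> E $ i) \<phi> = (\<integral>x. \<phi> x * D x $ i \<partial>L)"
   by (rule img(2)[of _ i \<phi> K]) (use that in "auto simp: \<mu>i measurable_restrict_space1")
  then show ?thesis using Lint[OF that(1)] by simp
 qed
 then show "\<phi> : borel_measurable borel ==> (!!x. x : \<U> ==> \<bar>\<phi> x\<bar> <= K) ==>
   signed_integral \<U> (%E. (LINT x:E|lebesgue. D x) $ i) \<phi> = (LINT x:\<U>|lebesgue. \<phi> x * D x $ i)"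
  unfolding \<mu>_def by blast
 have "is_gradient_measure \<U> u \<mu>"
  unfolding is_gradient_measure_def
 proof (intro conjI vm ballI allI)
  fix \<phi> i assume \<phi>: "\<phi> : test_functions \<U>"
  obtain K where K: "!!x. \<bar>\<phi> x\<bar> <= K" using test_function_bounded[OF \<phi>] by blast
  have "(LINT x:\<U>|lebesgue. u x * partial_deriv i \<phi> x) = - (LINT x:\<U>|lebesgue. partial_deriv i u x * \<phi> x)"
   using C1_weak_partial[OF \<U> C1_gradient_C1_on[OF u], of i] \<phi> by (simp add: weak_partial_def)
  also have "(LINT x:\<U>|lebesgue. partial_deriv i u x * \<phi> x) = (LINT x:\<U>|lebesgue. \<phi> x * D x $ i)"
   unfolding set_lebesgue_integral_def
   by (intro Bochner_Integration.integral_cong) (auto simp: indicator_def C1_gradient_partial[OF u])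
  also have "... = signed_integral \<U> (%E. \<mu> E $ i) \<phi>"
   by (rule si[symmetric, OF C1_on_borel[OF test_function_C1[OF \<phi>]] K])
  finally show "(LINT x:\<U>|lebesgue. u x * partial_deriv i \<phi> x) = - signed_integral \<U> (%E. \<mu> E $ i) \<phi>" .
 qed
 then show "is_gradient_measure \<U> u (%E. LINT x:E|lebesgue. D x)" unfolding \<mu>_def[abs_def] .
 show "lebesgue_decomposition \<U> (%E. LINT x:E|lebesgue. D x) D (%E. 0)"
  unfolding lebesgue_decomposition_def using D
  by (auto simp: vector_measure_on_def intro!: bexI[of _ "{}"])
qed

section \<open>Functions with vanishing weak gradient\<close>

lemma open_null_empty:
 fixes S :: "'a::euclidean_space set"
 assumes "open S" "emeasure lborel S = 0"
 shows "S = {}"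
proof -
 have "S : null_sets lborel" using assms by (auto simp: null_sets_def borel_open)
 then have "negligible S" by (simp add: negligible_iff_null_sets null_sets_completionI)
 then show ?thesis using open_not_negligible[OF assms(1)] by blast
qed

lemma C1_primitive:
 fixes g :: "real => real"
 assumes g: "continuous_on UNIV g" "!!t. t \<notin> {p..q} ==> g t = 0" and int0: "integral {p..q} g = 0" and pq: "p <= q"
 obtains A where "C1_real A g" "!!t. t \<notin> {p..q} ==> A t = 0"
proof
 define A where "A t = integral {p - 1..t} g" for t
 have io: "g integrable_on {c..d}" for c d
  by (rule integrable_continuous_real[OF continuous_on_subset[OF g(1)]]) auto
 have left: "A t = 0" if "t < p" for t
 proof -
  have "integral {p - 1..t} g = integral {p - 1..t} (%_. 0)"
  proof (rule integral_cong)
   fix x assume "x : {p - 1..t}"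
   then have "x \<notin> {p..q}" using that by auto
   then show "g x = 0" by (rule g(2))
  qed
  then show ?thesis by (simp add: A_def)
 qed
 show "A t = 0" if "t \<notin> {p..q}" for t
 proof (cases "t < p")
  case False
  then have "q < t" using that pq by auto
  have "A t = integral {p - 1..p} g + integral {p..q} g + integral {q..t} g"
   unfolding A_def using pq \<open>q < t\<close>
   by (simp add: Henstock_Kurzweil_Integration.integral_combine[OF _ _ io])
  also have "integral {p - 1..p} g = integral {p - 1..p} (%_. 0)"
   by (rule integral_spike[of "{p}"]) (use g(2) in auto)
  also have "integral {q..t} g = integral {q..t} (%_. 0)"
   by (rule integral_spike[of "{q}"]) (use g(2) in auto)
  finally show ?thesis using int0 by simp
 qed (rule left)
 have "(A has_real_derivative g t) (at t)" for t
 proof (cases "t < p")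
  case True
  have "(A has_real_derivative 0) (at t)"
   by (rule has_field_derivative_transform_within_open[of "%_. 0" _ _ "{..<p}"]) (use True left in auto)
  then show ?thesis using g(2)[of t] True by simp
 next
  case False
  have "(A has_real_derivative g t) (at t within {p - 1..t + 1})"
   unfolding A_def using False
   by (intro integral_has_real_derivative continuous_on_subset[OF g(1)]) auto
  moreover have "at t within {p - 1..t + 1} = at t"
   using False by (intro at_within_interior) auto
  ultimately show ?thesis by simp
 qed
 then show "C1_real A g" using g(1) by (simp add: C1_real_def)
qed

lemma bump_integral_pos:
 assumes "a < b"
 obtains n where "0 < integral {a..b} (bump a b n)"
proof -
 define m where "m = (a + b) / 2"
 have "\<forall>\<^sub>F n in sequentially. bump a b n m = 1 & bump' a b n m = 0"
  using assms by (intro bump_eventually) (auto simp: m_def)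
 then obtain n where n: "bump a b n m = 1" by (auto simp: eventually_sequentially)
 have c: "continuous_on {a..b} (bump a b n)"
  using C1_real_continuous[OF C1_real_bump] by (rule continuous_on_subset) auto
 have "integral {a..b} (bump a b n) ~= 0"
  using integral_eq_0_iff[OF c assms] bump_bounds n assms by (auto simp: m_def intro!: bexI[of _ "(a + b) / 2"])
 moreover have "0 <= integral {a..b} (bump a b n)"
  using bump_bounds c by (intro integral_nonneg integrable_continuous_real) auto
 ultimately show ?thesis using that[of n] by simp
qed

text \<open>A product \<open>\<alpha>(x\<^sub>1) \<beta>(x\<^sub>2)\<close> differs from a multiple of a fixed product
 \<open>\<kappa>\<^sub>1(x\<^sub>1) \<kappa>\<^sub>2(x\<^sub>2)\<close> by a sum of partial derivatives of test functions. Hence the linear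
 functional given by \<open>w\<close> is, on such products, proportional to the one given by the constant 1.\<close>

lemma zero_gradient_box:
 fixes w :: "real ^ 2 => real"
 assumes ab: "a $ 1 < b $ 1" "a $ 2 < b $ 2"
  and w: "set_integrable lebesgue (box a b) w"
  and z: "!!\<phi> i. \<phi> : test_functions (box a b) ==> (LINT x:box a b|lebesgue. w x * partial_deriv i \<phi> x) = 0"
 obtains c where "AE x in lebesgue. x : box a b --> w x = c"
proof -
 let ?V = "box a b"
 have Vb[measurable]: "?V : sets borel" by (simp add: borel_open)
 obtain v where v[measurable]: "v : borel_measurable borel" and vi: "set_integrable lborel ?V v"
  and wv: "AE x in lborel. x : ?V --> w x = v x"
  and int: "!!\<phi>. \<phi> : borel_measurable borel ==> (LINT x:?V|lebesgue. w x * \<phi> x) = (LINT x:?V|lborel. v x * \<phi> x)"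
  by (rule lebesgue_borel_representative[OF w Vb], rule that)
 define L where "L = restrict_space lborel ?V"
 have sL: "sets L = borel_on ?V" unfolding L_def by (rule sets_restrict_space_cong) simp
 have spL: "space L = ?V" by (simp add: L_def space_restrict_space)
 have Lint: "(LINT x:?V|lborel. f x) = (\<integral>x. f x \<partial>L)" for f :: "real ^ 2 => real"
  unfolding L_def by (subst integral_restrict_space) (auto simp: set_lebesgue_integral_def)
 have bL: "f : borel_measurable L" if "f : borel_measurable borel" for f :: "real ^ 2 => real"
  using measurable_restrict_space1[OF that] by (simp add: measurable_cong_sets[OF sL refl])
 have viL: "integrable L v"
  unfolding L_def by (subst integrable_restrict_space) (use vi in "auto simp: set_integrable_def")
 have fmV: "emeasure lborel ?V < \<infinity>" by (rule emeasure_bounded_finite) simp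
 have fL: "finite_measure L"
  using fmV by (intro finite_measureI) (simp add: L_def emeasure_restrict_space space_restrict_space)
 have oneL: "integrable L (%x. 1 :: real)" using fL by (simp add: finite_measure.integrable_const)
 define ker where "ker f \<longleftrightarrow> integrable L f &
  (\<forall>\<phi> i. \<phi> : test_functions ?V --> (\<integral>x. f x * partial_deriv i \<phi> x \<partial>L) = 0)" for f :: "real ^ 2 => real"
 have kerv: "ker v"
  unfolding ker_def
 proof (intro conjI viL allI impI)
  fix \<phi> and i :: 2 assume \<phi>: "\<phi> : test_functions ?V"
  have "(\<integral>x. v x * partial_deriv i \<phi> x \<partial>L) = (LINT x:?V|lebesgue. w x * partial_deriv i \<phi> x)"
   using int[OF partial_deriv_borel[OF test_function_C1[OF \<phi>], of i]] by (simp add: Lint)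
  then show "(\<integral>x. v x * partial_deriv i \<phi> x \<partial>L) = 0" using z[OF \<phi>] by simp
 qed
 have ker1: "ker (%x. 1)"
  unfolding ker_def
 proof (intro conjI oneL allI impI)
  fix \<phi> and i :: 2 assume \<phi>: "\<phi> : test_functions ?V"
  have G: "C1_gradient ?V (%x. 1) (%x. 0)" by (rule C1_gradient_const)
  have "(LINT x:?V|lebesgue. 1 * partial_deriv i \<phi> x) = - (LINT x:?V|lebesgue. partial_deriv i (%x. 1) x * \<phi> x)"
   using C1_weak_partial[OF open_box C1_gradient_C1_on[OF G], of i] \<phi> by (simp add: weak_partial_def)
  also have "(LINT x:?V|lebesgue. partial_deriv i (%x. 1) x * \<phi> x) = (LINT x:?V|lebesgue. 0)"
   unfolding set_lebesgue_integral_def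
   by (intro Bochner_Integration.integral_cong) (auto simp: C1_gradient_partial[OF G] indicator_def)
  finally have "(LINT x:?V|lebesgue. partial_deriv i \<phi> x) = 0" by simp
  moreover have "(LINT x:?V|lebesgue. partial_deriv i \<phi> x) = (LINT x:?V|lborel. partial_deriv i \<phi> x)"
   using partial_deriv_borel[OF test_function_C1[OF \<phi>], of i]
   by (intro set_integral_lebesgue_lborel(1)) auto
  ultimately show "(\<integral>x. 1 * partial_deriv i \<phi> x \<partial>L) = 0" by (simp add: Lint)
 qed
 obtain n1 where n1: "0 < integral {a $ 1..b $ 1} (bump (a $ 1) (b $ 1) n1)" using bump_integral_pos[OF ab(1)] by blast
 obtain n2 where n2: "0 < integral {a $ 2..b $ 2} (bump (a $ 2) (b $ 2) n2)" using bump_integral_pos[OF ab(2)] by blast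
 define \<kappa>1 where "\<kappa>1 = bump (a $ 1) (b $ 1) n1"
 define \<kappa>2 where "\<kappa>2 = bump (a $ 2) (b $ 2) n2"
 define J1 where "J1 = integral {a $ 1..b $ 1} \<kappa>1"
 define J2 where "J2 = integral {a $ 2..b $ 2} \<kappa>2"
 have J: "J1 > 0" "J2 > 0" using n1 n2 by (auto simp: J1_def J2_def \<kappa>1_def \<kappa>2_def)
 define Q where "Q f \<alpha> \<beta> = (\<integral>x. f x * (\<alpha> (x $ 1) * \<beta> (x $ 2)) \<partial>L)" for f :: "real ^ 2 => real" and \<alpha> \<beta> :: "real => real"
 define adm where "adm l u \<alpha> \<longleftrightarrow> (\<exists>\<alpha>'. C1_real \<alpha> \<alpha>') & (\<exists>p q. l < p & p <= q & q < u & (\<forall>t. t \<notin> {p..q} --> \<alpha> t = 0))"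
  for l u and \<alpha> :: "real => real"
 have adm_bump: "adm l u (bump s t n)" if "l <= s" "s < t" "t <= u" for l u s t n
 proof (cases "s + 1 / real (Suc n) <= t - 1 / real (Suc n)")
  case True
  have "0 < 1 / real (Suc n)" by simp
  then have "l < s + 1 / real (Suc n)" "t - 1 / real (Suc n) < u" using that by linarith+
  moreover have "\<forall>r. r \<notin> {s + 1 / real (Suc n)..t - 1 / real (Suc n)} --> bump s t n r = 0"
   using bump_outside by blast
  ultimately show ?thesis
   unfolding adm_def using C1_real_bump True by blast
 next
  case False
  then have "bump s t n r = 0" for r by (intro bump_outside) auto
  then show ?thesis
   unfolding adm_def using that C1_real_bump
   by (intro conjI exI[of _ "bump' s t n"] exI[of _ "(s + t) / 2"]) auto
 qed
 have \<kappa>adm: "adm (a $ 1) (b $ 1) \<kappa>1" "adm (a $ 2) (b $ 2) \<kappa>2"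
  unfolding \<kappa>1_def \<kappa>2_def using ab by (auto intro: adm_bump)
 have bnd: "\<exists>K. \<forall>t. \<bar>\<alpha> t\<bar> <= K" if \<alpha>: "adm l u \<alpha>" for l u \<alpha>
 proof -
  obtain \<alpha>' p q where "C1_real \<alpha> \<alpha>'" and o: "!!t. t \<notin> {p..q} ==> \<alpha> t = 0" using \<alpha> unfolding adm_def by blast
  then have "continuous_on {p..q} \<alpha>" by (metis C1_real_continuous continuous_on_subset subset_UNIV)
  then have "compact (\<alpha> ` {p..q})" by (intro compact_continuous_image) auto
  then obtain K where K: "\<forall>t\<in>{p..q}. \<bar>\<alpha> t\<bar> <= K" by (auto dest!: compact_imp_bounded simp: bounded_iff)
  have "\<bar>\<alpha> t\<bar> <= max K 0" for t using K o[of t] by (cases "t : {p..q}") (auto simp: le_max_iff_disj)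
  then show ?thesis by blast
 qed
 have cont: "continuous_on UNIV \<alpha>" if "adm l u \<alpha>" for l u \<alpha>
  using that by (auto simp: adm_def intro: C1_real_continuous)
 have mble: "(%x. \<alpha> (x $ 1) * \<beta> (x $ 2)) : borel_measurable borel" if "continuous_on UNIV \<alpha>" "continuous_on UNIV \<beta>" for \<alpha> \<beta> :: "real => real"
  by (intro borel_measurable_times measurable_compose[OF borel_measurable_vec_nth borel_measurable_continuous_onI] that) auto
 have Qint: "integrable L (%x. f x * (\<alpha> (x $ 1) * \<beta> (x $ 2)))"
  if f: "integrable L f" and \<alpha>: "adm l u \<alpha>" "adm l' u' \<beta>" for f \<alpha> \<beta> l u l' u'
 proof -
  obtain K1 K2 where K: "!!t. \<bar>\<alpha> t\<bar> <= K1" "!!t. \<bar>\<beta> t\<bar> <= K2" using bnd[OF \<alpha>(1)] bnd[OF \<alpha>(2)] by blast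
  have b: "\<bar>\<alpha> (x $ 1) * \<beta> (x $ 2)\<bar> <= \<bar>K1 * K2\<bar>" for x :: "real^2"
   unfolding abs_mult using K by (intro mult_mono) (auto intro: order_trans[OF _ abs_ge_self])
  show ?thesis
  proof (rule Bochner_Integration.integrable_bound[of _ "%x. \<bar>K1 * K2\<bar> * f x"])
   show "AE x in L. norm (f x * (\<alpha> (x $ 1) * \<beta> (x $ 2))) <= norm (\<bar>K1 * K2\<bar> * f x)"
   proof (rule AE_I2)
    fix x :: "real^2"
    have "\<bar>f x\<bar> * \<bar>\<alpha> (x $ 1) * \<beta> (x $ 2)\<bar> <= \<bar>f x\<bar> * \<bar>K1 * K2\<bar>" by (intro mult_left_mono b) auto
    then show "norm (f x * (\<alpha> (x $ 1) * \<beta> (x $ 2))) <= norm (\<bar>K1 * K2\<bar> * f x)" by (simp add: abs_mult mult_ac)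
   qed
   show "(%x. f x * (\<alpha> (x $ 1) * \<beta> (x $ 2))) : borel_measurable L"
    using borel_measurable_integrable[OF f] bL[OF mble[OF cont[OF \<alpha>(1)] cont[OF \<alpha>(2)]]] by (rule borel_measurable_times)
  qed (use f in auto)
 qed
 have prim: "\<exists>A. C1_real A (%t. J * \<alpha> t - I * \<kappa> t) & (\<exists>p q. l < p & p <= q & q < u & (\<forall>t. t \<notin> {p..q} --> A t = 0))"
  if \<alpha>: "adm l u \<alpha>" and \<kappa>: "adm l u \<kappa>" and I: "I = integral {l..u} \<alpha>" and J: "J = integral {l..u} \<kappa>" for \<alpha> \<kappa> l u I J
 proof -
  obtain p q where p: "l < p" "p <= q" "q < u" "!!t. t \<notin> {p..q} ==> \<alpha> t = 0" using \<alpha> unfolding adm_def by blast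
  obtain p' q' where p': "l < p'" "p' <= q'" "q' < u" "!!t. t \<notin> {p'..q'} ==> \<kappa> t = 0" using \<kappa> unfolding adm_def by blast
  define P where "P = min p p'"
  define R where "R = max q q'"
  have PR: "l < P" "P <= R" "R < u" using p p' by (auto simp: P_def R_def)
  have o: "\<alpha> t = 0" "\<kappa> t = 0" if "t \<notin> {P..R}" for t
  proof -
   have "t \<notin> {p..q}" "t \<notin> {p'..q'}" using that by (auto simp: P_def R_def)
   then show "\<alpha> t = 0" "\<kappa> t = 0" using p(4) p'(4) by blast+
  qed
  let ?g = "%t. J * \<alpha> t - I * \<kappa> t"
  have c: "continuous_on UNIV ?g" using cont[OF \<alpha>] cont[OF \<kappa>] by (intro continuous_intros)
  have io: "f integrable_on {l..u}" if "continuous_on UNIV f" for f :: "real => real"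
   by (rule integrable_continuous_real[OF continuous_on_subset[OF that]]) auto
  have "integral {P..R} ?g = integral {l..u} ?g"
  proof (rule integral_spike_set)
   have g0: "?g x = 0" if "x \<notin> {P..R}" for x using o[OF that] by simp
   have "{P..R} \<subseteq> {l..u}" using PR by auto
   then have "{x : {P..R} - {l..u}. ?g x ~= 0} = {}" "{x : {l..u} - {P..R}. ?g x ~= 0} = {}"
    using g0 by blast+
   then show "negligible {x : {P..R} - {l..u}. ?g x ~= 0}" "negligible {x : {l..u} - {P..R}. ?g x ~= 0}"
    by (simp_all only: negligible_empty)
  qed
  also have "... = J * I - I * J"
  proof (rule integral_unique)
   show "(?g has_integral J * I - I * J) {l..u}"
    unfolding I J
    by (intro has_integral_diff has_integral_mult_right integrable_integral io cont[OF \<alpha>] cont[OF \<kappa>])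
  qed
  finally have "integral {P..R} ?g = 0" by simp
  then obtain A where "C1_real A ?g" "!!t. t \<notin> {P..R} ==> A t = 0"
   using C1_primitive[OF c _ _ PR(2)] o by (metis diff_self mult_zero_right)
  then show ?thesis using PR by blast
 qed
 have fac: "J1 * J2 * Q f \<alpha> \<beta> = integral {a $ 1..b $ 1} \<alpha> * integral {a $ 2..b $ 2} \<beta> * Q f \<kappa>1 \<kappa>2"
  if f: "ker f" and \<alpha>: "adm (a $ 1) (b $ 1) \<alpha>" and \<beta>: "adm (a $ 2) (b $ 2) \<beta>" for f \<alpha> \<beta>
 proof -
  have fi: "integrable L f" using f by (simp add: ker_def)
  have kerD: "(\<integral>x. f x * partial_deriv i \<phi> x \<partial>L) = 0" if "\<phi> : test_functions ?V" for \<phi> i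
   using f that by (simp add: ker_def)
  let ?I1 = "integral {a $ 1..b $ 1} \<alpha>" and ?I2 = "integral {a $ 2..b $ 2} \<beta>"
  obtain A p q where A: "C1_real A (%t. J1 * \<alpha> t - ?I1 * \<kappa>1 t)" "a $ 1 < p" "q < b $ 1" "!!t. t \<notin> {p..q} ==> A t = 0"
   using prim[OF \<alpha> \<kappa>adm(1) refl J1_def] by blast
  obtain B p' q' where B: "C1_real B (%t. J2 * \<beta> t - ?I2 * \<kappa>2 t)" "a $ 2 < p'" "q' < b $ 2" "!!t. t \<notin> {p'..q'} ==> B t = 0"
   using prim[OF \<beta> \<kappa>adm(2) refl J2_def] by blast
  obtain \<beta>' r s where \<beta>': "C1_real \<beta> \<beta>'" "a $ 2 < r" "s < b $ 2" "!!t. t \<notin> {r..s} ==> \<beta> t = 0"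
   using \<beta> unfolding adm_def by blast
  obtain \<kappa>' r' s' where \<kappa>': "C1_real \<kappa>1 \<kappa>'" "a $ 1 < r'" "s' < b $ 1" "!!t. t \<notin> {r'..s'} ==> \<kappa>1 t = 0"
   using \<kappa>adm(1) unfolding adm_def by blast
  have t1: "(%x::real^2. A (x $ 1) * \<beta> (x $ 2)) : test_functions ?V"
   by (rule test_functions_product(1)[OF A(1) \<beta>'(1) order.refl A(2,3) _ \<beta>'(2,3)]) (fact A(4), fact \<beta>'(4))
  have d1: "partial_deriv 1 (%x::real^2. A (x $ 1) * \<beta> (x $ 2)) x = (J1 * \<alpha> (x $ 1) - ?I1 * \<kappa>1 (x $ 1)) * \<beta> (x $ 2)" for x
   by (rule test_functions_product(2)[OF A(1) \<beta>'(1) order.refl A(2,3) _ \<beta>'(2,3)]) (fact A(4), fact \<beta>'(4))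
  have t2: "(%x::real^2. \<kappa>1 (x $ 1) * B (x $ 2)) : test_functions ?V"
   by (rule test_functions_product(1)[OF \<kappa>'(1) B(1) order.refl \<kappa>'(2,3) _ B(2,3)]) (fact \<kappa>'(4), fact B(4))
  have d2: "partial_deriv 2 (%x::real^2. \<kappa>1 (x $ 1) * B (x $ 2)) x = \<kappa>1 (x $ 1) * (J2 * \<beta> (x $ 2) - ?I2 * \<kappa>2 (x $ 2))" for x
   by (rule test_functions_product(3)[OF \<kappa>'(1) B(1) order.refl \<kappa>'(2,3) _ B(2,3)]) (fact \<kappa>'(4), fact B(4))
  have "(\<integral>x. f x * ((J1 * \<alpha> (x $ 1) - ?I1 * \<kappa>1 (x $ 1)) * \<beta> (x $ 2)) \<partial>L) = 0"
   using kerD[OF t1, of 1] by (simp only: d1)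
  moreover have "(\<integral>x. f x * ((J1 * \<alpha> (x $ 1) - ?I1 * \<kappa>1 (x $ 1)) * \<beta> (x $ 2)) \<partial>L)
    = (\<integral>x. J1 * (f x * (\<alpha> (x $ 1) * \<beta> (x $ 2))) - ?I1 * (f x * (\<kappa>1 (x $ 1) * \<beta> (x $ 2))) \<partial>L)"
   by (intro Bochner_Integration.integral_cong) (auto simp: algebra_simps)
  moreover have "... = J1 * Q f \<alpha> \<beta> - ?I1 * Q f \<kappa>1 \<beta>"
   unfolding Q_def using Qint[OF fi \<alpha> \<beta>] Qint[OF fi \<kappa>adm(1) \<beta>] by simp
  ultimately have e1: "J1 * Q f \<alpha> \<beta> = ?I1 * Q f \<kappa>1 \<beta>" by simp
  have "(\<integral>x. f x * (\<kappa>1 (x $ 1) * (J2 * \<beta> (x $ 2) - ?I2 * \<kappa>2 (x $ 2))) \<partial>L) = 0"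
   using kerD[OF t2, of 2] by (simp only: d2)
  moreover have "(\<integral>x. f x * (\<kappa>1 (x $ 1) * (J2 * \<beta> (x $ 2) - ?I2 * \<kappa>2 (x $ 2))) \<partial>L)
    = (\<integral>x. J2 * (f x * (\<kappa>1 (x $ 1) * \<beta> (x $ 2))) - ?I2 * (f x * (\<kappa>1 (x $ 1) * \<kappa>2 (x $ 2))) \<partial>L)"
   by (intro Bochner_Integration.integral_cong) (auto simp: algebra_simps)
  moreover have "... = J2 * Q f \<kappa>1 \<beta> - ?I2 * Q f \<kappa>1 \<kappa>2"
   unfolding Q_def using Qint[OF fi \<kappa>adm(1) \<beta>] Qint[OF fi \<kappa>adm] by simp
  ultimately have e2: "J2 * Q f \<kappa>1 \<beta> = ?I2 * Q f \<kappa>1 \<kappa>2" by simp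
  have "J1 * J2 * Q f \<alpha> \<beta> = J2 * (J1 * Q f \<alpha> \<beta>)" by simp
  also have "... = ?I1 * (J2 * Q f \<kappa>1 \<beta>)" unfolding e1 by simp
  finally show ?thesis unfolding e2 by simp
 qed
 have idL: "(%x. x) : borel_measurable L"
  using measurable_restrict_space1[of "%x. x" borel borel ?V] by (simp add: measurable_cong_sets[OF sL refl])
 define c where "c = Q v \<kappa>1 \<kappa>2 / Q (%x. 1) \<kappa>1 \<kappa>2"
 have det: "(\<integral>x. indicator B x * f x \<partial>L) = 0"
  if f: "integrable L f" and B: "B : sets borel"
   and Q0: "!!\<alpha> \<beta>. adm (a $ 1) (b $ 1) \<alpha> ==> adm (a $ 2) (b $ 2) \<beta> ==> Q f \<alpha> \<beta> = 0" for f B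
 proof (rule test_functions_determine[OF open_box idL _ f _ B])
  show "x : ?V" if "x : space L" for x using that spL by simp
  fix s t :: "real ^ 2" and n assume st: "box s t \<subseteq> ?V"
  show "(\<integral>x. box_bump s t n x * f x \<partial>L) = 0"
  proof (cases "s $ 1 < t $ 1 & s $ 2 < t $ 2")
   case True
   then have "box s t ~= {}" by (auto simp: interval_ne_empty_cart forall_2)
   then have "a $ i <= s $ i & t $ i <= b $ i" for i
    using st by (auto simp: subset_interval_cart interval_ne_empty_cart)
   then have "Q f (bump (s $ 1) (t $ 1) n) (bump (s $ 2) (t $ 2) n) = 0"
    using True by (intro Q0 adm_bump) auto
   then show ?thesis by (simp add: Q_def box_bump_def mult.commute)
  next
   case False
   then have "box_bump s t n x = 0" for x
    by (auto simp: box_bump_def intro!: bump_zero)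
   then show ?thesis by simp
  qed
 qed
 have c1: "Q (%x. 1) \<kappa>1 \<kappa>2 ~= 0"
 proof
  assume "Q (%x. 1) \<kappa>1 \<kappa>2 = 0"
  then have "(\<integral>x. indicator UNIV x * (1::real) \<partial>L) = 0"
   using fac[OF ker1] J by (intro det oneL) auto
  then have "measure L ?V = 0" by (simp add: spL)
  moreover have "measure L ?V = measure lborel ?V"
   by (simp add: L_def measure_restrict_space)
  ultimately have "emeasure lborel ?V = 0"
   using fmV by (simp add: emeasure_eq_ennreal_measure)
  then have "?V = {}" by (rule open_null_empty[OF open_box])
  moreover have "?V ~= {}" unfolding interval_ne_empty_cart using ab by (simp add: forall_2)
  ultimately show False by simp
 qed
 have "(\<integral>x. indicator B x * (v x - c) \<partial>L) = 0" if B: "B : sets borel" for B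
 proof (rule det[OF _ B])
  have ci: "integrable L (%x. c)" using fL by (simp add: finite_measure.integrable_const)
  show "integrable L (%x. v x - c)" using viL ci by simp
  fix \<alpha> \<beta> assume \<alpha>: "adm (a $ 1) (b $ 1) \<alpha>" and \<beta>: "adm (a $ 2) (b $ 2) \<beta>"
  have "Q (%x. v x - c) \<alpha> \<beta> = Q v \<alpha> \<beta> - c * Q (%x. 1) \<alpha> \<beta>"
   unfolding Q_def using Qint[OF viL \<alpha> \<beta>] Qint[OF oneL \<alpha> \<beta>] by (simp add: left_diff_distrib)
  moreover have "J1 * J2 * (Q v \<alpha> \<beta> - c * Q (%x. 1) \<alpha> \<beta>) = 0"
  proof -
   have "J1 * J2 * (Q v \<alpha> \<beta> - c * Q (%x. 1) \<alpha> \<beta>) = J1 * J2 * Q v \<alpha> \<beta> - c * (J1 * J2 * Q (%x. 1) \<alpha> \<beta>)"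
    by (simp add: algebra_simps)
   also have "... = integral {a $ 1..b $ 1} \<alpha> * integral {a $ 2..b $ 2} \<beta> * (Q v \<kappa>1 \<kappa>2 - c * Q (%x. 1) \<kappa>1 \<kappa>2)"
    unfolding fac[OF kerv \<alpha> \<beta>] fac[OF ker1 \<alpha> \<beta>] by (simp add: algebra_simps)
   finally show ?thesis using c1 by (simp add: c_def)
  qed
  ultimately show "Q (%x. v x - c) \<alpha> \<beta> = 0" using J by simp
 qed
 then have "AE x in L. v x - c = 0"
 proof (intro density_unique_real)
  show "integrable L (%x. v x - c)" using viL fL by (simp add: finite_measure.integrable_const)
  fix A assume "A : sets L"
  then have "A : sets borel" using sL by (simp add: borel_on_iff)
  assume *: "!!B. B : sets borel ==> (\<integral>x. indicator B x * (v x - c) \<partial>L) = 0"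
  from *[OF \<open>A \<in> sets borel\<close>] show "(LINT x:A|L. v x - c) = (LINT x:A|L. 0)"
   by (simp add: set_lebesgue_integral_def)
 qed auto
 then have "AE x in lborel. x : ?V --> v x = c"
  unfolding L_def by (subst (asm) AE_restrict_space_iff) auto
 with wv have "AE x in lborel. x : ?V --> w x = c" by eventually_elim auto
 then show ?thesis by (intro that) (simp add: AE_lebesgue_iff)
qed

text \<open>The function is almost everywhere constant on every box in the domain; two overlapping boxes
 carry the same constant, so that connectedness gives a single one.\<close>

lemma zero_gradient_constant:
 fixes w :: "real ^ 2 => real"
 assumes \<U>: "open \<U>" "connected \<U>" and w: "set_integrable lebesgue \<U> w"
  and z: "!!\<phi> i. \<phi> : test_functions \<U> ==> (LINT x:\<U>|lebesgue. w x * partial_deriv i \<phi> x) = 0"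
 obtains c where "AE x in lebesgue. x : \<U> --> w x = c"
proof -
 have box: "\<exists>c. AE x in lebesgue. x : box a b --> w x = c"
  if ab: "box a b \<subseteq> \<U>" "box a b ~= {}" for a b
 proof -
  have "a $ 1 < b $ 1" "a $ 2 < b $ 2" using ab(2) by (auto simp: interval_ne_empty_cart forall_2)
  moreover have "set_integrable lebesgue (box a b) w" by (rule set_integrable_subset[OF w _ ab(1)]) auto
  moreover have "(LINT x:box a b|lebesgue. w x * partial_deriv i \<phi> x) = 0"
   if \<phi>: "\<phi> : test_functions (box a b)" for \<phi> i
  proof -
   have \<phi>\<U>: "\<phi> : test_functions \<U>" using \<phi> ab(1) by (auto simp: test_functions_def)
   have d: "partial_deriv i \<phi> x = 0" if "x \<notin> box a b" for x
   proof -
    let ?K = "closure {x. \<phi> x ~= 0}"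
    have xK: "x : - ?K" using that \<phi> by (auto simp: test_functions_def)
    have "\<phi> y = 0" if "y : - ?K" for y using that closure_subset[of "{x. \<phi> x ~= 0}"] by blast
    then have "C1_gradient (- ?K) \<phi> (%x. 0)"
    by (rule C1_gradient_cong_open[OF C1_gradient_const open_Compl[OF closed_closure]])
    from C1_gradient_partial[OF this xK, of i] show ?thesis by simp
   qed
   have "(LINT x:box a b|lebesgue. w x * partial_deriv i \<phi> x) = (LINT x:\<U>|lebesgue. w x * partial_deriv i \<phi> x)"
    unfolding set_lebesgue_integral_def using ab(1) d
    by (intro Bochner_Integration.integral_cong) (auto simp: indicator_def)
   then show ?thesis using z[OF \<phi>\<U>] by simp
  qed
  ultimately show ?thesis using zero_gradient_box by blast
 qed
 define good where "good x c a b \<longleftrightarrow> x : box a b & box a b \<subseteq> \<U> & (AE y in lebesgue. y : box a b --> w y = c)"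
  for x a b :: "real ^ 2" and c
 have "\<exists>c a b. good x c a b" if x: "x : \<U>" for x
 proof -
  obtain a b where "x : box a b" "box a b \<subseteq> \<U>"
   by (rule open_contains_box[OF \<U>(1) x])
  then show ?thesis using box[of a b] unfolding good_def by blast
 qed
 then obtain C a b where "!!x. x : \<U> ==> good x (C x) (a x) (b x)" by metis
 then have C: "!!x. x : \<U> ==> x : box (a x) (b x)" "!!x. x : \<U> ==> box (a x) (b x) \<subseteq> \<U>"
   "!!x. x : \<U> ==> AE y in lebesgue. y : box (a x) (b x) --> w y = C x"
  unfolding good_def by blast+
 have overlap: "r = s" if "AE y in lebesgue. y : U --> w y = r" "AE y in lebesgue. y : V --> w y = s"
  "open U" "open V" "x : U Int V" for r s U V x
 proof (rule ccontr)
  assume "r ~= s"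
  have "AE y in lebesgue. y \<notin> U Int V" using that(1,2) by eventually_elim (use \<open>r ~= s\<close> in auto)
  then have "AE y in lborel. y \<notin> U Int V" by (simp only: AE_lebesgue_iff)
  then have "emeasure lborel (U Int V) = 0"
   using that(3,4) by (subst (asm) AE_iff_null_sets[symmetric]) (auto simp: borel_open open_Int)
  then have "U Int V = {}" by (rule open_null_empty[OF open_Int[OF that(3,4)]])
  then show False using that(5) by simp
 qed
 show ?thesis
 proof (cases "\<U> = {}")
  case True
  then show ?thesis using that by simp
 next
  case False
  then obtain x0 where x0: "x0 : \<U>" by blast
  have const: "C x = C x0" if "x : \<U>" for x
  proof (rule connected_local_const[OF \<U>(2) that x0], intro ballI)
   fix y assume y: "y : \<U>"
   have "C y = C z" if "z : box (a y) (b y)" "z : \<U>" for z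
    using overlap[OF C(3)[OF y] C(3)[OF that(2)] open_box open_box, of z] C(1)[OF that(2)] that(1) by simp
   then show "\<forall>\<^sub>F z in at y within \<U>. C y = C z"
    unfolding eventually_at_topological using C(1)[OF y] by (intro exI[of _ "box (a y) (b y)"]) auto
  qed
  obtain D where D: "countable D" "D \<subseteq> Pow \<U>" "!!X. X : D ==> \<exists>a b. X = box a b" "\<Union>D = \<U>"
   by (rule open_countable_Union_open_box[OF \<U>(1)]) metis
  have "AE x in lebesgue. x : X --> w x = C x0" if X: "X : D" for X
  proof (cases "X = {}")
   case False
   then obtain x where x: "x : X" by blast
   obtain p q where pq: "X = box p q" using D(3)[OF X] by blast
   then obtain c where c: "AE y in lebesgue. y : X --> w y = c" using box[of p q] False D(2) X by auto
   have "x : \<U>" using x D(2) X by auto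
   have "c = C x"
    by (rule overlap[OF c C(3)[OF \<open>x \<in> \<U>\<close>], of x]) (use pq x C(1)[OF \<open>x \<in> \<U>\<close>] in auto)
   then show ?thesis using c const[OF \<open>x \<in> \<U>\<close>] by simp
  qed simp
  then have "AE x in lebesgue. \<forall>X\<in>D. x : X --> w x = C x0"
   by (rule AE_ball_countable'[OF _ D(1)])
  then have "AE x in lebesgue. x : \<U> --> w x = C x0" by eventually_elim (use D(4) in auto)
  then show ?thesis by (rule that)
 qed
qed

section \<open>One-dimensional Hausdorff measure\<close>

definition hausdorff1_outer :: "'a::metric_space set => ennreal" where
 "hausdorff1_outer E = (SUP \<delta>\<in>{0<..}. hausdorff1_pre \<delta> E)"

lemma hausdorff1_pre_le:
 assumes "E \<subseteq> (\<Union>n. C n)" "!!n::nat. bounded (C n)" "!!n. diameter (C n) <= \<delta>"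
 shows "hausdorff1_pre \<delta> E <= (\<Sum>n. ennreal (diameter (C n)))"
 unfolding hausdorff1_pre_def by (rule INF_lower) (use assms in auto)

lemma hausdorff1_pre_mono: "A \<subseteq> B ==> hausdorff1_pre \<delta> A <= hausdorff1_pre \<delta> B"
 unfolding hausdorff1_pre_def by (rule INF_superset_mono) auto

lemma hausdorff1_pre_antimono: "\<delta> <= \<delta>' ==> hausdorff1_pre \<delta>' E <= hausdorff1_pre \<delta> E"
 unfolding hausdorff1_pre_def by (rule INF_superset_mono) (auto intro: order_trans)

lemma hausdorff1_pre_empty: "0 < \<delta> ==> hausdorff1_pre \<delta> {} = 0"
 using hausdorff1_pre_le[of "{}" "%_. {}" \<delta>] by simp

lemma hausdorff1_pre_le_outer: "0 < \<delta> ==> hausdorff1_pre \<delta> E <= hausdorff1_outer E"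
 unfolding hausdorff1_outer_def by (rule SUP_upper) auto

lemma hausdorff1_outer_mono: "A \<subseteq> B ==> hausdorff1_outer A <= hausdorff1_outer B"
 unfolding hausdorff1_outer_def by (intro SUP_mono) (auto intro: hausdorff1_pre_mono)

lemma hausdorff1_outer_empty: "hausdorff1_outer {} = 0"
 unfolding hausdorff1_outer_def by (simp add: hausdorff1_pre_empty SUP_constant image_constant_conv bot_ennreal)

lemma hausdorff1_pre_subadditive:
 fixes A :: "nat => 'a::metric_space set"
 shows "hausdorff1_pre \<delta> (\<Union>n. A n) <= (\<Sum>n. hausdorff1_pre \<delta> (A n))"
proof (rule ennreal_le_epsilon)
 fix e :: real assume e: "0 < e" and fin: "(\<Sum>n. hausdorff1_pre \<delta> (A n)) < top"
 have "\<exists>C. A n \<subseteq> (\<Union>k. C k) & (\<forall>k. bounded (C k) & diameter (C k) <= \<delta>) &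
   (\<Sum>k. ennreal (diameter (C k))) <= hausdorff1_pre \<delta> (A n) + ennreal (e * (1 / 2) ^ Suc n)" for n
 proof -
  have "hausdorff1_pre \<delta> (A n) < top"
   using fin ennreal_suminf_lessD by blast
  then have "hausdorff1_pre \<delta> (A n) < hausdorff1_pre \<delta> (A n) + ennreal (e * (1 / 2) ^ Suc n)"
   using e by (cases "hausdorff1_pre \<delta> (A n)") (auto simp: ennreal_plus[symmetric] ennreal_less_iff simp del: ennreal_plus)
  then show ?thesis
   unfolding hausdorff1_pre_def[of \<delta> "A n"] INF_less_iff by (auto intro!: less_imp_le)
 qed
 then obtain C where C: "!!n. A n \<subseteq> (\<Union>k. C n k)" "!!n k. bounded (C n k)" "!!n k. diameter (C n k) <= \<delta>"
  "!!n. (\<Sum>k. ennreal (diameter (C n k))) <= hausdorff1_pre \<delta> (A n) + ennreal (e * (1 / 2) ^ Suc n)"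
  by metis
 define D where "D i = (case prod_decode i of (n, k) => C n k)" for i
 have "hausdorff1_pre \<delta> (\<Union>n. A n) <= (\<Sum>i. ennreal (diameter (D i)))"
 proof (rule hausdorff1_pre_le)
  show "(\<Union>n. A n) \<subseteq> (\<Union>i. D i)"
  proof
   fix x assume "x : (\<Union>n. A n)"
   then obtain n k where "x : C n k" using C(1) by blast
   then have "x : D (prod_encode (n, k))" by (simp add: D_def)
   then show "x : (\<Union>i. D i)" by blast
  qed
 qed (auto simp: D_def C split: prod.split)
 also have "... = (\<Sum>i. (%(n, k). ennreal (diameter (C n k))) (prod_decode i))"
  by (intro suminf_cong) (simp add: D_def split: prod.split)
 also have "... = (\<Sum>n. \<Sum>k. ennreal (diameter (C n k)))"
  by (rule suminf_ennreal_2dimen) simp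
 also have "... <= (\<Sum>n. hausdorff1_pre \<delta> (A n) + ennreal (e * (1 / 2) ^ Suc n))"
  by (intro suminf_le C(4)) auto
 also have "... = (\<Sum>n. hausdorff1_pre \<delta> (A n)) + (\<Sum>n. ennreal (e * (1 / 2) ^ Suc n))"
  by (rule suminf_add[symmetric]) auto
 also have "(\<Sum>n. ennreal (e * (1 / 2) ^ Suc n)) = ennreal e"
  using e sums_mult[OF power_half_series, of e] by (intro suminf_ennreal_eq) auto
 finally show "hausdorff1_pre \<delta> (\<Union>n. A n) <= (\<Sum>n. hausdorff1_pre \<delta> (A n)) + ennreal e" .
qed

lemma hausdorff1_outer_subadditive:
 fixes A :: "nat => 'a::metric_space set"
 shows "hausdorff1_outer (\<Union>n. A n) <= (\<Sum>n. hausdorff1_outer (A n))"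
 unfolding hausdorff1_outer_def[of "\<Union>n. A n"]
proof (rule SUP_least)
 fix \<delta> :: real assume "\<delta> : {0<..}"
 then have "(\<Sum>n. hausdorff1_pre \<delta> (A n)) <= (\<Sum>n. hausdorff1_outer (A n))"
  by (intro suminf_le hausdorff1_pre_le_outer) auto
 then show "hausdorff1_pre \<delta> (\<Union>n. A n) <= (\<Sum>n. hausdorff1_outer (A n))"
  using hausdorff1_pre_subadditive order_trans by blast
qed

lemma hausdorff1_outer_Un: "hausdorff1_outer (A \<union> B) <= hausdorff1_outer A + hausdorff1_outer B"
proof -
 have "hausdorff1_outer (\<Union>n. binaryset A B n) <= (\<Sum>n. hausdorff1_outer (binaryset A B n))"
  by (rule hausdorff1_outer_subadditive)
 then show ?thesis
  using suminf_binaryset_eq[of hausdorff1_outer A B] by (simp add: UN_binaryset_eq hausdorff1_outer_empty)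
qed

text \<open>A set of diameter less than the distance of \<open>A\<close> and \<open>B\<close> meets at most one of them.\<close>

lemma hausdorff1_outer_separated:
 fixes A B :: "'a::metric_space set"
 assumes d: "0 < d" "!!x y. x : A ==> y : B ==> d <= dist x y"
 shows "hausdorff1_outer A + hausdorff1_outer B <= hausdorff1_outer (A \<union> B)"
proof -
 have pre: "hausdorff1_pre \<delta> A + hausdorff1_pre \<delta> B <= hausdorff1_pre \<delta> (A \<union> B)" if \<delta>: "\<delta> < d" for \<delta>
  unfolding hausdorff1_pre_def[of \<delta> "A \<union> B"]
 proof (rule INF_greatest, safe)
  fix C :: "nat => 'a set" assume C: "A \<union> B \<subseteq> (\<Union>n. C n)" "\<forall>n. bounded (C n) & diameter (C n) <= \<delta>"
  define P where "P S n = (if C n Int S = {} then {} else C n)" for S n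
  have P: "hausdorff1_pre \<delta> S <= (\<Sum>n. ennreal (diameter (P S n)))" if S: "S \<subseteq> A \<union> B" "S ~= {}" for S
  proof (rule hausdorff1_pre_le)
   show "S \<subseteq> (\<Union>n. P S n)"
   proof
    fix x assume "x : S"
    then obtain n where "x : C n" using S(1) C(1) by blast
    then have "x : P S n" using \<open>x \<in> S\<close> by (auto simp: P_def)
    then show "x : (\<Union>n. P S n)" by blast
   qed
   have "0 <= \<delta>" using C(2) diameter_ge_0 order_trans by blast
   then show "bounded (P S n)" "diameter (P S n) <= \<delta>" for n using C(2) by (auto simp: P_def)
  qed
  have D: "ennreal (diameter (P A n)) + ennreal (diameter (P B n)) <= ennreal (diameter (C n))" for n
  proof (cases "C n Int A = {} \<or> C n Int B = {}")
   case False
   then obtain x y where xy: "x : C n" "x : A" "y : C n" "y : B" by blast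
   then have "dist x y <= diameter (C n)" using C(2) by (intro diameter_bounded_bound) auto
   then have "d <= \<delta>" using d(2)[OF xy(2,4)] C(2)[rule_format, of n] by linarith
   then show ?thesis using \<delta> by simp
  qed (auto simp: P_def)
  have e: "hausdorff1_pre \<delta> ({} :: 'a set) <= 0"
  proof -
   have "0 <= \<delta>" using C(2) diameter_ge_0 order_trans by blast
   then show ?thesis using hausdorff1_pre_le[of "{}" "%_. {}" \<delta>] by simp
  qed
  have "hausdorff1_pre \<delta> S <= (\<Sum>n. ennreal (diameter (P S n)))" if "S \<subseteq> A \<union> B" for S
   using P[OF that] e by (cases "S = {}") auto
  then have "hausdorff1_pre \<delta> A + hausdorff1_pre \<delta> B <= (\<Sum>n. ennreal (diameter (P A n))) + (\<Sum>n. ennreal (diameter (P B n)))"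
   by (intro add_mono) auto
  also have "... = (\<Sum>n. ennreal (diameter (P A n)) + ennreal (diameter (P B n)))" by (rule suminf_add) auto
  also have "... <= (\<Sum>n. ennreal (diameter (C n)))" by (intro suminf_le D) auto
  finally show "hausdorff1_pre \<delta> A + hausdorff1_pre \<delta> B <= (\<Sum>n. ennreal (diameter (C n)))" .
 qed
 have both: "hausdorff1_pre \<delta>1 A + hausdorff1_pre \<delta>2 B <= hausdorff1_outer (A \<union> B)" if "0 < \<delta>1" "0 < \<delta>2" for \<delta>1 \<delta>2
 proof -
  define \<delta> where "\<delta> = min (d / 2) (min \<delta>1 \<delta>2)"
  have \<delta>: "0 < \<delta>" "\<delta> < d" "\<delta> <= \<delta>1" "\<delta> <= \<delta>2" using that d(1) by (auto simp: \<delta>_def)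
  have "hausdorff1_pre \<delta>1 A + hausdorff1_pre \<delta>2 B <= hausdorff1_pre \<delta> A + hausdorff1_pre \<delta> B"
   by (intro add_mono hausdorff1_pre_antimono \<delta>)
  also have "... <= hausdorff1_pre \<delta> (A \<union> B)" by (rule pre[OF \<delta>(2)])
  also have "... <= hausdorff1_outer (A \<union> B)" by (rule hausdorff1_pre_le_outer[OF \<delta>(1)])
  finally show ?thesis .
 qed
 have ne: "{0::real<..} ~= {}" by (auto intro: exI[of _ 1])
 have "hausdorff1_pre \<delta>1 A + hausdorff1_outer B <= hausdorff1_outer (A \<union> B)" if "0 < \<delta>1" for \<delta>1
  unfolding hausdorff1_outer_def[of B] ennreal_SUP_add_right[OF ne]
  by (rule SUP_least) (use both that in auto)
 then show ?thesis
  unfolding hausdorff1_outer_def[of A] ennreal_SUP_add_left[OF ne, symmetric]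
  by (intro SUP_least) auto
qed

text \<open>Closed sets satisfy the Caratheodory condition: the part of \<open>X\<close> outside of \<open>F\<close> is exhausted by
 the sets of points of distance at least \<open>1/(n+1)\<close>, and the layers \<open>D k\<close> in between with indices of
 equal parity are pairwise separated, which makes the sum of their measures finite.\<close>

lemma closed_lambda_system:
 fixes F :: "'a::metric_space set"
 assumes F: "closed F"
 shows "F : lambda_system UNIV (Pow UNIV) hausdorff1_outer"
proof -
 let ?f = "hausdorff1_outer :: 'a set => ennreal"
 have "?f (F Int X) + ?f (X - F) <= ?f X" for X
 proof (cases "F = {} \<or> ?f X = top")
  case True
  then show ?thesis by (auto simp: hausdorff1_outer_empty)
 next
  case False
  then have ne: "F ~= {}" and fin: "?f X < top" by (auto simp: less_top)
  define Y where "Y n = {x : X. 1 / real (n + 1) <= infdist x F}" for n :: nat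
  define D where "D k = Y (Suc k) - Y k" for k
  have near: "infdist y F <= dist x y" if "x : F" for x y
   using infdist_le[OF that, of y] by (simp add: dist_commute)
  have Dist: "infdist x F - infdist y F <= dist x y" for x y
   using infdist_triangle[of x F y] by simp
  have a: "?f (F Int X) + ?f (Y n) <= ?f X" for n
  proof -
   have "?f (F Int X) + ?f (Y n) <= ?f (F Int X \<union> Y n)"
   proof (rule hausdorff1_outer_separated[of "1 / real (n + 1)"])
    fix x y assume "x : F Int X" "y : Y n"
    then show "1 / real (n + 1) <= dist x y" using near[of x y] by (auto simp: Y_def)
   qed simp
   also have "... <= ?f X" by (rule hausdorff1_outer_mono) (auto simp: Y_def)
   finally show ?thesis .
  qed
  have b: "?f (X - F) <= ?f (Y n) + (\<Sum>k. ?f (D (k + n)))" for n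
  proof -
   have "X - F \<subseteq> Y n \<union> (\<Union>k. D (k + n))"
   proof
    fix x assume x: "x : X - F"
    then have "0 < infdist x F"
    using in_closed_iff_infdist_zero[OF F ne, of x] infdist_nonneg[of x F] by (auto simp: less_le)
    then obtain m where "1 / real (m + 1) < infdist x F"
    using reals_Archimedean[of "infdist x F"] by (auto simp: inverse_eq_divide)
    then have ex: "x : Y m" using x by (auto simp: Y_def)
    define k where "k = (LEAST m. x : Y m)"
    have k: "x : Y k" unfolding k_def by (rule LeastI[of "%m. x : Y m", OF ex])
    have k2: "x \<notin> Y j" if "j < k" for j using that not_less_Least unfolding k_def by blast
    show "x : Y n \<union> (\<Union>k. D (k + n))"
    proof (cases "k <= n")
    case True
    have "1 / real (n + 1) <= 1 / real (k + 1)" using True by (intro divide_left_mono) auto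
    then show ?thesis using k by (auto simp: Y_def)
    next
    case False
    then obtain j where "k = Suc (j + n)" by (metis add.commute less_imp_Suc_add not_le add_Suc_right)
    then have "x : D (j + n)" using k k2[of "j + n"] by (simp add: D_def)
    then show ?thesis by blast
    qed
   qed
   then have "?f (X - F) <= ?f (Y n \<union> (\<Union>k. D (k + n)))" by (rule hausdorff1_outer_mono)
   also have "... <= ?f (Y n) + ?f (\<Union>k. D (k + n))" by (rule hausdorff1_outer_Un)
   also have "... <= ?f (Y n) + (\<Sum>k. ?f (D (k + n)))" by (intro add_left_mono hausdorff1_outer_subadditive)
   finally show ?thesis .
  qed
  have DX: "D k \<subseteq> X" for k by (auto simp: D_def Y_def)
  have par: "(\<Sum>k<N. ?f (D (2 * k + e))) <= ?f (\<Union>k<N. D (2 * k + e))" for N e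
  proof (induction N)
   case (Suc N)
   show ?case
   proof (cases "N = 0")
    case False
    have "(\<Sum>k<Suc N. ?f (D (2 * k + e))) <= ?f (\<Union>k<N. D (2 * k + e)) + ?f (D (2 * N + e))"
    using Suc by (simp add: add_mono)
    also have "... <= ?f ((\<Union>k<N. D (2 * k + e)) \<union> D (2 * N + e))"
    proof (rule hausdorff1_outer_separated[of "1 / real (2 * N + e) - 1 / real (2 * N + e + 1)"])
    show "0 < 1 / real (2 * N + e) - 1 / real (2 * N + e + 1)"
    proof -
    have "1 / real (2 * N + e + 1) < 1 / real (2 * N + e)"
    using False by (intro divide_strict_left_mono) auto
    then show ?thesis by simp
    qed
    fix x y assume "x : (\<Union>k<N. D (2 * k + e))" and y: "y : D (2 * N + e)"
    then obtain k where k: "k < N" "x : D (2 * k + e)" by blast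
    have "1 / real (2 * N + e) <= 1 / real (Suc (2 * k + e) + 1)"
    using k(1) by (intro divide_left_mono) auto
    also have "... <= infdist x F" using k(2) by (simp add: D_def Y_def)
    finally have "1 / real (2 * N + e) <= infdist x F" .
    moreover have "infdist y F <= 1 / real (2 * N + e + 1)" using y by (auto simp: D_def Y_def)
    ultimately show "1 / real (2 * N + e) - 1 / real (2 * N + e + 1) <= dist x y"
    using Dist[of x y] by linarith
    qed
    finally show ?thesis by (simp add: lessThan_Suc Un_commute)
   qed (simp add: lessThan_Suc)
  qed (simp add: hausdorff1_outer_empty)
  have "(\<Sum>k<N. ?f (D k)) <= 2 * ?f X" for N
  proof -
   have "(\<Sum>k<N. ?f (D k)) <= (\<Sum>k<2 * N. ?f (D k))" by (intro sum_mono2) auto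
   also have "... = (\<Sum>k<N. ?f (D (2 * k + 0))) + (\<Sum>k<N. ?f (D (2 * k + 1)))"
    by (induction N) (auto simp: algebra_simps)
   also have "... <= ?f X + ?f X"
    by (intro add_mono order_trans[OF par] hausdorff1_outer_mono) (use DX in auto)
   finally show ?thesis by (simp add: mult_2)
  qed
  then have "(\<Sum>k. ?f (D k)) <= 2 * ?f X" by (intro suminf_le_const) auto
  also have "... < top" using fin by (simp add: ennreal_mult_less_top)
  finally have S: "(\<Sum>k. ?f (D k)) < top" .
  define r where "r k = enn2real (?f (D k))" for k
  have r: "?f (D k) = ennreal (r k)" "0 <= r k" for k
   using ennreal_suminf_lessD[OF S, of k] by (auto simp: r_def)
  have sr: "summable r" using S r by (intro summable_suminf_not_top) (auto simp: less_top)
  show ?thesis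
  proof (rule ennreal_le_epsilon)
   fix e :: real assume "0 < e"
   then obtain n where n: "norm (\<Sum>i. r (i + n)) < e" using suminf_exist_split[OF _ sr] by blast
   have "(\<Sum>k. ?f (D (k + n))) = ennreal (\<Sum>k. r (k + n))"
    unfolding r(1) using r(2) sr by (intro suminf_ennreal2) (auto simp: summable_iff_shift)
   also have "... <= ennreal e" using n by (intro ennreal_leI) auto
   finally have "?f (X - F) <= ?f (Y n) + ennreal e" using b[of n] by (meson add_left_mono order_trans)
   then have "?f (F Int X) + ?f (X - F) <= ?f (F Int X) + (?f (Y n) + ennreal e)" by (rule add_left_mono)
   also have "... <= ?f X + ennreal e" using a[of n] by (simp add: add.assoc[symmetric] add_right_mono)
   finally show "?f (F Int X) + ?f (X - F) <= ?f X + ennreal e" .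
  qed
 qed
 moreover have "?f X <= ?f (F Int X) + ?f (X - F)" for X
 proof -
  have "F Int X \<union> (X - F) = X" by blast
  then show ?thesis using hausdorff1_outer_Un[of "F Int X" "X - F"] by simp
 qed
 ultimately have "?f (F Int X) + ?f ((UNIV - F) Int X) = ?f X" for X
  by (metis antisym Compl_eq_Diff_UNIV Diff_eq Int_commute)
 then show ?thesis by (simp add: lambda_system_def)
qed

lemma sets_hausdorff1 [simp, measurable_cong]: "sets hausdorff1 = sets borel"
proof -
 have "sigma_sets UNIV (sets (borel :: 'a measure)) = sets borel"
  using sets.sigma_sets_eq[of "borel :: 'a measure"] by simp
 then show ?thesis by (simp add: hausdorff1_def sets_measure_of_conv)
qed

lemma space_hausdorff1 [simp]: "space hausdorff1 = UNIV"
 by (simp add: hausdorff1_def space_measure_of_conv)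

lemma emeasure_hausdorff1:
 fixes E :: "'a::metric_space set"
 assumes E: "E : sets borel"
 shows "emeasure hausdorff1 E = hausdorff1_outer E"
proof -
 let ?f = "hausdorff1_outer :: 'a set => ennreal"
 let ?L = "lambda_system UNIV (Pow UNIV) ?f"
 interpret S: sigma_algebra "UNIV :: 'a set" "Pow UNIV" by (rule sigma_algebra_Pow)
 have "outer_measure_space (Pow UNIV) ?f"
  unfolding outer_measure_space_def positive_def increasing_def countably_subadditive_def
  by (auto simp: hausdorff1_outer_empty hausdorff1_outer_mono intro: hausdorff1_outer_subadditive)
 then have ms: "measure_space UNIV ?L ?f" by (rule S.caratheodory_lemma)
 then interpret L: sigma_algebra UNIV ?L by (simp add: measure_space_def)
 have "sets borel = sigma_sets UNIV (Collect closed :: 'a set set)"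
  by (subst borel_eq_closed) simp
 also have "... \<subseteq> ?L"
 proof (rule L.sigma_sets_subset, rule subsetI)
  fix F :: "'a set" assume "F : Collect closed"
  then show "F : ?L" using closed_lambda_system by blast
 qed
 finally have sub: "sets borel \<subseteq> ?L" .
 have "countably_additive (sets borel) ?f"
  using ms sub unfolding measure_space_def countably_additive_def by (meson subset_trans subsetD)
 then show ?thesis
  unfolding hausdorff1_def hausdorff1_outer_def[abs_def, symmetric] using E
  by (intro emeasure_measure_of_sigma)
    (auto simp: positive_def hausdorff1_outer_empty intro: sets.sigma_algebra_axioms[of borel, simplified])
qed

lemma hausdorff1_outer_Lipschitz:
 fixes f :: "'a::metric_space => 'b::metric_space"
 assumes L: "0 < L" "!!x y. dist (f x) (f y) <= L * dist x y"
 shows "hausdorff1_outer (f ` E) <= ennreal L * hausdorff1_outer E"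
 unfolding hausdorff1_outer_def[of "f ` E"]
proof (rule SUP_least)
 fix \<delta> :: real assume "\<delta> : {0<..}"
 then have \<delta>: "0 < \<delta>" by simp
 have "inverse (ennreal L) * hausdorff1_pre \<delta> (f ` E) <= hausdorff1_pre (\<delta> / L) E"
  unfolding hausdorff1_pre_def[of _ E]
 proof (rule INF_greatest, safe)
  fix C :: "nat => 'a set" assume C: "E \<subseteq> (\<Union>n. C n)" "\<forall>n. bounded (C n) & diameter (C n) <= \<delta> / L"
  have ds: "dist (f x) (f y) <= L * diameter (C n)" if "x : C n" "y : C n" for x y n
  proof -
   have "dist x y <= diameter (C n)" using C(2) that by (intro diameter_bounded_bound) auto
   then show ?thesis using L(2)[of x y] L(1) by (meson less_imp_le mult_left_mono order_trans)
  qed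
  have dm: "diameter (f ` C n) <= L * diameter (C n)" for n
  proof (cases "C n = {}")
   case False
   then show ?thesis using ds by (auto simp: diameter_def[of "f ` C n"] intro!: cSUP_least)
  qed simp
  have bd: "bounded (f ` C n)" for n
   unfolding bounded_two_points using ds by blast
  have "hausdorff1_pre \<delta> (f ` E) <= (\<Sum>n. ennreal (diameter (f ` C n)))"
  proof (rule hausdorff1_pre_le[OF _ bd])
   show "f ` E \<subseteq> (\<Union>n. f ` C n)" using C(1) by blast
   show "diameter (f ` C n) <= \<delta>" for n
   proof -
    have "L * diameter (C n) <= L * (\<delta> / L)" using C(2) L(1) by (intro mult_left_mono) auto
    then show ?thesis using dm[of n] L(1) by simp
   qed
  qed
  also have "... <= (\<Sum>n. ennreal L * ennreal (diameter (C n)))"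
   using dm L(1) C(2) by (intro suminf_le) (auto simp: ennreal_mult'[symmetric] diameter_ge_0 intro!: ennreal_leI)
  also have "... = ennreal L * (\<Sum>n. ennreal (diameter (C n)))" by simp
  finally have "inverse (ennreal L) * hausdorff1_pre \<delta> (f ` E) <= inverse (ennreal L) * (ennreal L * (\<Sum>n. ennreal (diameter (C n))))"
   by (rule mult_left_mono) simp
  also have "... = (\<Sum>n. ennreal (diameter (C n)))"
   using L(1) by (simp add: mult.assoc[symmetric] inverse_ennreal ennreal_mult[symmetric] del: ennreal_suminf_cmult)
  finally show "inverse (ennreal L) * hausdorff1_pre \<delta> (f ` E) <= (\<Sum>n. ennreal (diameter (C n)))" .
 qed
 also have "... <= hausdorff1_outer E" using \<delta> L(1) by (intro hausdorff1_pre_le_outer) simp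
 finally have "ennreal L * (inverse (ennreal L) * hausdorff1_pre \<delta> (f ` E)) <= ennreal L * hausdorff1_outer E"
  by (rule mult_left_mono) simp
 then show "hausdorff1_pre \<delta> (f ` E) <= ennreal L * hausdorff1_outer E"
  using L(1) by (simp add: mult.assoc[symmetric] inverse_ennreal ennreal_mult[symmetric])
qed

lemma hausdorff1_outer_interval:
 fixes a :: real
 assumes "0 < a"
 shows "hausdorff1_outer {0..a} <= ennreal a"
 unfolding hausdorff1_outer_def
proof (rule SUP_least)
 fix \<delta> :: real assume "\<delta> : {0<..}"
 then have \<delta>: "0 < \<delta>" by simp
 obtain N where N: "a / \<delta> < real N" using reals_Archimedean2 by blast
 have "0 < a / \<delta>" using \<delta> assms by simp
 then have N0: "0 < N" using N by (metis of_nat_0 gr_zeroI less_asym)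
 have aN: "a / real N <= \<delta>" using N \<delta> N0 by (simp add: field_simps)
 define C where "C n = (if n < N then {a * real n / real N..a * real (Suc n) / real N} else {})" for n
 have d: "diameter (C n) = (if n < N then a / real N else 0)" for n
 proof -
  have "a * real n / real N <= a * real (Suc n) / real N"
   using assms by (intro divide_right_mono mult_left_mono) auto
  moreover have "a * real (Suc n) / real N - a * real n / real N = a / real N"
   by (simp add: diff_divide_distrib[symmetric] algebra_simps)
  ultimately show ?thesis by (simp add: C_def diameter_closed_interval)
 qed
 have "hausdorff1_pre \<delta> {0..a} <= (\<Sum>n. ennreal (diameter (C n)))"
 proof (rule hausdorff1_pre_le)
  show "{0..a} \<subseteq> (\<Union>n. C n)"
  proof
   fix x assume x: "x : {0..a}"
   show "x : (\<Union>n. C n)"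
   proof (cases "x = a")
    case True
    have "x : C (N - 1)" using N0 True assms by (auto simp: C_def field_simps)
    then show ?thesis by blast
   next
    case False
    define n where "n = nat \<lfloor>x * real N / a\<rfloor>"
    have nn: "0 <= x * real N / a" using x assms by simp
    have n: "real n <= x * real N / a" "x * real N / a < real (Suc n)"
    unfolding n_def using nn by linarith+
    have "x * real N / a < real N" using False x assms N0 by (simp add: field_simps)
    then have "n < N" using n(1) by linarith
    then have "x : C n" using n assms N0 by (auto simp: C_def field_simps)
    then show ?thesis by blast
   qed
  qed
  show "bounded (C n)" for n by (simp add: C_def)
  show "diameter (C n) <= \<delta>" for n unfolding d using aN \<delta> by simp
 qed
 also have "... = (\<Sum>n<N. ennreal (diameter (C n)))"
  by (rule suminf_finite) (auto simp: d)
 also have "... = ennreal a" using N0 assms by (simp add: d ennreal_of_nat_eq_real_of_nat ennreal_mult[symmetric])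
 finally show "hausdorff1_pre \<delta> {0..a} <= ennreal a" .
qed

lemma hausdorff1_outer_circle: "hausdorff1_outer (sphere (0 :: real ^ 2) 1) <= ennreal (2 * pi)"
proof -
 define \<gamma> :: "real => real ^ 2" where "\<gamma> t = vector [cos t, sin t]" for t
 have "dist (\<gamma> s) (\<gamma> t) <= 1 * dist s t" for s t
 proof -
  have "(dist (\<gamma> s) (\<gamma> t))\<^sup>2 = (cos s - cos t)\<^sup>2 + (sin s - sin t)\<^sup>2"
   by (simp add: \<gamma>_def dist_norm norm_vec_def L2_set_def sum_2 vector_2)
  also have "... = 2 - 2 * cos (s - t)"
   using sin_cos_squared_add[of s] sin_cos_squared_add[of t] by (simp add: cos_diff power2_eq_square algebra_simps)
  also have "... = (2 * sin ((s - t) / 2))\<^sup>2"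
  proof -
   have "2 * ((s - t) / 2) = s - t" by simp
   then have "cos (s - t) = 1 - 2 * (sin ((s - t) / 2))\<^sup>2"
    using cos_double_sin[of "(s - t) / 2"] by (simp only:)
   then show ?thesis by (simp add: power_mult_distrib)
  qed
  also have "... <= (s - t)\<^sup>2"
  proof -
   have "\<bar>sin ((s - t) / 2)\<bar> <= \<bar>(s - t) / 2\<bar>" by (rule abs_sin_x_le_abs_x)
   then have "\<bar>2 * sin ((s - t) / 2)\<bar> <= \<bar>s - t\<bar>" by (simp add: abs_mult)
   then show ?thesis by (simp only: abs_le_square_iff)
  qed
  finally show ?thesis by (simp add: dist_real_def abs_le_square_iff[symmetric])
 qed
 from hausdorff1_outer_Lipschitz[OF zero_less_one this, of "{0..2 * pi}"]
 have "hausdorff1_outer (\<gamma> ` {0..2 * pi}) <= ennreal (2 * pi)"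
  using hausdorff1_outer_interval[of "2 * pi"] by simp
 moreover have "sphere 0 1 \<subseteq> \<gamma> ` {0..2 * pi}"
 proof
  fix x :: "real ^ 2" assume "x : sphere 0 1"
  then have "(x $ 1)\<^sup>2 + (x $ 2)\<^sup>2 = 1" by (simp add: norm_vec_def L2_set_def sum_2)
  then obtain t where t: "0 <= t" "t < 2 * pi" "x $ 1 = cos t" "x $ 2 = sin t" using sincos_total_2pi by blast
  then have "x = \<gamma> t" by (simp add: \<gamma>_def vec_eq_iff forall_2)
  then show "x : \<gamma> ` {0..2 * pi}" using t by auto
 qed
 ultimately show ?thesis using hausdorff1_outer_mono order_trans by blast
qed

section \<open>Arc length measure on the unit circle\<close>

text \<open>Arc length of a subset of the unit circle is twice the area of the cone over it. Described in
 this way, integration in polar coordinates is a matter of scaling.\<close>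

definition circle_measure :: "(real ^ 2) measure" where
 "circle_measure = distr (density lborel (%x. 2 * indicator (ball 0 1) x)) (restrict_space borel (cball 0 1)) sgn"

lemma sgn_borel [measurable]: "(sgn :: real ^ 2 => real ^ 2) : borel_measurable borel"
 unfolding sgn_div_norm by measurable

lemma norm_sgn_le: "norm (sgn x) <= 1" for x :: "'a::real_normed_vector"
 by (simp add: norm_sgn)

lemma sgn_restrict [measurable]: "(sgn :: real ^ 2 => real ^ 2) : borel \<rightarrow>\<^sub>M restrict_space borel (cball 0 1)"
 by (rule measurable_restrict_space2) (auto simp: norm_sgn_le)

lemma cone_density_borel [measurable, simp]:
 "(%x :: real ^ 2. 2 * indicator (ball 0 1) x :: ennreal) : borel_measurable borel"
 by (intro borel_measurable_times_ennreal borel_measurable_indicator borel_measurable_const) (auto simp: borel_open)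

lemma sets_circle_measure [simp]: "sets circle_measure = borel_on (cball 0 1)"
 by (simp add: circle_measure_def)

lemma space_circle_measure [simp]: "space circle_measure = cball 0 1"
 by (simp add: circle_measure_def space_restrict_space)

lemma emeasure_circle_measure:
 assumes "B : borel_on (cball 0 1)"
 shows "emeasure circle_measure B = 2 * emeasure lborel (sgn -` B Int ball 0 1)"
proof -
 have B: "B : sets borel" using assms by (simp add: borel_on_iff)
 then have m: "sgn -` B : sets borel" using measurable_sets[OF sgn_borel, of B] by simp
 have "emeasure circle_measure B = emeasure (density lborel (%x. 2 * indicator (ball 0 1) x)) (sgn -` B)"
  unfolding circle_measure_def using assms by (subst emeasure_distr) auto
 also have "... = (\<integral>\<^sup>+x. 2 * indicator (ball 0 1) x * indicator (sgn -` B) x \<partial>lborel)"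
  using m by (subst emeasure_density) auto
 also have "... = (\<integral>\<^sup>+x. 2 * indicator (sgn -` B Int ball 0 1) x \<partial>lborel)"
  by (intro nn_integral_cong) (auto simp: indicator_def)
 also have "... = 2 * emeasure lborel (sgn -` B Int ball 0 1)"
  using m by (subst nn_integral_cmult) (auto simp: borel_open intro!: borel_measurable_indicator)
 finally show ?thesis .
qed

lemma finite_circle_measure: "finite_measure circle_measure"
proof
 have "emeasure lborel (sgn -` cball 0 1 Int ball 0 1 :: (real ^ 2) set) <= emeasure lborel (ball 0 1 :: (real ^ 2) set)"
  by (rule emeasure_mono) auto
 also have "... < \<infinity>" by (rule emeasure_bounded_finite) simp
 finally show "emeasure circle_measure (space circle_measure) ~= \<infinity>"
  by (subst emeasure_circle_measure) (auto simp: borel_on_iff ennreal_mult_eq_top_iff)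
qed

lemma circle_measure_off_sphere: "emeasure circle_measure (cball 0 1 - sphere 0 1) = 0"
proof -
 have "sgn -` (cball 0 1 - sphere 0 1) Int ball 0 1 \<subseteq> {0 :: real ^ 2}"
  by (auto simp: norm_sgn split: if_splits)
 then have "emeasure lborel (sgn -` (cball 0 1 - sphere 0 1) Int ball 0 1 :: (real ^ 2) set) = 0"
  by (rule emeasure_eq_0[rotated 2]) auto
 then show ?thesis by (subst emeasure_circle_measure) (auto simp: borel_on_iff)
qed

lemma AE_circle_measure: "AE y in circle_measure. norm y = 1"
 by (rule AE_I'[of "cball 0 1 - sphere 0 1"])
   (auto simp: null_sets_def circle_measure_off_sphere borel_on_iff)

text \<open>Relative to an orthonormal basis \<open>e, e'\<close> with \<open>e\<close> in the arc \<open>C\<close>, the slopes of the points of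
 \<open>C\<close> differ by at most the diameter times a factor close to 1, so the cone over \<open>C\<close> lies in a
 triangle with one vertex at the origin, height 1 and accordingly small base.\<close>

lemma cone_area:
 fixes C :: "(real ^ 2) set"
 assumes C: "bounded C" "diameter C <= \<delta>" and \<delta>: "0 < \<delta>" "\<delta> < 1"
 obtains T where "T : sets borel" "{x : ball 0 1. sgn x : C Int sphere 0 1} \<subseteq> T"
  "emeasure lborel T <= ennreal (diameter C / (2 * (1 - \<delta>\<^sup>2 / 2)\<^sup>2))"
proof (cases "C Int sphere 0 1 = {}")
 case True
 then show ?thesis by (intro that[of "{}"]) auto
next
 case False
 then obtain e where e: "e : C" "norm e = 1" by auto
 define e' :: "real ^ 2" where "e' = vector [- e $ 2, e $ 1]"
 define \<kappa> where "\<kappa> = 1 - \<delta>\<^sup>2 / 2"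
 have "\<delta>\<^sup>2 < 1" using \<delta> by (simp add: power_less_one_iff)
 then have \<kappa>: "0 < \<kappa>" by (simp add: \<kappa>_def)
 define L where "L = diameter C / \<kappa>\<^sup>2"
 have L0: "0 <= L" using diameter_ge_0[OF C(1)] by (simp add: L_def)
 have e2: "(e $ 1)\<^sup>2 + (e $ 2)\<^sup>2 = 1" using e(2) by (simp add: norm_vec_def L2_set_def sum_2)
 define q where "q y = (y \<bullet> e') / (y \<bullet> e)" for y
 have in2: "x \<bullet> y = x $ 1 * y $ 1 + x $ 2 * y $ 2" for x y :: "real ^ 2" by (simp add: inner_vec_def sum_2)
 have e': "e' $ 1 = - e $ 2" "e' $ 2 = e $ 1" by (simp_all add: e'_def)
 have near: "\<kappa> <= y \<bullet> e" if "y : C" "norm y = 1" for y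
 proof -
  have "dist y e <= \<delta>" using diameter_bounded_bound[OF C(1) that(1) e(1)] C(2) by linarith
  then have "(norm (y - e))\<^sup>2 <= \<delta>\<^sup>2" by (intro power_mono) (auto simp: dist_norm)
  moreover have "(norm (y - e))\<^sup>2 = 2 - 2 * (y \<bullet> e)"
   using that(2) e(2) by (simp add: power2_norm_eq_inner inner_diff_left inner_diff_right inner_commute norm_eq_1)
  ultimately show ?thesis by (simp add: \<kappa>_def)
 qed
 have slope: "q y - q z <= L" if y: "y : C" "norm y = 1" and z: "z : C" "norm z = 1" for y z
 proof -
  have p: "\<kappa> <= y \<bullet> e" "\<kappa> <= z \<bullet> e" using near y z by auto
  have "q y - q z = ((y \<bullet> e') * (z \<bullet> e) - (z \<bullet> e') * (y \<bullet> e)) / ((y \<bullet> e) * (z \<bullet> e))"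
   using p \<kappa> by (simp add: q_def diff_frac_eq)
  also have "(y \<bullet> e') * (z \<bullet> e) - (z \<bullet> e') * (y \<bullet> e) = (z $ 1 * y $ 2 - z $ 2 * y $ 1) * ((e $ 1)\<^sup>2 + (e $ 2)\<^sup>2)"
   by (simp add: in2 e' power2_eq_square algebra_simps)
  also have "... = vector [- z $ 2, z $ 1] \<bullet> (y - z)"
   by (simp add: e2 in2 algebra_simps)
  finally have "q y - q z = (vector [- z $ 2, z $ 1] \<bullet> (y - z)) / ((y \<bullet> e) * (z \<bullet> e))" .
  also have "... <= diameter C / ((y \<bullet> e) * (z \<bullet> e))"
  proof (rule divide_right_mono)
   have "norm (vector [- z $ 2, z $ 1] :: real ^ 2) = norm z"
    by (simp add: norm_vec_def L2_set_def sum_2 add.commute)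
   then have "vector [- z $ 2, z $ 1] \<bullet> (y - z) <= norm (y - z)"
    using norm_cauchy_schwarz[of "vector [- z $ 2, z $ 1] :: real ^ 2" "y - z"] z(2) by simp
   also have "... <= diameter C" using diameter_bounded_bound[OF C(1) y(1) z(1)] by (simp add: dist_norm)
   finally show "vector [- z $ 2, z $ 1] \<bullet> (y - z) <= diameter C" .
   show "0 <= (y \<bullet> e) * (z \<bullet> e)" using p \<kappa> by simp
  qed
  also have "... <= diameter C / \<kappa>\<^sup>2"
   using p \<kappa> diameter_ge_0[OF C(1)] by (intro divide_left_mono) (auto simp: power2_eq_square intro!: mult_mono)
  finally show ?thesis by (simp add: L_def)
 qed
 define m where "m = Inf (q ` (C Int sphere 0 1))"
 have qm: "m <= q y" "q y <= m + L" if y: "y : C" "norm y = 1" for y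
 proof -
  have bb: "bdd_below (q ` (C Int sphere 0 1))"
   using slope[OF e] by (intro bdd_belowI[of _ "q e - L"]) (auto simp: algebra_simps)
  show "m <= q y" unfolding m_def using y by (intro cInf_lower bb) auto
  have "q y - L <= m" unfolding m_def
  proof (rule cInf_greatest)
   show "q ` (C Int sphere 0 1) ~= {}" using False by simp
   fix r assume "r : q ` (C Int sphere 0 1)"
   then show "q y - L <= r" using slope[OF y] by (auto simp: algebra_simps)
  qed
  then show "q y <= m + L" by simp
 qed
 define P where "P = e + m *\<^sub>R e'"
 define Q where "Q = e + (m + L) *\<^sub>R e'"
 show ?thesis
 proof (rule that[of "convex hull {0, P, Q}"])
  have cpt: "compact (convex hull {0, P, Q})" by (intro compact_convex_hull finite_imp_compact) auto
  then show "convex hull {0, P, Q} : sets borel" by (intro borel_closed compact_imp_closed)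
  have "measure lborel (convex hull {0, P, Q}) = \<bar>Q $ 1 * P $ 2 - P $ 1 * Q $ 2\<bar> / 2"
   by (subst content_triangle) simp
  also have "Q $ 1 * P $ 2 - P $ 1 * Q $ 2 = - L * ((e $ 1)\<^sup>2 + (e $ 2)\<^sup>2)"
   by (simp add: P_def Q_def e' power2_eq_square algebra_simps)
  finally have "measure lborel (convex hull {0, P, Q}) = L / 2" using L0 by (simp add: e2)
  moreover have "emeasure lborel (convex hull {0, P, Q}) = ennreal (measure lborel (convex hull {0, P, Q}))"
   using emeasure_bounded_finite[OF compact_imp_bounded[OF cpt]] by (intro emeasure_eq_ennreal_measure) auto
  ultimately have "emeasure lborel (convex hull {0, P, Q}) = ennreal (L / 2)" by (simp only:)
  then show "emeasure lborel (convex hull {0, P, Q}) <= ennreal (diameter C / (2 * (1 - \<delta>\<^sup>2 / 2)\<^sup>2))"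
   by (simp add: L_def \<kappa>_def mult.commute)
  show "{x : ball 0 1. sgn x : C Int sphere 0 1} \<subseteq> convex hull {0, P, Q}"
  proof safe
   fix x :: "real ^ 2" assume x: "x : ball 0 1" "sgn x : C" "sgn x : sphere 0 1"
   define y where "y = sgn x"
   have y: "y : C" "norm y = 1" using x by (auto simp: y_def)
   define r where "r = norm x"
   have xr: "x = r *\<^sub>R y" by (cases "x = 0") (simp_all add: r_def y_def sgn_div_norm)
   have r: "0 <= r" "r < 1" using x by (auto simp: r_def)
   define p where "p = r * (y \<bullet> e)"
   have ye: "\<kappa> <= y \<bullet> e" "y \<bullet> e <= 1" using near[OF y] norm_cauchy_schwarz[of y e] y e by auto
   have p: "0 <= p" "p <= 1" using r ye \<kappa> by (auto simp: p_def intro!: mult_nonneg_nonneg mult_le_one)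
   define t where "t = (if L = 0 then 0 else (q y - m) / L)"
   have t: "0 <= t" "t <= 1" "q y = m + t * L"
    using qm[OF y] L0 by (auto simp: t_def divide_le_eq)
   have dec: "y = (y \<bullet> e) *\<^sub>R (e + q y *\<^sub>R e')"
   proof -
    have "y \<bullet> e ~= 0" using ye \<kappa> by auto
    then have "(y \<bullet> e) *\<^sub>R (e + q y *\<^sub>R e') = (y \<bullet> e) *\<^sub>R e + (y \<bullet> e') *\<^sub>R e'"
    by (simp add: q_def scaleR_add_right)
    also have "... = ((e $ 1)\<^sup>2 + (e $ 2)\<^sup>2) *\<^sub>R y"
    by (simp add: vec_eq_iff forall_2 in2 e' power2_eq_square algebra_simps)
    finally show ?thesis by (simp add: e2)
   qed
   have "x = (r * (y \<bullet> e)) *\<^sub>R (e + q y *\<^sub>R e')" using xr dec by (metis scaleR_scaleR)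
   then have "x = (1 - p) *\<^sub>R 0 + (p * (1 - t)) *\<^sub>R P + (p * t) *\<^sub>R Q"
    by (simp add: p_def P_def Q_def t(3) algebra_simps)
   moreover have "0 <= 1 - p" "0 <= p * (1 - t)" "0 <= p * t" "(1 - p) + p * (1 - t) + p * t = 1"
    using p t by (simp_all add: mult_nonneg_nonneg, simp add: right_diff_distrib)
   ultimately show "x : convex hull {0, P, Q}" unfolding convex_hull_3 by blast
  qed
 qed
qed

lemma circle_measure_le_hausdorff1:
 assumes B: "B : sets borel" "B \<subseteq> sphere 0 1"
 shows "emeasure circle_measure B <= hausdorff1_outer B"
proof -
 interpret finite_measure circle_measure by (rule finite_circle_measure)
 have Bon: "B : borel_on (cball 0 1)" using B by (auto simp: borel_on_iff)
 define r where "r = measure circle_measure B"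
 have r: "emeasure circle_measure B = ennreal r" "0 <= r" by (auto simp: r_def emeasure_eq_measure)
 have step: "ennreal ((1 - \<delta>\<^sup>2 / 2)\<^sup>2 * r) <= hausdorff1_outer B" if \<delta>: "0 < \<delta>" "\<delta> < 1" for \<delta> :: real
 proof -
  define \<kappa> where "\<kappa> = 1 - \<delta>\<^sup>2 / 2"
  have "\<delta>\<^sup>2 < 1" using \<delta> by (simp add: power_less_one_iff)
  then have \<kappa>: "0 < \<kappa>" by (simp add: \<kappa>_def)
  have "ennreal (\<kappa>\<^sup>2 * r) <= hausdorff1_pre \<delta> B"
   unfolding hausdorff1_pre_def
  proof (rule INF_greatest, safe)
   fix C :: "nat => (real ^ 2) set"
   assume C: "B \<subseteq> (\<Union>n. C n)" "\<forall>n. bounded (C n) & diameter (C n) <= \<delta>"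
   define good where "good n T \<longleftrightarrow> T : sets borel & {x : ball 0 1. sgn x : C n Int sphere 0 1} \<subseteq> T
    & emeasure lborel T <= ennreal (diameter (C n) / (2 * \<kappa>\<^sup>2))" for n and T :: "(real ^ 2) set"
   have "\<exists>T. good n T" for n
   proof -
    have "bounded (C n)" "diameter (C n) <= \<delta>" using C(2) by auto
    then obtain T where "T : sets borel" "{x : ball 0 1. sgn x : C n Int sphere 0 1} \<subseteq> T"
    "emeasure lborel T <= ennreal (diameter (C n) / (2 * (1 - \<delta>\<^sup>2 / 2)\<^sup>2))"
    by (rule cone_area[OF _ _ \<delta>])
    then have "good n T" unfolding good_def \<kappa>_def by (intro conjI)
    then show ?thesis by blast
   qed
   then obtain T where "!!n. good n (T n)" by metis
   then have T: "T n : sets borel" "{x : ball 0 1. sgn x : C n Int sphere 0 1} \<subseteq> T n"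
    "emeasure lborel (T n) <= ennreal (diameter (C n) / (2 * \<kappa>\<^sup>2))" for n
    unfolding good_def by blast+
   have "emeasure lborel (sgn -` B Int ball 0 1) <= emeasure lborel (\<Union>n. T n)"
   proof (rule emeasure_mono)
    show "sgn -` B Int ball 0 1 \<subseteq> (\<Union>n. T n)"
    proof
    fix x assume x: "x : sgn -` B Int ball 0 1"
    then obtain n where "sgn x : C n" using C(1) by auto
    moreover have "sgn x : sphere 0 1" using x B(2) by blast
    ultimately have "x : T n" using x by (intro subsetD[OF T(2)]) auto
    then show "x : (\<Union>n. T n)" by blast
    qed
   qed (use T(1) in auto)
   also have "... <= (\<Sum>n. emeasure lborel (T n))"
    by (rule emeasure_subadditive_countably) (use T(1) in auto)
   also have "... <= (\<Sum>n. ennreal (1 / (2 * \<kappa>\<^sup>2)) * ennreal (diameter (C n)))"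
    using T(3) C(2) by (intro suminf_le) (auto simp: ennreal_mult[symmetric] diameter_ge_0)
   also have "... = ennreal (1 / (2 * \<kappa>\<^sup>2)) * (\<Sum>n. ennreal (diameter (C n)))" by simp
   finally have "ennreal (2 * \<kappa>\<^sup>2) * emeasure lborel (sgn -` B Int ball 0 1)
    <= ennreal (2 * \<kappa>\<^sup>2) * (ennreal (1 / (2 * \<kappa>\<^sup>2)) * (\<Sum>n. ennreal (diameter (C n))))"
    by (rule mult_left_mono) simp
   also have "... = (\<Sum>n. ennreal (diameter (C n)))"
    using \<kappa> by (simp add: mult.assoc[symmetric] ennreal_mult[symmetric] del: ennreal_suminf_cmult)
   also have "ennreal (2 * \<kappa>\<^sup>2) * emeasure lborel (sgn -` B Int ball 0 1) = ennreal (\<kappa>\<^sup>2) * emeasure circle_measure B"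
    using \<kappa> by (simp add: emeasure_circle_measure[OF Bon] ennreal_mult mult_ac)
   also have "... = ennreal (\<kappa>\<^sup>2 * r)" using r by (simp add: ennreal_mult)
   finally show "ennreal (\<kappa>\<^sup>2 * r) <= (\<Sum>n. ennreal (diameter (C n)))" .
  qed
  also have "... <= hausdorff1_outer B" by (rule hausdorff1_pre_le_outer[OF \<delta>(1)])
  finally show ?thesis by (simp add: \<kappa>_def)
 qed
 have "(%n. ennreal ((1 - (1 / real (Suc (Suc n)))\<^sup>2 / 2)\<^sup>2 * r)) \<longlonglongrightarrow> ennreal ((1 - 0\<^sup>2 / 2)\<^sup>2 * r)"
 proof (intro tendsto_ennrealI tendsto_mult tendsto_power tendsto_diff tendsto_divide tendsto_const)
  show "(%n. 1 / real (Suc (Suc n))) \<longlonglongrightarrow> 0"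
   using LIMSEQ_Suc[OF LIMSEQ_inverse_real_of_nat] by (simp add: inverse_eq_divide)
 qed auto
 then have "ennreal ((1 - 0\<^sup>2 / 2)\<^sup>2 * r) <= hausdorff1_outer B"
  by (rule LIMSEQ_le_const2) (auto intro!: exI[of _ 0] step)
 then show ?thesis using r by simp
qed

lemma hausdorff1_circle:
 assumes B: "B : sets borel" "B \<subseteq> sphere 0 1"
 shows "hausdorff1_outer B = emeasure circle_measure B"
proof (rule antisym)
 interpret finite_measure circle_measure by (rule finite_circle_measure)
 let ?S = "sphere 0 1 :: (real ^ 2) set"
 have S: "?S : sets borel" "?S - B : sets borel" using B by auto
 have "emeasure circle_measure ?S = ennreal (2 * pi)"
 proof -
  have eq: "sgn -` ?S Int ball 0 1 = ball 0 1 - {0}" by (auto simp: norm_sgn)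
  have "emeasure lborel (ball 0 1 - {0 :: real ^ 2}) = emeasure lborel (ball 0 1 :: (real ^ 2) set)"
   by (subst emeasure_Diff) auto
  also have "... = ennreal pi" by (simp add: emeasure_ball unit_ball_vol_2)
  finally show ?thesis
   by (subst emeasure_circle_measure) (auto simp: borel_on_iff eq ennreal_mult)
 qed
 moreover have "emeasure circle_measure B + emeasure circle_measure (?S - B) = emeasure circle_measure ?S"
  using B S by (subst plus_emeasure) (auto simp: borel_on_iff Un_absorb1 intro!: arg_cong[of _ _ "emeasure circle_measure"])
 moreover have "hausdorff1_outer B + hausdorff1_outer (?S - B) = hausdorff1_outer ?S"
 proof -
  have "emeasure hausdorff1 B + emeasure hausdorff1 (?S - B) = emeasure hausdorff1 (B \<union> (?S - B))"
   using B S by (intro plus_emeasure) auto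
  moreover have "B \<union> (?S - B) = ?S" using B by auto
  ultimately show ?thesis using B S by (simp add: emeasure_hausdorff1)
 qed
 ultimately have "hausdorff1_outer B + hausdorff1_outer (?S - B) <= emeasure circle_measure B + emeasure circle_measure (?S - B)"
  using hausdorff1_outer_circle by simp
 also have "... <= emeasure circle_measure B + hausdorff1_outer (?S - B)"
  by (intro add_left_mono circle_measure_le_hausdorff1) (use S in auto)
 finally have *: "hausdorff1_outer B + hausdorff1_outer (?S - B) <= emeasure circle_measure B + hausdorff1_outer (?S - B)" .
 have "hausdorff1_outer (?S - B) <= hausdorff1_outer ?S" by (rule hausdorff1_outer_mono) auto
 also have "... < top" using hausdorff1_outer_circle by (auto simp: le_less_trans)
 finally have fin: "hausdorff1_outer (?S - B) < top" .
 show "hausdorff1_outer B <= emeasure circle_measure B"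
  using * fin unfolding add.commute[of _ "hausdorff1_outer (?S - B)"]
  by (subst (asm) ennreal_add_left_cancel_le) auto
 show "emeasure circle_measure B <= hausdorff1_outer B" using circle_measure_le_hausdorff1[OF B] .
qed

text \<open>Arc length on the circle of radius \<open>\<rho>\<close>, transported from the unit circle.\<close>

lemma hausdorff1_sphere:
 fixes \<rho> :: real
 assumes \<rho>: "0 < \<rho>"
 shows "density hausdorff1 (indicator (sphere (0 :: real ^ 2) \<rho>))
    = distr (density circle_measure (%_. ennreal \<rho>)) borel (%y. \<rho> *\<^sub>R y)"
proof (rule measure_eqI)
 show "sets (density hausdorff1 (indicator (sphere (0 :: real ^ 2) \<rho>)))
   = sets (distr (density circle_measure (%_. ennreal \<rho>)) borel (%y. \<rho> *\<^sub>R y))" by simp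
 fix E :: "(real ^ 2) set" assume "E : sets (density hausdorff1 (indicator (sphere 0 \<rho>)))"
 then have E[measurable]: "E : sets borel" by simp
 define B where "B = {y. \<rho> *\<^sub>R y : E} Int sphere 0 1"
 have pre: "{y. \<rho> *\<^sub>R y : E} : sets borel"
  using measurable_sets[of "%y. \<rho> *\<^sub>R y" borel borel E] by (simp add: vimage_def)
 have B: "B : sets borel" "B \<subseteq> sphere 0 1" using pre by (auto simp: B_def)
 have im: "(%y. \<rho> *\<^sub>R y) ` B = E Int sphere 0 \<rho>"
 proof
  show "E Int sphere 0 \<rho> \<subseteq> (%y. \<rho> *\<^sub>R y) ` B"
  proof
   fix x assume x: "x : E Int sphere 0 \<rho>"
   then have "x /\<^sub>R \<rho> : B" "x = \<rho> *\<^sub>R (x /\<^sub>R \<rho>)" using \<rho> by (auto simp: B_def)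
   then show "x : (%y. \<rho> *\<^sub>R y) ` B" by blast
  qed
 qed (use \<rho> in "auto simp: B_def")
 have le: "hausdorff1_outer ((%y. c *\<^sub>R y) ` A) <= ennreal c * hausdorff1_outer A" if "0 < c" for c and A :: "(real ^ 2) set"
  by (rule hausdorff1_outer_Lipschitz) (use that in "auto simp: dist_norm scaleR_diff_right[symmetric]")
 have eq: "hausdorff1_outer ((%y. \<rho> *\<^sub>R y) ` B) = ennreal \<rho> * hausdorff1_outer B"
 proof (rule antisym[OF le[OF \<rho>]])
  have "(%y. inverse \<rho> *\<^sub>R y) ` (%y. \<rho> *\<^sub>R y) ` B = B" using \<rho> by (simp add: image_image)
  then have "hausdorff1_outer B <= ennreal (inverse \<rho>) * hausdorff1_outer ((%y. \<rho> *\<^sub>R y) ` B)"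
   using le[of "inverse \<rho>" "(%y. \<rho> *\<^sub>R y) ` B"] \<rho> by simp
  then have "ennreal \<rho> * hausdorff1_outer B <= ennreal \<rho> * (ennreal (inverse \<rho>) * hausdorff1_outer ((%y. \<rho> *\<^sub>R y) ` B))"
   by (rule mult_left_mono) simp
  then show "ennreal \<rho> * hausdorff1_outer B <= hausdorff1_outer ((%y. \<rho> *\<^sub>R y) ` B)"
   using \<rho> by (simp add: mult.assoc[symmetric] ennreal_mult[symmetric])
 qed
 have "emeasure (density hausdorff1 (indicator (sphere 0 \<rho>))) E = emeasure hausdorff1 (E Int sphere 0 \<rho>)"
 proof -
  have "sphere (0 :: real ^ 2) \<rho> : sets hausdorff1" by (simp add: borel_closed)
  then have "emeasure (density hausdorff1 (indicator (sphere 0 \<rho>))) E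
    = (\<integral>\<^sup>+x. indicator (sphere 0 \<rho>) x * indicator E x \<partial>hausdorff1)"
   by (intro emeasure_density borel_measurable_indicator) auto
  also have "... = (\<integral>\<^sup>+x. indicator (E Int sphere 0 \<rho>) x \<partial>hausdorff1)"
   by (intro nn_integral_cong) (auto simp: indicator_def)
  also have "... = emeasure hausdorff1 (E Int sphere 0 \<rho>)"
   by (intro nn_integral_indicator) (auto simp: borel_closed)
  finally show ?thesis .
 qed
 also have "... = ennreal \<rho> * emeasure circle_measure B"
  using eq hausdorff1_circle[OF B] by (simp add: im emeasure_hausdorff1)
 also have "emeasure circle_measure B = emeasure circle_measure ({y. \<rho> *\<^sub>R y : E} Int cball 0 1)"
  using AE_circle_measure pre B by (intro emeasure_eq_AE) (auto simp: B_def borel_on_iff elim: eventually_mono)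
 also have "ennreal \<rho> * ... = emeasure (density circle_measure (%_. ennreal \<rho>)) ({y. \<rho> *\<^sub>R y : E} Int cball 0 1)"
 proof -
  have "{y. \<rho> *\<^sub>R y : E} Int cball 0 1 : sets circle_measure" using pre by (auto simp: borel_on_iff)
  then show ?thesis by (subst emeasure_density) (auto simp: nn_integral_cmult_indicator)
 qed
 also have "... = emeasure (distr (density circle_measure (%_. ennreal \<rho>)) borel (%y. \<rho> *\<^sub>R y)) E"
 proof -
  have "(%y. \<rho> *\<^sub>R y) : borel_measurable circle_measure"
  proof -
   have "(%y :: real ^ 2. \<rho> *\<^sub>R y) : borel_measurable borel" by measurable
   from measurable_restrict_space1[OF this, of "cball 0 1"] show ?thesis
    by (simp add: measurable_cong_sets[OF sets_circle_measure refl])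
  qed
  then show ?thesis by (subst emeasure_distr) (auto simp: vimage_def)
 qed
 finally show "emeasure (density hausdorff1 (indicator (sphere 0 \<rho>))) E
   = emeasure (distr (density circle_measure (%_. ennreal \<rho>)) borel (%y. \<rho> *\<^sub>R y)) E" .
qed

section \<open>Radial test fields\<close>

lemma inner_sgn_self: "x \<bullet> sgn x = norm (x :: 'a::real_inner)"
 by (cases "x = 0") (simp_all add: sgn_div_norm dot_square_norm power2_eq_square)

lemma norm_sgn_1: "x ~= 0 ==> norm (sgn x) = 1" for x :: "'a::real_normed_vector"
 by (simp add: norm_sgn)

lemma has_derivative_sgn:
 fixes x :: "'a::real_inner"
 assumes "x ~= 0"
 shows "(sgn has_derivative (%v. (v - (sgn x \<bullet> v) *\<^sub>R sgn x) /\<^sub>R norm x)) (at x)"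
proof -
 have n: "(norm has_derivative (%v. sgn x \<bullet> v)) (at x)"
  using has_derivative_norm[OF assms] by (simp add: inner_commute)
 have "((%y. inverse (norm y)) has_derivative (%v. - (inverse (norm x) * (sgn x \<bullet> v) * inverse (norm x)))) (at x)"
  by (rule Deriv.has_derivative_inverse[OF _ n]) (use assms in auto)
 from has_derivative_scaleR[OF this has_derivative_ident]
 show ?thesis
  unfolding sgn_div_norm
  by (rule has_derivative_eq_rhs) (use assms in "auto simp: fun_eq_iff scaleR_diff_right algebra_simps")
qed

text \<open>A function that is constant along rays has a gradient orthogonal to \<open>x\<close>.\<close>

lemma C1_gradient_sgn:
 fixes \<psi> :: "real ^ 'n::finite => real"
 assumes "C1_on UNIV \<psi>"
 obtains E where "C1_gradient (- {0}) (%x. \<psi> (sgn x)) E" "!!x. x ~= 0 ==> E x \<bullet> x = 0"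
proof -
 define D where "D x = (\<chi> i. partial_deriv i \<psi> x)" for x
 have D: "C1_gradient UNIV \<psi> D" unfolding D_def using assms by (rule C1_on_gradient)
 define E where "E x = (D (sgn x) - (D (sgn x) \<bullet> sgn x) *\<^sub>R sgn x) /\<^sub>R norm x" for x
 have "((%x. \<psi> (sgn x)) has_derivative (%v. E x \<bullet> v)) (at x)" if "x ~= 0" for x
 proof -
  have "(\<psi> has_derivative (%v. D (sgn x) \<bullet> v)) (at (sgn x))" using D by (simp add: C1_gradient_def)
  from has_derivative_compose[OF has_derivative_sgn[OF that] this]
  show ?thesis
   by (rule has_derivative_eq_rhs)
    (auto simp: fun_eq_iff E_def inner_diff_left inner_diff_right algebra_simps)
 qed
 moreover have "continuous_on (- {0}) E"
 proof -
  have s: "continuous_on (- {0}) (sgn :: real ^ 'n => real ^ 'n)"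
   unfolding sgn_div_norm by (intro continuous_intros) auto
  have "continuous_on (- {0}) (%x. D (sgn x))"
   by (rule continuous_on_compose2[OF _ s, of UNIV]) (use D in "auto simp: C1_gradient_def")
  with s show ?thesis unfolding E_def by (intro continuous_intros) auto
 qed
 moreover have "E x \<bullet> x = 0" if "x ~= 0" for x
 proof -
  have "(D (sgn x) - (D (sgn x) \<bullet> sgn x) *\<^sub>R sgn x) \<bullet> sgn x = 0"
   using that by (simp add: inner_diff_left dot_square_norm norm_sgn)
  moreover have "x = norm x *\<^sub>R sgn x" using that by (simp add: sgn_div_norm)
  ultimately show ?thesis unfolding E_def by (metis inner_scaleR_left inner_scaleR_right mult_zero_right)
 qed
 ultimately show ?thesis using that[of E] by (auto simp: C1_gradient_def)
qed

lemma C1_gradient_real_norm: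
 assumes "!!t. 0 < t ==> (h has_real_derivative h' t) (at t)" "continuous_on {0<..} h'"
 shows "C1_gradient (- {0}) (%x :: real ^ 'n::finite. h (norm x)) (%x. h' (norm x) *\<^sub>R sgn x)"
 by (rule C1_gradient_compose[OF C1_gradient_norm])
   (use assms in "auto intro: continuous_on_subset")

definition radial_field :: "(real ^ 2 => real) => (real => real) => 2 => real ^ 2 => real" where
 "radial_field \<psi> h i x = \<psi> (sgn x) * (h (norm x) / (norm x)\<^sup>2) * x $ i"

text \<open>The divergence of \<open>\<psi>(x/|x|) h(|x|) x / |x|\<^sup>2\<close> is \<open>\<psi>(x/|x|) h'(|x|) / |x|\<close>.\<close>

lemma radial_field_test:
 assumes \<psi>: "C1_on UNIV \<psi>" and h: "C1_real h h'" and pq: "0 < p" "!!t. t \<notin> {p..q} ==> h t = 0"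
  and \<U>: "{x. p <= norm x & norm x <= q} \<subseteq> \<U>"
 shows "radial_field \<psi> h i : test_functions \<U>"
  and "x ~= 0 ==> (\<Sum>i\<in>UNIV. partial_deriv i (radial_field \<psi> h i) x) = \<psi> (sgn x) * (h' (norm x) / norm x)"
proof -
 obtain E where E: "C1_gradient (- {0}) (%x. \<psi> (sgn x)) E" "!!x. x ~= 0 ==> E x \<bullet> x = 0"
  using C1_gradient_sgn[OF \<psi>] by blast
 define k where "k t = h t / t\<^sup>2" for t
 define k' where "k' t = h' t / t\<^sup>2 - 2 * h t / t ^ 3" for t
 have hd: "(h has_real_derivative h' t) (at t)" "continuous_on UNIV h'" "continuous_on UNIV h" for t
  using h C1_real_continuous[OF h] by (auto simp: C1_real_def)
 have kd: "(k has_real_derivative k' t) (at t)" if "0 < t" for t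
  unfolding k_def k'_def
  by (rule derivative_eq_intros hd refl)+ (use that in "auto simp: field_simps power2_eq_square power3_eq_cube power4_eq_xxxx")
 have kc: "continuous_on {0<..} k'"
  unfolding k'_def using hd(2,3) by (intro continuous_intros) (auto intro: continuous_on_subset)
 let ?a = "%x. \<psi> (sgn x) * k (norm x)"
 let ?Da = "%x. \<psi> (sgn x) *\<^sub>R (k' (norm x) *\<^sub>R sgn x) + k (norm x) *\<^sub>R E x"
 have a: "C1_gradient (- {0}) ?a ?Da"
  by (intro C1_gradient_mult E C1_gradient_real_norm kd kc)
 let ?D = "%i x. ?a x *\<^sub>R axis i 1 + x $ i *\<^sub>R ?Da x"
 have G: "C1_gradient (- {0}) (radial_field \<psi> h i) (?D i)" for i
  using C1_gradient_mult[OF a C1_gradient_coord[of _ i]] by (simp add: radial_field_def[abs_def] k_def)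
 have "C1_on (ball 0 p) (radial_field \<psi> h i)"
  by (rule C1_on_cong_open[OF C1_gradient_C1_on[OF C1_gradient_const[of _ 0]] open_ball])
    (auto simp: radial_field_def pq(2))
 then have "C1_on (- {0} \<union> ball 0 p) (radial_field \<psi> h i)"
  by (intro C1_on_Un C1_gradient_C1_on[OF G]) auto
 moreover have "- {0} \<union> ball 0 p = (UNIV :: (real ^ 2) set)" using pq(1) by auto
 ultimately have C1: "C1_on UNIV (radial_field \<psi> h i)" by simp
 show "radial_field \<psi> h i : test_functions \<U>"
 proof (rule test_functionsI[OF C1 _ \<U>])
  have "{x :: real ^ 2. p <= norm x & norm x <= q} = cball 0 q - ball 0 p" by auto
  then show "compact {x :: real ^ 2. p <= norm x & norm x <= q}" by (simp add: compact_diff)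
  show "radial_field \<psi> h i x = 0" if "x \<notin> {x. p <= norm x & norm x <= q}" for x
   using that pq(2)[of "norm x"] by (auto simp: radial_field_def)
 qed
 assume x: "x ~= 0"
 have "(\<Sum>i\<in>UNIV. partial_deriv i (radial_field \<psi> h i) x) = (\<Sum>i\<in>UNIV. ?D i x $ i)"
  by (intro sum.cong) (use C1_gradient_partial[OF G] x in auto)
 also have "... = 2 * ?a x + ?Da x \<bullet> x"
  by (simp add: sum_2 inner_vec_def axis_def algebra_simps)
 also have "?Da x \<bullet> x = \<psi> (sgn x) * k' (norm x) * norm x"
  using E(2)[OF x] by (simp add: inner_add_left inner_commute[of "sgn x"] inner_sgn_self)
 also have "2 * ?a x + \<psi> (sgn x) * k' (norm x) * norm x = \<psi> (sgn x) * (h' (norm x) / norm x)"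
  using x by (simp add: k_def k'_def field_simps power2_eq_square power3_eq_cube)
 finally show "(\<Sum>i\<in>UNIV. partial_deriv i (radial_field \<psi> h i) x) = \<psi> (sgn x) * (h' (norm x) / norm x)" .
qed

section \<open>Traces on the boundary of the annulus\<close>

lemma open_annulus: "open (annulus r s)"
proof -
 have "annulus r s = ball 0 s - cball 0 r" by (auto simp: annulus_def)
 then show ?thesis by (simp add: open_Diff)
qed

lemma annulus_bounded: "emeasure lborel (annulus r s) < \<infinity>"
proof (rule emeasure_bounded_finite)
 show "bounded (annulus r s)"
  by (rule bounded_subset[of "ball 0 s"]) (auto simp: annulus_def)
qed

text \<open>A function of bounded variation together with a common reference measure \<open>M\<close> for Lebesgue
 measure (density \<open>l\<close>) and its gradient (density \<open>d\<close>).\<close>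

locale bv_density =
 fixes r1 r2 :: real and w l :: "real ^ 2 => real" and M :: "(real ^ 2) measure" and d :: "real ^ 2 => real ^ 2"
 assumes \<rho>: "0 < r1" "r1 < r2"
  and M: "finite_measure M" "sets M = borel_on (annulus r1 r2)"
  and l: "integrable M l" "!!x. 0 <= l x" "density M (%x. ennreal (l x)) = restrict_space lborel (annulus r1 r2)"
  and d: "integrable M d"
  and w: "w : borel_measurable borel" "integrable M (%x. w x * l x)"
  and weak: "!!\<phi> i. \<phi> : test_functions (annulus r1 r2) ==>
   (\<integral>x. w x * partial_deriv i \<phi> x * l x + \<phi> x * d x $ i \<partial>M) = 0"
begin

abbreviation "\<U> \<equiv> annulus r1 r2"

lemma \<U>b: "\<U> : sets borel" by (simp add: borel_open open_annulus)

lemma spM: "space M = \<U>" using sets_eq_imp_space_eq[OF M(2)] by (simp add: space_restrict_space)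

lemma nz: "x : \<U> ==> 0 < norm x" using \<rho> by (auto simp: annulus_def)

lemma borel_M: "f : borel_measurable borel ==> f : borel_measurable M"
 unfolding measurable_cong_sets[OF M(2) refl] by (rule measurable_restrict_space1)

lemma integrable_bounded_mult:
 fixes f b :: "real ^ 2 => real"
 assumes f: "integrable M f" and b: "b : borel_measurable borel" "!!x. x : \<U> ==> \<bar>b x\<bar> <= K"
 shows "integrable M (%x. b x * f x)"
proof (rule Bochner_Integration.integrable_bound[of _ "%x. K * f x"])
 show "(%x. b x * f x) : borel_measurable M"
  using borel_M[OF b(1)] borel_measurable_integrable[OF f] by (rule borel_measurable_times)
 show "AE x in M. norm (b x * f x) <= norm (K * f x)"
  using b(2) by (auto simp: abs_mult spM intro!: AE_I2 mult_right_mono intro: order_trans[OF _ abs_ge_self])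
qed (use f in auto)

lemma compact_closed_annulus: "compact (cball 0 r2 - ball 0 r1 :: (real ^ 2) set)"
 by (simp add: compact_diff)

lemma bounded_on_annulus:
 assumes "continuous_on (cball 0 r2 - ball 0 r1) (b :: real ^ 2 => real)"
 obtains K where "!!x. x : \<U> ==> \<bar>b x\<bar> <= K"
proof -
 have "compact (b ` (cball 0 r2 - ball 0 r1))"
  using assms compact_closed_annulus by (rule compact_continuous_image)
 then obtain K where "\<forall>x\<in>cball 0 r2 - ball 0 r1. \<bar>b x\<bar> <= K"
  by (auto dest!: compact_imp_bounded simp: bounded_iff)
 then show ?thesis by (intro that[of K]) (auto simp: annulus_def)
qed

lemma di: "integrable M (%x. d x $ i)"
 using d by (rule integrable_bounded_linear[OF bounded_linear_vec_nth])

lemma radial_integrable: "integrable M (%x. x \<bullet> d x)"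
proof -
 have "integrable M (%x. x $ i * d x $ i)" for i
 proof (rule integrable_bounded_mult[OF di])
  show "\<bar>x $ i\<bar> <= r2" if "x : \<U>" for x
   using component_le_norm_cart[of x i] that by (auto simp: annulus_def)
 qed simp
 then show ?thesis by (simp add: inner_vec_def sum_2)
qed

definition rad :: "(real => real) => (real => real) => real ^ 2 => real" where
 "rad H H' x = (H' (norm x) / norm x) * (w x * l x) + (H (norm x) / (norm x)\<^sup>2) * (x \<bullet> d x)"

lemma continuous_norm_quotient:
 assumes "continuous_on UNIV (h :: real => real)"
 shows "continuous_on (cball 0 r2 - ball 0 r1) (%x :: real ^ 2. h (norm x) / norm x ^ n)"
  and "(%x :: real ^ 2. h (norm x) / norm x ^ n) : borel_measurable borel"
proof -
 have c: "continuous_on A (%x :: real ^ 2. h (norm x))" for A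
  by (rule continuous_on_compose2[OF assms]) (auto intro!: continuous_intros)
 show "continuous_on (cball 0 r2 - ball 0 r1) (%x :: real ^ 2. h (norm x) / norm x ^ n)"
  using \<rho> by (intro continuous_intros c) auto
 show "(%x :: real ^ 2. h (norm x) / norm x ^ n) : borel_measurable borel"
  by (intro borel_measurable_divide borel_measurable_power borel_measurable_continuous_onI c) (auto intro!: continuous_intros)
qed

lemma integrable_norm_quotient:
 assumes "continuous_on UNIV (h :: real => real)" "integrable M f"
 shows "integrable M (%x. (h (norm x) / norm x ^ n) * f x)"
proof -
 obtain K where "!!x :: real ^ 2. x : \<U> ==> \<bar>h (norm x) / norm x ^ n\<bar> <= K"
  using bounded_on_annulus[OF continuous_norm_quotient(1)[OF assms(1)]] by blast
 then show ?thesis by (rule integrable_bounded_mult[OF assms(2) continuous_norm_quotient(2)[OF assms(1)]])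
qed

lemma integrable_rad:
 assumes "C1_real H H'"
 shows "integrable M (rad H H')"
proof -
 have "continuous_on UNIV H'" using assms by (simp add: C1_real_def)
 from integrable_norm_quotient[OF this w(2), of 1]
  integrable_norm_quotient[OF C1_real_continuous[OF assms] radial_integrable, of 2]
 show ?thesis by (simp add: rad_def[abs_def])
qed

lemma sgn_M: "sgn : M \<rightarrow>\<^sub>M restrict_space borel (cball 0 1)" "sgn : borel_measurable M"
proof -
 show "sgn : borel_measurable M" by (rule borel_M) simp
 then show "sgn : M \<rightarrow>\<^sub>M restrict_space borel (cball 0 1)"
  by (rule measurable_restrict_space2[rotated]) (auto simp: norm_sgn_le)
qed

text \<open>If the cut-off vanishes near both circles, then the integral against a C1 function of the direction
 is the integral against the divergence of a radial test field, hence zero; such functions determine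
 the finite measure on the directions.\<close>

lemma rad_zero_indicator:
 assumes h: "C1_real h h'" and pq: "r1 < p" "q < r2" "!!t. t \<notin> {p..q} ==> h t = 0" and B: "B : sets borel"
 shows "(\<integral>x. indicator B (sgn x) * rad h h' x \<partial>M) = 0"
proof (rule test_functions_determine[OF open_UNIV sgn_M(2) _ integrable_rad[OF h] _ B])
 fix a b :: "real ^ 2" and n
 let ?\<psi> = "box_bump a b n"
 have \<psi>: "C1_on UNIV ?\<psi>" using box_bump_test[of a b UNIV n] by (auto intro: test_function_C1)
 have t: "radial_field ?\<psi> h i : test_functions \<U>" for i
  by (rule radial_field_test(1)[OF \<psi> h _ pq(3)]) (use \<rho> pq in "auto simp: annulus_def")
 have dv: "(\<Sum>i\<in>UNIV. partial_deriv i (radial_field ?\<psi> h i) x) = ?\<psi> (sgn x) * (h' (norm x) / norm x)" if "x : \<U>" for x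
  by (rule radial_field_test(2)[OF \<psi> h _ pq(3), where \<U> = \<U>]) (use \<rho> pq nz[OF that] in "auto simp: annulus_def")
 have i1: "integrable M (%x. w x * partial_deriv i (radial_field ?\<psi> h i) x * l x + radial_field ?\<psi> h i x * d x $ i)" for i
 proof -
  have C: "C1_on UNIV (radial_field ?\<psi> h i)" using t test_function_C1 by blast
  obtain K where K: "!!x. x : \<U> ==> \<bar>partial_deriv i (radial_field ?\<psi> h i) x\<bar> <= K"
   by (rule bounded_on_annulus[of "partial_deriv i (radial_field ?\<psi> h i)"])
    (use C in "auto simp: C1_on_def intro: continuous_on_subset")
  obtain K' where K': "!!x. \<bar>radial_field ?\<psi> h i x\<bar> <= K'" using test_function_bounded[OF t] by blast
  have "integrable M (%x. partial_deriv i (radial_field ?\<psi> h i) x * (w x * l x))"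
   by (rule integrable_bounded_mult[OF w(2) partial_deriv_borel[OF C] K])
  moreover have "integrable M (%x. radial_field ?\<psi> h i x * d x $ i)"
   by (rule integrable_bounded_mult[OF di C1_on_borel[OF C] K'])
  ultimately show ?thesis by (simp add: mult_ac)
 qed
 have "(\<integral>x. ?\<psi> (sgn x) * rad h h' x \<partial>M)
   = (\<integral>x. (\<Sum>i\<in>UNIV. (w x * partial_deriv i (radial_field ?\<psi> h i) x * l x + radial_field ?\<psi> h i x * d x $ i)) \<partial>M)"
 proof (rule Bochner_Integration.integral_cong)
  fix x assume "x : space M"
  then have x: "x : \<U>" by (simp add: spM)
  have "(\<Sum>i\<in>UNIV. (w x * partial_deriv i (radial_field ?\<psi> h i) x * l x + radial_field ?\<psi> h i x * d x $ i))
   = (w x * l x) * (\<Sum>i\<in>UNIV. partial_deriv i (radial_field ?\<psi> h i) x) + (\<Sum>i\<in>UNIV. radial_field ?\<psi> h i x * d x $ i)"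
   by (simp add: sum.distrib sum_distrib_left mult_ac)
  also have "(\<Sum>i\<in>UNIV. radial_field ?\<psi> h i x * d x $ i) = ?\<psi> (sgn x) * (h (norm x) / (norm x)\<^sup>2) * (x \<bullet> d x)"
   by (simp add: radial_field_def inner_vec_def sum_distrib_left sum_divide_distrib mult_ac)
  finally show "?\<psi> (sgn x) * rad h h' x = (\<Sum>i\<in>UNIV. (w x * partial_deriv i (radial_field ?\<psi> h i) x * l x + radial_field ?\<psi> h i x * d x $ i))"
   unfolding dv[OF x] by (simp add: rad_def algebra_simps)
 qed simp
 also have "... = (\<Sum>i\<in>UNIV. (\<integral>x. (w x * partial_deriv i (radial_field ?\<psi> h i) x * l x + radial_field ?\<psi> h i x * d x $ i) \<partial>M))"
  by (rule Bochner_Integration.integral_sum) (rule i1)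
 also have "... = 0" using weak[OF t] by simp
 finally show "(\<integral>x. ?\<psi> (sgn x) * rad h h' x \<partial>M) = 0" .
qed auto

lemma rad_zero:
 assumes h: "C1_real h h'" and pq: "r1 < p" "q < r2" "!!t. t \<notin> {p..q} ==> h t = 0"
  and \<psi>: "\<psi> : borel_measurable borel" "!!y. norm y <= 1 ==> \<bar>\<psi> y\<bar> <= K"
 shows "(\<integral>x. \<psi> (sgn x) * rad h h' x \<partial>M) = 0"
proof -
 have c: "(cball 0 1 :: (real ^ 2) set) : sets borel" by simp
 have \<psi>r: "\<psi> : borel_measurable (restrict_space borel (cball 0 1))" by (rule measurable_restrict_space1[OF \<psi>(1)])
 have "signed_integral (cball 0 1) (%E. 0) \<psi> = (\<integral>x. \<psi> (sgn x) * rad h h' x \<partial>M)"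
 proof (rule signed_integral_image(2)[OF sgn_M(1) integrable_rad[OF h] c _ \<psi>r])
  fix E :: "(real ^ 2) set" assume "E : borel_on (cball 0 1)"
  then have "E : sets borel" by (simp add: borel_on_iff)
  from rad_zero_indicator[OF h pq this] show "0 = (\<integral>x. indicator E (sgn x) * rad h h' x \<partial>M)" by simp
 qed (use \<psi>(2) in auto)
 moreover have "signed_integral (cball 0 1) (%E. 0) \<psi> = (\<integral>x. \<psi> (sgn x) * 0 \<partial>M)"
  by (rule signed_integral_image(2)[OF sgn_M(1) _ c _ \<psi>r]) (use \<psi>(2) in auto)
 ultimately show ?thesis by simp
qed

lemma lborel_cone_null:
 assumes B: "B : borel_on (cball 0 1)" "emeasure circle_measure B = 0"
 shows "AE x in lborel. x : \<U> --> sgn x \<notin> B"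
proof -
 have "emeasure lborel (sgn -` B Int ball 0 1) = 0"
  using B by (simp add: emeasure_circle_measure)
 moreover have Bb: "sgn -` B : sets borel" using measurable_sets[OF sgn_borel, of B] B by (simp add: borel_on_iff)
 ultimately have "sgn -` B Int ball 0 1 : null_sets lborel" by (auto simp: null_sets_def)
 then have N: "negligible (sgn -` B Int ball 0 1)" by (simp add: negligible_iff_null_sets null_sets_completionI)
 have "negligible ((%x. (r2 + 1) *\<^sub>R x) ` (sgn -` B Int ball 0 1))"
  by (rule negligible_differentiable_image_negligible[OF _ N])
    (auto simp: differentiable_on_def intro!: bounded_linear_imp_differentiable bounded_linear_scaleR_right)
 then have "(%x. (r2 + 1) *\<^sub>R x) ` (sgn -` B Int ball 0 1) : null_sets lebesgue" by (simp add: negligible_iff_null_sets)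
 then have "AE x in lebesgue. x \<notin> (%x. (r2 + 1) *\<^sub>R x) ` (sgn -` B Int ball 0 1)" by (rule AE_not_in)
 then have "AE x in lborel. x \<notin> (%x. (r2 + 1) *\<^sub>R x) ` (sgn -` B Int ball 0 1)" by (simp only: AE_lebesgue_iff)
 then show ?thesis
 proof eventually_elim
  case (elim x)
  show ?case
  proof (intro impI notI)
   assume x: "x : \<U>" "sgn x : B"
   have p: "0 < r2 + 1" using \<rho> by linarith
   have "x /\<^sub>R (r2 + 1) : sgn -` B Int ball 0 1"
    using x p by (auto simp: annulus_def sgn_scaleR field_simps)
   moreover have "x = (r2 + 1) *\<^sub>R (x /\<^sub>R (r2 + 1))" using p by simp
   ultimately show False using elim by blast
  qed
 qed
qed

lemma AE_l_zero:
 assumes "AE x in lborel. x : \<U> --> P x"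
 shows "AE x in M. \<not> P x --> l x = 0"
proof -
 have "AE x in restrict_space lborel \<U>. P x"
  using assms \<U>b by (subst AE_restrict_space_iff) auto
 then have "AE x in density M (%x. ennreal (l x)). P x" unfolding l(3) .
 then have "AE x in M. 0 < ennreal (l x) --> P x"
  using borel_measurable_integrable[OF l(1)] by (subst (asm) AE_density) auto
 then show ?thesis by eventually_elim (use l(2) in "auto simp: less_le")
qed

text \<open>For a set \<open>B\<close> of directions of measure zero, the cone over \<open>B\<close> is Lebesgue null, so only the
 gradient contributes to the left hand side below; but the radial component of the gradient cannot
 charge such a cone either, as testing with cut-offs of \<open>H\<close> shows.\<close>

lemma trace_density_exists:
 assumes H: "C1_real H H'"
 obtains T where "integrable circle_measure T"
  "!!B. B : borel_on (cball 0 1) ==> (\<integral>x. indicator B (sgn x) * rad H H' x \<partial>M) = (\<integral>y. indicator B y * T y \<partial>circle_measure)"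
proof -
 define \<nu> where "\<nu> B = (\<integral>x. indicator B (sgn x) * rad H H' x \<partial>M)" for B
 have c: "(cball 0 1 :: (real ^ 2) set) : sets borel" by simp
 have vm: "vector_measure_on (cball 0 1) \<nu>"
  by (rule signed_integral_image(1)[OF sgn_M(1) integrable_rad[OF H] c]) (simp add: \<nu>_def)
 have "\<nu> B = 0" if B: "B : borel_on (cball 0 1)" "emeasure circle_measure B = 0" for B
 proof -
  have Bb: "B : sets borel" using B by (simp add: borel_on_iff)
  have iB: "(%x. indicator B (sgn x) :: real) : borel_measurable M"
   by (rule measurable_compose[OF sgn_M(2)]) (use Bb in auto)
  have AE0: "AE x in M. sgn x : B --> l x = 0"
   using AE_l_zero[OF lborel_cone_null[OF B]] by eventually_elim auto
  define R where "R x = (H (norm x) / (norm x)\<^sup>2) * (x \<bullet> d x)" for x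
  have R: "integrable M R"
   unfolding R_def by (rule integrable_norm_quotient[OF C1_real_continuous[OF H] radial_integrable])
  have Rm: "R : borel_measurable M" using R by auto
  have z: "(\<integral>x. indicator B (sgn x) * (bump r1 r2 n (norm x) * R x) \<partial>M) = 0" for n
  proof -
   let ?h = "%t. bump r1 r2 n t * H t" and ?h' = "%t. bump' r1 r2 n t * H t + bump r1 r2 n t * H' t"
   have h: "C1_real ?h ?h'" by (rule C1_real_mult[OF C1_real_bump H])
   have "0 = (\<integral>x. indicator B (sgn x) * rad ?h ?h' x \<partial>M)"
    by (rule rad_zero_indicator[OF h _ _ _ Bb, symmetric, of "r1 + 1 / real (Suc n)" "r2 - 1 / real (Suc n)"])
    (simp_all add: bump_outside)
   also have "... = (\<integral>x. indicator B (sgn x) * (bump r1 r2 n (norm x) * R x) \<partial>M)"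
   proof (rule integral_cong_AE)
    show "(%x. indicator B (sgn x) * rad ?h ?h' x) : borel_measurable M"
    using iB borel_measurable_integrable[OF integrable_rad[OF h]] by (rule borel_measurable_times)
    have "(%x. bump r1 r2 n (norm x)) : borel_measurable M"
    using continuous_norm_quotient(2)[OF C1_real_continuous[OF C1_real_bump], of r1 r2 n 0] by (intro borel_M) simp
    then show "(%x. indicator B (sgn x) * (bump r1 r2 n (norm x) * R x)) : borel_measurable M"
    using iB Rm by (intro borel_measurable_times)
    show "AE x in M. indicator B (sgn x) * rad ?h ?h' x = indicator B (sgn x) * (bump r1 r2 n (norm x) * R x)"
    using AE0 by eventually_elim (auto simp: indicator_def rad_def R_def)
   qed
   finally show ?thesis by simp
  qed
  have "(%n. \<integral>x. indicator B (sgn x) * (bump r1 r2 n (norm x) * R x) \<partial>M) \<longlonglongrightarrow> (\<integral>x. indicator B (sgn x) * R x \<partial>M)"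
  proof (rule integral_dominated_convergence[where w = "%x. norm (R x)"])
   show "(%x. indicator B (sgn x) * R x) : borel_measurable M" using iB Rm by (rule borel_measurable_times)
   have "(%x. bump r1 r2 n (norm x)) : borel_measurable M" for n
    using continuous_norm_quotient(2)[OF C1_real_continuous[OF C1_real_bump], of r1 r2 n 0] by (intro borel_M) simp
   then show "(%x. indicator B (sgn x) * (bump r1 r2 n (norm x) * R x)) : borel_measurable M" for n
    using iB Rm by (intro borel_measurable_times)
   show "AE x in M. (%n. indicator B (sgn x) * (bump r1 r2 n (norm x) * R x)) \<longlonglongrightarrow> indicator B (sgn x) * R x"
   proof (rule AE_I2)
    fix x assume "x : space M"
    then have "indicator {r1<..<r2} (norm x) = (1 :: real)" by (auto simp: spM annulus_def)
    then have "(%n. indicator B (sgn x) * (bump r1 r2 n (norm x) * R x)) \<longlonglongrightarrow> indicator B (sgn x) * (1 * R x)"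
    using bump_tendsto[of r1 r2 "norm x"] by (intro tendsto_intros) simp
    then show "(%n. indicator B (sgn x) * (bump r1 r2 n (norm x) * R x)) \<longlonglongrightarrow> indicator B (sgn x) * R x" by simp
   qed
   show "AE x in M. norm (indicator B (sgn x) * (bump r1 r2 n (norm x) * R x)) <= norm (R x)" for n
    using bump_bounds by (auto simp: indicator_def abs_mult intro!: mult_left_le_one_le)
  qed (use R in auto)
  then have "(\<integral>x. indicator B (sgn x) * R x \<partial>M) = 0" by (simp add: z LIMSEQ_const_iff)
  moreover have "\<nu> B = (\<integral>x. indicator B (sgn x) * R x \<partial>M)"
   unfolding \<nu>_def
  proof (rule integral_cong_AE)
   show "(%x. indicator B (sgn x) * rad H H' x) : borel_measurable M"
    using iB borel_measurable_integrable[OF integrable_rad[OF H]] by (rule borel_measurable_times)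
   show "(%x. indicator B (sgn x) * R x) : borel_measurable M" using iB Rm by (rule borel_measurable_times)
   show "AE x in M. indicator B (sgn x) * rad H H' x = indicator B (sgn x) * R x"
    using AE0 by eventually_elim (auto simp: indicator_def rad_def R_def)
  qed
  ultimately show ?thesis by simp
 qed
 from signed_Radon_Nikodym[OF vm c finite_circle_measure sets_circle_measure this]
 obtain T where "integrable circle_measure T"
  "!!B. B : borel_on (cball 0 1) ==> \<nu> B = (\<integral>y. indicator B y * T y \<partial>circle_measure)" by blast
 then show ?thesis using that by (simp add: \<nu>_def)
qed

lemma trace_density_integral:
 assumes H: "C1_real H H'" and T: "integrable circle_measure T"
  "!!B. B : borel_on (cball 0 1) ==> (\<integral>x. indicator B (sgn x) * rad H H' x \<partial>M) = (\<integral>y. indicator B y * T y \<partial>circle_measure)"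
  and \<psi>: "\<psi> : borel_measurable borel" "!!y. norm y <= 1 ==> \<bar>\<psi> y\<bar> <= K"
 shows "(\<integral>x. \<psi> (sgn x) * rad H H' x \<partial>M) = (\<integral>y. \<psi> y * T y \<partial>circle_measure)"
proof -
 have c: "(cball 0 1 :: (real ^ 2) set) : sets borel" by simp
 have \<psi>r: "\<psi> : borel_measurable (restrict_space borel (cball 0 1))" by (rule measurable_restrict_space1[OF \<psi>(1)])
 let ?\<nu> = "%B. \<integral>y. indicator B y * T y \<partial>circle_measure"
 have "signed_integral (cball 0 1) ?\<nu> \<psi> = (\<integral>x. \<psi> (sgn x) * rad H H' x \<partial>M)"
  by (rule signed_integral_image(2)[OF sgn_M(1) integrable_rad[OF H] c _ \<psi>r]) (use \<psi>(2) T(2) in auto)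
 moreover have "signed_integral (cball 0 1) ?\<nu> \<psi> = (\<integral>y. \<psi> y * T y \<partial>circle_measure)"
  by (rule signed_integral_image(2)[where p = "%x. x", OF _ T(1) c _ \<psi>r])
    (use \<psi>(2) in "auto simp: measurable_cong_sets[OF sets_circle_measure refl]")
 ultimately show ?thesis by simp
qed

end

lemma bump'_zero:
 assumes "a + 2 / real (Suc n) <= t" "t <= b - 2 / real (Suc n)"
 shows "bump' a b n t = 0"
proof -
 have m: "0 < real (Suc n)" by simp
 have "2 / real (Suc n) <= t - a" "2 / real (Suc n) <= b - t" using assms by auto
 then have "1 <= real (Suc n) * (t - a) - 1" "1 <= real (Suc n) * (b - t) - 1"
  using m by (simp_all only: pos_divide_le_eq mult.commute; linarith)+
 then show ?thesis by (simp add: bump'_def smoothstep'_1)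
qed

lemma bump'_bound: "\<exists>C\<ge>0. \<forall>a b n t. \<bar>bump' a b n t\<bar> <= real (Suc n) * C"
proof -
 obtain C where C: "C \<ge> 0" "!!t. \<bar>smoothstep' t\<bar> <= C" using smoothstep'_bounded by blast
 have "\<bar>bump' a b n t\<bar> <= real (Suc n) * (C + C)" for a b n t
 proof -
  have p: "\<bar>smoothstep' u * smoothstep v\<bar> <= C" for u v
   using mult_mono[OF C(2)[of u] smoothstep_bounds(2)[of v] C(1)] smoothstep_bounds(1)[of v] by (simp add: abs_mult)
  have "\<bar>smoothstep' u * smoothstep v - smoothstep r * smoothstep' q\<bar> <= C + C" for u v r q
   using p[of u v] p[of q r] by (simp add: mult.commute[of "smoothstep r"] abs_diff_le_iff) linarith
  then show ?thesis unfolding bump'_def abs_mult by (intro mult_mono) auto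
 qed
 then show ?thesis using C(1) by (intro exI[of _ "C + C"]) auto
qed

lemma C1_Lipschitz_on_ball:
 fixes G :: "real ^ 'n::finite => real"
 assumes "C1_gradient UNIV G D"
 obtains C where "0 <= C" "!!x y. norm x <= R ==> norm y <= R ==> \<bar>G x - G y\<bar> <= C * norm (x - y)"
proof -
 have "compact (D ` cball 0 R)"
  using assms by (intro compact_continuous_image) (auto simp: C1_gradient_def intro: continuous_on_subset)
 then obtain C where C: "\<forall>x\<in>cball 0 R. norm (D x) <= C" by (auto dest!: compact_imp_bounded simp: bounded_iff)
 have "norm (G x - G y) <= max C 0 * norm (x - y)" if xy: "norm x <= R" "norm y <= R" for x y
 proof (rule differentiable_bound[of "cball 0 R" G "%x v. D x \<bullet> v"])
  fix z :: "real ^ 'n" assume z: "z : cball 0 R"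
  show "(G has_derivative (%v. D z \<bullet> v)) (at z within cball 0 R)"
   using assms by (auto simp: C1_gradient_def intro: has_derivative_at_withinI)
  show "onorm (%v. D z \<bullet> v) <= max C 0"
  proof (rule onorm_le)
   fix v
   have "norm (D z \<bullet> v) <= norm (D z) * norm v" by (simp add: Cauchy_Schwarz_ineq2)
   also have "... <= max C 0 * norm v" using C z by (intro mult_right_mono) (auto simp: le_max_iff_disj)
   finally show "norm (D z \<bullet> v) <= max C 0 * norm v" .
  qed
 qed (use xy in auto)
 then show ?thesis by (intro that[of "max C 0"]) auto
qed

context bv_density
begin

lemma bump_norm_borel: "(%x :: real ^ 2. bump r1 r2 n (norm x)) : borel_measurable borel"
 using continuous_norm_quotient(2)[OF C1_real_continuous[OF C1_real_bump], of r1 r2 n 0] by simp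

lemma bump_norm_tendsto:
 assumes "x : \<U>"
 shows "(%n. bump r1 r2 n (norm x)) \<longlonglongrightarrow> 1"
 using bump_tendsto[of r1 r2 "norm x"] assms by (simp add: annulus_def)

text \<open>As the cut-off approaches the boundary circle of radius \<open>s\<close>, the values of \<open>\<phi>\<close> in the layer
 where its derivative lives may be replaced by the values on the circle: the error is of the order
 of the width of the layer, which compensates for the size of the derivative.\<close>

lemma cutoff_limit:
 assumes H: "C1_real H H'" and s: "0 < s" "s <= r2"
  and near: "!!n r. N <= n ==> r1 < r ==> r < r2 ==> bump' r1 r2 n r * H r ~= 0 ==> \<bar>r - s\<bar> <= 2 / real (Suc n)"
  and \<phi>: "C1_on UNIV \<phi>"
 shows "(%n. \<integral>x. \<phi> x * x $ i * (bump' r1 r2 n (norm x) * H (norm x) / norm x) * (w x * l x) \<partial>M)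
  \<longlonglongrightarrow> - (\<integral>x. (\<phi> (s *\<^sub>R sgn x) * (s *\<^sub>R sgn x) $ i) * rad H H' x \<partial>M)"
proof -
 define G where "G x = \<phi> x * x $ i" for x
 have G: "C1_gradient UNIV G (%x. \<phi> x *\<^sub>R axis i 1 + x $ i *\<^sub>R (\<chi> i. partial_deriv i \<phi> x))"
  unfolding G_def by (intro C1_gradient_mult C1_on_gradient \<phi> C1_gradient_coord)
 have Gc: "continuous_on A G" for A using C1_gradient_continuous_on[OF G] continuous_on_subset by blast
 have Gb: "G : borel_measurable borel" by (rule borel_measurable_continuous_onI[OF Gc])
 define \<psi> where "\<psi> y = G (s *\<^sub>R y)" for y
 have \<psi>c: "continuous_on A \<psi>" for A
  unfolding \<psi>_def by (rule continuous_on_compose2[OF Gc[of UNIV]]) (auto intro!: continuous_intros)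
 have \<psi>b: "\<psi> : borel_measurable borel" by (rule borel_measurable_continuous_onI[OF \<psi>c])
 have "compact (\<psi> ` cball 0 1)" by (intro compact_continuous_image \<psi>c) auto
 then obtain K where "\<forall>y\<in>cball 0 1. \<bar>\<psi> y\<bar> <= K" by (auto dest!: compact_imp_bounded simp: bounded_iff)
 then have K: "\<bar>\<psi> y\<bar> <= K" if "norm y <= 1" for y using that by simp
 have \<psi>s: "(%x. \<psi> (sgn x)) : borel_measurable borel" by (rule measurable_compose[OF sgn_borel \<psi>b])
 have \<psi>sK: "\<bar>\<psi> (sgn x)\<bar> <= K" for x by (rule K) (rule norm_sgn_le)
 define b' where "b' n t = bump' r1 r2 n t * H t" for n t
 have b'c: "continuous_on UNIV (b' n)" for n
  unfolding b'_def using C1_real_bump[of r1 r2 n] C1_real_continuous[OF H] by (intro continuous_intros) (auto simp: C1_real_def)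
 have ib: "integrable M (%x. (b' n (norm x) / norm x) * (w x * l x))" for n
  using integrable_norm_quotient[OF b'c[of n] w(2), of 1] by simp
 have iR: "integrable M (%x. bump r1 r2 n (norm x) * rad H H' x)" for n
  by (rule integrable_bounded_mult[OF integrable_rad[OF H] bump_norm_borel, of _ 1]) (use bump_bounds in auto)
 have id: "(\<integral>x. \<psi> (sgn x) * ((b' n (norm x) / norm x) * (w x * l x)) \<partial>M) = - (\<integral>x. \<psi> (sgn x) * (bump r1 r2 n (norm x) * rad H H' x) \<partial>M)" for n
 proof -
  let ?h = "%t. bump r1 r2 n t * H t" and ?h' = "%t. bump' r1 r2 n t * H t + bump r1 r2 n t * H' t"
  have h: "C1_real ?h ?h'" by (rule C1_real_mult[OF C1_real_bump H])
  have "0 = (\<integral>x. \<psi> (sgn x) * rad ?h ?h' x \<partial>M)"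
   by (rule rad_zero[OF h _ _ _ \<psi>b K, symmetric, of "r1 + 1 / real (Suc n)" "r2 - 1 / real (Suc n)"])
    (simp_all add: bump_outside)
  also have "... = (\<integral>x. \<psi> (sgn x) * ((b' n (norm x) / norm x) * (w x * l x)) + \<psi> (sgn x) * (bump r1 r2 n (norm x) * rad H H' x) \<partial>M)"
   by (intro Bochner_Integration.integral_cong) (auto simp: rad_def b'_def add_divide_distrib algebra_simps)
  also have "... = (\<integral>x. \<psi> (sgn x) * ((b' n (norm x) / norm x) * (w x * l x)) \<partial>M) + (\<integral>x. \<psi> (sgn x) * (bump r1 r2 n (norm x) * rad H H' x) \<partial>M)"
   by (intro Bochner_Integration.integral_add integrable_bounded_mult[OF ib \<psi>s \<psi>sK] integrable_bounded_mult[OF iR \<psi>s \<psi>sK])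
  finally show ?thesis by simp
 qed
 have lim1: "(%n. \<integral>x. \<psi> (sgn x) * (bump r1 r2 n (norm x) * rad H H' x) \<partial>M) \<longlonglongrightarrow> (\<integral>x. \<psi> (sgn x) * rad H H' x \<partial>M)"
 proof (rule integral_dominated_convergence[where w = "%x. norm (\<psi> (sgn x) * rad H H' x)"])
  have i: "integrable M (%x. \<psi> (sgn x) * rad H H' x)" by (rule integrable_bounded_mult[OF integrable_rad[OF H] \<psi>s \<psi>sK])
  then show "integrable M (%x. norm (\<psi> (sgn x) * rad H H' x))" "(%x. \<psi> (sgn x) * rad H H' x) : borel_measurable M" by auto
  show "(%x. \<psi> (sgn x) * (bump r1 r2 n (norm x) * rad H H' x)) : borel_measurable M" for n
   using integrable_bounded_mult[OF iR \<psi>s \<psi>sK] by auto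
  show "AE x in M. (%n. \<psi> (sgn x) * (bump r1 r2 n (norm x) * rad H H' x)) \<longlonglongrightarrow> \<psi> (sgn x) * rad H H' x"
  proof (rule AE_I2)
   fix x assume "x : space M"
   then have "(%n. \<psi> (sgn x) * (bump r1 r2 n (norm x) * rad H H' x)) \<longlonglongrightarrow> \<psi> (sgn x) * (1 * rad H H' x)"
    by (intro tendsto_intros bump_norm_tendsto) (simp add: spM)
   then show "(%n. \<psi> (sgn x) * (bump r1 r2 n (norm x) * rad H H' x)) \<longlonglongrightarrow> \<psi> (sgn x) * rad H H' x" by simp
  qed
  show "AE x in M. norm (\<psi> (sgn x) * (bump r1 r2 n (norm x) * rad H H' x)) <= norm (\<psi> (sgn x) * rad H H' x)" for n
   using bump_bounds by (auto simp: abs_mult intro!: mult_left_mono mult_left_le_one_le)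
 qed
 obtain C where C: "0 <= C" "!!x y. norm x <= r2 ==> norm y <= r2 ==> \<bar>G x - G y\<bar> <= C * norm (x - y)"
  using C1_Lipschitz_on_ball[OF G] by blast
 obtain C' where C': "C' \<ge> 0" "!!a b n t. \<bar>bump' a b n t\<bar> <= real (Suc n) * C'" using bump'_bound by blast
 obtain KH where KH: "!!x :: real ^ 2. x : \<U> ==> \<bar>H (norm x) / norm x ^ 1\<bar> <= KH"
  using bounded_on_annulus[OF continuous_norm_quotient(1)[OF C1_real_continuous[OF H]]] by blast
 have lim2: "(%n. \<integral>x. (G x - \<psi> (sgn x)) * ((b' n (norm x) / norm x) * (w x * l x)) \<partial>M) \<longlonglongrightarrow> (\<integral>x. 0 \<partial>M)"
 proof (rule LIMSEQ_offset[of _ N], rule integral_dominated_convergence[where w = "%x. (2 * C * C' * KH) * \<bar>w x * l x\<bar>"])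
  show "integrable M (%x. (2 * C * C' * KH) * \<bar>w x * l x\<bar>)" using w(2) by auto
  have "(%x. G x - \<psi> (sgn x)) : borel_measurable M" using Gb \<psi>s by (intro borel_M borel_measurable_diff)
  then show "(%x. (G x - \<psi> (sgn x)) * ((b' (n + N) (norm x) / norm x) * (w x * l x))) : borel_measurable M" for n
   using borel_measurable_integrable[OF ib] by (rule borel_measurable_times)
  show "AE x in M. (%n. (G x - \<psi> (sgn x)) * ((b' (n + N) (norm x) / norm x) * (w x * l x))) \<longlonglongrightarrow> 0"
  proof (rule AE_I2)
   fix x assume "x : space M"
   then have "r1 < norm x" "norm x < r2" by (auto simp: spM annulus_def)
   then have "\<forall>\<^sub>F n in sequentially. bump r1 r2 n (norm x) = 1 & bump' r1 r2 n (norm x) = 0" by (rule bump_eventually)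
   then have "\<forall>\<^sub>F n in sequentially. (G x - \<psi> (sgn x)) * ((b' n (norm x) / norm x) * (w x * l x)) = 0"
    by eventually_elim (simp add: b'_def)
   then have "(%n. (G x - \<psi> (sgn x)) * ((b' n (norm x) / norm x) * (w x * l x))) \<longlonglongrightarrow> 0" by (rule tendsto_eventually)
   then show "(%n. (G x - \<psi> (sgn x)) * ((b' (n + N) (norm x) / norm x) * (w x * l x))) \<longlonglongrightarrow> 0"
    by (rule LIMSEQ_ignore_initial_segment)
  qed
  show "AE x in M. norm ((G x - \<psi> (sgn x)) * ((b' (n + N) (norm x) / norm x) * (w x * l x))) <= (2 * C * C' * KH) * \<bar>w x * l x\<bar>" for n
  proof (rule AE_I2)
   fix x assume "x : space M"
   then have x: "x : \<U>" by (simp add: spM)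
   have KH0: "0 <= KH" using KH[OF x] abs_ge_zero order_trans by blast
   have "\<bar>(G x - \<psi> (sgn x)) * (b' (n + N) (norm x) / norm x)\<bar> <= 2 * C * C' * KH"
   proof (cases "b' (n + N) (norm x) = 0")
    case False
    have "x = norm x *\<^sub>R sgn x" using nz[OF x] by (simp add: sgn_div_norm)
    then have "norm (x - s *\<^sub>R sgn x) = norm ((norm x - s) *\<^sub>R sgn x)" by (metis scaleR_left_diff_distrib)
    also have "... = \<bar>norm x - s\<bar>" using nz[OF x] by (simp add: norm_sgn)
    also have "... <= 2 / real (Suc (n + N))"
    using near[of "n + N" "norm x"] False x by (auto simp: b'_def annulus_def)
    finally have n1: "norm (x - s *\<^sub>R sgn x) <= 2 / real (Suc (n + N))" .
    have "\<bar>G x - \<psi> (sgn x)\<bar> <= C * norm (x - s *\<^sub>R sgn x)"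
    unfolding \<psi>_def using x s nz[OF x] by (intro C(2)) (auto simp: annulus_def norm_sgn)
    also have "... <= C * (2 / real (Suc (n + N)))" by (rule mult_left_mono[OF n1 C(1)])
    finally have g: "\<bar>G x - \<psi> (sgn x)\<bar> <= C * (2 / real (Suc (n + N)))" .
    have "\<bar>b' (n + N) (norm x) / norm x\<bar> = \<bar>bump' r1 r2 (n + N) (norm x)\<bar> * \<bar>H (norm x) / norm x ^ 1\<bar>"
    by (simp add: b'_def abs_mult)
    also have "... <= (real (Suc (n + N)) * C') * KH"
    by (rule mult_mono[OF C'(2) KH[OF x]]) (use C'(1) in auto)
    finally have "\<bar>b' (n + N) (norm x) / norm x\<bar> <= (real (Suc (n + N)) * C') * KH" .
    then have "\<bar>G x - \<psi> (sgn x)\<bar> * \<bar>b' (n + N) (norm x) / norm x\<bar> <= (C * (2 / real (Suc (n + N)))) * ((real (Suc (n + N)) * C') * KH)"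
    using g C(1) by (intro mult_mono) auto
    also have "... = 2 * C * C' * KH"
    by (simp add: field_simps del: of_nat_Suc)
    finally show ?thesis by (simp only: abs_mult)
   qed (use C(1) C'(1) KH0 in simp)
   then have "\<bar>(G x - \<psi> (sgn x)) * (b' (n + N) (norm x) / norm x)\<bar> * \<bar>w x * l x\<bar> <= (2 * C * C' * KH) * \<bar>w x * l x\<bar>"
    by (rule mult_right_mono) simp
   then show "norm ((G x - \<psi> (sgn x)) * ((b' (n + N) (norm x) / norm x) * (w x * l x))) <= (2 * C * C' * KH) * \<bar>w x * l x\<bar>"
    by (simp only: real_norm_def abs_mult mult.assoc)
  qed
 qed simp
 obtain KG where KG: "!!x. x : \<U> ==> \<bar>G x\<bar> <= KG" using bounded_on_annulus[OF Gc] by blast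
 have "(\<integral>x. \<phi> x * x $ i * (bump' r1 r2 n (norm x) * H (norm x) / norm x) * (w x * l x) \<partial>M)
   = (\<integral>x. (G x - \<psi> (sgn x)) * ((b' n (norm x) / norm x) * (w x * l x)) \<partial>M) - (\<integral>x. \<psi> (sgn x) * (bump r1 r2 n (norm x) * rad H H' x) \<partial>M)" for n
 proof -
  have "(\<integral>x. (G x - \<psi> (sgn x)) * ((b' n (norm x) / norm x) * (w x * l x)) \<partial>M)
    = (\<integral>x. G x * ((b' n (norm x) / norm x) * (w x * l x)) \<partial>M) - (\<integral>x. \<psi> (sgn x) * ((b' n (norm x) / norm x) * (w x * l x)) \<partial>M)"
   unfolding left_diff_distrib
   by (intro Bochner_Integration.integral_diff integrable_bounded_mult[OF ib \<psi>s \<psi>sK] integrable_bounded_mult[OF ib Gb KG])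
  then show ?thesis unfolding id by (simp add: G_def b'_def mult_ac)
 qed
 moreover have "(%n. (\<integral>x. (G x - \<psi> (sgn x)) * ((b' n (norm x) / norm x) * (w x * l x)) \<partial>M) - (\<integral>x. \<psi> (sgn x) * (bump r1 r2 n (norm x) * rad H H' x) \<partial>M))
   \<longlonglongrightarrow> (\<integral>x. 0 \<partial>M) - (\<integral>x. \<psi> (sgn x) * rad H H' x \<partial>M)"
  by (intro tendsto_diff lim1 lim2)
 ultimately show ?thesis by (simp add: \<psi>_def G_def)
qed

definition "HL t = smoothstep (- (3 / (r2 - r1)) * t + (2 * r2 + r1) / (r2 - r1))"
definition "HL' t = - (3 / (r2 - r1)) * smoothstep' (- (3 / (r2 - r1)) * t + (2 * r2 + r1) / (r2 - r1))"
definition "HR t = 1 - HL t"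
definition "HR' t = - HL' t"

lemma C1_HL: "C1_real HL HL'"
 unfolding HL_def[abs_def] HL'_def[abs_def] by (rule C1_real_affine[OF C1_real_smoothstep])

lemma C1_HR: "C1_real HR HR'"
 using C1_HL by (auto simp: C1_real_def HR_def[abs_def] HR'_def[abs_def] intro!: derivative_eq_intros continuous_intros)

lemma HL_eq: "HL t = smoothstep ((2 * r2 + r1 - 3 * t) / (r2 - r1))"
 by (simp add: HL_def diff_divide_distrib)

lemma HL_right: "(2 * r2 + r1) / 3 <= t ==> HL t = 0"
 unfolding HL_eq using \<rho> by (intro smoothstep_0 divide_nonpos_pos) auto

lemma HR_left: "t <= (r2 + 2 * r1) / 3 ==> HR t = 0"
proof -
 assume "t <= (r2 + 2 * r1) / 3"
 then have "1 <= (2 * r2 + r1 - 3 * t) / (r2 - r1)" using \<rho> by (simp add: le_divide_eq)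
 then show ?thesis by (simp add: HR_def HL_eq smoothstep_1)
qed

lemma cutoff_layers:
 obtains N where
  "!!n r. N <= n ==> r1 < r ==> r < r2 ==> bump' r1 r2 n r * HL r ~= 0 ==> \<bar>r - r1\<bar> <= 2 / real (Suc n)"
  "!!n r. N <= n ==> r1 < r ==> r < r2 ==> bump' r1 r2 n r * HR r ~= 0 ==> \<bar>r - r2\<bar> <= 2 / real (Suc n)"
proof -
 define D where "D = (r2 - r1) / 3"
 have D: "0 < D" using \<rho> by (simp add: D_def)
 obtain N where N: "2 / D < real N" using reals_Archimedean2 by blast
 have small: "2 / real (Suc n) <= D" if "N <= n" for n
 proof -
  have "2 / D <= real (Suc n)" using N that by linarith
  then show ?thesis using D by (simp add: field_simps)
 qed
 show ?thesis
 proof (rule that[of N])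
  fix n r assume a: "N <= n" "r1 < r" "r < r2"
  { assume "bump' r1 r2 n r * HL r ~= 0"
   then have "\<not> (r1 + 2 / real (Suc n) <= r & r <= r2 - 2 / real (Suc n))" "r < (2 * r2 + r1) / 3"
    using bump'_zero HL_right[of r] by force+
   moreover have "(2 * r2 + r1) / 3 = r2 - D" by (simp add: D_def field_simps)
   ultimately show "\<bar>r - r1\<bar> <= 2 / real (Suc n)" using small[OF a(1)] a(2) by linarith }
  { assume "bump' r1 r2 n r * HR r ~= 0"
   then have "\<not> (r1 + 2 / real (Suc n) <= r & r <= r2 - 2 / real (Suc n))" "(r2 + 2 * r1) / 3 < r"
    using bump'_zero HR_left[of r] by force+
   moreover have "(r2 + 2 * r1) / 3 = r1 + D" by (simp add: D_def field_simps)
   ultimately show "\<bar>r - r2\<bar> <= 2 / real (Suc n)" using small[OF a(1)] a(3) by linarith }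
 qed
qed

lemma cutoff_test:
 assumes \<phi>: "C1_on UNIV \<phi>"
 shows "(%x. \<phi> x * bump r1 r2 n (norm x)) : test_functions \<U>"
  and "x : \<U> ==> partial_deriv i (%x. \<phi> x * bump r1 r2 n (norm x)) x
   = partial_deriv i \<phi> x * bump r1 r2 n (norm x) + \<phi> x * (bump' r1 r2 n (norm x) * x $ i / norm x)"
proof -
 let ?f = "%x. \<phi> x * bump r1 r2 n (norm x)"
 have G: "C1_gradient (- {0}) ?f (%x. \<phi> x *\<^sub>R (bump' r1 r2 n (norm x) *\<^sub>R sgn x) + bump r1 r2 n (norm x) *\<^sub>R (\<chi> i. partial_deriv i \<phi> x))"
  using C1_real_bump[of r1 r2 n]
  by (intro C1_gradient_mult C1_gradient_subset[OF C1_on_gradient[OF \<phi>]] C1_gradient_real_norm)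
    (auto simp: C1_real_def intro: continuous_on_subset)
 have "C1_on (ball 0 r1) ?f"
  by (rule C1_on_cong_open[OF C1_gradient_C1_on[OF C1_gradient_const[of _ 0]] open_ball])
    (auto simp: bump_zero)
 then have "C1_on (- {0} \<union> ball 0 r1) ?f"
  by (intro C1_on_Un C1_gradient_C1_on[OF G]) auto
 moreover have "- {0} \<union> ball 0 r1 = (UNIV :: (real ^ 2) set)" using \<rho> by auto
 ultimately have C1: "C1_on UNIV ?f" by simp
 let ?K = "cball 0 (r2 - 1 / real (Suc n)) - ball 0 (r1 + 1 / real (Suc n)) :: (real ^ 2) set"
 have m: "0 < 1 / real (Suc n)" by simp
 show "?f : test_functions \<U>"
 proof (rule test_functionsI[OF C1, of ?K])
  show "compact ?K" by (simp add: compact_diff)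
  show "?K \<subseteq> \<U>"
  proof
   fix x assume "x : ?K"
   then have "norm x <= r2 - 1 / real (Suc n)" "r1 + 1 / real (Suc n) <= norm x" by (auto simp del: of_nat_Suc)
   then show "x : \<U>" using m unfolding annulus_def mem_Collect_eq by linarith
  qed
  show "?f x = 0" if "x \<notin> ?K" for x
   using that bump_outside[of "norm x" r1 n r2] by (auto simp del: of_nat_Suc)
 qed
 assume "x : \<U>"
 then have "x : - {0}" using nz by auto
 from C1_gradient_partial[OF G this, of i]
 show "partial_deriv i ?f x = partial_deriv i \<phi> x * bump r1 r2 n (norm x) + \<phi> x * (bump' r1 r2 n (norm x) * x $ i / norm x)"
  by (simp add: sgn_div_norm field_simps)
qed

text \<open>The weak derivative is tested with \<open>\<phi>\<close> times a cut-off that exhausts the annulus. The derivative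
 of the cut-off lives in two thin layers along the circles; there \<open>\<phi>\<close> may be replaced by its value on
 the circle, which leaves the radial quantities that define the densities \<open>T1\<close> and \<open>T2\<close>.\<close>

lemma trace_formula:
 assumes T1: "integrable circle_measure T1"
  "!!B. B : borel_on (cball 0 1) ==> (\<integral>x. indicator B (sgn x) * rad HL HL' x \<partial>M) = - (\<integral>y. indicator B y * T1 y \<partial>circle_measure)"
  and T2: "integrable circle_measure T2"
  "!!B. B : borel_on (cball 0 1) ==> (\<integral>x. indicator B (sgn x) * rad HR HR' x \<partial>M) = (\<integral>y. indicator B y * T2 y \<partial>circle_measure)"
  and \<phi>: "C1_on UNIV \<phi>"
 shows "(\<integral>x. w x * partial_deriv i \<phi> x * l x \<partial>M) + (\<integral>x. \<phi> x * d x $ i \<partial>M)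
  = (\<integral>y. (\<phi> (r2 *\<^sub>R y) * (r2 *\<^sub>R y) $ i) * T2 y \<partial>circle_measure) - (\<integral>y. (\<phi> (r1 *\<^sub>R y) * (r1 *\<^sub>R y) $ i) * T1 y \<partial>circle_measure)"
proof -
 have bd: "\<exists>K. \<forall>x\<in>\<U>. \<bar>b x\<bar> <= K" if "continuous_on UNIV b" for b :: "real ^ 2 => real"
  using bounded_on_annulus[OF continuous_on_subset[OF that]] by (metis subset_UNIV)
 have pc: "continuous_on UNIV (partial_deriv i \<phi>)" using \<phi> by (simp add: C1_on_def)
 have \<phi>c: "continuous_on UNIV \<phi>" using \<phi> by (rule C1_on_continuous_on)
 have ip: "integrable M (%x. partial_deriv i \<phi> x * (w x * l x))"
  using bd[OF pc] integrable_bounded_mult[OF w(2) partial_deriv_borel[OF \<phi>]] by blast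
 have i\<phi>: "integrable M (%x. \<phi> x * d x $ i)"
  using bd[OF \<phi>c] integrable_bounded_mult[OF di C1_on_borel[OF \<phi>]] by blast
 let ?b = "%n x. bump r1 r2 n (norm x)"
 have ib: "integrable M (%x. ?b n x * f x)" if "integrable M f" for f :: "real ^ 2 => real" and n
  by (rule integrable_bounded_mult[OF that bump_norm_borel, of _ 1]) (use bump_bounds in auto)
 have limb: "(%n. \<integral>x. ?b n x * f x \<partial>M) \<longlonglongrightarrow> (\<integral>x. f x \<partial>M)" if f: "integrable M f" for f :: "real ^ 2 => real"
 proof (rule integral_dominated_convergence[where w = "%x. norm (f x)"])
  show "AE x in M. (%n. ?b n x * f x) \<longlonglongrightarrow> f x"
  proof (rule AE_I2)
   fix x assume "x : space M"
   then have "(%n. ?b n x * f x) \<longlonglongrightarrow> 1 * f x" by (intro tendsto_intros bump_norm_tendsto) (simp add: spM)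
   then show "(%n. ?b n x * f x) \<longlonglongrightarrow> f x" by simp
  qed
  show "AE x in M. norm (?b n x * f x) <= norm (f x)" for n
   using bump_bounds by (auto simp: abs_mult intro!: mult_left_le_one_le)
  show "(%x. ?b n x * f x) : borel_measurable M" for n using ib[OF f] by auto
 qed (use f in auto)
 let ?q = "%H n x. \<phi> x * x $ i * (bump' r1 r2 n (norm x) * H (norm x) / norm x) * (w x * l x)"
 have iq: "integrable M (?q H n)" if "continuous_on UNIV H" for H n
 proof -
  have c: "continuous_on UNIV (%t. bump' r1 r2 n t * H t)"
   using C1_real_bump[of r1 r2 n] that by (intro continuous_intros) (auto simp: C1_real_def)
  have c2: "continuous_on UNIV (%x. \<phi> x * x $ i)" using \<phi>c by (intro continuous_intros)
  have "integrable M (%x. (\<phi> x * x $ i) * ((bump' r1 r2 n (norm x) * H (norm x) / norm x ^ 1) * (w x * l x)))"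
   using bd[OF c2] integrable_bounded_mult[OF integrable_norm_quotient[OF c w(2)] borel_measurable_continuous_onI[OF c2]] by blast
  then show ?thesis by (simp add: mult.assoc)
 qed
 have zero: "(\<integral>x. ?b n x * (partial_deriv i \<phi> x * (w x * l x)) \<partial>M) + (\<integral>x. ?b n x * (\<phi> x * d x $ i) \<partial>M)
   + ((\<integral>x. ?q HL n x \<partial>M) + (\<integral>x. ?q HR n x \<partial>M)) = 0" for n
 proof -
  have "0 = (\<integral>x. w x * partial_deriv i (%x. \<phi> x * ?b n x) x * l x + (\<phi> x * ?b n x) * d x $ i \<partial>M)"
   using weak[OF cutoff_test(1)[OF \<phi>]] by simp
  also have "... = (\<integral>x. ?b n x * (partial_deriv i \<phi> x * (w x * l x)) + ?b n x * (\<phi> x * d x $ i) + (?q HL n x + ?q HR n x) \<partial>M)"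
  proof (rule Bochner_Integration.integral_cong)
   fix x assume "x : space M"
   then have x: "x : \<U>" by (simp add: spM)
   have "?q HL n x + ?q HR n x = \<phi> x * x $ i * (bump' r1 r2 n (norm x) * (HL (norm x) + HR (norm x)) / norm x) * (w x * l x)"
    by (simp add: add_divide_distrib distrib_left distrib_right)
   also have "HL (norm x) + HR (norm x) = 1" by (simp add: HR_def)
   finally have q: "?q HL n x + ?q HR n x = \<phi> x * x $ i * (bump' r1 r2 n (norm x) / norm x) * (w x * l x)" by simp
   show "w x * partial_deriv i (%x. \<phi> x * ?b n x) x * l x + (\<phi> x * ?b n x) * d x $ i
    = ?b n x * (partial_deriv i \<phi> x * (w x * l x)) + ?b n x * (\<phi> x * d x $ i) + (?q HL n x + ?q HR n x)"
    unfolding q cutoff_test(2)[OF \<phi> x] by (simp add: algebra_simps)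
  qed simp
  also have "... = (\<integral>x. ?b n x * (partial_deriv i \<phi> x * (w x * l x)) \<partial>M) + (\<integral>x. ?b n x * (\<phi> x * d x $ i) \<partial>M)
   + ((\<integral>x. ?q HL n x \<partial>M) + (\<integral>x. ?q HR n x \<partial>M))"
   using ib[OF ip, of n] ib[OF i\<phi>, of n] iq[OF C1_real_continuous[OF C1_HL], of n] iq[OF C1_real_continuous[OF C1_HR], of n] by simp
  finally show ?thesis by simp
 qed
 obtain N where N: "!!n r. N <= n ==> r1 < r ==> r < r2 ==> bump' r1 r2 n r * HL r ~= 0 ==> \<bar>r - r1\<bar> <= 2 / real (Suc n)"
  "!!n r. N <= n ==> r1 < r ==> r < r2 ==> bump' r1 r2 n r * HR r ~= 0 ==> \<bar>r - r2\<bar> <= 2 / real (Suc n)"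
  using cutoff_layers by blast
 let ?\<psi> = "%s y. \<phi> (s *\<^sub>R y) * (s *\<^sub>R y) $ i"
 have l1: "(%n. \<integral>x. ?q HL n x \<partial>M) \<longlonglongrightarrow> - (\<integral>x. ?\<psi> r1 (sgn x) * rad HL HL' x \<partial>M)"
  by (rule cutoff_limit[OF C1_HL _ _ N(1) \<phi>]) (use \<rho> in auto)
 have l2: "(%n. \<integral>x. ?q HR n x \<partial>M) \<longlonglongrightarrow> - (\<integral>x. ?\<psi> r2 (sgn x) * rad HR HR' x \<partial>M)"
  by (rule cutoff_limit[OF C1_HR _ _ N(2) \<phi>]) (use \<rho> in auto)
 have "(%n. (\<integral>x. ?b n x * (partial_deriv i \<phi> x * (w x * l x)) \<partial>M) + (\<integral>x. ?b n x * (\<phi> x * d x $ i) \<partial>M)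
   + ((\<integral>x. ?q HL n x \<partial>M) + (\<integral>x. ?q HR n x \<partial>M)))
   \<longlonglongrightarrow> (\<integral>x. partial_deriv i \<phi> x * (w x * l x) \<partial>M) + (\<integral>x. \<phi> x * d x $ i \<partial>M)
    + (- (\<integral>x. ?\<psi> r1 (sgn x) * rad HL HL' x \<partial>M) + - (\<integral>x. ?\<psi> r2 (sgn x) * rad HR HR' x \<partial>M))"
  by (intro tendsto_add limb ip i\<phi> l1 l2)
 then have eq: "(\<integral>x. partial_deriv i \<phi> x * (w x * l x) \<partial>M) + (\<integral>x. \<phi> x * d x $ i \<partial>M)
   = (\<integral>x. ?\<psi> r1 (sgn x) * rad HL HL' x \<partial>M) + (\<integral>x. ?\<psi> r2 (sgn x) * rad HR HR' x \<partial>M)"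
  unfolding zero by (simp add: LIMSEQ_const_iff)
 have \<psi>c: "continuous_on A (?\<psi> s)" for s A
  by (intro continuous_intros continuous_on_compose2[OF \<phi>c]) auto
 have \<psi>b: "?\<psi> s : borel_measurable borel" for s by (rule borel_measurable_continuous_onI[OF \<psi>c])
 have "\<exists>K. \<forall>y. norm y <= 1 --> \<bar>?\<psi> s y\<bar> <= K" for s
 proof -
  have "compact (?\<psi> s ` cball 0 1)" by (intro compact_continuous_image \<psi>c) auto
  then obtain K where "\<forall>r\<in>?\<psi> s ` cball 0 1. norm r <= K" by (auto dest!: compact_imp_bounded simp only: bounded_iff)
  then have "\<bar>?\<psi> s y\<bar> <= K" if "norm y <= 1" for y using that by auto
  then show ?thesis by blast
 qed
 then obtain K where K: "!!s y. norm y <= 1 ==> \<bar>?\<psi> s y\<bar> <= K s" by metis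
 have T1': "integrable circle_measure (%y. - T1 y)" using T1(1) by simp
 have "(\<integral>x. ?\<psi> r1 (sgn x) * rad HL HL' x \<partial>M) = (\<integral>y. ?\<psi> r1 y * - T1 y \<partial>circle_measure)"
  by (rule trace_density_integral[OF C1_HL T1' _ \<psi>b K]) (simp add: T1(2))
 moreover have "(\<integral>x. ?\<psi> r2 (sgn x) * rad HR HR' x \<partial>M) = (\<integral>y. ?\<psi> r2 y * T2 y \<partial>circle_measure)"
  by (rule trace_density_integral[OF C1_HR T2 \<psi>b K])
 ultimately show ?thesis using eq by (simp add: mult_ac)
qed

end

section \<open>Integration over the boundary circles\<close>

lemma circle_borel: "f : borel_measurable borel ==> f : borel_measurable circle_measure"
 unfolding measurable_cong_sets[OF sets_circle_measure refl] by (rule measurable_restrict_space1)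

lemma sphere_integral:
 fixes f :: "real ^ 2 => real"
 assumes \<rho>: "0 < \<rho>" and f: "f : borel_measurable borel"
 shows "set_integrable hausdorff1 (sphere 0 \<rho>) f \<longleftrightarrow> integrable circle_measure (%y. f (\<rho> *\<^sub>R y))"
  and "(LINT x:sphere 0 \<rho>|hausdorff1. f x) = \<rho> * (\<integral>y. f (\<rho> *\<^sub>R y) \<partial>circle_measure)"
proof -
 have S: "sphere (0 :: real ^ 2) \<rho> : sets hausdorff1" by (simp add: borel_closed)
 have fH: "f : borel_measurable hausdorff1" using f by (simp add: measurable_cong_sets[OF sets_hausdorff1 refl])
 have dens: "density hausdorff1 (%x. ennreal (indicator (sphere (0 :: real ^ 2) \<rho>) x)) = density hausdorff1 (indicator (sphere 0 \<rho>))"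
  by (simp add: ennreal_indicator)
 have sc: "(%y. \<rho> *\<^sub>R y) : borel_measurable circle_measure" by (rule circle_borel) simp
 have fs: "(%y. f (\<rho> *\<^sub>R y)) : borel_measurable circle_measure" by (rule measurable_compose[OF sc f])
 have sc2: "(%y. \<rho> *\<^sub>R y) : borel_measurable (density circle_measure (%_. ennreal \<rho>))" using sc by simp
 have "set_integrable hausdorff1 (sphere 0 \<rho>) f \<longleftrightarrow> integrable (density hausdorff1 (indicator (sphere 0 \<rho>))) f"
  unfolding set_integrable_def dens[symmetric] using S fH by (subst integrable_density) (auto intro!: borel_measurable_indicator)
 also have "... \<longleftrightarrow> integrable (density circle_measure (%_. ennreal \<rho>)) (%y. f (\<rho> *\<^sub>R y))"
  unfolding hausdorff1_sphere[OF \<rho>] by (subst integrable_distr_eq[OF sc2 f]) simp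
 also have "... \<longleftrightarrow> integrable circle_measure (%y. f (\<rho> *\<^sub>R y))"
  using \<rho> fs by (subst integrable_density) auto
 finally show "set_integrable hausdorff1 (sphere 0 \<rho>) f \<longleftrightarrow> integrable circle_measure (%y. f (\<rho> *\<^sub>R y))" .
 have "(LINT x:sphere 0 \<rho>|hausdorff1. f x) = (\<integral>x. f x \<partial>density hausdorff1 (indicator (sphere 0 \<rho>)))"
  unfolding set_lebesgue_integral_def dens[symmetric] using S fH by (subst integral_density) (auto intro!: borel_measurable_indicator)
 also have "... = (\<integral>y. f (\<rho> *\<^sub>R y) \<partial>density circle_measure (%_. ennreal \<rho>))"
  unfolding hausdorff1_sphere[OF \<rho>] by (subst integral_distr[OF sc2 f]) simp
 also have "... = \<rho> * (\<integral>y. f (\<rho> *\<^sub>R y) \<partial>circle_measure)"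
  using \<rho> fs by (subst integral_density) auto
 finally show "(LINT x:sphere 0 \<rho>|hausdorff1. f x) = \<rho> * (\<integral>y. f (\<rho> *\<^sub>R y) \<partial>circle_measure)" .
qed

lemma frontier_annulus:
 assumes "0 < r" "r < s"
 shows "frontier (annulus r s) = sphere 0 r \<union> sphere 0 s"
  and "closure (annulus r s) = cball 0 s - ball 0 r"
proof -
 have "closure (annulus r s) \<subseteq> cball 0 s - ball 0 r"
  by (rule closure_minimal) (auto simp: annulus_def closed_Diff)
 moreover have "cball 0 s - ball 0 r \<subseteq> closure (annulus r s)"
 proof
  fix x :: "real ^ 2" assume "x : cball 0 s - ball 0 r"
  then have x: "r <= norm x" "norm x <= s" by auto
  have x0: "norm x ~= 0" using x assms by auto
  define m where "m = (r + s) / 2"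
  define c where "c n = 1 + (1 / real (Suc n)) * (m / norm x - 1)" for n :: nat
  have cn: "c n * norm x = (1 - 1 / real (Suc n)) * norm x + (1 / real (Suc n)) * m" for n
  proof -
   have "(1 + t * (m / norm x - 1)) * norm x = (1 - t) * norm x + t * m" for t
    using x0 by (simp add: field_simps)
   then show ?thesis unfolding c_def .
  qed
  have in_A: "c n *\<^sub>R x : annulus r s" for n
  proof -
   define t where "t = 1 / real (Suc n)"
   have t: "0 < t" "t <= 1" by (auto simp: t_def)
   have mm: "r < m" "m < s" using assms by (auto simp: m_def)
   have "(1 - t) * r + t * r < (1 - t) * norm x + t * m"
    using t x mm by (intro add_le_less_mono mult_left_mono mult_strict_left_mono) auto
   moreover have "(1 - t) * norm x + t * m < (1 - t) * s + t * s"
    using t x mm by (intro add_le_less_mono mult_left_mono mult_strict_left_mono) auto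
   ultimately have "r < c n * norm x" "c n * norm x < s"
    unfolding cn t_def[symmetric] by (simp_all add: algebra_simps)
   moreover from this have "0 <= c n" using x0 assms by (smt (verit) mult_neg_pos zero_less_norm_iff norm_zero)
   ultimately show ?thesis by (simp add: annulus_def)
  qed
  have "(%n. 1 / real (Suc n)) \<longlonglongrightarrow> 0" using LIMSEQ_inverse_real_of_nat by (simp add: inverse_eq_divide)
  then have "(%n. c n *\<^sub>R x) \<longlonglongrightarrow> (1 + 0 * (m / norm x - 1)) *\<^sub>R x"
   unfolding c_def by (intro tendsto_intros)
  then have "(%n. c n *\<^sub>R x) \<longlonglongrightarrow> x" by simp
  then show "x : closure (annulus r s)" using in_A unfolding closure_sequential
   by (intro exI[of _ "%n. c n *\<^sub>R x"] conjI allI)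
 qed
 ultimately show cl: "closure (annulus r s) = cball 0 s - ball 0 r" by (rule antisym)
 have "frontier (annulus r s) = (cball 0 s - ball 0 r) - annulus r s"
  by (simp only: frontier_def cl interior_open[OF open_annulus])
 also have "... = sphere 0 r \<union> sphere 0 s"
  using assms by (auto simp: annulus_def)
 finally show "frontier (annulus r s) = sphere 0 r \<union> sphere 0 s" .
qed

lemma frontier_integral:
 fixes f :: "real ^ 2 => real"
 assumes \<rho>: "0 < r1" "r1 < r2" and f: "f : borel_measurable borel"
  and i: "integrable circle_measure (%y. f (r1 *\<^sub>R y))" "integrable circle_measure (%y. f (r2 *\<^sub>R y))"
 shows "set_integrable hausdorff1 (frontier (annulus r1 r2)) f"
  and "(LINT x:frontier (annulus r1 r2)|hausdorff1. f x)
   = r1 * (\<integral>y. f (r1 *\<^sub>R y) \<partial>circle_measure) + r2 * (\<integral>y. f (r2 *\<^sub>R y) \<partial>circle_measure)"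
proof -
 have S: "sphere (0 :: real ^ 2) r : sets hausdorff1" for r by (simp add: borel_closed)
 have s: "set_integrable hausdorff1 (sphere 0 r1) f" "set_integrable hausdorff1 (sphere 0 r2) f"
  using i sphere_integral(1)[OF _ f] \<rho> by auto
 have fr: "frontier (annulus r1 r2) = sphere 0 r1 \<union> sphere 0 r2" by (rule frontier_annulus(1)[OF \<rho>])
 show "set_integrable hausdorff1 (frontier (annulus r1 r2)) f"
  unfolding fr by (rule set_integrable_Un[OF s S S])
 have "sphere 0 r1 Int sphere (0 :: real ^ 2) r2 = {}" using \<rho> by auto
 then have "(LINT x:frontier (annulus r1 r2)|hausdorff1. f x) = (LINT x:sphere 0 r1|hausdorff1. f x) + (LINT x:sphere 0 r2|hausdorff1. f x)"
  unfolding fr by (rule set_integral_Un[OF _ s])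
 then show "(LINT x:frontier (annulus r1 r2)|hausdorff1. f x)
   = r1 * (\<integral>y. f (r1 *\<^sub>R y) \<partial>circle_measure) + r2 * (\<integral>y. f (r2 *\<^sub>R y) \<partial>circle_measure)"
  using sphere_integral(2)[OF _ f] \<rho> by auto
qed

definition annulus_trace :: "real => (real ^ 2 => real) => (real ^ 2 => real) => real ^ 2 => real" where
 "annulus_trace r2 T1 T2 x = (if norm x = r2 then T2 (sgn x) else T1 (sgn x))"

lemma annulus_normal_borel: "(%x. annulus_normal r1 r2 x $ i) : borel_measurable borel"
 unfolding annulus_normal_def by measurable

lemma norm_annulus_normal:
 assumes "0 < r1" "r1 < r2" "x : frontier (annulus r1 r2)"
 shows "norm (annulus_normal r1 r2 x) = 1"
 using assms frontier_annulus(1)[OF assms(1,2)] by (auto simp: annulus_normal_def)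

lemma annulus_trace_integral:
 fixes T1 T2 :: "real ^ 2 => real"
 assumes \<rho>: "0 < r1" "r1 < r2" and T: "integrable circle_measure T1" "integrable circle_measure T2"
  and \<phi>: "continuous_on UNIV \<phi>"
 shows "set_integrable hausdorff1 (frontier (annulus r1 r2)) (annulus_trace r2 T1 T2)"
  and "(LINT x:frontier (annulus r1 r2)|hausdorff1. \<phi> x * annulus_normal r1 r2 x $ i * annulus_trace r2 T1 T2 x)
   = (\<integral>y. (\<phi> (r2 *\<^sub>R y) * (r2 *\<^sub>R y) $ i) * T2 y \<partial>circle_measure) - (\<integral>y. (\<phi> (r1 *\<^sub>R y) * (r1 *\<^sub>R y) $ i) * T1 y \<partial>circle_measure)"
proof -
 let ?T = "annulus_trace r2 T1 T2" and ?n = "annulus_normal r1 r2"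
 have Ts: "(%x. S (sgn x)) : borel_measurable borel" if "integrable circle_measure S" for S :: "real ^ 2 => real"
 proof -
  have "S : borel_measurable (restrict_space borel (cball 0 1))"
   using borel_measurable_integrable[OF that] by (simp add: measurable_cong_sets[OF sets_circle_measure refl])
  then show ?thesis by (rule measurable_compose[OF sgn_restrict])
 qed
 have Tb: "?T : borel_measurable borel"
  unfolding annulus_trace_def[abs_def] using Ts[OF T(1)] Ts[OF T(2)] by measurable
 have sgn1: "sgn (r *\<^sub>R y) = y" if "norm y = 1" "0 < r" for r and y :: "real ^ 2"
  using that by (simp add: sgn_scaleR sgn_div_norm)
 have T1e: "?T (r1 *\<^sub>R y) = T1 y" and T2e: "?T (r2 *\<^sub>R y) = T2 y" if "norm y = 1" for y
  using that \<rho> by (simp_all add: annulus_trace_def sgn1)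
 have AEi: "integrable circle_measure f" if "integrable circle_measure g" "f : borel_measurable circle_measure"
  "!!y. norm y = 1 ==> f y = g y" for f g :: "real ^ 2 => real"
 proof -
  have "AE y in circle_measure. f y = g y" using AE_circle_measure by eventually_elim (rule that(3))
  then show ?thesis using that(1,2) by (subst integrable_cong_AE) auto
 qed
 have sc: "(%y. h (r *\<^sub>R y)) : borel_measurable circle_measure" if "h : borel_measurable borel" for h :: "real ^ 2 => real" and r
  by (rule circle_borel, rule measurable_compose[OF _ that]) simp
 show "set_integrable hausdorff1 (frontier (annulus r1 r2)) ?T"
  by (rule frontier_integral(1)[OF \<rho> Tb]) (auto intro: AEi[OF T(1) sc[OF Tb] T1e] AEi[OF T(2) sc[OF Tb] T2e])
 let ?f = "%x. \<phi> x * ?n x $ i * ?T x"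
 have fb: "?f : borel_measurable borel"
  using Tb annulus_normal_borel borel_measurable_continuous_onI[OF \<phi>] by measurable
 let ?\<psi> = "%s y. \<phi> (s *\<^sub>R y) * (s *\<^sub>R y) $ i"
 have \<psi>c: "continuous_on A (?\<psi> s)" for s A
  by (intro continuous_intros continuous_on_compose2[OF \<phi>]) auto
 have ip: "integrable circle_measure (%y. ?\<psi> s y * S y)" if S: "integrable circle_measure S" for s S
 proof -
  have "compact (?\<psi> s ` cball 0 1)" by (intro compact_continuous_image \<psi>c) auto
  then obtain K where "\<forall>r\<in>?\<psi> s ` cball 0 1. norm r <= K" by (auto dest!: compact_imp_bounded simp only: bounded_iff)
  then have K: "\<bar>?\<psi> s y\<bar> <= K" if "norm y <= 1" for y using that by auto
  show ?thesis
  proof (rule Bochner_Integration.integrable_bound[of _ "%y. K * S y"])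
   show "(%y. ?\<psi> s y * S y) : borel_measurable circle_measure"
    using circle_borel[OF borel_measurable_continuous_onI[OF \<psi>c]] borel_measurable_integrable[OF S] by (rule borel_measurable_times)
   show "AE y in circle_measure. norm (?\<psi> s y * S y) <= norm (K * S y)"
   proof (rule AE_I2)
    fix y assume "y : space circle_measure"
    then have "\<bar>?\<psi> s y\<bar> <= \<bar>K\<bar>" using K[of y] by auto
    then show "norm (?\<psi> s y * S y) <= norm (K * S y)"
    unfolding real_norm_def abs_mult[of "?\<psi> s y"] abs_mult[of K] by (rule mult_right_mono) simp
   qed
  qed (use S in auto)
 qed
 have e1: "?f (r1 *\<^sub>R y) = - (1 / r1) * (?\<psi> r1 y * T1 y)" and e2: "?f (r2 *\<^sub>R y) = (1 / r2) * (?\<psi> r2 y * T2 y)" if "norm y = 1" for y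
  unfolding T1e[OF that] T2e[OF that] using that \<rho> by (simp_all add: annulus_normal_def)
 have i1: "integrable circle_measure (%y. ?f (r1 *\<^sub>R y))"
  by (rule AEi[OF integrable_mult_right[OF ip[OF T(1), of r1]] sc[OF fb] e1])
 have i2: "integrable circle_measure (%y. ?f (r2 *\<^sub>R y))"
  by (rule AEi[OF integrable_mult_right[OF ip[OF T(2), of r2]] sc[OF fb] e2])
 have cong: "(\<integral>y. f y \<partial>circle_measure) = (\<integral>y. g y \<partial>circle_measure)"
  if "integrable circle_measure f" "integrable circle_measure g" "!!y. norm y = 1 ==> f y = g y" for f g :: "real ^ 2 => real"
 proof -
  have "AE y in circle_measure. f y = g y" using AE_circle_measure by eventually_elim (rule that(3))
  then show ?thesis using that(1,2) by (intro integral_cong_AE) auto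
 qed
 define P where "P s S = (\<integral>y. ?\<psi> s y * S y \<partial>circle_measure)" for s S
 have "(\<integral>y. ?f (r1 *\<^sub>R y) \<partial>circle_measure) = (\<integral>y. - (1 / r1) * (?\<psi> r1 y * T1 y) \<partial>circle_measure)"
  by (rule cong[OF i1 integrable_mult_right[OF ip[OF T(1), of r1]] e1])
 then have I1: "(\<integral>y. ?f (r1 *\<^sub>R y) \<partial>circle_measure) = - (1 / r1) * P r1 T1"
  by (simp only: integral_mult_right_zero P_def)
 have "(\<integral>y. ?f (r2 *\<^sub>R y) \<partial>circle_measure) = (\<integral>y. (1 / r2) * (?\<psi> r2 y * T2 y) \<partial>circle_measure)"
  by (rule cong[OF i2 integrable_mult_right[OF ip[OF T(2), of r2]] e2])
 then have I2: "(\<integral>y. ?f (r2 *\<^sub>R y) \<partial>circle_measure) = (1 / r2) * P r2 T2"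
  by (simp only: integral_mult_right_zero P_def)
 have "(LINT x:frontier (annulus r1 r2)|hausdorff1. ?f x) = P r2 T2 - P r1 T1"
  unfolding frontier_integral(2)[OF \<rho> fb i1 i2] I1 I2 using \<rho> by simp
 then show "(LINT x:frontier (annulus r1 r2)|hausdorff1. ?f x)
   = (\<integral>y. ?\<psi> r2 y * T2 y \<partial>circle_measure) - (\<integral>y. ?\<psi> r1 y * T1 y \<partial>circle_measure)"
  by (simp only: P_def)
qed

text \<open>The Gauss--Green formula determines the products of the trace with the components of the normal,
 and the normal has length one.\<close>

lemma trace_unique:
 fixes T T' :: "real ^ 2 => real"
 assumes \<rho>: "0 < r1" "r1 < r2"
  and T: "is_trace (annulus r1 r2) (annulus_normal r1 r2) w T" "is_trace (annulus r1 r2) (annulus_normal r1 r2) w T'"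
 shows "AE x in hausdorff1. x : frontier (annulus r1 r2) --> T x = T' x"
proof -
 let ?S = "frontier (annulus r1 r2)" and ?n = "annulus_normal r1 r2"
 define h where "h x = indicator ?S x * (T x - T' x)" for x
 have iT: "integrable hausdorff1 (%x. indicator ?S x * T x)" "integrable hausdorff1 (%x. indicator ?S x * T' x)"
  using T by (auto simp: is_trace_def set_integrable_def)
 have h: "integrable hausdorff1 h" unfolding h_def right_diff_distrib using iT by auto
 have nb: "(%x. ?n x $ i) : borel_measurable hausdorff1" for i
  using annulus_normal_borel by (simp add: measurable_cong_sets[OF sets_hausdorff1 refl])
 have bnd: "integrable hausdorff1 (%x. c x * (indicator ?S x * f x))"
  if "integrable hausdorff1 (%x. indicator ?S x * f x)" "c : borel_measurable hausdorff1" "!!x. x : ?S ==> \<bar>c x\<bar> <= 1" for c f :: "real ^ 2 => real"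
 proof (rule Bochner_Integration.integrable_bound[OF that(1)])
  show "(%x. c x * (indicator ?S x * f x)) : borel_measurable hausdorff1"
   using that(2) borel_measurable_integrable[OF that(1)] by (rule borel_measurable_times)
  show "AE x in hausdorff1. norm (c x * (indicator ?S x * f x)) <= norm (indicator ?S x * f x)"
   using that(3) by (auto simp: indicator_def abs_mult intro!: AE_I2 mult_left_le_one_le)
 qed
 have n1: "\<bar>?n x $ i\<bar> <= 1" if "x : ?S" for x i
  using component_le_norm_cart[of "?n x" i] norm_annulus_normal[OF \<rho> that] by simp
 have hn: "integrable hausdorff1 (%x. ?n x $ i * h x)" for i
  unfolding h_def by (rule bnd[OF h[unfolded h_def] nb n1])
 have AEi: "AE x in hausdorff1. ?n x $ i * h x = 0" for i
 proof (rule density_unique_real[OF hn])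
  fix A :: "(real ^ 2) set" assume "A : sets hausdorff1"
  then have A: "A : sets borel" by simp
  have "(\<integral>x. indicator A x * (?n x $ i * h x) \<partial>hausdorff1) = 0"
  proof (rule test_functions_determine[OF open_UNIV _ _ hn _ A])
   show "(%x. x) : borel_measurable hausdorff1" by (simp add: measurable_cong_sets[OF sets_hausdorff1 refl])
   fix a b :: "real ^ 2" and n
   let ?\<phi> = "box_bump a b n"
   have C: "C1_on UNIV ?\<phi>" using box_bump_test[of a b UNIV n] by (auto intro: test_function_C1)
   have cb: "(%x. ?\<phi> x * ?n x $ i) : borel_measurable hausdorff1"
    using C1_on_borel[OF C] nb by (intro borel_measurable_times) (simp_all add: measurable_cong_sets[OF sets_hausdorff1 refl])
   have c1: "\<bar>?\<phi> x * ?n x $ i\<bar> <= 1" if "x : ?S" for x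
    unfolding abs_mult using box_bump_bounds n1[OF that] by (intro mult_le_one) auto
   have int: "integrable hausdorff1 (%x. (?\<phi> x * ?n x $ i) * (indicator ?S x * f x))"
    if "integrable hausdorff1 (%x. indicator ?S x * f x)" for f
    by (rule bnd[OF that cb c1])
   have "(LINT x:?S|hausdorff1. ?\<phi> x * ?n x $ i * T x) = (LINT x:?S|hausdorff1. ?\<phi> x * ?n x $ i * T' x)"
   proof -
    have "(LINT x:annulus r1 r2|lebesgue. w x * partial_deriv i ?\<phi> x) = - signed_integral (annulus r1 r2) (%E. gradient_measure (annulus r1 r2) w E $ i) ?\<phi>
    + (LINT x:?S|hausdorff1. ?\<phi> x * ?n x $ i * T x)"
    using T(1) C unfolding is_trace_def by blast
    moreover have "(LINT x:annulus r1 r2|lebesgue. w x * partial_deriv i ?\<phi> x) = - signed_integral (annulus r1 r2) (%E. gradient_measure (annulus r1 r2) w E $ i) ?\<phi>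
    + (LINT x:?S|hausdorff1. ?\<phi> x * ?n x $ i * T' x)"
    using T(2) C unfolding is_trace_def by blast
    ultimately show ?thesis by linarith
   qed
   then have "(\<integral>x. (?\<phi> x * ?n x $ i) * (indicator ?S x * T x) \<partial>hausdorff1) = (\<integral>x. (?\<phi> x * ?n x $ i) * (indicator ?S x * T' x) \<partial>hausdorff1)"
    by (simp add: set_lebesgue_integral_def mult_ac)
   moreover have "(\<integral>x. ?\<phi> x * (?n x $ i * h x) \<partial>hausdorff1)
    = (\<integral>x. (?\<phi> x * ?n x $ i) * (indicator ?S x * T x) - (?\<phi> x * ?n x $ i) * (indicator ?S x * T' x) \<partial>hausdorff1)"
    by (intro Bochner_Integration.integral_cong) (auto simp: h_def algebra_simps)
   ultimately show "(\<integral>x. ?\<phi> x * (?n x $ i * h x) \<partial>hausdorff1) = 0"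
    using int[OF iT(1)] int[OF iT(2)] by simp
  qed auto
  then show "(LINT x:A|hausdorff1. ?n x $ i * h x) = (LINT x:A|hausdorff1. 0)"
   by (simp add: set_lebesgue_integral_def)
 qed auto
 have "AE x in hausdorff1. \<forall>i\<in>(UNIV :: 2 set). ?n x $ i * h x = 0" by (rule AE_finite_allI) (use AEi in auto)
 then show ?thesis
 proof eventually_elim
  case (elim x)
  show ?case
  proof
   assume x: "x : ?S"
   have "?n x ~= 0" using norm_annulus_normal[OF \<rho> x] by auto
   then obtain i where "?n x $ i ~= 0" by (auto simp: vec_eq_iff)
   then have "h x = 0" using elim by auto
   then show "T x = T' x" using x by (simp add: h_def)
  qed
 qed
qed

section \<open>Structure of functions of bounded variation on the annulus\<close>

lemma gradient_measure_is: "w : BV \<U> ==> is_gradient_measure \<U> w (gradient_measure \<U> w)"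
proof -
 assume "w : BV \<U>"
 then have "\<exists>\<mu>. is_gradient_measure \<U> w \<mu>" by (simp add: BV_def)
 then show ?thesis unfolding gradient_measure_def by (rule someI_ex)
qed

text \<open>Existence of the trace: the densities of the two boundary layers are glued together, with opposite
 signs because the outward normal of the inner circle points towards the origin.\<close>

lemma bv_trace_is_trace:
 assumes \<rho>: "0 < r1" "r1 < r2" and w: "w : BV (annulus r1 r2)"
 shows "is_trace (annulus r1 r2) (annulus_normal r1 r2) w (bv_trace (annulus r1 r2) (annulus_normal r1 r2) w)"
proof -
 let ?\<U> = "annulus r1 r2"
 define \<mu> where "\<mu> = gradient_measure ?\<U> w"
 have g: "is_gradient_measure ?\<U> w \<mu>" unfolding \<mu>_def by (rule gradient_measure_is[OF w])
 then have vm: "vector_measure_on ?\<U> \<mu>" by (simp add: is_gradient_measure_def)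
 have \<U>b: "?\<U> : sets borel" by (simp add: borel_open open_annulus)
 have wi: "set_integrable lebesgue ?\<U> w" using w by (simp add: BV_def)
 obtain v where v: "v : borel_measurable borel" "set_integrable lborel ?\<U> v"
  and "AE x in lborel. x : ?\<U> --> w x = v x"
  and v3: "!!\<phi>. \<phi> : borel_measurable borel ==> (LINT x:?\<U>|lebesgue. w x * \<phi> x) = (LINT x:?\<U>|lborel. v x * \<phi> x)"
  by (rule lebesgue_borel_representative[OF wi \<U>b], rule that)
 obtain M d l where M: "finite_measure M" "sets M = borel_on ?\<U>" and d: "integrable M d"
  and \<mu>d: "!!E i. E : borel_on ?\<U> ==> \<mu> E $ i = (\<integral>x. indicator E x * (d x :: real ^ 2) $ i \<partial>M)"
  and l: "integrable M l" "!!x. 0 <= (l x :: real)" "density M (%x. ennreal (l x)) = restrict_space lborel ?\<U>"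
  by (rule vector_measure_density[OF vm \<U>b annulus_bounded], rule that)
 have di: "integrable M (%x. d x $ i)" for i
  using d by (rule integrable_bounded_linear[OF bounded_linear_vec_nth])
 have id: "(%x. x) : M \<rightarrow>\<^sub>M restrict_space borel ?\<U>" by (simp add: measurable_cong_sets[OF M(2) refl])
 have lm: "l : borel_measurable M" using l(1) by auto
 have wl: "(LINT x:?\<U>|lebesgue. w x * \<phi> x) = (\<integral>x. v x * \<phi> x * l x \<partial>M)" if [measurable]: "\<phi> : borel_measurable borel" for \<phi>
 proof -
  have [measurable]: "v : borel_measurable borel" by (rule v(1))
  have "(%x. v x * \<phi> x) : borel_measurable borel" by measurable
  then have "(\<integral>x. v x * \<phi> x * l x \<partial>M) = (LINT x:?\<U>|lborel. v x * \<phi> x)"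
   by (intro integral_restrict_density(1)[OF \<U>b M(2) lm l(2,3)] measurable_restrict_space1)
  then show ?thesis using v3[OF that] by simp
 qed
 have si: "signed_integral ?\<U> (%E. \<mu> E $ i) \<phi> = (\<integral>x. \<phi> x * d x $ i \<partial>M)" if \<phi>: "C1_on UNIV \<phi>" for \<phi> i
 proof -
  have "compact (\<phi> ` cball 0 r2)"
   using C1_on_continuous_on[OF \<phi>] by (intro compact_continuous_image) (auto intro: continuous_on_subset)
  then obtain K where "\<forall>x\<in>cball 0 r2. \<bar>\<phi> x\<bar> <= K" by (auto dest!: compact_imp_bounded simp: bounded_iff)
  then have K: "\<bar>\<phi> x\<bar> <= K" if "x : ?\<U>" for x using that by (auto simp: annulus_def)
  show ?thesis
   by (rule signed_integral_image(2)[where p = "%x. x", OF id di \<U>b _ measurable_restrict_space1[OF C1_on_borel[OF \<phi>]] K])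
    (auto simp: \<mu>d)
 qed
 interpret bv_density r1 r2 v l M d
 proof (rule bv_density.intro)
  show "integrable M (%x. v x * l x)"
   using integral_restrict_density(2)[OF \<U>b M(2) lm l(2,3) measurable_restrict_space1[OF v(1)]] v(2) by simp
  then have vl: "integrable M (%x. v x * l x)" .
  fix \<phi> and i :: 2 assume \<phi>: "\<phi> : test_functions ?\<U>"
  have C: "C1_on UNIV \<phi>" using \<phi> by (rule test_function_C1)
  have b: "integrable M (%x. b x * f x)" if f: "integrable M f" and "continuous_on UNIV b" for b f :: "real ^ 2 => real"
  proof -
   have "compact (b ` cball 0 r2)"
    using that(2) by (intro compact_continuous_image) (auto intro: continuous_on_subset)
   then obtain K where K: "\<forall>x\<in>cball 0 r2. \<bar>b x\<bar> <= K" by (auto dest!: compact_imp_bounded simp: bounded_iff)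
   have spM: "space M = ?\<U>" using sets_eq_imp_space_eq[OF M(2)] by (simp add: space_restrict_space)
   have bm: "b : borel_measurable M"
    unfolding measurable_cong_sets[OF M(2) refl]
    by (rule measurable_restrict_space1[OF borel_measurable_continuous_onI[OF that(2)]])
   show ?thesis
   proof (rule Bochner_Integration.integrable_bound[of _ "%x. K * f x"])
    show "(%x. b x * f x) : borel_measurable M" using bm borel_measurable_integrable[OF f] by (rule borel_measurable_times)
    show "AE x in M. norm (b x * f x) <= norm (K * f x)"
    using K by (auto simp: spM annulus_def abs_mult intro!: AE_I2 mult_right_mono intro: order_trans[OF _ abs_ge_self])
   qed (use f in auto)
  qed
  have "(\<integral>x. v x * partial_deriv i \<phi> x * l x \<partial>M) = - (\<integral>x. \<phi> x * d x $ i \<partial>M)"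
   using g \<phi> wl[OF partial_deriv_borel[OF C, of i]] si[OF C, of i] by (simp add: is_gradient_measure_def)
  moreover have "integrable M (%x. v x * partial_deriv i \<phi> x * l x)"
   using b[OF vl, of "partial_deriv i \<phi>"] C by (simp add: C1_on_def mult_ac)
  moreover have "integrable M (%x. \<phi> x * d x $ i)" by (rule b[OF di C1_on_continuous_on[OF C]])
  ultimately show "(\<integral>x. v x * partial_deriv i \<phi> x * l x + \<phi> x * d x $ i \<partial>M) = 0" by simp
 qed (fact \<rho> M l d v(1))+
 obtain T1 where T1: "integrable circle_measure T1"
  "!!B. B : borel_on (cball 0 1) ==> (\<integral>x. indicator B (sgn x) * rad HL HL' x \<partial>M) = (\<integral>y. indicator B y * T1 y \<partial>circle_measure)"
  using trace_density_exists[OF C1_HL] by blast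
 obtain T2 where T2: "integrable circle_measure T2"
  "!!B. B : borel_on (cball 0 1) ==> (\<integral>x. indicator B (sgn x) * rad HR HR' x \<partial>M) = (\<integral>y. indicator B y * T2 y \<partial>circle_measure)"
  using trace_density_exists[OF C1_HR] by blast
 have T1': "integrable circle_measure (%y. - T1 y)" using T1(1) by simp
 let ?T = "annulus_trace r2 (%y. - T1 y) T2"
 have "is_trace ?\<U> (annulus_normal r1 r2) w ?T"
  unfolding is_trace_def
 proof (intro conjI allI impI)
  show "set_integrable hausdorff1 (frontier ?\<U>) ?T"
   by (rule annulus_trace_integral(1)[OF \<rho> T1' T2(1) continuous_on_const])
  fix \<phi> :: "real ^ 2 => real" and i assume \<phi>: "C1_on UNIV \<phi>"
  have "(\<integral>x. v x * partial_deriv i \<phi> x * l x \<partial>M) + (\<integral>x. \<phi> x * d x $ i \<partial>M)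
   = (LINT x:frontier ?\<U>|hausdorff1. \<phi> x * annulus_normal r1 r2 x $ i * ?T x)"
   unfolding annulus_trace_integral(2)[OF \<rho> T1' T2(1) C1_on_continuous_on[OF \<phi>]]
   by (rule trace_formula[OF T1' _ T2 \<phi>]) (simp add: T1(2))
  then show "(LINT x:?\<U>|lebesgue. w x * partial_deriv i \<phi> x) = - signed_integral ?\<U> (%E. gradient_measure ?\<U> w E $ i) \<phi>
    + (LINT x:frontier ?\<U>|hausdorff1. \<phi> x * annulus_normal r1 r2 x $ i * ?T x)"
   using wl[OF partial_deriv_borel[OF \<phi>, of i]] si[OF \<phi>, of i] by (simp add: \<mu>_def)
 qed
 then show ?thesis unfolding bv_trace_def
  by (rule someI[where P = "is_trace ?\<U> (annulus_normal r1 r2) w"])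
qed

lemma BV_structure:
 assumes \<rho>: "0 < r1" "r1 < r2" and w: "w : BV (annulus r1 r2)"
 obtains N k where "set_integrable lebesgue (annulus r1 r2) (grad_ac (annulus r1 r2) w)"
  "finite_measure N" "sets N = borel_on (annulus r1 r2)" "integrable N (k :: real ^ 2 => real ^ 2)"
  "!!E i. E : borel_on (annulus r1 r2) ==> grad_sing (annulus r1 r2) w E $ i = (\<integral>x. indicator E x * k x $ i \<partial>N)"
  "!!\<phi> K i. \<phi> : borel_measurable borel ==> \<forall>x\<in>annulus r1 r2. \<bar>\<phi> x\<bar> <= K ==>
    signed_integral (annulus r1 r2) (%E. gradient_measure (annulus r1 r2) w E $ i) \<phi>
    = (LINT x:annulus r1 r2|lebesgue. \<phi> x * grad_ac (annulus r1 r2) w x $ i) + (\<integral>x. \<phi> x * k x $ i \<partial>N)"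
proof -
 let ?\<U> = "annulus r1 r2"
 define \<mu> where "\<mu> = gradient_measure ?\<U> w"
 have g: "is_gradient_measure ?\<U> w \<mu>" unfolding \<mu>_def by (rule gradient_measure_is[OF w])
 then have vm: "vector_measure_on ?\<U> \<mu>" by (simp add: is_gradient_measure_def)
 have \<U>b: "?\<U> : sets borel" by (simp add: borel_open open_annulus)
 show thesis
 proof (rule lebesgue_decomposition_exists[OF vm \<U>b annulus_bounded])
  fix N f \<sigma> and k :: "real ^ 2 => real ^ 2"
  assume D: "lebesgue_decomposition ?\<U> \<mu> f \<sigma>"
   and N: "finite_measure N" "sets N = borel_on ?\<U>" "integrable N k"
   and \<sigma>: "!!E i. E : borel_on ?\<U> ==> \<sigma> E $ i = (\<integral>x. indicator E x * k x $ i \<partial>N)"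
   and si: "!!\<phi> K i. \<phi> : borel_measurable borel ==> (!!x. x : ?\<U> ==> \<bar>\<phi> x\<bar> <= K) ==>
    signed_integral ?\<U> (%E. \<mu> E $ i) \<phi> = (LINT x:?\<U>|lebesgue. \<phi> x * f x $ i) + (\<integral>x. \<phi> x * k x $ i \<partial>N)"
 have "\<exists>\<sigma>. lebesgue_decomposition ?\<U> \<mu> (grad_ac ?\<U> w) \<sigma>"
  unfolding grad_ac_def \<mu>_def[symmetric]
  by (rule someI_ex[where P = "%f. \<exists>\<sigma>. lebesgue_decomposition ?\<U> \<mu> f \<sigma>"]) (use D in blast)
 then obtain \<sigma>' where D1: "lebesgue_decomposition ?\<U> \<mu> (grad_ac ?\<U> w) \<sigma>'" by blast
 have "\<exists>f. lebesgue_decomposition ?\<U> \<mu> f (grad_sing ?\<U> w)"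
  unfolding grad_sing_def \<mu>_def[symmetric]
  by (rule someI_ex[where P = "%\<sigma>. \<exists>f. lebesgue_decomposition ?\<U> \<mu> f \<sigma>"]) (use D in blast)
 then obtain f' where D2: "lebesgue_decomposition ?\<U> \<mu> f' (grad_sing ?\<U> w)" by blast
 have AE: "AE x in lebesgue. x : ?\<U> --> grad_ac ?\<U> w x = f x"
  by (rule lebesgue_decomposition_unique(1)[OF D1 D \<U>b]) simp
 have sing: "grad_sing ?\<U> w E = \<sigma> E" if "E : borel_on ?\<U>" for E
  by (rule lebesgue_decomposition_unique(2)[OF D2 D \<U>b _ that]) simp
 have fi: "set_integrable lebesgue ?\<U> f" "set_integrable lebesgue ?\<U> (grad_ac ?\<U> w)"
  using D D1 unfolding lebesgue_decomposition_def by blast+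
 show thesis
 proof (rule that[OF fi(2) N])
  show "grad_sing ?\<U> w E $ i = (\<integral>x. indicator E x * k x $ i \<partial>N)" if "E : borel_on ?\<U>" for E i
   using sing[OF that] \<sigma>[OF that] by simp
  fix \<phi> :: "real ^ 2 => real" and K i
  assume \<phi>: "\<phi> : borel_measurable borel" "\<forall>x\<in>?\<U>. \<bar>\<phi> x\<bar> <= K"
  have m: "(%x. indicator ?\<U> x *\<^sub>R (\<phi> x * h x $ i)) : borel_measurable lebesgue" if "set_integrable lebesgue ?\<U> h" for h :: "real ^ 2 => real ^ 2"
  proof -
   have "integrable lebesgue (%x. indicator ?\<U> x * h x $ i)"
    using integrable_bounded_linear[OF bounded_linear_vec_nth that[unfolded set_integrable_def], of i] by simp
   moreover have "\<phi> : borel_measurable lebesgue" by (rule measurable_completion) (use \<phi> in simp)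
   ultimately have "(%x. \<phi> x * (indicator ?\<U> x * h x $ i)) : borel_measurable lebesgue"
    using borel_measurable_times borel_measurable_integrable by blast
   then show ?thesis by (simp add: mult_ac)
  qed
  have "(LINT x:?\<U>|lebesgue. \<phi> x * f x $ i) = (LINT x:?\<U>|lebesgue. \<phi> x * grad_ac ?\<U> w x $ i)"
   unfolding set_lebesgue_integral_def
   by (rule integral_cong_AE[OF m[OF fi(1)] m[OF fi(2)]]) (use AE in eventually_elim, auto simp: indicator_def)
  then show "signed_integral ?\<U> (%E. gradient_measure ?\<U> w E $ i) \<phi>
    = (LINT x:?\<U>|lebesgue. \<phi> x * grad_ac ?\<U> w x $ i) + (\<integral>x. \<phi> x * k x $ i \<partial>N)"
   using si[OF \<phi>(1), of K i] \<phi>(2) by (simp add: \<mu>_def)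
 qed
 qed
qed

section \<open>Polar coordinates\<close>

lemma emeasure_cone:
 assumes B: "B : borel_on (cball 0 1)" and s: "0 < s"
 shows "emeasure lborel (sgn -` B Int ball 0 s) = emeasure circle_measure B * ennreal (s\<^sup>2 / 2)"
proof -
 have Bb: "sgn -` B : sets borel" using measurable_sets[OF sgn_borel, of B] B by (simp add: borel_on_iff)
 have im: "sgn -` B Int ball 0 s = (%x. s *\<^sub>R x + 0) ` (sgn -` B Int ball 0 1)"
 proof
  show "sgn -` B Int ball 0 s \<subseteq> (%x. s *\<^sub>R x + 0) ` (sgn -` B Int ball 0 1)"
  proof
   fix x assume x: "x : sgn -` B Int ball 0 s"
   then have "x /\<^sub>R s : sgn -` B Int ball 0 1" using s by (auto simp: sgn_scaleR field_simps)
   moreover have "x = s *\<^sub>R (x /\<^sub>R s) + 0" using s by simp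
   ultimately show "x : (%x. s *\<^sub>R x + 0) ` (sgn -` B Int ball 0 1)" by blast
  qed
 qed (use s in "auto simp: sgn_scaleR")
 have meas: "sgn -` B Int ball 0 r : sets lborel" for r using Bb by (auto simp: borel_open)
 have "emeasure lborel (sgn -` B Int ball 0 s) = emeasure lebesgue (sgn -` B Int ball 0 s)" using meas by simp
 also have "... = ennreal (\<bar>s\<bar> ^ DIM(real ^ 2)) * emeasure lebesgue (sgn -` B Int ball 0 1)"
  unfolding im by (subst emeasure_lebesgue_affine) simp
 also have "emeasure lebesgue (sgn -` B Int ball 0 1) = emeasure lborel (sgn -` B Int ball 0 1)" using meas by simp
 also have "ennreal (\<bar>s\<bar> ^ DIM(real ^ 2)) = ennreal (s\<^sup>2 / 2) * 2"
  by (simp add: ennreal_mult[symmetric] flip: ennreal_numeral)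
 finally show ?thesis by (simp add: emeasure_circle_measure[OF B] mult_ac)
qed

text \<open>Both sides are finite measures on the line, so that it suffices to compare them on half lines, where
 the area of a truncated cone is known by scaling.\<close>

lemma polar_coordinates:
 assumes B: "B : borel_on (cball 0 1)" and R: "0 < R"
 shows "distr (density lborel (%x. indicator (sgn -` B Int ball 0 R) x)) borel norm
  = density lborel (%r. emeasure circle_measure B * (ennreal r * indicator {0..R} r))"
  (is "?L = ?R")
proof (rule measure_eqI_lessThan)
 interpret finite_measure circle_measure by (rule finite_circle_measure)
 let ?V = "%s. sgn -` B Int ball (0 :: real ^ 2) s"
 have Bb: "sgn -` B : sets borel" using measurable_sets[OF sgn_borel, of B] B by (simp add: borel_on_iff)
 have meas: "?V r : sets lborel" for r using Bb by (auto simp: borel_open)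
 have VR: "indicator (?V R) : borel_measurable (lborel :: (real ^ 2) measure)" using meas by (intro borel_measurable_indicator)
 have L: "emeasure ?L {a<..} = emeasure lborel (?V R Int {x. a < norm x})" for a
 proof -
  have o: "{x :: real ^ 2. a < norm x} : sets borel" by measurable
  have "emeasure ?L {a<..} = emeasure (density lborel (indicator (?V R))) {x. a < norm x}"
   by (subst emeasure_distr) (auto simp: vimage_def)
  also have "... = (\<integral>\<^sup>+x. indicator (?V R) x * indicator {x. a < norm x} x \<partial>lborel)"
   using VR o by (intro emeasure_density) auto
  also have "... = (\<integral>\<^sup>+x. indicator (?V R Int {x. a < norm x}) x \<partial>lborel)"
   by (intro nn_integral_cong) (auto simp: indicator_def)
  also have "... = emeasure lborel (?V R Int {x. a < norm x})"
   using meas o by (intro nn_integral_indicator) auto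
  finally show ?thesis .
 qed
 have Rm: "(%r. emeasure circle_measure B * (ennreal r * indicator {0..R} r)) : borel_measurable lborel" by measurable
 have ftc: "(\<integral>\<^sup>+r. ennreal r * indicator {a..R} r \<partial>lborel) = ennreal (R\<^sup>2 / 2 - a\<^sup>2 / 2)" if "0 <= a" "a <= R" for a
  by (rule nn_integral_FTC_Icc) (use that in "auto intro!: derivative_eq_intros")
 have Rr: "emeasure ?R {a<..} = emeasure circle_measure B * ennreal (R\<^sup>2 / 2 - (max a 0)\<^sup>2 / 2)" if "a <= R" for a
 proof -
  have "emeasure ?R {a<..} = (\<integral>\<^sup>+r. emeasure circle_measure B * (ennreal r * indicator {0..R} r) * indicator {a<..} r \<partial>lborel)"
   using Rm by (intro emeasure_density) auto
  also have "... = (\<integral>\<^sup>+r. emeasure circle_measure B * (ennreal r * indicator {max a 0..R} r) \<partial>lborel)"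
  proof (rule nn_integral_cong_AE)
   have "AE r in lborel. r ~= a" by (rule AE_lborel_singleton)
   then show "AE r in lborel. emeasure circle_measure B * (ennreal r * indicator {0..R} r) * indicator {a<..} r
    = emeasure circle_measure B * (ennreal r * indicator {max a 0..R} r)"
    by eventually_elim (auto simp: indicator_def)
  qed
  also have "... = emeasure circle_measure B * ennreal (R\<^sup>2 / 2 - (max a 0)\<^sup>2 / 2)"
   using ftc[of "max a 0"] that R by (subst nn_integral_cmult) auto
  finally show ?thesis .
 qed
 show "emeasure ?L {a<..} < \<infinity>" for a
 proof -
  have "emeasure lborel (?V R Int {x. a < norm x}) <= emeasure lborel (?V R)" using meas by (intro emeasure_mono) auto
  also have "... < \<infinity>" using emeasure_cone[OF B R] by (simp add: emeasure_eq_measure ennreal_mult_less_top)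
  finally show ?thesis by (simp add: L)
 qed
 show "emeasure ?L {a<..} = emeasure ?R {a<..}" for a
 proof -
  consider "R < a" | "a <= 0" "a <= R" | "0 < a" "a <= R" by linarith
  then show ?thesis
  proof cases
   case 1
   have "?V R Int {x. a < norm x} = {}" using 1 by auto
   moreover have "emeasure ?R {a<..} = (\<integral>\<^sup>+(r :: real). 0 \<partial>lborel)"
    using Rm 1 by (subst emeasure_density) (auto intro!: nn_integral_cong simp: indicator_def simp del: nn_integral_0_iff nn_integral_const)
   ultimately show ?thesis by (simp add: L)
  next
   case 2
   have "emeasure lborel (?V R Int {x. a < norm x}) = emeasure lborel (?V R)"
   proof (rule emeasure_eq_AE)
    have "AE x in (lborel :: (real ^ 2) measure). x ~= 0" by (rule AE_lborel_singleton)
    then show "AE x in lborel. x : ?V R Int {x. a < norm x} \<longleftrightarrow> x : ?V R"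
    by eventually_elim (use 2 in "auto intro: le_less_trans")
    have "{x :: real ^ 2. a < norm x} : sets lborel" by measurable
    then show "?V R Int {x. a < norm x} : sets lborel" using meas by auto
   qed (use meas in auto)
   then show ?thesis using Rr[OF 2(2)] 2(1) emeasure_cone[OF B R] by (simp add: L max_absorb2)
  next
   case 3
   have "emeasure lborel (?V R Int {x. a < norm x}) = emeasure lborel (?V R - ?V a)"
   proof (rule emeasure_eq_AE)
    have "sphere (0 :: real ^ 2) a : null_sets lebesgue"
    using negligible_sphere[of "0 :: real ^ 2" a] by (simp add: negligible_iff_null_sets)
    then have "AE x in lebesgue. x \<notin> sphere (0 :: real ^ 2) a" by (rule AE_not_in)
    then have "AE x in lborel. x \<notin> sphere (0 :: real ^ 2) a" by (simp only: AE_lebesgue_iff)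
    then show "AE x in lborel. x : ?V R Int {x. a < norm x} \<longleftrightarrow> x : ?V R - ?V a"
    by eventually_elim auto
    have "{x :: real ^ 2. a < norm x} : sets lborel" by measurable
    then show "?V R Int {x. a < norm x} : sets lborel" using meas by auto
   qed (use meas in auto)
   also have "... = emeasure lborel (?V R) - emeasure lborel (?V a)"
    using 3 meas emeasure_cone[OF B 3(1)] by (intro emeasure_Diff) (auto simp: ennreal_mult_eq_top_iff)
   also have "... = emeasure circle_measure B * (ennreal (R\<^sup>2 / 2) - ennreal (a\<^sup>2 / 2))"
    unfolding emeasure_cone[OF B R] emeasure_cone[OF B 3(1)]
    using 3 by (simp add: emeasure_eq_measure ennreal_minus ennreal_mult[symmetric] right_diff_distrib power_mono divide_right_mono)
   finally show ?thesis using Rr[OF 3(2)] 3 by (simp add: L ennreal_minus max_absorb1)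
  qed
 qed
qed auto

lemma polar_integral:
 fixes f :: "real => real"
 assumes B: "B : borel_on (cball 0 1)" and R: "0 < R" and f: "f : borel_measurable borel"
  and i: "set_integrable lborel {0..R} (%r. r * f r)"
 shows "integrable lborel (%x. indicator (ball 0 R) x * (indicator B (sgn x) * f (norm x)))"
  and "(\<integral>x. indicator (ball 0 R) x * (indicator B (sgn x) * f (norm x)) \<partial>lborel)
   = measure circle_measure B * (LINT r:{0..R}|lborel. r * f r)"
proof -
 interpret finite_measure circle_measure by (rule finite_circle_measure)
 let ?V = "sgn -` B Int ball (0 :: real ^ 2) R"
 have Bb: "sgn -` B : sets borel" using measurable_sets[OF sgn_borel, of B] B by (simp add: borel_on_iff)
 have VR: "?V : sets lborel" using Bb by (auto simp: borel_open)
 let ?c = "measure circle_measure B"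
 have d2: "density lborel (%r. emeasure circle_measure B * (ennreal r * indicator {0..R} r))
   = density lborel (%r. ennreal (?c * (r * indicator {0..R} r)))"
  by (rule density_cong) (auto simp: emeasure_eq_measure indicator_def ennreal_mult)
 have d1: "density lborel (indicator ?V) = density lborel (%x. ennreal (indicator ?V x))"
  by (rule density_cong) (use VR in "auto simp: ennreal_indicator")
 have fn: "(%x :: real ^ 2. f (norm x)) : borel_measurable borel" by (rule measurable_compose[OF _ f]) simp
 have nm: "norm : borel_measurable (density lborel (%x. ennreal (indicator ?V x)))" by simp
 have eq: "(%x. indicator ?V x * f (norm x)) = (%x. indicator (ball 0 R) x * (indicator B (sgn x) * f (norm x)))"
  by (auto simp: fun_eq_iff indicator_def)
 note P = polar_coordinates[OF B R, unfolded d1 d2]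
 have cm: "(%r. ?c * (r * indicator {0..R} r)) : borel_measurable lborel" by measurable
 have i2: "integrable lborel (%r. (?c * (r * indicator {0..R} r)) *\<^sub>R f r)"
  using integrable_mult_right[OF i[unfolded set_integrable_def], of ?c] by (simp add: mult_ac)
 have "integrable (density lborel (%r. ennreal (?c * (r * indicator {0..R} r)))) f"
  using i2 f cm by (subst integrable_density) (auto simp: indicator_def)
 then have "integrable (density lborel (%x. ennreal (indicator ?V x))) (%x. f (norm x))"
  unfolding P[symmetric] by (subst (asm) integrable_distr_eq[OF nm f])
 then show "integrable lborel (%x. indicator (ball 0 R) x * (indicator B (sgn x) * f (norm x)))"
  unfolding eq[symmetric] using VR fn by (subst (asm) integrable_density) auto
 have "(\<integral>x. indicator (ball 0 R) x * (indicator B (sgn x) * f (norm x)) \<partial>lborel)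
   = (\<integral>x. f (norm x) \<partial>density lborel (%x. ennreal (indicator ?V x)))"
  unfolding eq[symmetric] using VR fn by (subst integral_density) auto
 also have "... = (\<integral>r. f r \<partial>density lborel (%r. ennreal (?c * (r * indicator {0..R} r))))"
  unfolding P[symmetric] by (rule integral_distr[OF nm f, symmetric])
 also have "... = (\<integral>r. (?c * (r * indicator {0..R} r)) *\<^sub>R f r \<partial>lborel)"
  using f cm by (intro integral_density) (auto simp: indicator_def)
 also have "... = ?c * (LINT r:{0..R}|lborel. r * f r)"
  unfolding set_lebesgue_integral_def by (simp add: mult_ac flip: integral_mult_right_zero)
 finally show "(\<integral>x. indicator (ball 0 R) x * (indicator B (sgn x) * f (norm x)) \<partial>lborel)
   = ?c * (LINT r:{0..R}|lborel. r * f r)" .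
qed

section \<open>The integrand\<close>

locale integrand =
 fixes g g' g'' :: "real => real" and A B :: real
 assumes g_deriv: "!!t. 0 <= t ==> (g has_real_derivative g' t) (at t within {0..})"
  and g'_deriv: "!!t. 0 <= t ==> (g' has_real_derivative g'' t) (at t within {0..})"
  and g''_cont: "continuous_on {0..} g''" and g''_pos: "!!t. 0 <= t ==> 0 < g'' t"
  and g_upper: "!!t. 0 <= t ==> g t <= A * t + B"
  and g0: "g 0 = 0" and g'0: "g' 0 = 0"
begin

text \<open>The odd extension of \<open>g'\<close>, which is a C1 diffeomorphism of the line onto \<open>(-S, S)\<close>.\<close>

definition "\<gamma> t = (if 0 <= t then g' t else - g' (- t))"

lemma \<gamma>_odd: "\<gamma> (- t) = - \<gamma> t"
 using g'0 by (cases "t = 0") (auto simp: \<gamma>_def)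

lemma \<gamma>_deriv: "(\<gamma> has_real_derivative g'' \<bar>t\<bar>) (at t)"
proof -
 have pos: "(\<gamma> has_real_derivative g'' t) (at t)" if "0 < t" for t
 proof -
  have "(g' has_real_derivative g'' t) (at t)"
   using g'_deriv[of t] that at_within_interior[of t "{0..}"] by simp
  then show ?thesis
   by (rule has_field_derivative_transform_within_open[of _ _ _ "{0<..}"]) (use that in "auto simp: \<gamma>_def")
 qed
 consider "0 < t" | "t < 0" | "t = 0" by linarith
 then show ?thesis
 proof cases
  case 1
  then show ?thesis using pos by simp
 next
  case 2
  then have "(\<gamma> has_real_derivative g'' (- t)) (at (- t))" by (intro pos) simp
  then have "((%t. - \<gamma> (- t)) has_real_derivative g'' (- t)) (at t)"
   by (auto intro!: derivative_eq_intros DERIV_chain2[of \<gamma>])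
  then show ?thesis using 2 by (simp add: \<gamma>_odd)
 next
  case 3
  have "((%z. g' z / z) \<longlongrightarrow> g'' 0) (at_right 0)"
  proof -
   have "((%z. (g' z - g' 0) / (z - 0)) \<longlongrightarrow> g'' 0) (at 0 within {0..})"
    using g'_deriv[of 0] by (simp add: has_field_derivative_iff)
   then have "((%z. g' z / z) \<longlongrightarrow> g'' 0) (at 0 within {0..})" by (simp add: g'0)
   then show ?thesis by (rule tendsto_within_subset) (simp add: subset_eq)
  qed
  moreover have "filterlim (%y::real. \<bar>y\<bar>) (at_right 0) (at 0)"
  proof -
   have "((%y::real. \<bar>y\<bar>) \<longlongrightarrow> 0) (at 0)" by (rule tendsto_rabs_zero[OF tendsto_ident_at])
   then show ?thesis by (auto simp: filterlim_at eventually_at_filter)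
  qed
  ultimately have "((%y. g' \<bar>y\<bar> / \<bar>y\<bar>) \<longlongrightarrow> g'' 0) (at 0)" by (rule filterlim_compose)
  moreover have "\<forall>\<^sub>F y in at 0. g' \<bar>y\<bar> / \<bar>y\<bar> = (\<gamma> y - \<gamma> 0) / (y - 0)"
   by (auto simp: eventually_at_filter \<gamma>_def g'0)
  ultimately have "((%y. (\<gamma> y - \<gamma> 0) / (y - 0)) \<longlongrightarrow> g'' 0) (at 0)" using filterlim_cong by fast
  then show ?thesis using 3 by (simp add: has_field_derivative_iff)
 qed
qed

lemma \<gamma>_mono: "s < t ==> \<gamma> s < \<gamma> t"
 by (rule DERIV_pos_imp_increasing) (use \<gamma>_deriv g''_pos in "auto intro!: exI")

lemma g'_mono: "0 <= s ==> s < t ==> g' s < g' t"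
 using \<gamma>_mono[of s t] by (simp add: \<gamma>_def)

lemma g_MVT:
 assumes "0 <= s" "s < t"
 obtains z where "s < z" "z < t" "g t - g s = (t - s) * g' z"
proof -
 have "\<exists>z\<in>{s<..<t}. g t - g s = g' z * (t - s)"
 proof (rule mvt_simple[OF assms(2), of g "%x. (*) (g' x)", simplified])
  fix x assume "s <= x" "x <= t"
  then have "(g has_real_derivative g' x) (at x within {0..})" using assms by (intro g_deriv) auto
  then have "(g has_real_derivative g' x) (at x within {s..t})"
   by (rule DERIV_subset) (use assms in auto)
  then show "(g has_derivative (*) (g' x)) (at x within {s..t})" by (simp add: has_field_derivative_def)
 qed
 then show ?thesis using that by (auto simp: mult.commute)
qed

text \<open>Strict convexity.\<close>

lemma g_tangent:
 assumes "0 <= s" "0 <= t" "s ~= t"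
 shows "g s + g' s * (t - s) < g t"
proof (cases "s < t")
 case True
 obtain z where z: "s < z" "z < t" "g t - g s = (t - s) * g' z" using g_MVT[OF assms(1) True] .
 have "(t - s) * g' s < (t - s) * g' z" using z(1) assms(1) True by (intro mult_strict_left_mono g'_mono) auto
 then show ?thesis using z(3) by (simp add: mult.commute)
next
 case False
 then have ts: "t < s" using assms(3) by simp
 obtain z where z: "t < z" "z < s" "g s - g t = (s - t) * g' z" using g_MVT[OF assms(2) ts] .
 have "(s - t) * g' z < (s - t) * g' s" using z(1,2) assms(2) ts by (intro mult_strict_left_mono g'_mono) auto
 then show ?thesis using z(3) by (simp add: algebra_simps)
qed

lemma g'_bounded: "\<exists>K. \<forall>t\<ge>0. g' t <= K"
proof -
 have gp: "0 <= g t" if "0 <= t" for t using g_tangent[of 0 t] that g0 g'0 by (cases "t = 0") auto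
 have big: "g' t <= 2 * A + \<bar>B\<bar>" if "1 <= t" for t
 proof -
  have "g t + g' t * (2 * t - t) < g (2 * t)" using that by (intro g_tangent) auto
  then have "g' t * t <= 2 * A * t + B" using gp[of t] g_upper[of "2 * t"] that by (simp add: mult_ac)
  also have "... <= (2 * A + \<bar>B\<bar>) * t" using that mult_left_mono[OF that, of "\<bar>B\<bar>"] by (simp add: distrib_right)
  finally show ?thesis using that by (simp add: mult_le_cancel_right)
 qed
 have "g' t <= 2 * A + \<bar>B\<bar>" if "0 <= t" for t
 proof (cases "1 <= t")
  case False
  then have "g' t < g' 1" using that by (intro g'_mono) auto
  then show ?thesis using big[of 1] by simp
 qed (rule big)
 then show ?thesis by blast
qed

definition "S = (SUP t\<in>{0..}. g' t)"

lemma g'_bdd: "bdd_above (g' ` {0..})"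
 using g'_bounded by (auto simp: bdd_above_def)

lemma g'_less_S: "0 <= t ==> g' t < S"
proof -
 assume "0 <= t"
 then have "g' t < g' (t + 1)" by (intro g'_mono) auto
 also have "... <= S" unfolding S_def using \<open>0 <= t\<close> by (intro cSUP_upper g'_bdd) auto
 finally show ?thesis .
qed

lemma S_pos: "0 < S" using g'_less_S[of 0] g'0 by simp

lemma g'_near_S:
 assumes "y < S"
 obtains T where "0 <= T" "y < g' T"
 using assms unfolding S_def by (subst (asm) less_cSUP_iff[OF _ g'_bdd]) auto

lemma recession_slope_eq: "recession_slope g = S"
proof -
 have "((%t. g t / t) \<longlongrightarrow> S) at_top"
 proof (rule order_tendstoI)
  fix y assume "y < S"
  then obtain T where T: "0 <= T" "(y + S) / 2 < g' T" using g'_near_S[of "(y + S) / 2"] by auto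
  define K where "K = \<bar>g T - g' T * T\<bar>"
  have "\<forall>\<^sub>F t in at_top. max (T + 1) (2 * (K + 1) / (S - y)) < t" by (rule eventually_gt_at_top)
  then show "\<forall>\<^sub>F t in at_top. y < g t / t"
  proof eventually_elim
   case (elim t)
   then have t: "0 < t" "T < t" "2 * (K + 1) < t * (S - y)"
    using T \<open>y < S\<close> by (auto simp: divide_less_eq)
   have "g T + g' T * (t - T) < g t" using T t by (intro g_tangent) auto
   moreover have "(y + S) / 2 * t <= g' T * t" using T t by (intro mult_right_mono) auto
   moreover have "- K <= g T - g' T * T" by (simp add: K_def)
   moreover have "y * t + (t * (S - y)) / 2 = (y + S) / 2 * t" by (simp add: field_simps)
   moreover have "g' T * (t - T) = g' T * t - g' T * T" by (rule right_diff_distrib)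
   moreover have "K + 1 < t * (S - y) / 2" using t(3) by simp
   ultimately have "y * t < g t" by linarith
   then show ?case using t(1) by (simp add: less_divide_eq)
  qed
 next
  fix y assume y: "S < y"
  have "\<forall>\<^sub>F t :: real in at_top. 0 < t" by (rule eventually_gt_at_top)
  then show "\<forall>\<^sub>F t in at_top. g t / t < y"
  proof eventually_elim
   case (elim t)
   obtain z where z: "0 < z" "z < t" "g t - g 0 = (t - 0) * g' z" using g_MVT[OF order.refl elim] .
   then have "g t / t = g' z" using elim g0 by simp
   then show ?case using g'_less_S[of z] z y by simp
  qed
 qed
 then show ?thesis unfolding recession_slope_def by (intro tendsto_Lim) auto
qed

definition "G = inv \<gamma>"

lemma inj_\<gamma>: "inj \<gamma>"
 by (rule injI) (metis \<gamma>_mono linorder_neqE_linordered_idom less_irrefl)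

lemma G_\<gamma>: "G (\<gamma> t) = t"
 unfolding G_def by (rule inv_f_f[OF inj_\<gamma>])

lemma \<gamma>_G:
 assumes "\<bar>y\<bar> < S"
 shows "\<gamma> (G y) = y"
proof -
 obtain T where T: "0 <= T" "\<bar>y\<bar> < g' T" using g'_near_S[OF assms] .
 have gT: "\<gamma> T = g' T" using T by (simp add: \<gamma>_def)
 have "\<exists>t\<ge>- T. t <= T & \<gamma> t = y"
 proof (rule IVT)
  show "\<forall>x. - T <= x & x <= T --> isCont \<gamma> x" using DERIV_isCont[OF \<gamma>_deriv] by blast
 qed (use T gT \<gamma>_odd[of T] in auto)
 then show ?thesis using G_\<gamma> by auto
qed

lemma G_odd: "\<bar>y\<bar> < S ==> G (- y) = - G y"
 using G_\<gamma>[of "- G y"] by (simp add: \<gamma>_odd \<gamma>_G)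

lemma G_0: "G 0 = 0"
 using G_\<gamma>[of 0] g'0 by (simp add: \<gamma>_def)

lemma G_mono: "\<bar>y\<bar> < S ==> \<bar>z\<bar> < S ==> y <= z ==> G y <= G z"
 using \<gamma>_mono[of "G z" "G y"] by (metis \<gamma>_G not_le)

definition "G' y = inverse (g'' \<bar>G y\<bar>)"

lemma G_deriv:
 assumes "\<bar>y\<bar> < S"
 shows "(G has_real_derivative G' y) (at y)"
 unfolding G'_def
proof (rule DERIV_inverse_function[where f = \<gamma> and g = G and a = "- S" and b = S])
 show "(\<gamma> has_real_derivative g'' \<bar>G y\<bar>) (at (G y))" by (rule \<gamma>_deriv)
 show "g'' \<bar>G y\<bar> ~= 0" using g''_pos[of "\<bar>G y\<bar>"] by simp
 have "isCont G (\<gamma> (G y))"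
  by (rule isCont_inverse_function[of 1]) (use G_\<gamma> DERIV_isCont[OF \<gamma>_deriv] in auto)
 then show "isCont G y" by (simp add: \<gamma>_G[OF assms])
qed (use assms \<gamma>_G in auto)

lemma G_continuous: "continuous_on {- S<..<S} G"
 by (intro continuous_at_imp_continuous_on ballI DERIV_isCont[OF G_deriv]) auto

lemma G'_continuous: "continuous_on {- S<..<S} G'"
proof -
 have "continuous_on {- S<..<S} (%y. g'' \<bar>G y\<bar>)"
  by (rule continuous_on_compose2[OF g''_cont]) (auto intro!: continuous_intros G_continuous)
 moreover have "g'' \<bar>G y\<bar> ~= 0" for y using g''_pos[of "\<bar>G y\<bar>"] by simp
 ultimately show ?thesis unfolding G'_def by (intro continuous_intros) auto
qed

text \<open>The vector version of the tangent inequality: \<open>y e\<close> is the derivative of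
 \<open>\<xi> \<mapsto> g (|\<xi>|)\<close> at the point \<open>G(y) e\<close>.\<close>

lemma g_norm_tangent:
 fixes e \<xi> :: "'v::real_inner"
 assumes y: "\<bar>y\<bar> < S" and e: "norm e = 1"
 shows "g (norm (G y *\<^sub>R e)) + (y *\<^sub>R e) \<bullet> (\<xi> - G y *\<^sub>R e) <= g (norm \<xi>)"
  and "g (norm (G y *\<^sub>R e)) + (y *\<^sub>R e) \<bullet> (\<xi> - G y *\<^sub>R e) = g (norm \<xi>) ==> \<xi> = G y *\<^sub>R e"
proof -
 define t where "t = \<bar>G y\<bar>"
 have t: "0 <= t" "norm (G y *\<^sub>R e) = t" using e by (auto simp: t_def)
 have sg: "g' t = \<bar>y\<bar> & (0 <= y --> G y = t) & (y < 0 --> G y = - t)"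
 proof (cases "0 <= y")
  case True
  then have "0 <= G y" using G_mono[of 0 y] y S_pos G_0 by simp
  then show ?thesis using True \<gamma>_G[OF y] by (simp add: t_def \<gamma>_def)
 next
  case False
  then have "G y <= 0" using G_mono[of y 0] y S_pos G_0 by simp
  moreover have "\<gamma> (- G y) = - y" using \<gamma>_odd[of "G y"] \<gamma>_G[OF y] by simp
  ultimately show ?thesis using False by (simp add: t_def \<gamma>_def)
 qed
 have yG: "y * G y = \<bar>y\<bar> * t" using sg by (cases "0 <= y") auto
 have ee: "e \<bullet> e = 1" using e by (simp add: dot_square_norm)
 have ex: "(y *\<^sub>R e) \<bullet> (\<xi> - G y *\<^sub>R e) = y * (e \<bullet> \<xi>) - \<bar>y\<bar> * t"
  using yG ee by (simp add: inner_diff_right algebra_simps)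
 have cs: "y * (e \<bullet> \<xi>) <= \<bar>y\<bar> * norm \<xi>"
 proof -
  have "\<bar>e \<bullet> \<xi>\<bar> <= norm \<xi>" using Cauchy_Schwarz_ineq2[of e \<xi>] e by simp
  then have "\<bar>y\<bar> * \<bar>e \<bullet> \<xi>\<bar> <= \<bar>y\<bar> * norm \<xi>" by (intro mult_left_mono) auto
  then show ?thesis by (metis abs_ge_self abs_mult order_trans)
 qed
 have tan: "g t + \<bar>y\<bar> * (norm \<xi> - t) <= g (norm \<xi>)"
  using g_tangent[of t "norm \<xi>"] t(1) sg by (cases "t = norm \<xi>") auto
 show "g (norm (G y *\<^sub>R e)) + (y *\<^sub>R e) \<bullet> (\<xi> - G y *\<^sub>R e) <= g (norm \<xi>)"
  unfolding t(2) ex using cs tan by (simp add: right_diff_distrib)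
 assume "g (norm (G y *\<^sub>R e)) + (y *\<^sub>R e) \<bullet> (\<xi> - G y *\<^sub>R e) = g (norm \<xi>)"
 then have eq: "g t + (y * (e \<bullet> \<xi>) - \<bar>y\<bar> * t) = g (norm \<xi>)" unfolding t(2) ex .
 have nt: "norm \<xi> = t"
 proof (rule ccontr)
  assume "norm \<xi> ~= t"
  then have "g t + \<bar>y\<bar> * (norm \<xi> - t) < g (norm \<xi>)" using g_tangent[of t "norm \<xi>"] t(1) sg by auto
  then show False using eq cs by (simp add: right_diff_distrib)
 qed
 then have ye: "y * (e \<bullet> \<xi>) = \<bar>y\<bar> * t" using eq by simp
 have "G y * (e \<bullet> \<xi>) = t * t"
 proof (cases "y = 0")
  case True
  then show ?thesis using G_0 by (simp add: t_def)
 next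
  case False
  have "y * (e \<bullet> \<xi>) = y * (if 0 <= y then t else - t)" using ye by auto
  then have "e \<bullet> \<xi> = (if 0 <= y then t else - t)" using False by (simp only: mult_cancel_left) simp
  then show ?thesis using sg by auto
 qed
 then have "(\<xi> - G y *\<^sub>R e) \<bullet> (\<xi> - G y *\<^sub>R e) = t * t - 2 * (t * t) + G y * G y"
  using nt ee dot_square_norm[of \<xi>] by (simp add: inner_diff_left inner_diff_right inner_commute power2_eq_square)
 also have "G y * G y = t * t" by (simp add: t_def)
 finally have "(\<xi> - G y *\<^sub>R e) \<bullet> (\<xi> - G y *\<^sub>R e) = 0" by simp
 then show "\<xi> = G y *\<^sub>R e" by simp
qed

end

section \<open>The radial profile\<close>

context integrand
begin

text \<open>For \<open>c < r1 S\<close> the total height of the profile depends continuously on \<open>c\<close>, which allows for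
 the intermediate value theorem. If all these heights are below \<open>\<Delta>\<close>, then the profiles increase to
 an integrable limit as \<open>c\<close> tends to \<open>r1 S\<close>, and the remaining gap is the jump.\<close>

lemma shooting_nonneg:
 assumes \<rho>: "0 < r1" "r1 < r2" and \<Delta>: "0 <= \<Delta>"
 obtains c where "0 <= c" "c <= r1 * S" "(%t. G (c / t)) integrable_on {r1<..<r2}"
  "S * \<bar>\<Delta> - integral {r1<..<r2} (%t. G (c / t))\<bar> = (c / r1) * (\<Delta> - integral {r1<..<r2} (%t. G (c / t)))"
proof -
 define I where "I C = integral {r1..r2} (%t. G (C / t))" for C
 have I_open: "I C = integral {r1<..<r2} (%t. G (C / t))" for C
  unfolding I_def by (rule integral_open_interval_real)
 have quot: "0 <= C / t & C / t < S" if "0 <= C" "C < r1 * S" "r1 <= t" for C t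
 proof -
  have "C < t * S" using that mult_right_mono[OF that(3), of S] S_pos by linarith
  then show ?thesis using that \<rho> by (simp add: divide_less_eq mult.commute)
 qed
 have cont: "continuous_on ({0..C} \<times> {r1..r2}) (%(C, t). G (C / t))" if "C < r1 * S" for C
  unfolding case_prod_beta
 proof (rule continuous_on_compose2[OF G_continuous])
  show "continuous_on ({0..C} \<times> {r1..r2}) (%x. fst x / snd x)"
   using \<rho> by (auto intro!: continuous_intros)
  show "(%x. fst x / snd x) ` ({0..C} \<times> {r1..r2}) \<subseteq> {- S<..<S}"
  proof (rule image_subsetI)
   fix x assume "x : {0..C} \<times> {r1..r2}"
   then have "0 <= fst x / snd x & fst x / snd x < S" using that by (intro quot) auto
   then show "fst x / snd x : {- S<..<S}" using S_pos by simp
  qed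
 qed
 have cI: "continuous_on {0..C} I" if "C < r1 * S" for C
  using integral_continuous_on_param[of "{0..C}" r1 r2 "%C t. G (C / t)"] cont[OF that]
  by (simp add: I_def[abs_def])
 have int: "(%t. G (C / t)) integrable_on {r1..r2}" if "0 <= C" "C < r1 * S" for C
 proof (rule integrable_continuous_real)
  have "continuous_on {r1..r2} (%t. (%(C, t). G (C / t)) (C, t))"
   by (rule continuous_on_compose2[OF cont[OF that(2)]]) (use that in "auto intro!: continuous_intros")
  then show "continuous_on {r1..r2} (%t. G (C / t))" by simp
 qed
 show thesis
 proof (cases "\<exists>C. 0 <= C & C < r1 * S & \<Delta> <= I C")
  case True
  then obtain C where C: "0 <= C" "C < r1 * S" "\<Delta> <= I C" by blast
  have "I 0 <= \<Delta>" using \<Delta> by (simp add: I_def G_0)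
  then obtain c where c: "0 <= c" "c <= C" "I c = \<Delta>"
   using IVT'[of I 0 \<Delta> C] C cI[OF C(2)] by blast
  have "(%t. G (c / t)) integrable_on {r1<..<r2}"
   using int[of c] c C by (simp add: integrable_on_open_interval_real)
  then show thesis using c C that[of c] by (simp add: I_open)
 next
  case False
  define c where "c = r1 * S"
  have cpos: "0 < c" using \<rho> S_pos by (simp add: c_def)
  define C where "C n = c * (1 - 1 / real (n + 2))" for n
  have C: "0 <= C n" "C n < c" "C n <= C (Suc n)" for n
  proof -
   have "0 <= 1 - 1 / real (n + 2)" "1 - 1 / real (n + 2) < 1" by (auto simp: divide_le_eq)
   then show "0 <= C n" "C n < c" unfolding C_def using cpos by (auto simp: mult_less_cancel_left)
   show "C n <= C (Suc n)" unfolding C_def using cpos by (intro mult_left_mono) (auto simp: frac_le)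
  qed
  have Ib: "0 <= I (C n) & I (C n) <= \<Delta>" for n
  proof
   show "I (C n) <= \<Delta>" using False C[of n] by (force simp: c_def)
   have "0 <= G (C n / t)" if "t : {r1..r2}" for t
    using quot[of "C n" t] C[of n] that G_mono[of 0 "C n / t"] S_pos \<rho> by (auto simp: G_0 c_def)
   then show "0 <= I (C n)" unfolding I_def by (intro integral_nonneg int) (use C in "auto simp: c_def")
  qed
  have "(%n. 1 / real (n + 2)) \<longlonglongrightarrow> 0"
   using LIMSEQ_ignore_initial_segment[OF lim_1_over_n, of 2] by simp
  then have "C \<longlonglongrightarrow> c * (1 - 0)" unfolding C_def[abs_def] by (intro tendsto_intros)
  then have Clim: "C \<longlonglongrightarrow> c" by simp
  have "(%t. G (c / t)) integrable_on {r1<..<r2} &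
   (%n. integral {r1<..<r2} (%t. G (C n / t))) \<longlonglongrightarrow> integral {r1<..<r2} (%t. G (c / t))"
  proof (rule monotone_convergence_increasing)
   show "(%t. G (C n / t)) integrable_on {r1<..<r2}" for n
    using int[of "C n"] C[of n] by (simp add: integrable_on_open_interval_real c_def)
   show "G (C n / t) <= G (C (Suc n) / t)" if "t : {r1<..<r2}" for n t
   proof (rule G_mono)
    show "\<bar>C n / t\<bar> < S" "\<bar>C (Suc n) / t\<bar> < S"
    using quot[of "C n" t] quot[of "C (Suc n)" t] C[of n] C[of "Suc n"] that by (auto simp: c_def)
    show "C n / t <= C (Suc n) / t" using C(3)[of n] that \<rho> by (intro divide_right_mono) auto
   qed
   show "(%n. G (C n / t)) \<longlonglongrightarrow> G (c / t)" if "t : {r1<..<r2}" for t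
   proof (rule isCont_tendsto_compose[where g = G])
    have "c / t < S" using that \<rho> S_pos by (simp add: c_def divide_less_eq)
    moreover have "0 <= c / t" using that \<rho> cpos by simp
    ultimately show "isCont G (c / t)" by (intro DERIV_isCont[OF G_deriv]) auto
    show "(%n. C n / t) \<longlonglongrightarrow> c / t" using that \<rho> by (intro tendsto_intros Clim) auto
   qed
   show "bounded (range (%n. integral {r1<..<r2} (%t. G (C n / t))))"
    unfolding bounded_iff using Ib by (intro exI[of _ \<Delta>]) (auto simp: I_open[symmetric])
  qed
  then have i: "(%t. G (c / t)) integrable_on {r1<..<r2}"
   and lim: "(%n. I (C n)) \<longlonglongrightarrow> I c" by (auto simp: I_open)
  have "I c <= \<Delta>" by (rule LIMSEQ_le_const2[OF lim]) (use Ib in auto)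
  then show thesis using i cpos \<rho> by (intro that[of c]) (auto simp: c_def I_open[symmetric])
 qed
qed

text \<open>The flux \<open>c\<close> is chosen by shooting. Either the boundary values are attained, or \<open>|c|\<close> takes
 the largest possible value \<open>r1 S\<close> and the solution jumps at the inner circle, in the direction
 of the missing height.\<close>

lemma shooting:
 assumes \<rho>: "0 < r1" "r1 < r2"
 obtains c where "\<bar>c\<bar> <= r1 * S" "(%t. G (c / t)) absolutely_integrable_on {r1<..<r2}"
  "S * \<bar>\<Delta> - integral {r1<..<r2} (%t. G (c / t))\<bar> = (c / r1) * (\<Delta> - integral {r1<..<r2} (%t. G (c / t)))"
proof -
 obtain c where c: "0 <= c" "c <= r1 * S" and i: "(%t. G (c / t)) integrable_on {r1<..<r2}"
  and eq: "S * \<bar>\<bar>\<Delta>\<bar> - integral {r1<..<r2} (%t. G (c / t))\<bar> = (c / r1) * (\<bar>\<Delta>\<bar> - integral {r1<..<r2} (%t. G (c / t)))"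
  using shooting_nonneg[OF \<rho> abs_ge_zero[of \<Delta>]] .
 have q: "\<bar>c / t\<bar> < S" "0 <= c / t" if "t : {r1<..<r2}" for t
 proof -
  have "r1 * S < t * S" using that S_pos by (intro mult_strict_right_mono) auto
  then have "c < t * S" using c by simp
  then show "\<bar>c / t\<bar> < S" "0 <= c / t" using c that \<rho> by (auto simp: divide_less_eq mult.commute)
 qed
 have ai: "(%t. G (c / t)) absolutely_integrable_on {r1<..<r2}"
  using i
 proof (rule nonnegative_absolutely_integrable_1)
  show "0 <= G (c / t)" if "t : {r1<..<r2}" for t
   using G_mono[of 0 "c / t"] q[OF that] S_pos by (simp add: G_0)
 qed
 show thesis
 proof (cases "0 <= \<Delta>")
  case True
  then show ?thesis using that[of c] c ai eq by simp
 next
  case False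
  have odd: "G (- (c / t)) = - G (c / t)" if "t : {r1<..<r2}" for t
   using G_odd[OF q(1)[OF that]] by simp
  have int: "integral {r1<..<r2} (%t. G (- c / t)) = - integral {r1<..<r2} (%t. G (c / t))"
   unfolding integral_neg[symmetric] by (rule integral_cong) (simp add: odd)
  have "(%t. - G (c / t)) absolutely_integrable_on {r1<..<r2}"
   using ai unfolding set_integrable_def by simp
  then have "(%t. G (- c / t)) absolutely_integrable_on {r1<..<r2}"
   unfolding set_integrable_def
   by (rule iffD1[OF Bochner_Integration.integrable_cong[OF refl], rotated]) (simp add: odd indicator_def)
  moreover have "\<bar>- \<Delta> - K\<bar> = \<bar>\<Delta> - - K\<bar>" "(- c / r1) * (\<Delta> - - K) = (c / r1) * (- \<Delta> - K)" for K
   by (auto simp: algebra_simps add_divide_distrib diff_divide_distrib)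
  ultimately show ?thesis using that[of "- c"] c eq False unfolding int by simp
 qed
qed

end

section \<open>Radial functions\<close>

locale radial =
 fixes r1 r2 :: real and U U' U'' :: "real => real"
 assumes \<rho>: "0 < r1" "r1 < r2"
  and U_cont: "continuous_on {r1..r2} U"
  and U_deriv: "!!t. r1 < t ==> t < r2 ==> (U has_real_derivative U' t) (at t)"
  and U'_deriv: "!!t. r1 < t ==> t < r2 ==> (U' has_real_derivative U'' t) (at t)"
  and U''_cont: "continuous_on {r1<..<r2} U''"
  and U'_int: "set_integrable lborel {r1<..<r2} U'"
begin

abbreviation "\<U> \<equiv> annulus r1 r2"

definition "u x = U (norm (x :: real ^ 2))"
definition "D x = U' (norm x) *\<^sub>R sgn (x :: real ^ 2)"

lemma \<U>b: "\<U> : sets borel" by (simp add: borel_open open_annulus)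

lemma nz: "x : \<U> ==> x ~= 0" using \<rho> by (auto simp: annulus_def)

lemma U'_cont: "continuous_on {r1<..<r2} U'"
 by (intro continuous_at_imp_continuous_on ballI DERIV_isCont[OF U'_deriv]) auto

lemma gradient_u: "C1_gradient \<U> u D"
 unfolding u_def[abs_def] D_def[abs_def]
proof (rule C1_gradient_compose[OF C1_gradient_norm, where h = U and h' = U'])
 show "0 \<notin> \<U>" using nz by blast
 show "(U has_real_derivative U' (norm x)) (at (norm x))" if "x : \<U>" for x
  using that by (intro U_deriv) (auto simp: annulus_def)
 show "continuous_on (norm ` \<U>) U'" by (rule continuous_on_subset[OF U'_cont]) (auto simp: annulus_def)
qed

lemma u_closure: "continuous_on (closure \<U>) u"
 unfolding u_def[abs_def] by (rule continuous_on_compose2[OF U_cont])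
  (auto simp: frontier_annulus(2)[OF \<rho>] intro!: continuous_intros)

lemma C1_u: "C1_on \<U> u" by (rule C1_gradient_C1_on[OF gradient_u])

lemma partial_u: "x : \<U> ==> partial_deriv i u x = D x $ i"
 by (rule C1_gradient_partial[OF gradient_u])

lemma C1_partial_u: "C1_on \<U> (partial_deriv i u)"
proof (rule C1_on_cong_open[OF _ open_annulus])
 show "partial_deriv i u x = (U' (norm x) / norm x) * x $ i" if "x : \<U>" for x
  using partial_u[OF that] by (simp add: D_def sgn_div_norm field_simps)
 have "C1_gradient \<U> (%x. (%t. U' t / t) (norm x)) (%x. (%t. (U'' t * t - U' t * 1) / (t * t)) (norm x) *\<^sub>R sgn x)"
 proof (rule C1_gradient_compose[OF C1_gradient_norm, where h = "%t. U' t / t" and h' = "%t. (U'' t * t - U' t * 1) / (t * t)"])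
  show "0 \<notin> \<U>" using nz by blast
  show "((%t. U' t / t) has_real_derivative (U'' (norm x) * norm x - U' (norm x) * 1) / (norm x * norm x)) (at (norm x))"
   if "x : \<U>" for x :: "real ^ 2"
   using that nz by (intro DERIV_divide U'_deriv DERIV_ident) (auto simp: annulus_def)
  have "continuous_on {r1<..<r2} (%t. (U'' t * t - U' t * 1) / (t * t))"
   using \<rho> by (intro continuous_intros U''_cont U'_cont) auto
  then show "continuous_on (norm ` \<U>) (%t. (U'' t * t - U' t * 1) / (t * t))"
   by (rule continuous_on_subset) (auto simp: annulus_def)
 qed
 from C1_gradient_mult[OF this C1_gradient_coord] show "C1_on \<U> (%x. (U' (norm x) / norm x) * x $ i)"
  by (rule C1_gradient_C1_on)
qed

lemma radial_integral:
 fixes f :: "real => real"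
 assumes B: "B : borel_on (cball 0 1)" and f: "continuous_on {r1<..<r2} f"
  and i: "set_integrable lborel {r1<..<r2} (%r. r * f r)"
 shows "set_integrable lborel \<U> (%x. indicator B (sgn x) * f (norm x))"
  and "(LINT x:\<U>|lborel. indicator B (sgn x) * f (norm x)) = measure circle_measure B * (LINT r:{r1<..<r2}|lborel. r * f r)"
proof -
 define F where "F r = indicator {r1<..<r2} r * f r" for r
 have F: "F : borel_measurable borel"
  using borel_measurable_continuous_on_indicator[OF _ f] by (simp add: F_def[abs_def])
 have R: "0 < r2" using \<rho> by simp
 have s: "(%r. indicator {0..r2} r *\<^sub>R (r * F r)) = (%r. indicator {r1<..<r2} r *\<^sub>R (r * f r))"
  using \<rho> by (auto simp: F_def indicator_def fun_eq_iff)
 have p: "(%x :: real ^ 2. indicator (ball 0 r2) x * (indicator B (sgn x) * F (norm x)))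
   = (%x. indicator \<U> x *\<^sub>R (indicator B (sgn x) * f (norm x)))"
  by (auto simp: F_def indicator_def fun_eq_iff annulus_def)
 have i': "set_integrable lborel {0..r2} (%r. r * F r)" using i unfolding set_integrable_def s .
 note P = polar_integral[OF B R F i', unfolded p]
 show "set_integrable lborel \<U> (%x. indicator B (sgn x) * f (norm x))" using P(1) by (simp add: set_integrable_def)
 show "(LINT x:\<U>|lborel. indicator B (sgn x) * f (norm x)) = measure circle_measure B * (LINT r:{r1<..<r2}|lborel. r * f r)"
  using P(2) unfolding set_lebesgue_integral_def s .
qed

lemma radial_integrable_U': "set_integrable lborel {r1<..<r2} (%r. r * U' r)"
 unfolding set_integrable_def
proof (rule Bochner_Integration.integrable_bound)
 show "integrable lborel (%r. r2 * (indicator {r1<..<r2} r *\<^sub>R U' r))"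
  using U'_int unfolding set_integrable_def by (intro integrable_mult_right)
 have "continuous_on {r1<..<r2} (%r. r * U' r)" by (intro continuous_intros U'_cont)
 then show "(%r. indicator {r1<..<r2} r *\<^sub>R (r * U' r)) : borel_measurable lborel"
  using borel_measurable_continuous_on_indicator[of "{r1<..<r2}" "%r. r * U' r"] by simp
 show "AE r in lborel. norm (indicator {r1<..<r2} r *\<^sub>R (r * U' r)) <= norm (r2 * (indicator {r1<..<r2} r *\<^sub>R U' r))"
 proof (rule AE_I2)
  fix r
  have "\<bar>r\<bar> * \<bar>U' r\<bar> <= \<bar>r2\<bar> * \<bar>U' r\<bar>" if "r1 < r" "r < r2" using that \<rho> by (intro mult_right_mono) auto
  then show "norm (indicator {r1<..<r2} r *\<^sub>R (r * U' r)) <= norm (r2 * (indicator {r1<..<r2} r *\<^sub>R U' r))"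
   by (simp add: indicator_def abs_mult)
 qed
qed

lemma D_integrable: "set_integrable lborel \<U> D" "set_integrable lebesgue \<U> D"
proof -
 have c: "cball (0 :: real ^ 2) 1 : borel_on (cball 0 1)" by (simp add: borel_on_iff)
 have "set_integrable lborel \<U> (%x. indicator (cball 0 1) (sgn x) * U' (norm x))"
  by (rule radial_integral(1)[OF c U'_cont radial_integrable_U'])
 then have i: "integrable lborel (%x. indicator \<U> x *\<^sub>R (indicator (cball 0 1) (sgn x) * U' (norm x)))"
  by (simp add: set_integrable_def)
 have m: "(%x. indicator \<U> x *\<^sub>R D x) : borel_measurable lborel"
  using borel_measurable_continuous_on_indicator[OF \<U>b, of D] gradient_u by (simp add: C1_gradient_def)
 show 1: "set_integrable lborel \<U> D"
  unfolding set_integrable_def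
  by (rule Bochner_Integration.integrable_bound[OF i m]) (auto simp: D_def norm_sgn indicator_def)
 then show "set_integrable lebesgue \<U> D" using set_integral_lebesgue_lborel(2)[OF \<U>b m] by simp
qed

end

lemma compact_Lp_space:
 fixes f :: "real ^ 2 => real"
 assumes K: "compact K" "continuous_on K f" and V: "V : sets borel" "V \<subseteq> K" and p: "0 <= p"
 shows "f : Lp_space p V" "set_integrable lebesgue V f"
proof -
 have L: "V : lmeasurable"
  by (rule fmeasurableI2[OF lmeasurable_compact[OF K(1)] V(2)]) (use V(1) in simp)
 have fm: "(%x. indicator V x *\<^sub>R f x) : borel_measurable borel"
  by (rule borel_measurable_continuous_on_indicator[OF V(1) continuous_on_subset[OF K(2) V(2)]])
 then have m: "set_borel_measurable lebesgue V f" unfolding set_borel_measurable_def by (simp add: measurable_completion)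
 obtain C where C: "!!x. x : V ==> \<bar>f x\<bar> <= C"
  using compact_imp_bounded[OF compact_continuous_image[OF K(2,1)]] V(2) by (auto simp: bounded_iff)
 have b: "set_integrable lebesgue V h"
  if "(%x. indicator V x *\<^sub>R h x) : borel_measurable borel" "!!x. x : V ==> \<bar>h x\<bar> <= C'" for h :: "real ^ 2 => real" and C'
  unfolding set_integrable_def
 proof (rule Bochner_Integration.integrable_bound)
  show "integrable lebesgue (%x. C' * indicator V x)"
   using L by (intro integrable_mult_right) (auto simp: fmeasurable_def)
  show "(%x. indicator V x *\<^sub>R h x) : borel_measurable lebesgue" using that(1) by (simp add: measurable_completion)
  show "AE x in lebesgue. norm (indicator V x *\<^sub>R h x) <= norm (C' * indicator V x)"
   using that(2) by (auto simp: indicator_def intro!: AE_I2 intro: order_trans[OF _ abs_ge_self])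
 qed
 show "set_integrable lebesgue V f" by (rule b[OF fm C])
 have "set_integrable lebesgue V (%x. \<bar>f x\<bar> powr p)"
 proof (rule b)
  show "\<bar>\<bar>f x\<bar> powr p\<bar> <= C powr p" if "x : V" for x using C[OF that] p by (simp add: powr_mono2)
  have "(%x. indicator V x *\<^sub>R \<bar>f x\<bar> powr p) = (%x. indicator V x * \<bar>indicator V x *\<^sub>R f x\<bar> powr p)"
   by (auto simp: indicator_def)
  then show "(%x. indicator V x *\<^sub>R \<bar>f x\<bar> powr p) : borel_measurable borel" using fm V(1) by simp
 qed
 then show "f : Lp_space p V" using m by (simp add: Lp_space_def)
qed

lemma C2_sobolev_loc:
 fixes f :: "real ^ 2 => real"
 assumes f: "C1_on \<U> f" and pf: "!!i. C1_on \<U> (partial_deriv i f)"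
 shows "f : sobolev_loc 2 2 \<U>"
 unfolding sobolev_loc_def
proof (intro CollectI allI impI)
 fix V :: "(real ^ 2) set" assume V: "open V & compact (closure V) & closure V \<subseteq> \<U>"
 then have sub: "V \<subseteq> \<U>" using closure_subset by blast
 have L: "h : Lp_space 2 V" if "continuous_on \<U> h" for h
  using V by (intro compact_Lp_space[of "closure V"] continuous_on_subset[OF that]) (auto simp: closure_subset)
 have C: "C1_on V h" if "C1_on \<U> h" for h
  using that sub by (auto simp: C1_on_def intro: continuous_on_subset)
 have w: "weak_partial V i h (partial_deriv i h)" if "C1_on \<U> h" for i h
  using V by (intro C1_weak_partial C that) auto
 have c: "continuous_on \<U> h" if "C1_on \<U> h" for h using that by (rule C1_on_continuous_on)
 have 2: "partial_deriv j (partial_deriv i f) : sobolev 0 2 V" for i j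
  using L pf by (simp add: C1_on_def)
 have 1: "partial_deriv i f : sobolev (Suc 0) 2 V" for i
  unfolding sobolev.simps(2) using L[OF c[OF pf]] w[OF pf] 2 by (intro CollectI conjI allI bexI[where x = "partial_deriv j (partial_deriv i f)" for j])
 have "f : sobolev (Suc (Suc 0)) 2 V"
  unfolding sobolev.simps(2)[of "Suc 0"] using L[OF c[OF f]] w[OF f] 1 by (intro CollectI conjI allI bexI[where x = "partial_deriv j f" for j])
 then show "f : sobolev 2 2 V" by (simp add: numeral_2_eq_2)
qed

context radial
begin

lemma u_sobolev_loc: "u : sobolev_loc 2 2 \<U>"
 by (rule C2_sobolev_loc[OF C1_u C1_partial_u])

lemma u_integrable: "0 <= p ==> u : Lp_space p \<U>" "set_integrable lebesgue \<U> u"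
proof -
 have "compact (closure \<U>)" by (simp add: frontier_annulus(2)[OF \<rho>] compact_diff)
 note c = compact_Lp_space[OF this u_closure \<U>b closure_subset]
 show "u : Lp_space p \<U>" if "0 <= p" by (rule c(1)[OF that])
 show "set_integrable lebesgue \<U> u" by (rule c(2)[OF order.refl])
qed

lemma u_sobolev: "u : sobolev 1 1 \<U>"
proof -
 have "partial_deriv i u : Lp_space 1 \<U>" for i
 proof -
  have Di: "set_integrable lebesgue \<U> (%x. D x $ i)"
   using integrable_bounded_linear[OF bounded_linear_vec_nth D_integrable(2)[unfolded set_integrable_def], of i]
   by (simp add: set_integrable_def)
  have eq: "(%x. indicator \<U> x *\<^sub>R partial_deriv i u x) = (%x. indicator \<U> x *\<^sub>R D x $ i)"
   using partial_u by (auto simp: indicator_def fun_eq_iff)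
  have i: "set_integrable lebesgue \<U> (partial_deriv i u)" using Di unfolding set_integrable_def eq .
  then have "set_borel_measurable lebesgue \<U> (partial_deriv i u)"
   unfolding set_integrable_def set_borel_measurable_def by (rule borel_measurable_integrable)
  moreover have "set_integrable lebesgue \<U> (%x. \<bar>partial_deriv i u x\<bar> powr 1)"
   using set_integrable_abs[OF i] by simp
  ultimately show ?thesis by (simp add: Lp_space_def)
 qed
 then show ?thesis using u_integrable(1)[of 1] C1_weak_partial[OF open_annulus C1_u] by auto
qed

end

section \<open>The gradient measure and the trace of a radial function\<close>

lemma integrable_bounded_factor:
 fixes f b :: "'a => real"
 assumes f: "integrable M f" and b: "b : borel_measurable M" "!!x. f x ~= 0 ==> \<bar>b x\<bar> <= K"
 shows "integrable M (%x. b x * f x)"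
proof (rule Bochner_Integration.integrable_bound[of _ "%x. K * f x"])
 show "integrable M (%x. K * f x)" using f by (rule integrable_mult_right)
 show "(%x. b x * f x) : borel_measurable M" using b(1) borel_measurable_integrable[OF f] by (rule borel_measurable_times)
 have "\<bar>b x\<bar> * \<bar>f x\<bar> <= \<bar>K\<bar> * \<bar>f x\<bar>" for x
 proof (cases "f x = 0")
  case False
  then have "\<bar>b x\<bar> <= \<bar>K\<bar>" using b(2)[of x] by linarith
  then show ?thesis by (rule mult_right_mono) simp
 qed simp
 then show "AE x in M. norm (b x * f x) <= norm (K * f x)" by (simp add: abs_mult)
qed

context radial
begin

lemma radial_flux:
 assumes H: "C1_real H H'"
 shows "set_integrable lborel {r1<..<r2} (%r. H' r * U r + H r * U' r)"
  and "(LINT r:{r1<..<r2}|lborel. H' r * U r + H r * U' r) = H r2 * U r2 - H r1 * U r1"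
proof -
 have Hc: "continuous_on {r1..r2} H" "continuous_on {r1..r2} H'"
  using continuous_on_subset[OF C1_real_continuous[OF H]] H by (auto simp: C1_real_def intro: continuous_on_subset)
 obtain K where K: "\<forall>r\<in>{r1..r2}. \<bar>H r\<bar> <= K"
  using compact_imp_bounded[OF compact_continuous_image[OF Hc(1) compact_Icc]] by (auto simp: bounded_iff)
 have "set_integrable lborel {r1..r2} (%r. H' r * U r)"
  by (intro borel_integrable_atLeastAtMost' continuous_intros Hc U_cont)
 then have 1: "set_integrable lborel {r1<..<r2} (%r. H' r * U r)"
  by (rule set_integrable_subset) auto
 have Hb: "H : borel_measurable lborel"
  using borel_measurable_continuous_onI[OF C1_real_continuous[OF H]] by simp
 have "integrable lborel (%r. H r * (indicator {r1<..<r2} r * U' r))"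
  by (rule integrable_bounded_factor[OF _ Hb, of _ K])
    (use U'_int K in "auto simp: set_integrable_def indicator_def")
 then have "set_integrable lborel {r1<..<r2} (%r. H r * U' r)" by (simp add: set_integrable_def mult.left_commute)
 with 1 show i: "set_integrable lborel {r1<..<r2} (%r. H' r * U r + H r * U' r)" by (rule set_integral_add(1))
 have "((%r. H' r * U r + H r * U' r) has_integral (H r2 * U r2 - H r1 * U r1)) {r1..r2}"
 proof (rule fundamental_theorem_of_calculus_interior)
  show "continuous_on {r1..r2} (%r. H r * U r)" by (intro continuous_intros Hc U_cont)
  show "((%r. H r * U r) has_vector_derivative H' r * U r + H r * U' r) (at r)" if "r : {r1<..<r2}" for r
  proof -
   have "(H has_real_derivative H' r) (at r)" using H by (simp add: C1_real_def)
   from DERIV_mult'[OF this U_deriv[of r]] that show ?thesis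
    by (simp add: has_real_derivative_iff_has_vector_derivative add.commute)
  qed
 qed (use \<rho> in auto)
 then show "(LINT r:{r1<..<r2}|lborel. H' r * U r + H r * U' r) = H r2 * U r2 - H r1 * U r1"
  unfolding set_borel_integral_eq_integral(2)[OF i] has_integral_Icc_iff_Ioo by (rule integral_unique)
qed

lemmas u_gradient_measure = C1_gradient_measure[OF open_annulus gradient_u D_integrable(2)]

lemma u_BV: "u : BV \<U>"
 using u_integrable(2) u_gradient_measure(1) by (auto simp: BV_def)

lemma gradient_measure_u: "E : borel_on \<U> ==> gradient_measure \<U> u E = (LINT x:E|lebesgue. D x)"
 by (rule gradient_measure_unique[OF open_annulus annulus_bounded gradient_measure_is[OF u_BV] u_gradient_measure(1)])

lemma decomposition_u: "lebesgue_decomposition \<U> (gradient_measure \<U> u) D (%E. 0)"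
 using u_gradient_measure(2) by (simp add: lebesgue_decomposition_def gradient_measure_u)

lemma grad_ac_u: "AE x in lebesgue. x : \<U> --> grad_ac \<U> u x = D x"
proof -
 have "\<exists>\<sigma>. lebesgue_decomposition \<U> (gradient_measure \<U> u) (grad_ac \<U> u) \<sigma>"
  unfolding grad_ac_def
  by (rule someI_ex[where P = "%f. \<exists>\<sigma>. lebesgue_decomposition \<U> (gradient_measure \<U> u) f \<sigma>"]) (use decomposition_u in blast)
 then obtain \<sigma> where "lebesgue_decomposition \<U> (gradient_measure \<U> u) (grad_ac \<U> u) \<sigma>" ..
 then show ?thesis by (rule lebesgue_decomposition_unique(1)[OF _ decomposition_u \<U>b refl])
qed

lemma grad_sing_u: "E : borel_on \<U> ==> grad_sing \<U> u E = 0"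
proof -
 assume E: "E : borel_on \<U>"
 have "\<exists>f. lebesgue_decomposition \<U> (gradient_measure \<U> u) f (grad_sing \<U> u)"
  unfolding grad_sing_def
  by (rule someI_ex[where P = "%\<sigma>. \<exists>f. lebesgue_decomposition \<U> (gradient_measure \<U> u) f \<sigma>"]) (use decomposition_u in blast)
 then obtain f where "lebesgue_decomposition \<U> (gradient_measure \<U> u) f (grad_sing \<U> u)" ..
 then show ?thesis by (rule lebesgue_decomposition_unique(2)[OF _ decomposition_u \<U>b refl E])
qed

text \<open>Here the radial densities of the boundary layers can be computed: in polar coordinates they are
 integrals of \<open>(H U)'\<close>, which the fundamental theorem of calculus evaluates to the boundary values.\<close>

lemma u_is_trace: "is_trace \<U> (annulus_normal r1 r2) u u"
proof -
 let ?M = "restrict_space lborel \<U>"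
 define w where "w x = indicator \<U> x * u x" for x
 interpret C: finite_measure circle_measure by (rule finite_circle_measure)
 have wb: "w : borel_measurable borel"
  using borel_measurable_continuous_on_indicator[OF \<U>b C1_on_continuous_on[OF C1_u]] by (simp add: w_def[abs_def])
 have M: "sets ?M = borel_on \<U>" by (simp add: sets_restrict_space)
 have fM: "finite_measure ?M"
  by (rule finite_measureI) (use annulus_bounded[of r1 r2] \<U>b in "simp add: space_restrict_space emeasure_restrict_space")
 have l: "integrable ?M (%x. 1 :: real)" using finite_measure.integrable_const[OF fM] .
 have dens: "density ?M (%x. ennreal 1) = ?M" by (simp add: density_1)
 have d: "integrable ?M D"
  using D_integrable(1) \<U>b by (simp add: integrable_restrict_space set_integrable_def)
 note R = integral_restrict_density[OF \<U>b M _ _ dens, simplified]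
 have wp: "(LINT x:\<U>|lebesgue. u x * p x) = (\<integral>x. w x * p x \<partial>?M)"
  and wi: "set_integrable lebesgue \<U> (%x. u x * p x) ==> integrable ?M (%x. w x * p x)"
  if p: "p : borel_measurable borel" for p :: "real ^ 2 => real"
 proof -
  have m: "(%x. w x * p x) : borel_measurable borel" using wb p by measurable
  have e: "(%x. indicator \<U> x *\<^sub>R (w x * p x)) = (%x. indicator \<U> x *\<^sub>R (u x * p x))"
   by (auto simp: w_def indicator_def)
  have m': "(%x. indicator \<U> x *\<^sub>R (u x * p x)) : borel_measurable lborel"
   unfolding e[symmetric] using m \<U>b by measurable
  show "(LINT x:\<U>|lebesgue. u x * p x) = (\<integral>x. w x * p x \<partial>?M)"
   unfolding set_integral_lebesgue_lborel(1)[OF \<U>b m'] R(1)[OF measurable_restrict_space1[OF m]]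
   unfolding set_lebesgue_integral_def e ..
  show "integrable ?M (%x. w x * p x)" if "set_integrable lebesgue \<U> (%x. u x * p x)"
   using that unfolding set_integral_lebesgue_lborel(2)[OF \<U>b m'] R(2)[OF measurable_restrict_space1[OF m]]
   unfolding set_integrable_def e .
 qed
 have id: "(%x. x) : ?M \<rightarrow>\<^sub>M restrict_space borel \<U>" by (simp add: measurable_cong_sets[OF M refl])
 have Di: "integrable ?M (%x. D x $ i)" for i using d by (rule integrable_bounded_linear[OF bounded_linear_vec_nth])
 have gm: "gradient_measure \<U> u E $ i = (\<integral>x. indicator E x * D x $ i \<partial>?M)" if E: "E : borel_on \<U>" for E i
 proof -
  have Eb: "E : sets borel" "E \<subseteq> \<U>" using E \<U>b by (auto simp: borel_on_iff)
  have iE: "integrable lborel (%x. indicator E x *\<^sub>R D x)"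
   using set_integrable_subset[OF D_integrable(1), of E] Eb by (simp add: set_integrable_def)
  have "gradient_measure \<U> u E = (\<integral>x. indicator E x *\<^sub>R D x \<partial>lborel)"
   unfolding gradient_measure_u[OF E] set_integral_lebesgue_lborel(1)[OF Eb(1) borel_measurable_integrable[OF iE]]
   by (simp add: set_lebesgue_integral_def)
  then have "gradient_measure \<U> u E $ i = (\<integral>x. (indicator E x *\<^sub>R D x) $ i \<partial>lborel)"
   using integral_bounded_linear[OF bounded_linear_vec_nth iE, of i] by simp
  also have "... = (\<integral>x. indicator \<U> x *\<^sub>R (indicator E x * D x $ i) \<partial>lborel)"
   using Eb(2) by (intro Bochner_Integration.integral_cong) (auto simp: indicator_def)
  also have "... = (\<integral>x. indicator E x * D x $ i \<partial>?M)" using \<U>b by (simp add: integral_restrict_space)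
  finally show ?thesis .
 qed
 have bd: "\<exists>K. \<forall>x\<in>\<U>. \<bar>b x\<bar> <= K" if "continuous_on UNIV b" for b :: "real ^ 2 => real"
 proof -
  have "compact (b ` cball 0 r2)" by (intro compact_continuous_image continuous_on_subset[OF that]) auto
  then obtain K where "\<forall>x\<in>cball 0 r2. \<bar>b x\<bar> <= K" by (auto dest!: compact_imp_bounded simp: bounded_iff)
  then show ?thesis by (intro exI[of _ K]) (auto simp: annulus_def)
 qed
 have si: "signed_integral \<U> (%E. gradient_measure \<U> u E $ i) \<phi> = (\<integral>x. \<phi> x * D x $ i \<partial>?M)"
  and iphi: "integrable ?M (%x. \<phi> x * D x $ i)" if \<phi>: "C1_on UNIV \<phi>" for \<phi> i
 proof -
  obtain K where K: "\<forall>x\<in>\<U>. \<bar>\<phi> x\<bar> <= K" using bd[OF C1_on_continuous_on[OF \<phi>]] by blast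
  have \<phi>b: "\<phi> : borel_measurable (restrict_space borel \<U>)" by (rule measurable_restrict_space1[OF C1_on_borel[OF \<phi>]])
  show "signed_integral \<U> (%E. gradient_measure \<U> u E $ i) \<phi> = (\<integral>x. \<phi> x * D x $ i \<partial>?M)"
   by (rule signed_integral_image(2)[where p = "%x. x", OF id Di \<U>b gm \<phi>b]) (use K in auto)
  have "integrable lborel (%x. \<phi> x * (indicator \<U> x * D x $ i))"
  proof (rule integrable_bounded_factor[where K = K])
   show "integrable lborel (%x. indicator \<U> x * D x $ i)" using Di[of i] \<U>b by (simp add: integrable_restrict_space)
   show "\<phi> : borel_measurable lborel" using C1_on_borel[OF \<phi>] by simp
   show "\<bar>\<phi> x\<bar> <= K" if "indicator \<U> x * D x $ i ~= 0" for x using that K by (auto simp: indicator_def split: if_splits)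
  qed
  then show "integrable ?M (%x. \<phi> x * D x $ i)" using \<U>b by (simp add: integrable_restrict_space mult_ac)
 qed
 have ui: "set_integrable lebesgue \<U> (%x. u x * p x)" if p: "continuous_on UNIV p" for p
 proof -
  obtain K where K: "\<forall>x\<in>\<U>. \<bar>p x\<bar> <= K" using bd[OF p] by blast
  have pl: "p : borel_measurable lebesgue" using borel_measurable_continuous_onI[OF p] by (simp add: measurable_completion)
  have "integrable lebesgue (%x. p x * (indicator \<U> x * u x))"
  proof (rule integrable_bounded_factor[OF _ pl])
   show "integrable lebesgue (%x. indicator \<U> x * u x)" using u_integrable(2) by (simp add: set_integrable_def)
   show "\<bar>p x\<bar> <= K" if "indicator \<U> x * u x ~= 0" for x using that K by (auto simp: indicator_def split: if_splits)
  qed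
  then show ?thesis by (simp add: set_integrable_def mult_ac)
 qed
 interpret T: bv_density r1 r2 w "%x. 1" ?M D
 proof (rule bv_density.intro)
  show "density ?M (%x. ennreal 1) = ?M" by (rule dens)
  show "integrable ?M (%x. w x * 1)" using wi[of "%x. 1"] ui[of "%x. 1"] by simp
  fix \<phi> and i :: 2 assume \<phi>: "\<phi> : test_functions \<U>"
  have C: "C1_on UNIV \<phi>" using \<phi> by (rule test_function_C1)
  have pc: "continuous_on UNIV (partial_deriv i \<phi>)" using C by (simp add: C1_on_def)
  have "(\<integral>x. w x * partial_deriv i \<phi> x \<partial>?M) = - (\<integral>x. \<phi> x * D x $ i \<partial>?M)"
   using gradient_measure_is[OF u_BV] \<phi> wp[OF partial_deriv_borel[OF C, of i]] si[OF C, of i]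
   by (simp add: is_gradient_measure_def)
  then show "(\<integral>x. w x * partial_deriv i \<phi> x * 1 + \<phi> x * D x $ i \<partial>?M) = 0"
   using wi[OF partial_deriv_borel[OF C] ui[OF pc]] iphi[OF C, of i] by simp
 qed (fact \<rho> fM M l d wb | simp)+
 have rad: "(\<integral>x. indicator B (sgn x) * T.rad H H' x \<partial>?M) = measure circle_measure B * (H r2 * U r2 - H r1 * U r1)"
  if B: "B : borel_on (cball 0 1)" and H: "C1_real H H'" for B H H'
 proof -
  define f where "f r = (H' r * U r + H r * U' r) / r" for r
  have Hc: "continuous_on {r1<..<r2} H" "continuous_on {r1<..<r2} H'"
   using continuous_on_subset[OF C1_real_continuous[OF H]] H by (auto simp: C1_real_def intro: continuous_on_subset)
  have Uc: "continuous_on {r1<..<r2} U" by (rule continuous_on_subset[OF U_cont]) auto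
  have f: "continuous_on {r1<..<r2} f"
   unfolding f_def[abs_def] using \<rho> by (intro continuous_intros Hc Uc U'_cont) auto
  have rf: "(%r. indicator {r1<..<r2} r *\<^sub>R (r * f r)) = (%r. indicator {r1<..<r2} r *\<^sub>R (H' r * U r + H r * U' r))"
   using \<rho> by (auto simp: f_def indicator_def)
  have i: "set_integrable lborel {r1<..<r2} (%r. r * f r)"
   using radial_flux(1)[OF H] unfolding set_integrable_def rf .
  have "(\<integral>x. indicator B (sgn x) * T.rad H H' x \<partial>?M) = (\<integral>x. indicator \<U> x *\<^sub>R (indicator B (sgn x) * T.rad H H' x) \<partial>lborel)"
   using \<U>b by (simp add: integral_restrict_space)
  also have "... = (LINT x:\<U>|lborel. indicator B (sgn x) * f (norm x))"
   unfolding set_lebesgue_integral_def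
  proof (rule Bochner_Integration.integral_cong[OF refl])
   fix x :: "real ^ 2"
   have "T.rad H H' x = f (norm x)" if "x : \<U>"
    using that nz[OF that]
    by (simp add: T.rad_def w_def u_def D_def inner_sgn_self f_def power2_eq_square add_divide_distrib)
   then show "indicator \<U> x *\<^sub>R (indicator B (sgn x) * T.rad H H' x) = indicator \<U> x *\<^sub>R (indicator B (sgn x) * f (norm x))"
    by (simp add: indicator_def)
  qed
  also have "... = measure circle_measure B * (LINT r:{r1<..<r2}|lborel. r * f r)"
   by (rule radial_integral(2)[OF B f i])
  also have "(LINT r:{r1<..<r2}|lborel. r * f r) = H r2 * U r2 - H r1 * U r1"
   using radial_flux(2)[OF H] unfolding set_lebesgue_integral_def rf .
  finally show ?thesis .
 qed
 have H1: "T.HL r1 = 1" "T.HL r2 = 0" "T.HR r1 = 0" "T.HR r2 = 1"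
  using T.HL_right[of r2] T.HR_left[of r1] \<rho> by (simp_all add: T.HR_def)
 have ci: "(\<integral>y. indicator B y * a \<partial>circle_measure) = measure circle_measure B * a" if "B : borel_on (cball 0 1)" for B and a :: real
 proof -
  have "B Int cball 0 1 = B" using that by (auto simp: borel_on_iff)
  then show ?thesis by simp
 qed
 have t1: "integrable circle_measure (%y. U r1)" and t2: "integrable circle_measure (%y. U r2)" by simp_all
 let ?T = "annulus_trace r2 (%y. U r1) (%y. U r2)"
 have Tu: "?T x = u x" if "x : frontier \<U>" for x
  using that by (auto simp: frontier_annulus(1)[OF \<rho>] annulus_trace_def u_def)
 then have e: "(%x. indicator (frontier \<U>) x *\<^sub>R ?T x) = (%x. indicator (frontier \<U>) x *\<^sub>R u x)"
  by (auto simp: indicator_def fun_eq_iff)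
 show ?thesis
  unfolding is_trace_def
 proof (intro conjI allI impI)
  show "set_integrable hausdorff1 (frontier \<U>) u"
   using annulus_trace_integral(1)[OF \<rho> t1 t2 continuous_on_const] unfolding set_integrable_def e .
  fix \<phi> :: "real ^ 2 => real" and i :: 2 assume \<phi>: "C1_on UNIV \<phi>"
  have "(\<integral>x. w x * partial_deriv i \<phi> x * 1 \<partial>?M) + (\<integral>x. \<phi> x * D x $ i \<partial>?M)
   = (LINT x:frontier \<U>|hausdorff1. \<phi> x * annulus_normal r1 r2 x $ i * ?T x)"
   unfolding annulus_trace_integral(2)[OF \<rho> t1 t2 C1_on_continuous_on[OF \<phi>]]
   by (rule T.trace_formula[OF t1 _ t2 _ \<phi>]) (simp_all only: rad T.C1_HL T.C1_HR ci H1, simp_all)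
  moreover have "(LINT x:frontier \<U>|hausdorff1. \<phi> x * annulus_normal r1 r2 x $ i * ?T x)
   = (LINT x:frontier \<U>|hausdorff1. \<phi> x * annulus_normal r1 r2 x $ i * u x)"
   unfolding set_lebesgue_integral_def using Tu by (intro Bochner_Integration.integral_cong refl) (auto simp: indicator_def)
  ultimately show "(LINT x:\<U>|lebesgue. u x * partial_deriv i \<phi> x)
    = - signed_integral \<U> (%E. gradient_measure \<U> u E $ i) \<phi>
    + (LINT x:frontier \<U>|hausdorff1. \<phi> x * annulus_normal r1 r2 x $ i * u x)"
   using wp[OF partial_deriv_borel[OF \<phi>, of i]] si[OF \<phi>, of i] by simp
 qed
qed

lemma bv_trace_u: "AE x in hausdorff1. x : frontier \<U> --> bv_trace \<U> (annulus_normal r1 r2) u x = u x"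
 by (rule trace_unique[OF \<rho> bv_trace_is_trace[OF \<rho> u_BV] u_is_trace])

end

section \<open>Calibration\<close>

text \<open>The field \<open>c x / |x|\<^sup>2\<close> is divergence free on the annulus. It is extended to a compactly
 supported C1 field on the plane because the defining property of the trace tests with such fields.\<close>

lemma calibration_field:
 assumes \<rho>: "0 < r1" "r1 < r2"
 obtains \<Phi> :: "real ^ 2 => real ^ 2" where "\<forall>i. (%x. \<Phi> x $ i) : test_functions UNIV"
  "\<forall>x. r1 <= norm x & norm x <= r2 --> \<Phi> x = (c / norm x) *\<^sub>R sgn x"
  "\<forall>x\<in>annulus r1 r2. (\<Sum>i\<in>UNIV. partial_deriv i (%x. \<Phi> x $ i) x) = 0"
proof -
 obtain n :: nat where n: "2 / real (Suc n) <= r1 / 2"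
 proof -
  obtain n :: nat where "4 / r1 < real n" using reals_Archimedean2 by blast
  then have "4 / r1 <= real (Suc n)" by simp
  then have "2 / real (Suc n) <= r1 / 2" using \<rho> by (simp add: field_simps)
  then show thesis by (rule that)
 qed
 define a b where "a = r1 / 2" and "b = r2 + r1 / 2"
 have one: "bump a b n t = 1 & bump' a b n t = 0" if "r1 <= t" "t <= r2" for t
 proof
  have m: "0 < real (Suc n)" by simp
  have "2 / real (Suc n) <= t - a" "2 / real (Suc n) <= b - t" using n that by (auto simp: a_def b_def)
  then have "1 <= real (Suc n) * (t - a) - 1" "1 <= real (Suc n) * (b - t) - 1"
   using m by (simp_all only: pos_divide_le_eq mult.commute; linarith)+
  then show "bump a b n t = 1" by (simp add: bump_def smoothstep_1)
  show "bump' a b n t = 0" using n that by (intro bump'_zero) (auto simp: a_def b_def)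
 qed
 have \<psi>: "C1_on UNIV (%x :: real ^ 2. c)" by (rule C1_gradient_C1_on[OF C1_gradient_const])
 have z: "bump a b n t = 0" if "t \<notin> {a..b}" for t using that by (intro bump_zero) auto
 have a: "0 < a" using \<rho> by (simp add: a_def)
 note F = radial_field_test[where p = a and q = b and h = "bump a b n", OF \<psi> C1_real_bump a z subset_UNIV]
 define \<Phi> where "\<Phi> x = (\<chi> i. radial_field (%x. c) (bump a b n) i x)" for x
 have c: "(%x. \<Phi> x $ i) = radial_field (%x. c) (bump a b n) i" for i by (auto simp: \<Phi>_def)
 show thesis
 proof (rule that[of \<Phi>])
  show "\<forall>i. (%x. \<Phi> x $ i) : test_functions UNIV" unfolding c using F(1) by blast
  show "\<forall>x. r1 <= norm x & norm x <= r2 --> \<Phi> x = (c / norm x) *\<^sub>R sgn x"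
   using one by (auto simp: \<Phi>_def radial_field_def vec_eq_iff sgn_div_norm power2_eq_square divide_inverse)
  show "\<forall>x\<in>annulus r1 r2. (\<Sum>i\<in>UNIV. partial_deriv i (%x. \<Phi> x $ i) x) = 0"
  proof
   fix x :: "real ^ 2" assume x: "x : annulus r1 r2"
   then have "x ~= 0" using \<rho> by (auto simp: annulus_def)
   then have "(\<Sum>i\<in>UNIV. partial_deriv i (radial_field (%x. c) (bump a b n) i) x) = c * (bump' a b n (norm x) / norm x)"
    using F(2) by blast
   then show "(\<Sum>i\<in>UNIV. partial_deriv i (%x. \<Phi> x $ i) x) = 0"
    unfolding c using one[of "norm x"] x by (simp add: annulus_def)
  qed
 qed
qed

lemma set_integrable_bounded_factor:
 fixes f b :: "'a => real"
 assumes f: "set_integrable M X f" and b: "b : borel_measurable M" "!!x. x : X ==> \<bar>b x\<bar> <= K"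
 shows "set_integrable M X (%x. b x * f x)"
proof -
 have "integrable M (%x. b x * (indicator X x * f x))"
  by (rule integrable_bounded_factor[OF _ b(1), of _ K])
    (use f b(2) in "auto simp: set_integrable_def indicator_def split: if_splits")
 then show ?thesis by (simp add: set_integrable_def mult.left_commute)
qed

lemma set_integrable_component:
 fixes F :: "'a => real ^ 'n"
 shows "set_integrable M X F ==> set_integrable M X (%x. F x $ i)"
 using integrable_bounded_linear[OF bounded_linear_vec_nth, of M "%x. indicator X x *\<^sub>R F x" i]
 by (simp add: set_integrable_def)

text \<open>The Gauss--Green formula for a divergence free field.\<close>

lemma divergence_free_flux:
 fixes \<Phi> F k :: "real ^ 2 => real ^ 2"
 assumes \<rho>: "0 < r1" "r1 < r2" and w: "set_integrable lebesgue (annulus r1 r2) w"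
  and T: "is_trace (annulus r1 r2) (annulus_normal r1 r2) w T"
  and F: "set_integrable lebesgue (annulus r1 r2) F"
  and N: "sets N = borel_on (annulus r1 r2)" "integrable N k"
  and si: "!!\<phi> K i. \<phi> : borel_measurable borel ==> \<forall>x\<in>annulus r1 r2. \<bar>\<phi> x\<bar> <= K ==>
    signed_integral (annulus r1 r2) (%E. gradient_measure (annulus r1 r2) w E $ i) \<phi>
    = (LINT x:annulus r1 r2|lebesgue. \<phi> x * F x $ i) + (\<integral>x. \<phi> x * k x $ i \<partial>N)"
  and \<Phi>: "\<forall>i. (%x. \<Phi> x $ i) : test_functions UNIV"
   "\<forall>x\<in>annulus r1 r2. (\<Sum>i\<in>UNIV. partial_deriv i (%x. \<Phi> x $ i) x) = 0"
 shows "set_integrable lebesgue (annulus r1 r2) (%x. \<Phi> x \<bullet> F x)" "integrable N (%x. \<Phi> x \<bullet> k x)"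
  and "set_integrable hausdorff1 (frontier (annulus r1 r2)) (%x. (\<Phi> x \<bullet> annulus_normal r1 r2 x) * T x)"
  and "(LINT x:annulus r1 r2|lebesgue. \<Phi> x \<bullet> F x) + (\<integral>x. \<Phi> x \<bullet> k x \<partial>N)
   = (LINT x:frontier (annulus r1 r2)|hausdorff1. (\<Phi> x \<bullet> annulus_normal r1 r2 x) * T x)"
proof -
 let ?\<U> = "annulus r1 r2" and ?n = "annulus_normal r1 r2"
 have C: "C1_on UNIV (%x. \<Phi> x $ i)" for i using \<Phi>(1) test_function_C1 by blast
 have "\<exists>K. \<forall>x. \<bar>\<Phi> x $ i\<bar> <= K" for i using \<Phi>(1) test_function_bounded[of "%x. \<Phi> x $ i" UNIV] by metis
 then obtain K where K: "\<bar>\<Phi> x $ i\<bar> <= K i" for x i by metis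
 have b: "(%x. \<Phi> x $ i) : borel_measurable borel" for i by (rule C1_on_borel[OF C])
 have bl: "f : borel_measurable borel ==> f : borel_measurable lebesgue" for f :: "real ^ 2 => real"
  by (simp add: measurable_completion)
 have bh: "f : borel_measurable borel ==> f : borel_measurable hausdorff1" for f :: "real ^ 2 => real"
  by (simp add: measurable_cong_sets[OF sets_hausdorff1 refl])
 have bN: "f : borel_measurable borel ==> f : borel_measurable N" for f :: "real ^ 2 => real"
  unfolding measurable_cong_sets[OF N(1) refl] by (rule measurable_restrict_space1)
 have iF: "set_integrable lebesgue ?\<U> (%x. \<Phi> x $ i * F x $ i)" for i
  by (rule set_integrable_bounded_factor[OF set_integrable_component[OF F] bl[OF b] K])
 have ik: "integrable N (%x. \<Phi> x $ i * k x $ i)" for i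
  by (rule integrable_bounded_factor[OF integrable_bounded_linear[OF bounded_linear_vec_nth N(2)] bN[OF b] K])
 have T1: "set_integrable hausdorff1 (frontier ?\<U>) T" using T by (simp add: is_trace_def)
 have iT: "set_integrable hausdorff1 (frontier ?\<U>) (%x. \<Phi> x $ i * ?n x $ i * T x)" for i
 proof (rule set_integrable_bounded_factor[OF T1])
  show "(%x. \<Phi> x $ i * ?n x $ i) : borel_measurable hausdorff1"
   using b annulus_normal_borel by (intro bh borel_measurable_times)
  show "\<bar>\<Phi> x $ i * ?n x $ i\<bar> <= K i * 1" if "x : frontier ?\<U>" for x
   unfolding abs_mult using K[of x i] component_le_norm_cart[of "?n x" i] norm_annulus_normal[OF \<rho> that]
   by (intro mult_mono) auto
 qed
 have iw: "set_integrable lebesgue ?\<U> (%x. w x * partial_deriv i (%x. \<Phi> x $ i) x)" for i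
 proof -
  have "continuous_on UNIV (partial_deriv i (%x. \<Phi> x $ i))" using C by (simp add: C1_on_def)
  then have "compact (partial_deriv i (%x. \<Phi> x $ i) ` cball 0 r2)"
   by (intro compact_continuous_image) (auto elim: continuous_on_subset)
  then obtain L where "\<forall>x\<in>cball 0 r2. \<bar>partial_deriv i (%x. \<Phi> x $ i) x\<bar> <= L"
   by (auto dest!: compact_imp_bounded simp: bounded_iff)
  then have L: "\<bar>partial_deriv i (%x. \<Phi> x $ i) x\<bar> <= L" if "x : ?\<U>" for x using that by (auto simp: annulus_def)
  show ?thesis
   using set_integrable_bounded_factor[OF w bl[OF partial_deriv_borel[OF C]] L] by (simp add: mult.commute)
 qed
 show "set_integrable lebesgue ?\<U> (%x. \<Phi> x \<bullet> F x)"
  unfolding inner_vec_def inner_real_def sum_2 by (intro set_integral_add iF)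
 show "integrable N (%x. \<Phi> x \<bullet> k x)"
  unfolding inner_vec_def inner_real_def sum_2 by (intro Bochner_Integration.integrable_add ik)
 show "set_integrable hausdorff1 (frontier ?\<U>) (%x. (\<Phi> x \<bullet> ?n x) * T x)"
  unfolding inner_vec_def inner_real_def sum_2 distrib_right by (intro set_integral_add iT)
 have eq: "(LINT x:?\<U>|lebesgue. w x * partial_deriv i (%x. \<Phi> x $ i) x)
   = - ((LINT x:?\<U>|lebesgue. \<Phi> x $ i * F x $ i) + (\<integral>x. \<Phi> x $ i * k x $ i \<partial>N))
    + (LINT x:frontier ?\<U>|hausdorff1. \<Phi> x $ i * ?n x $ i * T x)" for i
  using T C si[OF b[of i], where K = "K i" and i = i] K by (simp add: is_trace_def)
 have "(LINT x:?\<U>|lebesgue. w x * partial_deriv 1 (%x. \<Phi> x $ 1) x) + (LINT x:?\<U>|lebesgue. w x * partial_deriv 2 (%x. \<Phi> x $ 2) x)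
   = (LINT x:?\<U>|lebesgue. w x * partial_deriv 1 (%x. \<Phi> x $ 1) x + w x * partial_deriv 2 (%x. \<Phi> x $ 2) x)"
  by (rule set_integral_add(2)[OF iw iw, symmetric])
 also have "... = (\<integral>(x :: real ^ 2). 0 \<partial>lebesgue)"
  unfolding set_lebesgue_integral_def
 proof (rule Bochner_Integration.integral_cong[OF refl])
  fix x :: "real ^ 2"
  show "indicator ?\<U> x *\<^sub>R (w x * partial_deriv 1 (%x. \<Phi> x $ 1) x + w x * partial_deriv 2 (%x. \<Phi> x $ 2) x) = 0"
   using \<Phi>(2) by (simp add: sum_2 distrib_left[symmetric] indicator_def)
 qed
 finally have z: "(LINT x:?\<U>|lebesgue. w x * partial_deriv 1 (%x. \<Phi> x $ 1) x) + (LINT x:?\<U>|lebesgue. w x * partial_deriv 2 (%x. \<Phi> x $ 2) x) = 0" by simp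
 have "(LINT x:?\<U>|lebesgue. \<Phi> x \<bullet> F x) = (LINT x:?\<U>|lebesgue. \<Phi> x $ 1 * F x $ 1) + (LINT x:?\<U>|lebesgue. \<Phi> x $ 2 * F x $ 2)"
  unfolding inner_vec_def inner_real_def sum_2 by (rule set_integral_add(2)[OF iF iF])
 moreover have "(\<integral>x. \<Phi> x \<bullet> k x \<partial>N) = (\<integral>x. \<Phi> x $ 1 * k x $ 1 \<partial>N) + (\<integral>x. \<Phi> x $ 2 * k x $ 2 \<partial>N)"
  unfolding inner_vec_def inner_real_def sum_2 by (rule Bochner_Integration.integral_add[OF ik ik])
 moreover have "(LINT x:frontier ?\<U>|hausdorff1. (\<Phi> x \<bullet> ?n x) * T x)
   = (LINT x:frontier ?\<U>|hausdorff1. \<Phi> x $ 1 * ?n x $ 1 * T x) + (LINT x:frontier ?\<U>|hausdorff1. \<Phi> x $ 2 * ?n x $ 2 * T x)"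
  unfolding inner_vec_def inner_real_def sum_2 distrib_right by (rule set_integral_add(2)[OF iT iT])
 ultimately show "(LINT x:?\<U>|lebesgue. \<Phi> x \<bullet> F x) + (\<integral>x. \<Phi> x \<bullet> k x \<partial>N) = (LINT x:frontier ?\<U>|hausdorff1. (\<Phi> x \<bullet> ?n x) * T x)"
  using z eq[of 1] eq[of 2] by linarith
qed

lemma set_nn_integral_eq_integral:
 fixes f :: "'a => real"
 assumes "set_integrable M X f" "!!x. x : X ==> 0 <= f x"
 shows "(\<integral>\<^sup>+x\<in>X. ennreal (f x) \<partial>M) = ennreal (LINT x:X|M. f x)"
proof -
 have "(\<integral>\<^sup>+x\<in>X. ennreal (f x) \<partial>M) = (\<integral>\<^sup>+x. ennreal (indicator X x *\<^sub>R f x) \<partial>M)"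
  by (intro nn_integral_cong) (auto simp: indicator_def)
 also have "... = ennreal (LINT x:X|M. f x)"
  unfolding set_lebesgue_integral_def
  using assms by (intro nn_integral_eq_integral) (auto simp: set_integrable_def indicator_def)
 finally show ?thesis .
qed

context integrand
begin

lemma g_bounds: "0 <= t ==> 0 <= g t" "0 <= t ==> g t <= S * t"
proof -
 show "0 <= g t" if "0 <= t" using g_tangent[of 0 t] that g0 g'0 by (cases "t = 0") auto
 show "g t <= S * t" if "0 <= t"
 proof (cases "t = 0")
  case False
  then have "0 < t" using that by simp
  obtain z where z: "0 < z" "z < t" "g t - g 0 = (t - 0) * g' z" using g_MVT[OF order.refl \<open>0 < t\<close>] .
  then have "g t <= t * S" using g'_less_S[of z] that g0 by (simp add: mult_left_mono)
  then show ?thesis by (simp add: mult.commute)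
 qed (simp add: g0)
qed

lemma g_norm_integrable:
 fixes F :: "'a => real ^ 2"
 assumes F: "set_integrable M X F"
 shows "set_integrable M X (%x. g (norm (F x)))"
proof -
 have "continuous_on {0..} g" using g_deriv by (intro DERIV_continuous_on) auto
 then have "continuous_on UNIV (%t. g \<bar>t\<bar>)" by (rule continuous_on_compose2) (auto intro!: continuous_intros)
 then have gm: "(%t. g \<bar>t\<bar>) \<in> borel_measurable borel" by (rule borel_measurable_continuous_onI)
 have e: "(%x. indicator X x *\<^sub>R g (norm (F x))) = (%x. (%t. g \<bar>t\<bar>) (norm (indicator X x *\<^sub>R F x)))"
  by (auto simp: indicator_def g0)
 show ?thesis
  unfolding set_integrable_def
 proof (rule Bochner_Integration.integrable_bound)
  show "integrable M (%x. S * norm (indicator X x *\<^sub>R F x))"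
   by (rule integrable_mult_right[OF integrable_norm[OF F[unfolded set_integrable_def]]])
  show "(%x. indicator X x *\<^sub>R g (norm (F x))) : borel_measurable M"
   unfolding e
   by (rule measurable_compose[OF measurable_compose[OF borel_measurable_integrable[OF F[unfolded set_integrable_def]] borel_measurable_norm] gm])
  show "AE x in M. norm (indicator X x *\<^sub>R g (norm (F x))) <= norm (S * norm (indicator X x *\<^sub>R F x))"
   using g_bounds S_pos by (auto simp: indicator_def intro!: AE_I2)
 qed
qed

end

lemma signed_integral_cong:
 assumes \<U>: "\<U> : sets borel" and eq: "!!E. E : borel_on \<U> ==> \<nu> E = \<nu>' E"
 shows "signed_integral \<U> \<nu> \<phi> = signed_integral \<U> \<nu>' \<phi>"
proof -
 have "positive_part \<U> \<kappa> = positive_part \<U> \<kappa>'" if e: "!!E. E : borel_on \<U> ==> \<kappa> E = \<kappa>' E" for \<kappa> \<kappa>'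
  unfolding positive_part_def
 proof (rule measure_of_eq)
  show "borel_on \<U> \<subseteq> Pow \<U>" using \<U> by (auto simp: borel_on_iff)
  fix E assume "E : sigma_sets \<U> (borel_on \<U>)"
  then have E: "E \<subseteq> \<U>"
   using sigma_sets_into_sp[OF \<open>borel_on \<U> \<subseteq> Pow \<U>\<close>] by blast
  show "(SUP B\<in>{B : sets borel. B \<subseteq> E}. ennreal (\<kappa> B)) = (SUP B\<in>{B : sets borel. B \<subseteq> E}. ennreal (\<kappa>' B))"
   using E \<U> by (intro SUP_cong refl arg_cong[where f = ennreal] e) (auto simp: borel_on_iff)
 qed
 from this[of \<nu> \<nu>'] this[of "%E. - \<nu> E" "%E. - \<nu>' E"] show ?thesis
  using eq by (simp add: signed_integral_def)
qed

lemma (in radial) signed_gradient_u: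
 assumes "\<phi> : borel_measurable borel" "\<forall>x\<in>\<U>. \<bar>\<phi> x\<bar> <= K"
 shows "signed_integral \<U> (%E. gradient_measure \<U> u E $ i) \<phi> = (LINT x:\<U>|lebesgue. \<phi> x * D x $ i)"
proof -
 have "signed_integral \<U> (%E. gradient_measure \<U> u E $ i) \<phi> = signed_integral \<U> (%E. (LINT x:E|lebesgue. D x) $ i) \<phi>"
  by (rule signed_integral_cong[OF \<U>b]) (simp add: gradient_measure_u)
 also have "... = (LINT x:\<U>|lebesgue. \<phi> x * D x $ i)"
  using assms by (intro u_gradient_measure(3)) auto
 finally show ?thesis .
qed

section \<open>The minimizer\<close>

locale calibrated = integrand g g' g'' A B +
 radial r1 r2 U "%t. integrand.G g' (c / t)" "%t. integrand.G' g' g'' (c / t) * (- c / t\<^sup>2)"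
 for g g' g'' :: "real => real" and A B r1 r2 :: real and U :: "real => real" and c :: real +
 fixes u\<^sub>0 :: "real => real"
 assumes flux_bound: "\<bar>c\<bar> <= r1 * S"
  and outer: "u\<^sub>0 r2 = U r2"
  and inner: "S * \<bar>u\<^sub>0 r1 - U r1\<bar> = - (c / r1) * (u\<^sub>0 r1 - U r1)"
begin

abbreviation "n \<equiv> annulus_normal r1 r2"
abbreviation "K \<equiv> relaxed_functional r1 r2 g (%x. u\<^sub>0 (norm x))"

lemma flux_quotient: "r1 < t ==> \<bar>c / t\<bar> < S"
proof -
 assume t: "r1 < t"
 then have "r1 * S < t * S" using S_pos by simp
 then show ?thesis using flux_bound t \<rho> by (simp add: abs_divide divide_less_eq mult.commute)
qed

lemma boundary_data_integrable: "set_integrable hausdorff1 (frontier \<U>) (%x. u\<^sub>0 (norm x))"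
proof -
 interpret C: finite_measure circle_measure by (rule finite_circle_measure)
 have "set_integrable hausdorff1 (frontier \<U>) (annulus_trace r2 (%y. u\<^sub>0 r1) (%y. u\<^sub>0 r2))"
  by (rule annulus_trace_integral(1)[OF \<rho> _ _ continuous_on_const]) simp_all
 moreover have "(%x :: real ^ 2. indicator (frontier \<U>) x *\<^sub>R annulus_trace r2 (%y. u\<^sub>0 r1) (%y. u\<^sub>0 r2) x)
   = (%x. indicator (frontier \<U>) x *\<^sub>R u\<^sub>0 (norm x))"
  by (auto simp: frontier_annulus(1)[OF \<rho>] annulus_trace_def indicator_def fun_eq_iff)
 ultimately show ?thesis by (simp add: set_integrable_def)
qed

definition "energy_u = (LINT x:\<U>|lebesgue. g (norm (D x))) + S * (LINT x:frontier \<U>|hausdorff1. \<bar>u\<^sub>0 (norm x) - u x\<bar>)"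

lemma boundary_gap_integrable:
 assumes "set_integrable hausdorff1 (frontier \<U>) T"
 shows "set_integrable hausdorff1 (frontier \<U>) (%x. \<bar>u\<^sub>0 (norm x) - T x\<bar>)"
 by (intro set_integrable_abs set_integral_diff(1) boundary_data_integrable assms)

lemma K_u: "K u = ennreal energy_u"
proof -
 have "(\<integral>\<^sup>+x\<in>\<U>. ennreal (g (norm (grad_ac \<U> u x))) \<partial>lebesgue) = (\<integral>\<^sup>+x\<in>\<U>. ennreal (g (norm (D x))) \<partial>lebesgue)"
  by (rule nn_integral_cong_AE) (use grad_ac_u in eventually_elim, auto simp: indicator_def)
 also have "... = ennreal (LINT x:\<U>|lebesgue. g (norm (D x)))"
  by (intro set_nn_integral_eq_integral g_norm_integrable D_integrable g_bounds) simp
 finally have 1: "(\<integral>\<^sup>+x\<in>\<U>. ennreal (g (norm (grad_ac \<U> u x))) \<partial>lebesgue) = ennreal (LINT x:\<U>|lebesgue. g (norm (D x)))" .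
 have "(\<integral>\<^sup>+x\<in>frontier \<U>. ennreal \<bar>u\<^sub>0 (norm x) - bv_trace \<U> n u x\<bar> \<partial>hausdorff1)
   = (\<integral>\<^sup>+x\<in>frontier \<U>. ennreal \<bar>u\<^sub>0 (norm x) - u x\<bar> \<partial>hausdorff1)"
  by (rule nn_integral_cong_AE) (use bv_trace_u in eventually_elim, auto simp: indicator_def)
 also have "... = ennreal (LINT x:frontier \<U>|hausdorff1. \<bar>u\<^sub>0 (norm x) - u x\<bar>)"
  using u_is_trace by (intro set_nn_integral_eq_integral boundary_gap_integrable) (auto simp: is_trace_def)
 finally have 2: "(\<integral>\<^sup>+x\<in>frontier \<U>. ennreal \<bar>u\<^sub>0 (norm x) - bv_trace \<U> n u x\<bar> \<partial>hausdorff1)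
   = ennreal (LINT x:frontier \<U>|hausdorff1. \<bar>u\<^sub>0 (norm x) - u x\<bar>)" .
 have 3: "total_variation (grad_sing \<U> u) \<U> = 0" by (rule total_variation_zero[OF grad_sing_u \<U>b])
 have "0 <= (LINT x:\<U>|lebesgue. g (norm (D x)))" "0 <= (LINT x:frontier \<U>|hausdorff1. \<bar>u\<^sub>0 (norm x) - u x\<bar>)"
  unfolding set_lebesgue_integral_def by (auto intro!: Bochner_Integration.integral_nonneg g_bounds simp: indicator_def)
 then show ?thesis
  using S_pos by (simp add: relaxed_functional_def Let_def 1 2 3 recession_slope_eq energy_u_def ennreal_mult ennreal_plus)
qed

text \<open>The three gaps \<open>e1\<close>, \<open>e2\<close> and \<open>e3\<close> are nonnegative because of the convexity of \<open>g\<close>, because the field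
 has length less than \<open>S\<close> inside and at most \<open>S\<close> on the boundary, and because \<open>u\<close> misses its boundary
 value only where the flux has maximal size and the right sign. The sum of their integrals is the
 difference of the energies, since the field carries the same flux identity for \<open>w\<close> and \<open>u\<close>. The real
 number \<open>E\<close> replaces the total variation by a lower bound, which avoids a separate argument for its
 finiteness.\<close>

lemma energy_excess:
 assumes w: "w : BV \<U>"
 obtains E F N k where "ennreal E <= K w" "energy_u <= E" "set_integrable lebesgue \<U> F"
  "E = energy_u ==> (AE x in lebesgue. x : \<U> --> F x = D x) & (AE x in N. k x = (0 :: real ^ 2))"
  "!!\<phi> K i. \<phi> : borel_measurable borel ==> \<forall>x\<in>\<U>. \<bar>\<phi> x\<bar> <= K ==>
    signed_integral \<U> (%E. gradient_measure \<U> w E $ i) \<phi> = (LINT x:\<U>|lebesgue. \<phi> x * F x $ i) + (\<integral>x. \<phi> x * k x $ i \<partial>N)"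
proof -
 define F where "F = grad_ac \<U> w"
 define T where "T = bv_trace \<U> n w"
 obtain N k where F0: "set_integrable lebesgue \<U> (grad_ac \<U> w)"
  and N: "finite_measure N" "sets N = borel_on \<U>" "integrable N (k :: real ^ 2 => real ^ 2)"
  and gs: "!!E i. E : borel_on \<U> ==> grad_sing \<U> w E $ i = (\<integral>x. indicator E x * k x $ i \<partial>N)"
  and si0: "!!\<phi> K i. \<phi> : borel_measurable borel ==> \<forall>x\<in>\<U>. \<bar>\<phi> x\<bar> <= K ==>
    signed_integral \<U> (%E. gradient_measure \<U> w E $ i) \<phi> = (LINT x:\<U>|lebesgue. \<phi> x * grad_ac \<U> w x $ i) + (\<integral>x. \<phi> x * k x $ i \<partial>N)"
  by (rule BV_structure[OF \<rho> w], rule that)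
 note F = F0[folded F_def] and si = si0[folded F_def]
 have spN: "space N = \<U>" using sets_eq_imp_space_eq[OF N(2)] by (simp add: space_restrict_space)
 have T: "is_trace \<U> n w T" unfolding T_def by (rule bv_trace_is_trace[OF \<rho> w])
 have Ti: "set_integrable hausdorff1 (frontier \<U>) T" "set_integrable hausdorff1 (frontier \<U>) u"
  using T u_is_trace by (auto simp: is_trace_def)
 obtain \<Phi> :: "real ^ 2 => real ^ 2" where \<Phi>: "\<forall>i. (%x. \<Phi> x $ i) : test_functions UNIV"
  "\<forall>x. r1 <= norm x & norm x <= r2 --> \<Phi> x = (c / norm x) *\<^sub>R sgn x"
  "\<forall>x\<in>\<U>. (\<Sum>i\<in>UNIV. partial_deriv i (%x. \<Phi> x $ i) x) = 0"
  by (rule calibration_field[OF \<rho>, of c], rule that)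
 have wi: "set_integrable lebesgue \<U> w" using w by (simp add: BV_def)
 have W: "set_integrable lebesgue \<U> (%x. \<Phi> x \<bullet> F x)" "integrable N (%x. \<Phi> x \<bullet> k x)"
  "set_integrable hausdorff1 (frontier \<U>) (%x. (\<Phi> x \<bullet> n x) * T x)"
  "(LINT x:\<U>|lebesgue. \<Phi> x \<bullet> F x) + (\<integral>x. \<Phi> x \<bullet> k x \<partial>N) = (LINT x:frontier \<U>|hausdorff1. (\<Phi> x \<bullet> n x) * T x)"
  by (rule divergence_free_flux[OF \<rho> wi T F N(2,3) _ \<Phi>(1,3)], rule si, assumption, assumption)+
 have si_u: "signed_integral \<U> (%E. gradient_measure \<U> u E $ i) \<phi> = (LINT x:\<U>|lebesgue. \<phi> x * D x $ i) + (\<integral>x. \<phi> x * (0 :: real ^ 2) $ i \<partial>N)"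
  if "\<phi> : borel_measurable borel" "\<forall>x\<in>\<U>. \<bar>\<phi> x\<bar> <= K" for \<phi> K i
  using signed_gradient_u[OF that] by simp
 have V: "set_integrable lebesgue \<U> (%x. \<Phi> x \<bullet> D x)" "set_integrable hausdorff1 (frontier \<U>) (%x. (\<Phi> x \<bullet> n x) * u x)"
  "(LINT x:\<U>|lebesgue. \<Phi> x \<bullet> D x) + (\<integral>x. \<Phi> x \<bullet> 0 \<partial>N) = (LINT x:frontier \<U>|hausdorff1. (\<Phi> x \<bullet> n x) * u x)"
  by (rule divergence_free_flux[OF \<rho> u_integrable(2) u_is_trace D_integrable(2) N(2) integrable_zero _ \<Phi>(1,3)], rule si_u, assumption, assumption)+
 define e1 where "e1 x = g (norm (F x)) - g (norm (D x)) - (\<Phi> x \<bullet> F x - \<Phi> x \<bullet> D x)" for x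
 define e2 where "e2 x = S * norm (k x) - \<Phi> x \<bullet> k x" for x
 define e3 where "e3 x = S * \<bar>u\<^sub>0 (norm x) - T x\<bar> - S * \<bar>u\<^sub>0 (norm x) - u x\<bar> + ((\<Phi> x \<bullet> n x) * T x - (\<Phi> x \<bullet> n x) * u x)" for x
 have \<Phi>\<U>: "\<Phi> x = (c / norm x) *\<^sub>R sgn x" "\<bar>c / norm x\<bar> < S" "norm (sgn x) = 1" if "x : \<U>" for x
  using \<Phi>(2) that flux_quotient[of "norm x"] norm_sgn_1[OF nz[OF that]] by (auto simp: annulus_def)
 have e1: "0 <= e1 x" "e1 x = 0 ==> F x = D x" if "x : \<U>" for x
  using g_norm_tangent[OF \<Phi>\<U>(2,3)[OF that], of "F x"]
  by (auto simp: e1_def \<Phi>\<U>(1)[OF that] D_def inner_diff_right)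
 have e2: "0 <= e2 x" "e2 x = 0 ==> k x = 0" if "x : \<U>" for x
 proof -
  have n: "norm (\<Phi> x) < S" using \<Phi>\<U>[OF that] by simp
  have cs: "\<Phi> x \<bullet> k x <= norm (\<Phi> x) * norm (k x)" by (rule norm_cauchy_schwarz)
  have "norm (\<Phi> x) * norm (k x) <= S * norm (k x)" using n by (intro mult_right_mono) auto
  then show "0 <= e2 x" using cs by (simp add: e2_def)
  show "k x = 0" if "e2 x = 0"
  proof (rule ccontr)
   assume "k x ~= 0"
   then have "norm (\<Phi> x) * norm (k x) < S * norm (k x)" using n by simp
   then show False using cs that by (simp add: e2_def)
  qed
 qed
 have e3: "0 <= e3 x" if x: "x : frontier \<U>" for x
 proof -
  define \<beta> where "\<beta> = \<Phi> x \<bullet> n x"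
  have r: "norm x = r1 \<or> norm x = r2" using x by (auto simp: frontier_annulus(1)[OF \<rho>])
  have \<beta>eq: "\<beta> = (if norm x = r2 then c / r2 else - (c / r1))"
  proof -
   have "x ~= 0" using r \<rho> by auto
   moreover have "\<Phi> x = (c / norm x) *\<^sub>R sgn x" using \<Phi>(2) r \<rho> by auto
   moreover have "sgn x \<bullet> x = norm x" by (simp add: inner_commute inner_sgn_self)
   ultimately show ?thesis using r \<rho> by (auto simp: \<beta>_def annulus_normal_def divide_inverse)
  qed
  have \<beta>b: "\<bar>\<beta>\<bar> <= S"
  proof -
   have "\<bar>c / r1\<bar> <= S" using flux_bound \<rho> by (simp add: abs_divide pos_divide_le_eq mult.commute)
   moreover have "\<bar>c / r2\<bar> < S" using flux_quotient[of r2] \<rho> by simp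
   ultimately show ?thesis by (auto simp: \<beta>eq)
  qed
  have "- \<beta> * (T x - u\<^sub>0 (norm x)) <= \<bar>\<beta>\<bar> * \<bar>T x - u\<^sub>0 (norm x)\<bar>"
   by (metis abs_ge_self abs_minus_cancel abs_mult)
  also have "... <= S * \<bar>T x - u\<^sub>0 (norm x)\<bar>" using \<beta>b by (intro mult_right_mono) auto
  finally have 1: "\<beta> * u\<^sub>0 (norm x) - \<beta> * T x <= S * \<bar>u\<^sub>0 (norm x) - T x\<bar>"
   by (simp add: algebra_simps abs_minus_commute)
  have "S * \<bar>u\<^sub>0 (norm x) - u x\<bar> = \<beta> * (u\<^sub>0 (norm x) - u x)"
   using r inner outer \<rho> by (auto simp: \<beta>eq u_def)
  then have 2: "S * \<bar>u\<^sub>0 (norm x) - u x\<bar> = \<beta> * u\<^sub>0 (norm x) - \<beta> * u x" by (simp add: right_diff_distrib)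
  show ?thesis using 1 2 unfolding e3_def \<beta>_def[symmetric] by linarith
 qed
 have i1: "set_integrable lebesgue \<U> (%x. g (norm (F x)))" "set_integrable lebesgue \<U> (%x. g (norm (D x)))"
  by (intro g_norm_integrable F D_integrable)+
 have i2: "integrable N (%x. norm (k x))" using N(3) by (rule integrable_norm)
 have i3: "set_integrable hausdorff1 (frontier \<U>) (%x. S * \<bar>u\<^sub>0 (norm x) - T x\<bar>)"
  "set_integrable hausdorff1 (frontier \<U>) (%x. S * \<bar>u\<^sub>0 (norm x) - u x\<bar>)"
  by (intro set_integrable_mult_right boundary_gap_integrable Ti)+
 have I1: "set_integrable lebesgue \<U> e1"
  unfolding e1_def[abs_def] by (intro set_integral_diff(1) i1 W(1) V(1))
 have I2: "integrable N e2" unfolding e2_def[abs_def] using i2 W(2) by simp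
 have X1: "(LINT x:\<U>|lebesgue. e1 x) = (LINT x:\<U>|lebesgue. g (norm (F x))) - (LINT x:\<U>|lebesgue. g (norm (D x)))
   - ((LINT x:\<U>|lebesgue. \<Phi> x \<bullet> F x) - (LINT x:\<U>|lebesgue. \<Phi> x \<bullet> D x))"
  unfolding e1_def by (simp add: set_integral_diff i1 W(1) V(1))
 have X2: "(\<integral>x. e2 x \<partial>N) = S * (\<integral>x. norm (k x) \<partial>N) - (\<integral>x. \<Phi> x \<bullet> k x \<partial>N)"
  unfolding e2_def using i2 W(2) by simp
 have X3: "(LINT x:frontier \<U>|hausdorff1. e3 x) = S * (LINT x:frontier \<U>|hausdorff1. \<bar>u\<^sub>0 (norm x) - T x\<bar>)
   - S * (LINT x:frontier \<U>|hausdorff1. \<bar>u\<^sub>0 (norm x) - u x\<bar>)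
   + ((LINT x:frontier \<U>|hausdorff1. (\<Phi> x \<bullet> n x) * T x) - (LINT x:frontier \<U>|hausdorff1. (\<Phi> x \<bullet> n x) * u x))"
  unfolding e3_def by (simp add: set_integral_diff set_integral_add i3 W(3) V(2))
 define E where "E = (LINT x:\<U>|lebesgue. g (norm (F x))) + S * (\<integral>x. norm (k x) \<partial>N)
   + S * (LINT x:frontier \<U>|hausdorff1. \<bar>u\<^sub>0 (norm x) - T x\<bar>)"
 have sum: "E - energy_u = (LINT x:\<U>|lebesgue. e1 x) + (\<integral>x. e2 x \<partial>N) + (LINT x:frontier \<U>|hausdorff1. e3 x)"
  using W(4) V(3) by (simp add: E_def energy_u_def X1 X2 X3)
 have P: "0 <= (LINT x:\<U>|lebesgue. e1 x)" "0 <= (\<integral>x. e2 x \<partial>N)" "0 <= (LINT x:frontier \<U>|hausdorff1. e3 x)"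
  unfolding set_lebesgue_integral_def using e1(1) e2(1) e3 spN
  by (auto intro!: Bochner_Integration.integral_nonneg Bochner_Integration.integral_nonneg_AE AE_I2 simp: indicator_def)
 show thesis
 proof (rule that)
  show "energy_u <= E" using sum P by linarith
  show "set_integrable lebesgue \<U> F" by (rule F)
  have n1: "0 <= (LINT x:\<U>|lebesgue. g (norm (F x)))" "0 <= (\<integral>x. norm (k x) \<partial>N)"
   "0 <= (LINT x:frontier \<U>|hausdorff1. \<bar>u\<^sub>0 (norm x) - T x\<bar>)"
   unfolding set_lebesgue_integral_def by (auto intro!: Bochner_Integration.integral_nonneg g_bounds simp: indicator_def)
  have "ennreal E = ennreal (LINT x:\<U>|lebesgue. g (norm (F x))) + ennreal S * ennreal (\<integral>x. norm (k x) \<partial>N)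
    + ennreal S * ennreal (LINT x:frontier \<U>|hausdorff1. \<bar>u\<^sub>0 (norm x) - T x\<bar>)"
   using n1 S_pos by (simp add: E_def ennreal_mult ennreal_plus)
  also have "ennreal (LINT x:\<U>|lebesgue. g (norm (F x))) = (\<integral>\<^sup>+x\<in>\<U>. ennreal (g (norm (F x))) \<partial>lebesgue)"
   by (rule set_nn_integral_eq_integral[symmetric, OF i1(1)]) (simp add: g_bounds)
  also have "ennreal (LINT x:frontier \<U>|hausdorff1. \<bar>u\<^sub>0 (norm x) - T x\<bar>) = (\<integral>\<^sup>+x\<in>frontier \<U>. ennreal \<bar>u\<^sub>0 (norm x) - T x\<bar> \<partial>hausdorff1)"
   by (rule set_nn_integral_eq_integral[symmetric, OF boundary_gap_integrable[OF Ti(1)]]) simp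
  finally show "ennreal E <= K w"
   using total_variation_ge[OF \<U>b N gs]
   by (simp add: relaxed_functional_def Let_def recession_slope_eq F_def[symmetric] T_def[symmetric] add_mono mult_left_mono)
  show "(AE x in lebesgue. x : \<U> --> F x = D x) & (AE x in N. k x = 0)" if "E = energy_u"
  proof
   have z: "(LINT x:\<U>|lebesgue. e1 x) = 0" "(\<integral>x. e2 x \<partial>N) = 0" using sum P that by linarith+
   have "AE x in lebesgue. indicator \<U> x *\<^sub>R e1 x = 0"
    using z(1) I1 e1(1) unfolding set_lebesgue_integral_def set_integrable_def
    by (subst (asm) integral_nonneg_eq_0_iff_AE) (auto simp: indicator_def)
   then show "AE x in lebesgue. x : \<U> --> F x = D x" by eventually_elim (use e1(2) in auto)
   have "AE x in N. e2 x = 0"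
    using z(2) I2 e2(1) spN by (subst (asm) integral_nonneg_eq_0_iff_AE) (auto intro!: AE_I2)
   moreover have "AE x in N. x : \<U>" by (rule AE_I2) (simp add: spN)
   ultimately show "AE x in N. k x = 0" by eventually_elim (use e2(2) in auto)
  qed
 qed (rule si)
qed

text \<open>In the case of equality all gaps vanish, hence \<open>w\<close> and \<open>u\<close> have the same gradient measure.\<close>

theorem calibration:
 assumes w: "w : BV \<U>"
 shows "K u <= K w" and "K w <= K u ==> \<exists>C. AE x in lebesgue. x : \<U> --> w x - u x = C"
proof -
 obtain E F N k where E: "ennreal E <= K w" "energy_u <= E" and Fi: "set_integrable lebesgue \<U> F" and Eq:
  "E = energy_u ==> (AE x in lebesgue. x : \<U> --> F x = D x) & (AE x in N. k x = (0 :: real ^ 2))"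
  and si: "!!\<phi> K i. \<phi> : borel_measurable borel ==> \<forall>x\<in>\<U>. \<bar>\<phi> x\<bar> <= K ==>
    signed_integral \<U> (%E. gradient_measure \<U> w E $ i) \<phi> = (LINT x:\<U>|lebesgue. \<phi> x * F x $ i) + (\<integral>x. \<phi> x * k x $ i \<partial>N)"
  by (rule energy_excess[OF w], rule that)
 show "K u <= K w" unfolding K_u using E(1,2) by (meson ennreal_leI order_trans)
 assume "K w <= K u"
 then have "ennreal E <= ennreal energy_u" using E(1) unfolding K_u by (rule order_trans[rotated])
 moreover have "0 <= energy_u"
  unfolding energy_u_def set_lebesgue_integral_def using S_pos
  by (auto intro!: Bochner_Integration.integral_nonneg add_nonneg_nonneg mult_nonneg_nonneg g_bounds simp: indicator_def)
 ultimately have "E = energy_u" using E(2) by (simp add: ennreal_le_iff)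
 with Eq have FD: "AE x in lebesgue. x : \<U> --> F x = D x" and k0: "AE x in N. k x = 0" by auto
 have wi: "set_integrable lebesgue \<U> w" using w by (simp add: BV_def)
 have d: "set_integrable lebesgue \<U> (%x. w x - u x)" by (intro set_integral_diff(1) wi u_integrable(2))
 have z: "(LINT x:\<U>|lebesgue. (w x - u x) * partial_deriv i \<phi> x) = 0" if \<phi>: "\<phi> : test_functions \<U>" for \<phi> i
 proof -
  have C: "C1_on UNIV \<phi>" using \<phi> by (rule test_function_C1)
  obtain L where L: "\<forall>x. \<bar>\<phi> x\<bar> <= L" using test_function_bounded[OF \<phi>] by metis
  have pl: "partial_deriv i \<phi> : borel_measurable lebesgue"
   using partial_deriv_borel[OF C] by (simp add: measurable_completion)
  have "continuous_on UNIV (partial_deriv i \<phi>)" using C by (simp add: C1_on_def)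
  then have "compact (partial_deriv i \<phi> ` cball 0 r2)"
   by (intro compact_continuous_image) (auto elim: continuous_on_subset)
  then obtain L' where "\<forall>x\<in>cball 0 r2. \<bar>partial_deriv i \<phi> x\<bar> <= L'" by (auto dest!: compact_imp_bounded simp: bounded_iff)
  then have L': "\<bar>partial_deriv i \<phi> x\<bar> <= L'" if "x : \<U>" for x using that by (auto simp: annulus_def)
  have i: "set_integrable lebesgue \<U> (%x. v x * partial_deriv i \<phi> x)" if "set_integrable lebesgue \<U> v" for v
   using set_integrable_bounded_factor[OF that pl L'] by (simp add: mult.commute)
  have s: "signed_integral \<U> (%E. gradient_measure \<U> w E $ i) \<phi> = signed_integral \<U> (%E. gradient_measure \<U> u E $ i) \<phi>"
  proof -
   have "(\<integral>x. \<phi> x * k x $ i \<partial>N) = 0" by (rule integral_eq_zero_AE) (use k0 in eventually_elim, simp)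
   moreover have "(LINT x:\<U>|lebesgue. \<phi> x * F x $ i) = (LINT x:\<U>|lebesgue. \<phi> x * D x $ i)"
    unfolding set_lebesgue_integral_def
   proof (rule integral_cong_AE)
    have \<phi>l: "\<phi> : borel_measurable lebesgue" using C1_on_borel[OF C] by (simp add: measurable_completion)
    have m: "(%x. indicator \<U> x *\<^sub>R (\<phi> x * v x $ i)) : borel_measurable lebesgue"
    if v: "set_integrable lebesgue \<U> v" for v :: "real ^ 2 => real ^ 2"
    by (rule borel_measurable_integrable)
    (use set_integrable_bounded_factor[OF set_integrable_component[OF v] \<phi>l, of L] L in "simp add: set_integrable_def")
    show "(%x. indicator \<U> x *\<^sub>R (\<phi> x * F x $ i)) : borel_measurable lebesgue"
    "(%x. indicator \<U> x *\<^sub>R (\<phi> x * D x $ i)) : borel_measurable lebesgue"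
    by (rule m[OF Fi], rule m[OF D_integrable(2)])
    show "AE x in lebesgue. indicator \<U> x *\<^sub>R (\<phi> x * F x $ i) = indicator \<U> x *\<^sub>R (\<phi> x * D x $ i)"
    using FD by eventually_elim (simp add: indicator_def)
   qed
   moreover have Lb: "\<forall>x\<in>\<U>. \<bar>\<phi> x\<bar> <= L" using L by simp
   ultimately show ?thesis
    using si[OF C1_on_borel[OF C] Lb, where i = i] signed_gradient_u[OF C1_on_borel[OF C] Lb, where i = i] by simp
  qed
  have "(LINT x:\<U>|lebesgue. v x * partial_deriv i \<phi> x) = - signed_integral \<U> (%E. gradient_measure \<U> v E $ i) \<phi>"
   if "v : BV \<U>" for v
   using gradient_measure_is[OF that] \<phi> by (simp add: is_gradient_measure_def)
  from this[OF w] this[OF u_BV] show ?thesis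
   unfolding left_diff_distrib using s by (simp add: set_integral_diff(2)[OF i[OF wi] i[OF u_integrable(2)]])
 qed
 have conn: "connected \<U>"
  using connected_annulus(1)[of r1 "0 :: real ^ 2" r2] by (simp add: annulus_def)
 show "\<exists>C. AE x in lebesgue. x : \<U> --> w x - u x = C"
  using zero_gradient_constant[OF open_annulus conn d z] by metis
qed

end

lemma (in integrand) calibrated_exists:
 assumes \<rho>: "0 < r1" "r1 < r2"
 obtains U c where "calibrated g g' g'' A B r1 r2 U c u\<^sub>0"
proof -
 obtain c where c: "\<bar>c\<bar> <= r1 * S" and ai: "(%t. G (c / t)) absolutely_integrable_on {r1<..<r2}"
  and eq: "S * \<bar>(u\<^sub>0 r2 - u\<^sub>0 r1) - integral {r1<..<r2} (%t. G (c / t))\<bar>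
   = (c / r1) * ((u\<^sub>0 r2 - u\<^sub>0 r1) - integral {r1<..<r2} (%t. G (c / t)))"
  by (rule shooting[OF \<rho>, of "u\<^sub>0 r2 - u\<^sub>0 r1"])
 have i: "(%t. G (c / t)) integrable_on {r1..r2}"
  using set_lebesgue_integral_eq_integral(1)[OF ai] by (simp add: integrable_on_open_interval_real)
 have q: "\<bar>c / t\<bar> < S" if "r1 < t" for t
 proof -
  have "r1 * S < t * S" using that S_pos by simp
  then show ?thesis using c that \<rho> by (simp add: abs_divide divide_less_eq mult.commute)
 qed
 define h where "h t = G (c / t)" for t
 have hd: "(h has_real_derivative G' (c / t) * (- c / t\<^sup>2)) (at t)" if "r1 < t" for t
 proof -
  have "((%t. c / t) has_real_derivative - c / t\<^sup>2) (at t)"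
   using that \<rho> by (auto intro!: derivative_eq_intros simp: power2_eq_square)
  from DERIV_chain2[OF G_deriv[OF q[OF that]] this] show ?thesis by (simp add: h_def[abs_def])
 qed
 have hc: "continuous_on {r1<..} h"
  by (intro continuous_at_imp_continuous_on ballI DERIV_isCont[OF hd]) auto
 define U where "U r = u\<^sub>0 r2 - integral {r..r2} h" for r
 have U1: "u\<^sub>0 r1 - U r1 = - ((u\<^sub>0 r2 - u\<^sub>0 r1) - integral {r1<..<r2} (%t. G (c / t)))"
  by (simp add: U_def h_def[abs_def] integral_open_interval_real)
 have "calibrated g g' g'' A B r1 r2 U c u\<^sub>0"
 proof (intro calibrated.intro radial.intro calibrated_axioms.intro)
  show "integrand g g' g'' A B" by (rule integrand_axioms)
  show "continuous_on {r1..r2} U"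
   unfolding U_def[abs_def] using i by (intro continuous_intros indefinite_integral_continuous_1') (simp add: h_def[abs_def])
  show "(U has_real_derivative G (c / t)) (at t)" if t: "r1 < t" "t < r2" for t
  proof -
   define a where "a = (r1 + t) / 2"
   have a: "r1 < a" "a < t" using t by (auto simp: a_def)
   have "((%x. integral {x..r2} h) has_real_derivative - h t) (at t within {a..r2})"
    by (rule integral_has_real_derivative'[OF continuous_on_subset[OF hc]]) (use a t in auto)
   then have "((%x. integral {x..r2} h) has_real_derivative - h t) (at t)"
    using at_within_Icc_at[of a t r2] a t by simp
   from DERIV_diff[OF DERIV_const[of "u\<^sub>0 r2"] this] show ?thesis by (simp add: U_def[abs_def] h_def)
  qed
  show "((%t. G (c / t)) has_real_derivative G' (c / t) * (- c / t\<^sup>2)) (at t)" if "r1 < t" "t < r2" for t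
   using hd[OF that(1)] by (simp add: h_def[abs_def])
  have "continuous_on {r1<..<r2} (%t. G' (c / t))"
  proof (rule continuous_on_compose2[OF G'_continuous])
   show "continuous_on {r1<..<r2} (%t. c / t)" using \<rho> by (auto intro!: continuous_intros)
   show "(%t. c / t) ` {r1<..<r2} \<subseteq> {- S<..<S}"
   proof (rule image_subsetI)
    show "c / t : {- S<..<S}" if "t : {r1<..<r2}" for t
    proof -
    have "r1 < t" using that by simp
    then have "- S < c / t & c / t < S" using q[of t] by linarith
    then show ?thesis by (simp only: greaterThanLessThan_iff)
    qed
   qed
  qed
  then show "continuous_on {r1<..<r2} (%t. G' (c / t) * (- c / t\<^sup>2))"
   using \<rho> by (intro continuous_intros) auto
  have "continuous_on {r1<..<r2} h" by (rule continuous_on_subset[OF hc]) auto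
  then have m: "(%t. indicator {r1<..<r2} t *\<^sub>R G (c / t)) : borel_measurable lborel"
   using borel_measurable_continuous_on_indicator[of "{r1<..<r2}" h] by (simp add: h_def[abs_def])
  show "set_integrable lborel {r1<..<r2} (%t. G (c / t))"
   using set_integral_lebesgue_lborel(2)[OF _ m] ai by simp
  show "u\<^sub>0 r2 = U r2" by (simp add: U_def)
  show "S * \<bar>u\<^sub>0 r1 - U r1\<bar> = - (c / r1) * (u\<^sub>0 r1 - U r1)"
   unfolding U1 abs_minus_cancel minus_mult_minus by (rule eq)
 qed (fact \<rho> c)+
 then show thesis by (rule that)
qed

theorem theorem1p1:
  fixes \<rho>\<^sub>1 \<rho>\<^sub>2 \<mu> \<mu>' a A b B \<nu>\<^sub>1 \<nu>\<^sub>2 :: real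
    and u\<^sub>0 g g' g'' :: "real \<Rightarrow> real"
  defines "\<Omega> \<equiv> annulus \<rho>\<^sub>1 \<rho>\<^sub>2"
    and "minimizer \<equiv> relaxed_minimizer \<rho>\<^sub>1 \<rho>\<^sub>2 g (\<lambda>x. u\<^sub>0 (norm x))"
  assumes "0 < \<rho>\<^sub>1" and "\<rho>\<^sub>1 < \<rho>\<^sub>2"
    and "1 < \<mu>"
    and g_nonneg: "\<And>t. 0 \<le> t \<Longrightarrow> 0 \<le> g t"
    and g_deriv: "\<And>t. 0 \<le> t \<Longrightarrow> (g has_real_derivative g' t) (at t within {0..})"
    and g'_deriv: "\<And>t. 0 \<le> t \<Longrightarrow> (g' has_real_derivative g'' t) (at t within {0..})"
    and g''_cont: "continuous_on {0..} g''"
    and "0 < a" and "0 < A"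
    and linear_growth: "\<And>t. 0 \<le> t \<Longrightarrow> a * t - b \<le> g t \<and> g t \<le> A * t + B"
    and "g 0 = 0" and "g' 0 = 0"
    and "0 < \<nu>\<^sub>1" and "0 < \<nu>\<^sub>2"
    and "1 \<le> \<mu>'" and "\<mu>' \<le> \<mu>"
    and ellipticity: "\<And>t. 0 \<le> t \<Longrightarrow>
      \<nu>\<^sub>1 * (1 + t) powr (- \<mu>) \<le> g'' t \<and> g'' t \<le> \<nu>\<^sub>2 * (1 + t) powr (- \<mu>')"
    and "\<mu> - \<mu>' < 2"
  shows "(\<exists>u. minimizer u \<and>
            u \<in> sobolev 1 1 \<Omega> \<and> continuous_on (closure \<Omega>) u \<and> C1_on \<Omega> u \<and>
            u \<in> sobolev_loc 2 2 \<Omega> \<and>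
            (\<exists>u'. \<forall>x\<in>closure \<Omega>. u x = u' (norm x))) \<and>
         (\<forall>v w. minimizer v \<and> minimizer w \<longrightarrow>
            (\<exists>c. AE x in lebesgue. x \<in> \<Omega> \<longrightarrow> v x - w x = c))"
proof -
 interpret integrand g g' g'' A B
 proof
  show "0 < g'' t" if "0 <= t" for t
  proof -
   have "0 < \<nu>\<^sub>1 * (1 + t) powr (- \<mu>)" using \<open>0 < \<nu>\<^sub>1\<close> that by simp
   then show ?thesis using ellipticity[OF that] by linarith
  qed
  show "g t <= A * t + B" if "0 <= t" for t using linear_growth[OF that] by simp
 qed (fact g_deriv g'_deriv g''_cont \<open>g 0 = 0\<close> \<open>g' 0 = 0\<close>)+
 obtain U c where cal: "calibrated g g' g'' A B \<rho>\<^sub>1 \<rho>\<^sub>2 U c u\<^sub>0"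
  using calibrated_exists[OF \<open>0 < \<rho>\<^sub>1\<close> \<open>\<rho>\<^sub>1 < \<rho>\<^sub>2\<close>] .
 interpret C: calibrated g g' g'' A B \<rho>\<^sub>1 \<rho>\<^sub>2 U c u\<^sub>0 by (rule cal)
 have min_u: "minimizer C.u"
  unfolding minimizer_def relaxed_minimizer_def is_arg_min_def
  using C.u_BV C.calibration(1) by (auto simp: not_less)
 have const: "\<exists>a. AE x in lebesgue. x : \<Omega> --> v x - C.u x = a" if "minimizer v" for v
 proof -
  have "v : BV \<Omega>" "\<not> C.K C.u < C.K v"
   using that C.u_BV unfolding minimizer_def relaxed_minimizer_def is_arg_min_def \<Omega>_def by auto
  then show ?thesis using C.calibration(2)[of v] unfolding \<Omega>_def by (simp add: not_less)
 qed
 show ?thesis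
 proof (intro conjI allI impI)
  show "\<exists>u. minimizer u & u : sobolev 1 1 \<Omega> & continuous_on (closure \<Omega>) u & C1_on \<Omega> u &
    u : sobolev_loc 2 2 \<Omega> & (\<exists>u'. \<forall>x\<in>closure \<Omega>. u x = u' (norm x))"
   using min_u C.u_sobolev C.u_closure C.C1_u C.u_sobolev_loc C.u_def unfolding \<Omega>_def by blast
  fix v w assume "minimizer v & minimizer w"
  then obtain a b where ab: "AE x in lebesgue. x : \<Omega> --> v x - C.u x = a" "AE x in lebesgue. x : \<Omega> --> w x - C.u x = b"
   using const by blast
  have "AE x in lebesgue. x : \<Omega> --> v x - w x = a - b"
   using ab by eventually_elim auto
  then show "\<exists>c. AE x in lebesgue. x : \<Omega> --> v x - w x = c" by blast
 qed
qed

end
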